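(* Let $1<p<\infty$, $0<r_0<1$ and $\mathbb{A}=\{z\in\mathbb{C}:r_0<|z|<1\}$. Let $\phi:\mathbb{A}\to\mathbb{A}$ be analytic with $\phi\in W^{1,\infty}(\mathbb{A})$, let $\alpha\in L^\infty(\mathbb{A})$, and let $\nu\in W^{1,\infty}(\mathbb{A})$ be real-valued with $\|\nu\|_{L^\infty(\mathbb{A})}\le\kappa$ for some $\kappa\in(0,1)$. Put $\widetilde\alpha=(\alpha\circ\phi)\overline{\partial\phi}$, $\widetilde\nu=\nu\circ\phi$ and $C_\phi(f)=f\circ\phi$. The following conditions are equivalent: (1) $C_\phi$ is an isometry from $H^p(\mathbb{A})$ into $H^p(\mathbb{A})$; (2) $C_\phi$ is an isometry from $G^p_\alpha(\mathbb{A})$ into $G^p_{\widetilde\alpha}(\mathbb{A})$; (3) $C_\phi$ is an isometry from $H^p_\nu(\mathbb{A})$ into $H^p_{\widetilde\nu}(\mathbb{A})$; (4) either there exists $\lambda\in\mathbb{C}$ with $|\lambda|=1$ such that $\phi(z)=\lambda z$ for all $z\in\mathbb{A}$, or there exists $\mu\in\mathbb{C}$ with $|\mu|=1$ such that $\phi(z)=\mu\frac{r_0}{z}$ for all $z\in\mathbb{A}$.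
   Context: $G^p_\alpha(\mathbb{A})$ (resp. $H^p_\nu(\mathbb{A})$) is the real vector space of measurable $f:\mathbb{A}\to\mathbb{C}$ solving, in the sense of distributions on $\mathbb{A}$, $\overline\partial f=\alpha\overline f$ (resp. $\overline\partial f=\nu\,\overline{\partial f}$), with $\operatorname{ess\,sup}_{r_0<r<1}\frac1{2\pi}\int_0^{2\pi}|f(re^{it})|^p\,dt<\infty$. Such functions are continuous in $\mathbb{A}$ and have a nontangential limit $\operatorname{tr}f$ a.e. on $\partial\mathbb{A}=\mathbb{T}\cup r_0\mathbb{T}$. All these spaces are equipped with the norm $\|\operatorname{tr}f\|_{L^p(\partial\mathbb{A})}$, where $\|h\|_{L^p(\partial\mathbb{A})}^p=\frac1{2\pi}\int_0^{2\pi}|h(e^{it})|^p\,dt+\frac1{2\pi}\int_0^{2\pi}|h(r_0e^{it})|^p\,dt$. $H^p(\mathbb{A})$ is the analytic Hardy space (case $\alpha=0$ or $\nu=0$), with the same norm. If $\phi$ is constant, $\widetilde\alpha$ is understood to be $0$. An isometry is a linear map $T$ with $\|Tx\|=\|x\|$ for all $x$ (not necessarily onto). *)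

theory Defs
  imports
    "HOL-Complex_Analysis.Complex_Analysis"
    "HOL-Probability.Essential_Supremum"
begin

definition annulus :: "real \<Rightarrow> complex set" where
  "annulus r0 = {z. r0 < cmod z \<and> cmod z < 1}"


subsection \<open>Distributional derivatives on the annulus\<close>

fun Ck :: "nat \<Rightarrow> (complex \<Rightarrow> complex) \<Rightarrow> bool" where
  "Ck 0 f \<longleftrightarrow> continuous_on UNIV f"
| "Ck (Suc k) f \<longleftrightarrow>
     (\<forall>z. f differentiable (at z)) \<and> (\<forall>v. Ck k (\<lambda>z. frechet_derivative f (at z) v))"

definition test_functions :: "real \<Rightarrow> (complex \<Rightarrow> complex) set" where
  "test_functions r0 =
     {\<psi>. (\<forall>k. Ck k \<psi>) \<and> compact (closure {z. \<psi> z \<noteq> 0}) \<and> closure {z. \<psi> z \<noteq> 0} \<subseteq> annulus r0}"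

text \<open>The Wirtinger operators, applied to real-differentiable functions.\<close>

definition d_z :: "(complex \<Rightarrow> complex) \<Rightarrow> complex \<Rightarrow> complex" where
  "d_z \<psi> z = (frechet_derivative \<psi> (at z) 1 - \<i> * frechet_derivative \<psi> (at z) \<i>) / 2"

definition d_zbar :: "(complex \<Rightarrow> complex) \<Rightarrow> complex \<Rightarrow> complex" where
  "d_zbar \<psi> z = (frechet_derivative \<psi> (at z) 1 + \<i> * frechet_derivative \<psi> (at z) \<i>) / 2"

text \<open>\<open>D g = h\<close> in the sense of distributions, for \<open>D\<close> one of \<open>d_z\<close>, \<open>d_zbar\<close> and
  \<open>g\<close>, \<open>h\<close> locally integrable on the annulus (always the case below).\<close>

definition weak_deriv ::
  "real \<Rightarrow> ((complex \<Rightarrow> complex) \<Rightarrow> complex \<Rightarrow> complex) \<Rightarrow>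
   (complex \<Rightarrow> complex) \<Rightarrow> (complex \<Rightarrow> complex) \<Rightarrow> bool" where
  "weak_deriv r0 D g h \<longleftrightarrow>
     (\<forall>\<psi>\<in>test_functions r0.
        (LINT z|lebesgue_on (annulus r0). g z * D \<psi> z) =
        - (LINT z|lebesgue_on (annulus r0). h z * \<psi> z))"

definition Linf_norm :: "real \<Rightarrow> (complex \<Rightarrow> complex) \<Rightarrow> ennreal" where
  "Linf_norm r0 g = esssup (lebesgue_on (annulus r0)) (\<lambda>z. ennreal (cmod (g z)))"

definition Linf :: "real \<Rightarrow> (complex \<Rightarrow> complex) set" where
  "Linf r0 = {g \<in> borel_measurable (lebesgue_on (annulus r0)). Linf_norm r0 g < \<infinity>}"

definition W1inf :: "real \<Rightarrow> (complex \<Rightarrow> complex) set" where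
  "W1inf r0 =
     {g \<in> Linf r0. (\<exists>h\<in>Linf r0. weak_deriv r0 d_z g h) \<and> (\<exists>h\<in>Linf r0. weak_deriv r0 d_zbar g h)}"


subsection \<open>Hardy spaces\<close>

definition hardy_bounded :: "real \<Rightarrow> real \<Rightarrow> (complex \<Rightarrow> complex) \<Rightarrow> bool" where
  "hardy_bounded r0 p f \<longleftrightarrow>
     esssup (lebesgue_on {r0<..<1})
       (\<lambda>r. ennreal (1 / (2 * pi)) *
          (\<integral>\<^sup>+t. ennreal (cmod (f (complex_of_real r * cis t)) powr p) \<partial>lebesgue_on {0..2 * pi}))
     < \<infinity>"

definition Hp :: "real \<Rightarrow> real \<Rightarrow> (complex \<Rightarrow> complex) set" where
  "Hp r0 p = {f. f holomorphic_on annulus r0 \<and> hardy_bounded r0 p f}"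

definition Gp :: "real \<Rightarrow> real \<Rightarrow> (complex \<Rightarrow> complex) \<Rightarrow> (complex \<Rightarrow> complex) set" where
  "Gp r0 p \<alpha> =
     {f \<in> borel_measurable (lebesgue_on (annulus r0)).
        weak_deriv r0 d_zbar f (\<lambda>z. \<alpha> z * cnj (f z)) \<and> hardy_bounded r0 p f}"

text \<open>The equation \<open>d_zbar f = \<nu> * cnj (d_z f)\<close> in the sense of distributions. One has
  \<open>cnj (d_z f) = d_zbar (cnj \<circ> f)\<close>, and the product of \<open>\<nu>\<close> in \<open>W1inf\<close> with the
  distribution \<open>d_zbar (cnj \<circ> f)\<close> is the functional sending \<open>\<psi>\<close> to
  \<open>- \<integral> cnj f * d_zbar (\<nu> * \<psi>)\<close>, where \<open>d_zbar (\<nu> * \<psi>) = \<nu> * d_zbar \<psi> + n * \<psi>\<close> for \<open>n\<close>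
  the (essentially unique) weak derivative \<open>d_zbar \<nu>\<close>.\<close>

definition weak_conj_beltrami :: "real \<Rightarrow> (complex \<Rightarrow> real) \<Rightarrow> (complex \<Rightarrow> complex) \<Rightarrow> bool" where
  "weak_conj_beltrami r0 \<nu> f \<longleftrightarrow>
     (\<exists>n\<in>Linf r0. weak_deriv r0 d_zbar (\<lambda>z. complex_of_real (\<nu> z)) n \<and>
        (\<forall>\<psi>\<in>test_functions r0.
           - (LINT z|lebesgue_on (annulus r0). f z * d_zbar \<psi> z) =
           - (LINT z|lebesgue_on (annulus r0).
                cnj (f z) * (complex_of_real (\<nu> z) * d_zbar \<psi> z + n z * \<psi> z))))"

definition Hp_nu :: "real \<Rightarrow> real \<Rightarrow> (complex \<Rightarrow> real) \<Rightarrow> (complex \<Rightarrow> complex) set" where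
  "Hp_nu r0 p \<nu> =
     {f \<in> borel_measurable (lebesgue_on (annulus r0)).
        weak_conj_beltrami r0 \<nu> f \<and> hardy_bounded r0 p f}"


subsection \<open>Boundary trace and norm\<close>

text \<open>\<open>L\<close> is the limit of \<open>f\<close> at the boundary point \<open>\<zeta>\<close> along every nontangential approach
  region, whatever its aperture \<open>b > 1\<close>.\<close>

definition nontangential_limit :: "real \<Rightarrow> (complex \<Rightarrow> complex) \<Rightarrow> complex \<Rightarrow> complex \<Rightarrow> bool" where
  "nontangential_limit r0 f \<zeta> L \<longleftrightarrow>
     (\<forall>b>1. (f \<longlongrightarrow> L)
        (at \<zeta> within {z \<in> annulus r0. dist z \<zeta> < b * infdist z (sphere 0 1 \<union> sphere 0 r0)}))"

text \<open>Meaningful where the nontangential limit exists, which for continuous members of the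
  Hardy spaces is almost everywhere on both circles.\<close>

definition trace :: "real \<Rightarrow> (complex \<Rightarrow> complex) \<Rightarrow> complex \<Rightarrow> complex" where
  "trace r0 f \<zeta> = (THE L. nontangential_limit r0 f \<zeta> L)"

definition boundary_Lp_norm :: "real \<Rightarrow> real \<Rightarrow> (complex \<Rightarrow> complex) \<Rightarrow> real" where
  "boundary_Lp_norm r0 p h =
     (1 / (2 * pi) * (LINT t|lebesgue_on {0..2 * pi}. cmod (h (cis t)) powr p) +
      1 / (2 * pi) * (LINT t|lebesgue_on {0..2 * pi}. cmod (h (complex_of_real r0 * cis t)) powr p))
     powr (1 / p)"

definition hardy_norm :: "real \<Rightarrow> real \<Rightarrow> (complex \<Rightarrow> complex) \<Rightarrow> real" where
  "hardy_norm r0 p f = boundary_Lp_norm r0 p (trace r0 f)"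


subsection \<open>Composition operators\<close>

definition real_linear_isometry ::
  "((complex \<Rightarrow> complex) \<Rightarrow> real) \<Rightarrow> (complex \<Rightarrow> complex) set \<Rightarrow> (complex \<Rightarrow> complex) set \<Rightarrow>
   ((complex \<Rightarrow> complex) \<Rightarrow> complex \<Rightarrow> complex) \<Rightarrow> bool" where
  "real_linear_isometry N X Y T \<longleftrightarrow>
     (\<forall>f\<in>X. T f \<in> Y) \<and>
     (\<forall>f\<in>X. \<forall>g\<in>X. T (\<lambda>z. f z + g z) = (\<lambda>z. T f z + T g z)) \<and>
     (\<forall>c::real. \<forall>f\<in>X. T (\<lambda>z. c *\<^sub>R f z) = (\<lambda>z. c *\<^sub>R T f z)) \<and>
     (\<forall>f\<in>X. N (T f) = N f)"

text \<open>Elements of \<open>Gp\<close> and \<open>Hp_nu\<close> are functions up to equality almost everywhere; each class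
  has exactly one representative (on the annulus) that is continuous there. Pointwise values,
  hence composition with \<open>\<phi>\<close> and boundary traces, refer to that representative.\<close>

definition continuous_reps :: "real \<Rightarrow> (complex \<Rightarrow> complex) set \<Rightarrow> (complex \<Rightarrow> complex) set" where
  "continuous_reps r0 X = {f \<in> X. continuous_on (annulus r0) f}"

definition comp_isometry ::
  "real \<Rightarrow> real \<Rightarrow> (complex \<Rightarrow> complex) \<Rightarrow>
   (complex \<Rightarrow> complex) set \<Rightarrow> (complex \<Rightarrow> complex) set \<Rightarrow> bool" where
  "comp_isometry r0 p \<phi> X Y \<longleftrightarrow>
     real_linear_isometry (hardy_norm r0 p) (continuous_reps r0 X) (continuous_reps r0 Y)
       (\<lambda>f. f \<circ> \<phi>)"

definition alpha_tilde ::
  "real \<Rightarrow> (complex \<Rightarrow> complex) \<Rightarrow> (complex \<Rightarrow> complex) \<Rightarrow> complex \<Rightarrow> complex" where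
  "alpha_tilde r0 \<phi> \<alpha> =
     (if \<phi> constant_on annulus r0 then (\<lambda>z. 0) else (\<lambda>z. \<alpha> (\<phi> z) * cnj (deriv \<phi> z)))"

end

theory Submission
  imports Defs
begin

text \<open>An isometry cannot move the mass of functions that are concentrated near one of the two boundary
  circles. Since \<open>\<phi>\<close> has bounded derivatives, it extends to a continuous self-map \<open>\<Phi>\<close> of the
  closed annulus (\<open>bounded_derivative_extension\<close>), so that for \<open>f\<close> continuous up to the boundary
  the norms of \<open>f\<close> and \<open>f \<circ> \<phi>\<close> are the integrals of \<open>\<bar>f\<bar>\<^sup>p\<close> and \<open>\<bar>f \<circ> \<Phi>\<bar>\<^sup>p\<close> over both circles. Let
  \<open>u\<close> be one of the coordinates \<open>z\<close> and \<open>r0 / z\<close>, which are unimodular on the outer and on the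
  inner circle. Apply the norm identity to \<open>u ^ n P(u)\<close> and let \<open>n\<close> tend to infinity: what remains
  are the integrals over the points with \<open>\<bar>u\<bar> = 1\<close>. Hence \<open>\<Phi>\<close> sends a part of the boundary of
  angular size \<open>2 pi\<close> to the circle \<open>\<bar>u\<bar> = 1\<close> (\<open>isometry_preserves_peak_mass\<close>). The two circles
  together use up the whole boundary, so by continuity \<open>\<Phi>\<close> maps each circle into a circle, and not
  both into the same one. Then \<open>\<Phi>(z) / z\<close> or \<open>z \<Phi>(z) / r0\<close> is unimodular on the boundary, hence
  constant by the maximum modulus principle (\<open>boundary_masses_imp_automorphism\<close>).

  The functions \<open>u ^ n P(u)\<close> belong to the analytic Hardy space. In the other two spaces nearby
  functions replace them. Multiply the Cauchy kernel \<open>1 / (z - \<zeta>)\<close> by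
  \<open>exp (N (u z - u \<zeta>) cnj (u \<zeta>))\<close>. This factor is holomorphic in \<open>z\<close> and equals \<open>1\<close> for \<open>z = \<zeta>\<close>,
  so the new kernel still inverts \<open>d_zbar\<close>; its modulus is \<open>W z / W \<zeta>\<close> times a Gaussian in
  \<open>\<bar>u z - u \<zeta>\<bar>\<close>, where \<open>W = exp (N \<bar>u\<bar>\<^sup>2 / 2)\<close>. In the supremum norm with weight \<open>W\<close> the transform
  is therefore small for large \<open>N\<close> (\<open>cauchy_norm_tendsto_0\<close>), and the equation
  \<open>d_zbar G = a G + b cnj G\<close> has a solution relatively close to any holomorphic function. For
  \<open>N = n\<close> the quotient of \<open>\<bar>u ^ n\<bar>\<close> and \<open>W\<close> is largest on \<open>\<bar>u\<bar> = 1\<close>, where the weight is largest,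
  too, so the solution near \<open>u ^ n P(u)\<close> has a uniformly small error (\<open>peak_solutions\<close>).

  The equation with coefficient \<open>\<nu>\<close> is of this form for the unknown \<open>f - \<nu> cnj f\<close>. The passage
  back to \<open>f\<close> (\<open>conj_unmix\<close>) changes the modulus in a way that depends on the argument. Averaging
  the norm identity over the phase of the peak function leaves a positive continuous weight
  instead (\<open>phase_mean\<close>), and a polynomial \<open>P\<close> with suitable modulus on the unit circle, from the
  Stone-Weierstrass theorem, cancels it.

  Conversely, rotations and \<open>z \<mapsto> \<mu> r0 / z\<close> extend to bi-Lipschitz maps of the closed annulus that
  preserve angular measure on the circles, so traces and norms are preserved, and the equations
  are transported by a change of variables in the weak formulation (\<open>composition_isometries\<close>).\<close>

section \<open>Smooth functions\<close>

text \<open>To prove that a function has derivatives of all orders it suffices to place it in an algebra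
  of differentiable functions that is closed under directional derivatives. This has to be checked
  for generators only.\<close>

inductive_set function_algebra :: "(complex \<Rightarrow> complex) set \<Rightarrow> (complex \<Rightarrow> complex) set" for G where
  base: "g \<in> G \<Longrightarrow> g \<in> function_algebra G"
| add: "f \<in> function_algebra G \<Longrightarrow> g \<in> function_algebra G \<Longrightarrow> (\<lambda>z. f z + g z) \<in> function_algebra G"
| mult: "f \<in> function_algebra G \<Longrightarrow> g \<in> function_algebra G \<Longrightarrow> (\<lambda>z. f z * g z) \<in> function_algebra G"

lemma frechet_derivative_eqI: "(F has_derivative D) (at z) \<Longrightarrow> frechet_derivative F (at z) v = D v"
  by (drule frechet_derivative_at) simp

lemma frechet_derivative_of_add:
  assumes "f differentiable at z" "g differentiable at z"
  shows "frechet_derivative (\<lambda>z. f z + g z) (at z) v =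
    frechet_derivative f (at z) v + frechet_derivative g (at z) v"
proof -
  have "((\<lambda>z. f z + g z) has_derivative
    (\<lambda>v. frechet_derivative f (at z) v + frechet_derivative g (at z) v)) (at z)"
    using assms by (intro has_derivative_add) (auto simp: frechet_derivative_works)
  then show ?thesis by (rule frechet_derivative_eqI)
qed

lemma frechet_derivative_of_mult:
  fixes f g :: "complex \<Rightarrow> complex"
  assumes "f differentiable at z" "g differentiable at z"
  shows "frechet_derivative (\<lambda>z. f z * g z) (at z) v =
    f z * frechet_derivative g (at z) v + frechet_derivative f (at z) v * g z"
proof -
  have "((\<lambda>z. f z * g z) has_derivative
    (\<lambda>v. f z * frechet_derivative g (at z) v + frechet_derivative f (at z) v * g z)) (at z)"
    using assms by (intro has_derivative_mult) (auto simp: frechet_derivative_works)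
  then show ?thesis by (rule frechet_derivative_eqI)
qed

lemma function_algebra_smooth:
  assumes diff: "\<And>g z. g \<in> G \<Longrightarrow> g differentiable at z"
    and der: "\<And>g v. g \<in> G \<Longrightarrow> (\<lambda>z. frechet_derivative g (at z) v) \<in> function_algebra G"
    and f: "f \<in> function_algebra G"
  shows "Ck k f"
proof -
  have d: "f differentiable at z" if "f \<in> function_algebra G" for f z
    using that by induction (auto intro: diff differentiable_add differentiable_mult)
  have D: "(\<lambda>z. frechet_derivative f (at z) v) \<in> function_algebra G"
    if "f \<in> function_algebra G" for f v
    using that
  proof induction
    case (add f g)
    then show ?case by (simp add: frechet_derivative_of_add d function_algebra.add)
  next
    case (mult f g)
    then show ?case
      by (simp add: frechet_derivative_of_mult d function_algebra.add function_algebra.mult)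
  qed (rule der)
  show ?thesis using f
  proof (induction k arbitrary: f)
    case 0
    then show ?case
      by (auto intro!: differentiable_imp_continuous_on simp: differentiable_on_def
          intro: d differentiable_at_withinI)
  next
    case (Suc k)
    then show ?case by (auto simp: d D)
  qed
qed

text \<open>The negative powers of \<open>x\<close> are part of the family because they appear in the derivatives of
  \<open>exp (- (1 / x))\<close>.\<close>

definition flat :: "nat \<Rightarrow> real \<Rightarrow> real" where
  "flat m x = (if x > 0 then exp (- (1 / x)) / x ^ m else 0)"

lemma flat_tendsto_0: "(flat m \<longlongrightarrow> 0) (at_right 0)"
proof -
  have "((\<lambda>x. x ^ m / exp x) \<longlongrightarrow> (0::real)) at_top" by (rule tendsto_power_div_exp_0)
  then have "((\<lambda>x. (inverse x) ^ m / exp (inverse x)) \<longlongrightarrow> (0::real)) (at_right 0)"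
    by (rule filterlim_compose) (rule filterlim_inverse_at_top_right)
  moreover have "\<forall>\<^sub>F x in at_right (0::real). (inverse x) ^ m / exp (inverse x) = flat m x"
    by (auto simp: eventually_at_right_field flat_def field_simps exp_minus intro!: exI[of _ 1])
  ultimately show ?thesis by (rule Lim_transform_eventually)
qed

lemma DERIV_flat: "(flat m has_real_derivative (flat (m + 2) x - m * flat (m + 1) x)) (at x)"
proof -
  consider "x > 0" | "x = 0" | "x < 0" by linarith
  then show ?thesis
  proof cases
    case 1
    have "((\<lambda>x. exp (- (1 / x)) / x ^ m) has_real_derivative
        (flat (m + 2) x - m * flat (m + 1) x)) (at x)"
      using 1 by (auto intro!: derivative_eq_intros simp: flat_def)
        (cases m; simp add: field_simps power2_eq_square power_add)
    then show ?thesis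
      by (rule has_field_derivative_transform_within[where d = x]) (use 1 in \<open>auto simp: flat_def dist_real_def\<close>)
  next
    case 2
    have "((\<lambda>h. (flat m h - flat m 0) / h) \<longlongrightarrow> 0) (at_right 0)"
      by (rule Lim_transform_eventually[OF flat_tendsto_0[of "Suc m"]])
        (auto simp: flat_def eventually_at_right_field field_simps intro!: exI[of _ 1])
    moreover have "((\<lambda>h. (flat m h - flat m 0) / h) \<longlongrightarrow> 0) (at_left 0)"
      by (rule tendsto_eventually) (auto simp: flat_def eventually_at_left_field intro!: exI[of _ "-1"])
    ultimately have "((\<lambda>h. (flat m h - flat m 0) / h) \<longlongrightarrow> 0) (at 0)"
      by (simp add: filterlim_at_split)
    then show ?thesis using 2 by (simp add: has_field_derivative_iff flat_def)
  next
    case 3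
    have "((\<lambda>x. 0) has_real_derivative (flat (m + 2) x - m * flat (m + 1) x)) (at x)"
      using 3 by (auto simp: flat_def)
    then show ?thesis
      by (rule has_field_derivative_transform_within[where d = "-x"]) (use 3 in \<open>auto simp: flat_def dist_real_def\<close>)
  qed
qed

text \<open>For \<open>m = 0\<close> this is the usual smooth function supported in the disc of radius \<open>e\<close> about \<open>a\<close>;
  the functions for larger \<open>m\<close> generate its derivatives.\<close>

definition bump :: "complex \<Rightarrow> real \<Rightarrow> nat \<Rightarrow> complex \<Rightarrow> complex" where
  "bump a e m z = of_real (flat m (1 - (cmod ((z - a) / of_real e))\<^sup>2))"

lemma bump_has_derivative:
  assumes "e > 0"
  shows "(bump a e m has_derivative
    (\<lambda>v. - (v * cnj (z - a) + cnj v * (z - a)) / (of_real e)\<^sup>2 *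
       (bump a e (m + 2) z - of_nat m * bump a e (m + 1) z))) (at z)"
proof -
  define s where "s = (\<lambda>z. 1 - (cmod ((z - a) / of_real e))\<^sup>2)"
  have s_eq: "s = (\<lambda>z. 1 - ((z - a) \<bullet> (z - a)) / e\<^sup>2)"
    using assms by (auto simp: s_def norm_divide power_divide dot_square_norm)
  have s: "(s has_derivative (\<lambda>v. - 2 * ((z - a) \<bullet> v) / e\<^sup>2)) (at z)"
    unfolding s_eq using assms
    by (auto intro!: derivative_eq_intros ext simp: inner_commute field_simps)
  have "(flat m \<circ> s has_derivative (*) (flat (m + 2) (s z) - m * flat (m + 1) (s z)) \<circ>
      (\<lambda>v. - 2 * ((z - a) \<bullet> v) / e\<^sup>2)) (at z)"
    by (rule diff_chain_at[OF s]) (use DERIV_flat[of m "s z"] in \<open>simp add: has_field_derivative_def\<close>)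
  then have "((\<lambda>z. complex_of_real ((flat m \<circ> s) z)) has_derivative
      (\<lambda>v. of_real (((*) (flat (m + 2) (s z) - m * flat (m + 1) (s z)) \<circ>
      (\<lambda>v. - 2 * ((z - a) \<bullet> v) / e\<^sup>2)) v))) (at z)"
    by (rule has_derivative_of_real)
  moreover have "(\<lambda>z. complex_of_real ((flat m \<circ> s) z)) = bump a e m"
    by (auto simp: bump_def s_def)
  moreover have "(of_real (((*) (flat (m + 2) (s z) - m * flat (m + 1) (s z)) \<circ>
      (\<lambda>v. - 2 * ((z - a) \<bullet> v) / e\<^sup>2)) v)) = - (v * cnj (z - a) + cnj v * (z - a)) / (of_real e)\<^sup>2 *
       (bump a e (m + 2) z - of_nat m * bump a e (m + 1) z)" for v
  proof -
    have "complex_of_real (2 * ((z - a) \<bullet> v)) = v * cnj (z - a) + cnj v * (z - a)"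
      by (simp add: complex_eq_iff inner_complex_def algebra_simps)
    moreover have "complex_of_real (- 2 * ((z - a) \<bullet> v) / e\<^sup>2) = - complex_of_real (2 * ((z - a) \<bullet> v)) / (of_real e)\<^sup>2"
      by simp
    ultimately have "complex_of_real (- 2 * ((z - a) \<bullet> v) / e\<^sup>2) = - (v * cnj (z - a) + cnj v * (z - a)) / (of_real e)\<^sup>2"
      by (simp only:)
    moreover have "complex_of_real (flat (m + 2) (s z) - m * flat (m + 1) (s z)) =
      bump a e (m + 2) z - of_nat m * bump a e (m + 1) z"
      by (simp add: bump_def s_def)
    ultimately show ?thesis by (simp only: comp_def of_real_mult mult.commute)
  qed
  ultimately show ?thesis by simp
qed

lemma bump_smooth:
  assumes "e > 0"
  shows "Ck k (bump a e m)"
proof -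
  define G where "G = range (bump a e) \<union> range (\<lambda>c z. c) \<union> {\<lambda>z. z, cnj}"
  have const: "(\<lambda>z. c) \<in> function_algebra G" for c by (rule function_algebra.base) (auto simp: G_def)
  have z: "(\<lambda>z. z) \<in> function_algebra G" by (rule function_algebra.base) (auto simp: G_def)
  have cz: "(\<lambda>z. cnj z) \<in> function_algebra G" by (rule function_algebra.base) (auto simp: G_def)
  have b: "bump a e m \<in> function_algebra G" for m by (rule function_algebra.base) (auto simp: G_def)
  have fd: "frechet_derivative (bump a e m) (at z) v = - (v * cnj (z - a) + cnj v * (z - a)) / (of_real e)\<^sup>2 *
       (bump a e (m + 2) z - of_nat m * bump a e (m + 1) z)" for m z v
    by (rule frechet_derivative_eqI[OF bump_has_derivative[OF assms]])
  have fd2: "frechet_derivative (bump a e m) (at z) v =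
     ((- v / (of_real e)\<^sup>2) * (cnj z + (- cnj a)) + (- cnj v / (of_real e)\<^sup>2) * (z + (-a))) *
     (bump a e (m + 2) z + (- of_nat m) * bump a e (m + 1) z)" for m z v
    unfolding fd by (simp add: divide_inverse algebra_simps)
  have fc: "frechet_derivative cnj (at z) v = cnj v" for z v
    by (rule frechet_derivative_eqI[OF bounded_linear_imp_has_derivative[OF bounded_linear_cnj]])
  have fid: "frechet_derivative (\<lambda>z. z) (at z) v = v" for z v :: complex
    by (simp add: frechet_derivative_id)
  show ?thesis
  proof (rule function_algebra_smooth[of G])
    fix g z assume "g \<in> G"
    then show "g differentiable at z"
      by (auto simp: G_def bounded_linear_imp_differentiable bounded_linear_cnj
          intro: differentiableI[OF bump_has_derivative[OF assms]])
  next
    fix g v assume "g \<in> G"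
    then consider m where "g = bump a e m" | c where "g = (\<lambda>z. c)" | "g = (\<lambda>z. z)" | "g = cnj"
      by (auto simp: G_def)
    then show "(\<lambda>z. frechet_derivative g (at z) v) \<in> function_algebra G"
    proof cases
      case 1
      show ?thesis unfolding 1 fd2
        by (intro function_algebra.add function_algebra.mult const z cz b)
    qed (auto simp: fc fid const)
  qed (rule b)
qed

lemma bump_nonneg: "bump a e m z = of_real (cmod (bump a e m z))"
  by (simp add: bump_def flat_def)

lemma bump_eq_0_iff: "e > 0 \<Longrightarrow> bump a e m z = 0 \<longleftrightarrow> dist z a \<ge> e"
proof -
  assume e: "e > 0"
  have "(cmod ((z - a) / of_real e))\<^sup>2 < 1 \<longleftrightarrow> dist z a < e"
    unfolding abs_square_less_1 using e by (simp add: norm_divide dist_norm)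
  moreover have "flat m x = 0 \<longleftrightarrow> x \<le> 0" for x by (auto simp: flat_def)
  ultimately show ?thesis by (simp add: bump_def not_less[symmetric])
qed

lemma bump_test_function:
  assumes "e > 0" "cball a e \<subseteq> annulus r0"
  shows "bump a e m \<in> test_functions r0"
proof -
  have "{z. bump a e m z \<noteq> 0} \<subseteq> cball a e"
    using assms by (auto simp: bump_eq_0_iff dist_commute)
  then have "closure {z. bump a e m z \<noteq> 0} \<subseteq> cball a e" by (simp add: closure_minimal)
  then show ?thesis
    using assms bounded_subset[OF bounded_cball \<open>{z. bump a e m z \<noteq> 0} \<subseteq> cball a e\<close>]
    by (auto simp: test_functions_def bump_smooth compact_closure)
qed

section \<open>Continuously differentiable functions with compact support\<close>

definition C1_compact :: "(complex \<Rightarrow> complex) \<Rightarrow> bool" where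
  "C1_compact F \<longleftrightarrow> (\<forall>z. F differentiable at z) \<and>
     (\<forall>v. continuous_on UNIV (\<lambda>z. frechet_derivative F (at z) v)) \<and> (\<exists>R. \<forall>z. cmod z \<ge> R \<longrightarrow> F z = 0)"

lemma test_function_C1_compact:
  assumes "\<psi> \<in> test_functions r0"
  shows "C1_compact \<psi>"
proof -
  have "Ck (Suc 0) \<psi>" "compact (closure {z. \<psi> z \<noteq> 0})" using assms by (auto simp: test_functions_def simp del: Ck.simps)
  moreover then obtain R where "\<And>z. z \<in> closure {z. \<psi> z \<noteq> 0} \<Longrightarrow> cmod z \<le> R"
    using compact_imp_bounded bounded_iff by metis
  then have "\<psi> z = 0" if "cmod z \<ge> R + 1" for z
    using that closure_subset[of "{z. \<psi> z \<noteq> 0}"] by (force simp: subset_iff)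
  ultimately show ?thesis by (auto simp: C1_compact_def)
qed

lemma frechet_derivative_basis:
  fixes F :: "complex \<Rightarrow> complex"
  assumes "F differentiable at z"
  shows "frechet_derivative F (at z) v =
    of_real (Re v) * frechet_derivative F (at z) 1 + of_real (Im v) * frechet_derivative F (at z) \<i>"
proof -
  have "linear (frechet_derivative F (at z))" using assms by (rule linear_frechet_derivative)
  then have "frechet_derivative F (at z) (Re v *\<^sub>R 1 + Im v *\<^sub>R \<i>) =
    of_real (Re v) * frechet_derivative F (at z) 1 + of_real (Im v) * frechet_derivative F (at z) \<i>"
    by (simp only: linear_add linear_cmul) (simp add: scaleR_conv_of_real)
  moreover have "Re v *\<^sub>R 1 + Im v *\<^sub>R \<i> = v" by (simp add: complex_eq_iff)
  ultimately show ?thesis by simp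
qed

lemma frechet_derivative_wirtinger:
  assumes "F differentiable at z"
  shows "frechet_derivative F (at z) v = v * d_z F z + cnj v * d_zbar F z"
  unfolding frechet_derivative_basis[OF assms, of v]
  by (simp add: d_z_def d_zbar_def complex_eq_iff field_simps)

lemma frechet_derivative_outside_support:
  assumes "open U" "z \<in> U" "\<And>w. w \<in> U \<Longrightarrow> F w = 0"
  shows "frechet_derivative F (at z) v = 0"
proof -
  have "((\<lambda>w. 0) has_derivative (\<lambda>v. 0)) (at z)" by simp
  then have "(F has_derivative (\<lambda>v. 0)) (at z)"
    by (rule has_derivative_transform_within_open[OF _ assms(1,2)]) (use assms in auto)
  then show ?thesis by (rule frechet_derivative_eqI)
qed

lemma C1_compactE:
  assumes "C1_compact F"
  obtains R L where "R > 0" "L \<ge> 0" "\<And>z. cmod z \<ge> R \<Longrightarrow> F z = 0" "\<And>z v. cmod z > R \<Longrightarrow> frechet_derivative F (at z) v = 0"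
    "\<And>z v. cmod (frechet_derivative F (at z) v) \<le> L * cmod v" "\<And>z w. cmod (F z - F w) \<le> L * cmod (z - w)"
proof -
  obtain R0 where R0: "\<And>z. cmod z \<ge> R0 \<Longrightarrow> F z = 0" using assms by (auto simp: C1_compact_def)
  define R where "R = max R0 1"
  have R: "\<And>z. cmod z \<ge> R \<Longrightarrow> F z = 0" "R > 0" using R0 by (auto simp: R_def)
  have diff: "F differentiable at z" for z using assms by (auto simp: C1_compact_def)
  have out: "frechet_derivative F (at z) v = 0" if "cmod z > R" for z v
    by (rule frechet_derivative_outside_support[of "- cball 0 R"]) (use R that in auto)
  have "\<exists>L. \<forall>z. cmod (frechet_derivative F (at z) v) \<le> L" for v
  proof -
    have "compact ((\<lambda>z. frechet_derivative F (at z) v) ` cball 0 R)"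
      using assms by (intro compact_continuous_image) (auto simp: C1_compact_def intro: continuous_on_subset)
    from compact_imp_bounded[OF this]
    obtain L where L: "\<And>z. z \<in> cball 0 R \<Longrightarrow> cmod (frechet_derivative F (at z) v) \<le> L"
      unfolding bounded_iff by blast
    have "cmod (frechet_derivative F (at z) v) \<le> max L 0" for z
    proof (cases "cmod z > R")
      case False
      then show ?thesis using L[of z] by (intro max.coboundedI1) simp
    qed (simp only: out norm_zero max.cobounded2)
    then show ?thesis by blast
  qed
  then obtain L1 L2 where L: "\<And>z. cmod (frechet_derivative F (at z) 1) \<le> L1"
     "\<And>z. cmod (frechet_derivative F (at z) \<i>) \<le> L2" by metis
  have L0: "L1 \<ge> 0" "L2 \<ge> 0" using L norm_ge_zero order_trans by blast+
  have bd: "cmod (frechet_derivative F (at z) v) \<le> (L1 + L2) * cmod v" for z v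
  proof -
    have "cmod (frechet_derivative F (at z) v) \<le> \<bar>Re v\<bar> * L1 + \<bar>Im v\<bar> * L2"
      unfolding frechet_derivative_basis[OF diff, of z v]
      by (rule norm_triangle_le) (auto simp: norm_mult intro!: add_mono mult_left_mono L)
    also have "\<dots> \<le> cmod v * L1 + cmod v * L2"
      using L0 by (intro add_mono mult_right_mono abs_Re_le_cmod abs_Im_le_cmod)
    finally show ?thesis by (simp add: algebra_simps)
  qed
  have "cmod (F z - F w) \<le> (L1 + L2) * cmod (z - w)" for z w
  proof (rule differentiable_bound[of UNIV F "\<lambda>z. frechet_derivative F (at z)"])
    show "(F has_derivative frechet_derivative F (at x)) (at x within UNIV)" for x
      using diff[of x] by (simp add: frechet_derivative_works)
    show "onorm (frechet_derivative F (at x)) \<le> L1 + L2" for x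
      by (rule onorm_bound) (use L0 bd in auto)
  qed auto
  then show thesis using that[of R "L1 + L2"] R out bd L0 by auto
qed

lemma C1_compact_continuous: "C1_compact F \<Longrightarrow> continuous_on UNIV F"
  by (auto simp: C1_compact_def intro!: differentiable_imp_continuous_on differentiable_at_withinI
      simp: differentiable_on_def)

lemma integrable_bounded_compact_support:
  fixes f :: "complex \<Rightarrow> 'b::{banach, second_countable_topology}"
  assumes [measurable]: "f \<in> borel_measurable borel" and "\<And>z. norm (f z) \<le> K" "\<And>z. cmod z > R \<Longrightarrow> f z = 0"
  shows "integrable lborel f"
proof (rule integrableI_bounded_set[where A = "cball 0 R" and B = K])
  show "emeasure lborel (cball (0::complex) R) < \<infinity>" by (rule emeasure_lborel_cball_finite)
  show "AE x in lborel. x \<notin> cball 0 R \<longrightarrow> f x = 0" using assms by auto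
qed (use assms in auto)

lemma integral_translate_complex:
  fixes f :: "complex \<Rightarrow> complex"
  assumes [measurable]: "f \<in> borel_measurable borel"
  shows "(LINT z|lborel. f (c + z)) = (LINT z|lborel. f z)"
proof -
  have "(LINT z|lborel. f z) = (LINT z|distr lborel borel ((+) c). f z)" by (simp only: lborel_distr_plus)
  also have "\<dots> = (LINT z|lborel. f (c + z))" by (rule integral_distr) auto
  finally show ?thesis by simp
qed

text \<open>Dominated convergence applies because \<open>F\<close> is Lipschitz: its difference quotients are
  uniformly bounded and vanish off one disc.\<close>

lemma integral_difference_quotient:
  assumes F: "C1_compact F" and k[measurable]: "k \<in> borel_measurable borel" and K: "\<And>z. cmod (k z) \<le> K"
    and X: "X \<longlonglongrightarrow> (0::real)" "\<And>n. X n \<noteq> 0"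
  shows "(\<lambda>n. LINT z|lborel. k z * ((F (z + X n *\<^sub>R v) - F z) /\<^sub>R X n)) \<longlonglongrightarrow>
     (LINT z|lborel. k z * frechet_derivative F (at z) v)"
proof -
  obtain R L where RL: "R > 0" "L \<ge> 0" "\<And>z. cmod z \<ge> R \<Longrightarrow> F z = 0"
    "\<And>z v. cmod z > R \<Longrightarrow> frechet_derivative F (at z) v = 0"
    "\<And>z v. cmod (frechet_derivative F (at z) v) \<le> L * cmod v" "\<And>z w. cmod (F z - F w) \<le> L * cmod (z - w)"
    using C1_compactE[OF F] by metis
  have K0: "K \<ge> 0" using K[of 0] norm_ge_zero order_trans by blast
  have [measurable]: "F \<in> borel_measurable borel"
    using C1_compact_continuous[OF F] by (rule borel_measurable_continuous_onI)
  have [measurable]: "(\<lambda>z. frechet_derivative F (at z) v) \<in> borel_measurable borel"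
    using F by (auto simp: C1_compact_def intro: borel_measurable_continuous_onI)
  have "Bseq X" using X(1) by (intro convergent_imp_Bseq convergentI)
  then obtain T where T: "\<And>n. \<bar>X n\<bar> \<le> T" by (auto simp: Bseq_def)
  define r where "r = R + T * cmod v"
  show ?thesis
  proof (rule integral_dominated_convergence[where w = "\<lambda>z. K * (L * cmod v) * indicator (cball 0 r) z"])
    show "integrable lborel (\<lambda>z. K * (L * cmod v) * indicator (cball 0 r) (z::complex))"
      by (intro integrable_mult_right integrable_real_indicator) (auto simp: emeasure_lborel_cball_finite[unfolded infinity_ennreal_def])
    show "AE z in lborel. (\<lambda>n. k z * ((F (z + X n *\<^sub>R v) - F z) /\<^sub>R X n)) \<longlonglongrightarrow> k z * frechet_derivative F (at z) v"
    proof (intro AE_I2 tendsto_mult tendsto_const)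
      fix z
      have Fd: "(F has_derivative frechet_derivative F (at z)) (at (z + 0 *\<^sub>R v))"
        using F by (auto simp: C1_compact_def frechet_derivative_works)
      have "((\<lambda>t. F (z + t *\<^sub>R v)) has_derivative (\<lambda>t. frechet_derivative F (at z) (t *\<^sub>R v))) (at 0)"
        by (rule has_derivative_compose[where f = "\<lambda>t. z + t *\<^sub>R v" and x = 0 and g = F, OF _ Fd])
          (auto intro!: derivative_eq_intros)
      then have "((\<lambda>t. F (z + t *\<^sub>R v)) has_vector_derivative frechet_derivative F (at z) v) (at 0)"
        unfolding has_vector_derivative_def
        using linear_cmul[OF linear_frechet_derivative[of F "at z"]] F by (auto simp: C1_compact_def)
      then have lim: "((\<lambda>h. norm (F (z + h *\<^sub>R v) - F z - h *\<^sub>R frechet_derivative F (at z) v) / norm h) \<longlongrightarrow> 0) (at 0)"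
        unfolding has_vector_derivative_def has_derivative_at by simp
      have "((\<lambda>h. (F (z + h *\<^sub>R v) - F z) /\<^sub>R h - frechet_derivative F (at z) v) \<longlongrightarrow> 0) (at 0)"
      proof (rule tendsto_norm_zero_cancel, rule Lim_transform_eventually[OF lim])
        have "norm (F (z + h *\<^sub>R v) - F z - h *\<^sub>R frechet_derivative F (at z) v) / norm h =
          norm ((F (z + h *\<^sub>R v) - F z) /\<^sub>R h - frechet_derivative F (at z) v)" if "h \<noteq> 0" for h :: real
        proof -
          have "(F (z + h *\<^sub>R v) - F z) /\<^sub>R h - frechet_derivative F (at z) v =
            (F (z + h *\<^sub>R v) - F z - h *\<^sub>R frechet_derivative F (at z) v) /\<^sub>R h"
            using that by (simp add: scaleR_diff_right)
          then show ?thesis by (simp add: divide_inverse mult.commute)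
        qed
        then show "\<forall>\<^sub>F h in at 0. norm (F (z + h *\<^sub>R v) - F z - h *\<^sub>R frechet_derivative F (at z) v) / norm h =
          norm ((F (z + h *\<^sub>R v) - F z) /\<^sub>R h - frechet_derivative F (at z) v)"
          by (auto simp: eventually_at_filter)
      qed
      then have "((\<lambda>t. (F (z + t *\<^sub>R v) - F z) /\<^sub>R t) \<longlongrightarrow> frechet_derivative F (at z) v) (at 0)"
        by (rule LIM_zero_cancel)
      then show "(\<lambda>n. (F (z + X n *\<^sub>R v) - F z) /\<^sub>R X n) \<longlonglongrightarrow> frechet_derivative F (at z) v"
        using X unfolding tendsto_at_iff_sequentially comp_def by auto
    qed
    show "AE z in lborel. cmod (k z * ((F (z + X n *\<^sub>R v) - F z) /\<^sub>R X n)) \<le> K * (L * cmod v) * indicator (cball 0 r) z" for n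
    proof (intro AE_I2)
      fix z
      have Xn: "\<bar>X n\<bar> > 0" using X by auto
      show "cmod (k z * ((F (z + X n *\<^sub>R v) - F z) /\<^sub>R X n)) \<le> K * (L * cmod v) * indicator (cball 0 r) z"
      proof (cases "cmod z \<le> r")
        case True
        have "cmod (F (z + X n *\<^sub>R v) - F z) \<le> L * (\<bar>X n\<bar> * cmod v)"
          using RL(6)[of "z + X n *\<^sub>R v" z] by simp
        then have "cmod ((F (z + X n *\<^sub>R v) - F z) /\<^sub>R X n) \<le> L * cmod v"
          using Xn by (simp only: norm_scaleR abs_inverse) (simp add: field_simps)
        then have "cmod (k z) * cmod ((F (z + X n *\<^sub>R v) - F z) /\<^sub>R X n) \<le> K * (L * cmod v)"
          by (intro mult_mono K K0) auto
        then have "cmod (k z * ((F (z + X n *\<^sub>R v) - F z) /\<^sub>R X n)) \<le> K * (L * cmod v)"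
          by (simp only: norm_mult)
        then show ?thesis using True by simp
      next
        case False
        have "cmod (X n *\<^sub>R v) \<le> T * cmod v" using T[of n] by (auto intro: mult_right_mono)
        moreover have "cmod z \<le> cmod (z + X n *\<^sub>R v) + cmod (X n *\<^sub>R v)"
          by (metis add_diff_cancel_right' norm_triangle_ineq4)
        moreover have "T * cmod v \<ge> 0" using T[of n] by (intro mult_nonneg_nonneg) auto
        ultimately have "cmod (z + X n *\<^sub>R v) \<ge> R" "cmod z \<ge> R" using False by (auto simp: r_def)
        then have "F (z + X n *\<^sub>R v) = 0" "F z = 0" using RL(3) by auto
        then show ?thesis using False by simp
      qed
    qed
  qed measurable
qed

text \<open>Translation invariance of Lebesgue measure makes the integral of every difference quotient vanish.\<close>

lemma integral_frechet_derivative_eq_0: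
  assumes F: "C1_compact F"
  shows "(LINT z|lborel. frechet_derivative F (at z) v) = 0"
proof -
  have [measurable]: "F \<in> borel_measurable borel"
    using C1_compact_continuous[OF F] by (rule borel_measurable_continuous_onI)
  obtain R L where RL: "R > 0" "L \<ge> 0" "\<And>z. cmod z \<ge> R \<Longrightarrow> F z = 0"
    "\<And>z v. cmod z > R \<Longrightarrow> frechet_derivative F (at z) v = 0"
    "\<And>z v. cmod (frechet_derivative F (at z) v) \<le> L * cmod v" "\<And>z w. cmod (F z - F w) \<le> L * cmod (z - w)"
    using C1_compactE[OF F] by metis
  have bd: "cmod (F z) \<le> L * (2 * R)" for z
  proof (cases "cmod z \<ge> R")
    case False
    then have "cmod (z - of_real R) \<le> 2 * R" using RL(1) norm_triangle_ineq4[of z "of_real R"] by auto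
    then have "L * cmod (z - of_real R) \<le> L * (2 * R)" using RL(2) by (rule mult_left_mono)
    then show ?thesis using RL(6)[of z "of_real R"] RL(3)[of "of_real R"] RL(1) by auto
  qed (use RL in auto)
  have int: "integrable lborel F"
    by (rule integrable_bounded_compact_support[where R = R and K = "L * (2 * R)"]) (use bd RL in auto)
  have int2: "integrable lborel (\<lambda>z. F (z + c))" for c
  proof (rule integrable_bounded_compact_support[where R = "R + cmod c" and K = "L * (2 * R)"])
    fix z assume "R + cmod c < cmod z"
    moreover have "cmod z \<le> cmod (z + c) + cmod c" by (metis add_diff_cancel_right' norm_triangle_ineq4)
    ultimately show "F (z + c) = 0" by (intro RL(3)) auto
  qed (use bd in auto)
  define X where "X n = inverse (real (Suc n))" for n
  have "(\<lambda>n. LINT z|lborel. 1 * ((F (z + X n *\<^sub>R v) - F z) /\<^sub>R X n)) \<longlonglongrightarrow>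
     (LINT z|lborel. 1 * frechet_derivative F (at z) v)"
    by (rule integral_difference_quotient[OF F, where K = 1])
      (use LIMSEQ_inverse_real_of_nat in \<open>auto simp: X_def\<close>)
  moreover have "(LINT z|lborel. 1 * ((F (z + X n *\<^sub>R v) - F z) /\<^sub>R X n)) = 0" for n
    using integral_translate_complex[of F "X n *\<^sub>R v"] int int2[of "X n *\<^sub>R v"]
    by (simp add: add.commute[of "X n *\<^sub>R v"])
  ultimately have "(\<lambda>n::nat. 0) \<longlonglongrightarrow> (LINT z|lborel. frechet_derivative F (at z) v)"
    by (simp only: mult_1)
  then show ?thesis by (simp add: LIMSEQ_const_iff)
qed

section \<open>The Cauchy-Pompeiu formula\<close>

lemma balls_borel [measurable]: "ball (c::complex) r \<in> sets borel" "cball (c::complex) r \<in> sets borel"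
  by auto

lemma cnj_borel [measurable]: "cnj \<in> borel_measurable borel"
  by (intro borel_measurable_continuous_onI continuous_intros)

lemma complex_of_real_borel [measurable]: "complex_of_real \<in> borel_measurable borel"
  by (intro borel_measurable_continuous_onI continuous_intros)

lemma integrable_bounded_support_norm:
  fixes f :: "complex \<Rightarrow> complex"
  assumes "integrable lborel g" "f \<in> borel_measurable borel" "\<And>z. cmod (f z) \<le> g z"
  shows "integrable lborel f"
proof (rule Bochner_Integration.integrable_bound[OF assms(1)])
  show "AE z in lborel. norm (f z) \<le> norm (g z)"
    using assms(3) by (intro AE_I2) (metis abs_ge_self order_trans real_norm_def)
qed (use assms(2) in simp)

text \<open>Where \<open>2 ^ - (k + 1) \<le> \<bar>z\<bar> < 2 ^ - k\<close> the integrand is at most \<open>2 ^ (k + 1)\<close>, on a set of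
  area at most \<open>pi 4 ^ - k\<close>; these contributions form a geometric series.\<close>

lemma nn_integral_inverse_norm_unit_ball:
  "(\<integral>\<^sup>+z. ennreal (indicator (ball 0 1) z / cmod z) \<partial>lborel) < \<infinity>"
proof -
  define f where "f k z = ennreal (2 ^ (k + 1)) * indicator (ball 0 ((1 / 2) ^ k)) (z::complex)" for k z
  have "(\<integral>\<^sup>+z. ennreal (indicator (ball 0 1) z / cmod z) \<partial>lborel) \<le> (\<integral>\<^sup>+z. (\<Sum>k. f k z) \<partial>lborel)"
  proof (rule nn_integral_mono_AE, rule AE_mp[OF AE_lborel_singleton[of 0]], intro AE_I2 impI)
    fix z :: complex assume z: "z \<noteq> 0"
    show "ennreal (indicator (ball 0 1) z / cmod z) \<le> (\<Sum>k. f k z)"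
    proof (cases "cmod z < 1")
      case True
      have "\<exists>n. (1 / 2) ^ n \<le> cmod z"
        using real_arch_pow_inv[of "cmod z" "1/2"] z by (auto intro: less_imp_le)
      define n where "n = (LEAST n. (1 / 2) ^ n \<le> cmod z)"
      have n: "(1 / 2) ^ n \<le> cmod z" unfolding n_def using \<open>\<exists>n. _\<close> by (rule LeastI_ex)
      then have "n \<noteq> 0" using True by (intro notI) simp
      then obtain k where k: "n = Suc k" by (cases n) auto
      have "\<not> (1 / 2) ^ k \<le> cmod z" using not_less_Least[of k "\<lambda>n. (1 / 2) ^ n \<le> cmod z"] k by (simp add: n_def)
      then have "f k z = ennreal (2 ^ (k + 1))" by (simp add: f_def)
      moreover have "1 / cmod z \<le> 2 ^ (k + 1)"
        using n z by (simp add: k field_simps)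
      ultimately have "ennreal (indicator (ball 0 1) z / cmod z) \<le> f k z"
        using True by (simp add: ennreal_leI)
      also have "f k z = (\<Sum>j\<in>{k}. f j z)" by simp
      also have "\<dots> \<le> (\<Sum>k. f k z)" by (rule sum_le_suminf) auto
      finally show ?thesis .
    qed auto
  qed
  also have "\<dots> = (\<Sum>k. \<integral>\<^sup>+z. f k z \<partial>lborel)"
    by (rule nn_integral_suminf) (simp add: f_def)
  also have "(\<lambda>k. \<integral>\<^sup>+z. f k z \<partial>lborel) = (\<lambda>k. ennreal (2 * pi * (1 / 2) ^ k))"
  proof
    fix k
    have "(\<integral>\<^sup>+z. f k z \<partial>lborel) = ennreal (2 ^ (k + 1)) * ennreal (pi * ((1 / 2) ^ k)\<^sup>2)"
      by (simp add: f_def nn_integral_cmult_indicator emeasure_ball unit_ball_vol_2)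
    also have "\<dots> = ennreal (2 ^ (k + 1) * (pi * ((1 / 2) ^ k)\<^sup>2))"
      by (rule ennreal_mult[symmetric]) auto
    also have "2 ^ (k + 1) * (pi * ((1 / 2) ^ k)\<^sup>2) = 2 * pi * (1 / 2) ^ k"
      by (simp add: power2_eq_square power_divide)
    finally show "(\<integral>\<^sup>+z. f k z \<partial>lborel) = ennreal (2 * pi * (1 / 2) ^ k)" .
  qed
  also have "(\<Sum>k. ennreal (2 * pi * (1 / 2) ^ k)) < \<infinity>"
    by (subst suminf_ennreal2) (auto intro!: summable_mult summable_geometric)
  finally show ?thesis .
qed

lemma integrable_inverse_norm_unit_ball: "integrable lborel (\<lambda>z::complex. indicator (ball 0 1) z / cmod z)"
  by (rule integrableI_nonneg, measurable) (use nn_integral_inverse_norm_unit_ball in auto)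

lemma integrable_inverse_norm_cball: "integrable lborel (\<lambda>z::complex. indicator (cball 0 R) z / cmod z)"
proof (rule Bochner_Integration.integrable_bound)
  show "integrable lborel (\<lambda>z::complex. indicator (ball 0 1) z / cmod z + indicator (cball 0 R) z)"
    by (intro Bochner_Integration.integrable_add integrable_inverse_norm_unit_ball integrable_real_indicator)
      (auto simp: emeasure_lborel_cball_finite[unfolded infinity_ennreal_def])
  show "(\<lambda>z::complex. indicator (cball 0 R) z / cmod z) \<in> borel_measurable lborel" by measurable
qed (auto split: split_indicator simp: divide_simps)

text \<open>The same dyadic decomposition: for \<open>2 ^ k \<le> \<bar>y\<bar> < 2 ^ (k + 1)\<close> the integrand is at most
  \<open>16 ^ - k\<close> and the area at most \<open>pi 4 ^ (k + 1)\<close>.\<close>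

lemma nn_integral_inverse_square:
  "(\<integral>\<^sup>+y. ennreal (1 / (1 + (cmod y)\<^sup>2)\<^sup>2) \<partial>lborel) < \<infinity>"
proof -
  define f where "f k z = ennreal ((1 / 16) ^ k) * indicator (ball 0 (2 ^ (k + 1))) (z::complex)" for k z
  have "(\<integral>\<^sup>+y. ennreal (1 / (1 + (cmod y)\<^sup>2)\<^sup>2) \<partial>lborel) \<le> (\<integral>\<^sup>+z. (\<Sum>k. f k z) \<partial>lborel)"
  proof (rule nn_integral_mono)
    fix z :: complex
    have le1: "1 / (1 + (cmod z)\<^sup>2)\<^sup>2 \<le> 1" by (simp add: divide_le_eq one_le_power)
    have "\<exists>n. cmod z < 2 ^ n" using real_arch_pow[of 2 "cmod z"] by auto
    define n where "n = (LEAST n. cmod z < 2 ^ n)"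
    have n: "cmod z < 2 ^ n" unfolding n_def using \<open>\<exists>n. _\<close> by (rule LeastI_ex)
    have "\<exists>k. cmod z < 2 ^ (k + 1) \<and> 1 / (1 + (cmod z)\<^sup>2)\<^sup>2 \<le> (1 / 16) ^ k"
    proof (cases n)
      case 0
      then show ?thesis using n le1 by (intro exI[of _ 0]) auto
    next
      case (Suc k)
      have "2 ^ k \<le> cmod z" using not_less_Least[of k "\<lambda>n. cmod z < 2 ^ n"] Suc by (simp add: n_def)
      then have "(2 ^ k)\<^sup>2 \<le> (cmod z)\<^sup>2" by (intro power_mono) auto
      then have "(2 ^ k)\<^sup>2 \<le> 1 + (cmod z)\<^sup>2" by linarith
      then have "((2 ^ k)\<^sup>2)\<^sup>2 \<le> (1 + (cmod z)\<^sup>2)\<^sup>2" by (rule power_mono) simp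
      moreover have "((2 ^ k)\<^sup>2)\<^sup>2 = (16 :: real) ^ k"
      proof -
        have "((2 ^ k)\<^sup>2)\<^sup>2 = (2 :: real) ^ (4 * k)"
          by (simp only: power_mult[symmetric]) (simp add: mult.commute)
        then show ?thesis by (simp add: power_mult)
      qed
      ultimately have "(16::real) ^ k \<le> (1 + (cmod z)\<^sup>2)\<^sup>2" by simp
      then have "1 / (1 + (cmod z)\<^sup>2)\<^sup>2 \<le> 1 / 16 ^ k"
        by (intro divide_left_mono) (auto intro!: mult_pos_pos zero_less_power add_pos_nonneg)
      then show ?thesis using n Suc by (intro exI[of _ k]) (simp add: power_divide)
    qed
    then obtain k where k: "cmod z < 2 ^ (k + 1)" "1 / (1 + (cmod z)\<^sup>2)\<^sup>2 \<le> (1 / 16) ^ k" by blast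
    then have "ennreal (1 / (1 + (cmod z)\<^sup>2)\<^sup>2) \<le> f k z" by (simp add: f_def ennreal_leI)
    also have "f k z = (\<Sum>j\<in>{k}. f j z)" by simp
    also have "\<dots> \<le> (\<Sum>k. f k z)" by (rule sum_le_suminf) auto
    finally show "ennreal (1 / (1 + (cmod z)\<^sup>2)\<^sup>2) \<le> (\<Sum>k. f k z)" .
  qed
  also have "\<dots> = (\<Sum>k. \<integral>\<^sup>+z. f k z \<partial>lborel)"
    by (rule nn_integral_suminf) (simp add: f_def)
  also have "(\<lambda>k. \<integral>\<^sup>+z. f k z \<partial>lborel) = (\<lambda>k. ennreal (4 * pi * (1 / 4) ^ k))"
  proof
    fix k
    have "(\<integral>\<^sup>+z. f k z \<partial>lborel) = ennreal ((1 / 16) ^ k) * ennreal (pi * (2 ^ (k + 1))\<^sup>2)"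
      by (simp add: f_def nn_integral_cmult_indicator emeasure_ball unit_ball_vol_2 del: power_Suc)
    also have "\<dots> = ennreal ((1 / 16) ^ k * (pi * (2 ^ (k + 1))\<^sup>2))"
      by (rule ennreal_mult[symmetric]) auto
    also have "(1 / 16) ^ k * (pi * (2 ^ (k + 1))\<^sup>2) = 4 * pi * ((1 / 16) ^ k * 4 ^ k)"
      by (simp add: power2_eq_square flip: power_mult_distrib)
    also have "(1 / 16 :: real) ^ k * 4 ^ k = (1 / 4) ^ k" by (simp flip: power_mult_distrib)
    finally show "(\<integral>\<^sup>+z. f k z \<partial>lborel) = ennreal (4 * pi * (1 / 4) ^ k)" .
  qed
  also have "(\<Sum>k. ennreal (4 * pi * (1 / 4) ^ k)) < \<infinity>"
    by (subst suminf_ennreal2) (auto intro!: summable_mult summable_geometric)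
  finally show ?thesis .
qed

lemma integrable_inverse_square: "integrable lborel (\<lambda>y::complex. 1 / (1 + (cmod y)\<^sup>2)\<^sup>2)"
  by (rule integrableI_nonneg, measurable) (use nn_integral_inverse_square in auto)

text \<open>The exponential is dominated by a multiple of \<open>(1 + \<bar>z\<bar>\<^sup>2) ^ - 2\<close>, because
  \<open>exp x \<ge> 1 + x + x\<^sup>2 / 2\<close> for \<open>x \<ge> 0\<close>; inside the unit disc the singularity of \<open>1 / \<bar>z\<bar>\<close>
  decides.\<close>

lemma integrable_gaussian_kernel:
  assumes c: "c > 0"
  shows "integrable lborel (\<lambda>z::complex. exp (- c * (cmod z)\<^sup>2) / cmod z)"
proof -
  define C where "C = 2 / min 1 (c\<^sup>2 / 2)"
  have C0: "C > 0" using c by (auto simp: C_def)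
  have exp_le: "exp (- c * s) \<le> C * (1 / (1 + s)\<^sup>2)" if "s \<ge> 0" for s
  proof -
    define k where "k = min 1 (c\<^sup>2 / 2)"
    have k: "k > 0" "k \<le> 1" "k \<le> c\<^sup>2 / 2" using c by (auto simp: k_def)
    have "k * (1 + s)\<^sup>2 \<le> k * (2 * (1 + s\<^sup>2))"
      using sum_squares_bound[of 1 s] k by (intro mult_left_mono) (auto simp: power2_eq_square algebra_simps)
    also have "\<dots> \<le> 2 * (1 + (c\<^sup>2 / 2) * s\<^sup>2)"
      using mult_right_mono[OF k(3), of "s\<^sup>2"] k(2) by (simp add: algebra_simps)
    also have "\<dots> = 2 + (c * s)\<^sup>2" by (simp add: power_mult_distrib)
    also have "\<dots> \<le> 2 * exp (c * s)"
    proof -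
      have "c * s \<ge> 0" using c that by simp
      from exp_lower_Taylor_quadratic[OF this] this show ?thesis by linarith
    qed
    finally have "k * (1 + s)\<^sup>2 \<le> 2 * exp (c * s)" .
    moreover have "(1 + s)\<^sup>2 > 0" using that by (auto intro!: zero_less_power)
    ultimately show ?thesis
      using k by (simp add: C_def exp_minus field_simps flip: k_def)
  qed
  show ?thesis
  proof (rule Bochner_Integration.integrable_bound)
    show "integrable lborel (\<lambda>z::complex. indicator (ball 0 1) z / cmod z + C * (1 / (1 + (cmod z)\<^sup>2)\<^sup>2))"
      by (intro Bochner_Integration.integrable_add integrable_inverse_norm_unit_ball
          integrable_mult_right integrable_inverse_square)
    show "AE z in lborel. norm (exp (- c * (cmod z)\<^sup>2) / cmod z) \<le>
        norm (indicator (ball 0 1) z / cmod z + C * (1 / (1 + (cmod z)\<^sup>2)\<^sup>2))"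
    proof (intro AE_I2)
      fix z :: complex
      have pos: "C * (1 / (1 + (cmod z)\<^sup>2)\<^sup>2) \<ge> 0" using C0 by simp
      have "exp (- c * (cmod z)\<^sup>2) / cmod z \<le> indicator (ball 0 1) z / cmod z + C * (1 / (1 + (cmod z)\<^sup>2)\<^sup>2)"
      proof (cases "cmod z < 1")
        case True
        have "exp (- c * (cmod z)\<^sup>2) \<le> 1" using c by simp
        then have "exp (- c * (cmod z)\<^sup>2) / cmod z \<le> 1 / cmod z" by (intro divide_right_mono) auto
        then show ?thesis using True pos by simp
      next
        case False
        then have "exp (- c * (cmod z)\<^sup>2) / cmod z \<le> exp (- c * (cmod z)\<^sup>2) / 1"
          by (intro divide_left_mono) auto
        also have "\<dots> \<le> C * (1 / (1 + (cmod z)\<^sup>2)\<^sup>2)" using exp_le[of "(cmod z)\<^sup>2"] by simp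
        finally show ?thesis using False by simp
      qed
      then show "norm (exp (- c * (cmod z)\<^sup>2) / cmod z) \<le>
        norm (indicator (ball 0 1) z / cmod z + C * (1 / (1 + (cmod z)\<^sup>2)\<^sup>2))"
        by (simp only: real_norm_def) (smt (verit) abs_of_nonneg divide_nonneg_nonneg exp_ge_zero norm_ge_zero)
    qed
  qed measurable
qed

lemma integrable_translate:
  fixes f :: "complex \<Rightarrow> 'b::{banach, second_countable_topology}"
  assumes "integrable lborel f"
  shows "integrable lborel (\<lambda>z. f (z - c))"
proof -
  have "integrable (distr lborel borel ((+) (- c))) f" by (simp only: lborel_distr_plus assms)
  then have "integrable lborel (\<lambda>z. f (- c + z))" by (rule integrable_distr[rotated]) auto
  then show ?thesis by simp
qed

lemma lborel_integral_affine:
  fixes f :: "complex \<Rightarrow> complex"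
  assumes [measurable]: "f \<in> borel_measurable borel" and "s \<noteq> 0"
  shows "(LINT z|lborel. f z) = (LINT y|lborel. s\<^sup>2 *\<^sub>R f (c + s *\<^sub>R y))"
proof -
  have "(LINT z|lborel. f z) = (LINT z|density (distr lborel borel (\<lambda>x. c + s *\<^sub>R x)) (\<lambda>_. ennreal (\<bar>s\<bar>^DIM(complex))). f z)"
    using lborel_affine[OF assms(2), of c] by simp
  also have "\<dots> = (LINT z|distr lborel borel (\<lambda>x. c + s *\<^sub>R x). s\<^sup>2 *\<^sub>R f z)"
    by (subst integral_density) auto
  also have "\<dots> = (LINT y|lborel. s\<^sup>2 *\<^sub>R f (c + s *\<^sub>R y))"
    by (subst integral_distr) auto
  finally show ?thesis .
qed

lemma d_zbar_eqI:
  assumes "(F has_derivative (\<lambda>v. a * v + b * cnj v)) (at z)"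
  shows "d_zbar F z = b"
  by (simp add: d_zbar_def frechet_derivative_eqI[OF assms] complex_eq_iff field_simps)

lemma d_zbar_measurable:
  assumes "C1_compact F"
  shows "d_zbar F \<in> borel_measurable borel"
proof -
  have "(\<lambda>z. frechet_derivative F (at z) v) \<in> borel_measurable borel" for v
    using assms by (auto simp: C1_compact_def intro: borel_measurable_continuous_onI)
  then show ?thesis unfolding d_zbar_def[abs_def] by measurable
qed

lemma d_z_measurable:
  assumes "C1_compact F"
  shows "d_z F \<in> borel_measurable borel"
proof -
  have "(\<lambda>z. frechet_derivative F (at z) v) \<in> borel_measurable borel" for v
    using assms by (auto simp: C1_compact_def intro: borel_measurable_continuous_onI)
  then show ?thesis unfolding d_z_def[abs_def] by measurable
qed

lemma integral_d_zbar_eq_0: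
  assumes F: "C1_compact F"
  shows "(LINT z|lborel. d_zbar F z) = 0"
proof -
  obtain R L where RL: "R > 0" "L \<ge> 0" "\<And>z. cmod z \<ge> R \<Longrightarrow> F z = 0"
    "\<And>z v. cmod z > R \<Longrightarrow> frechet_derivative F (at z) v = 0"
    "\<And>z v. cmod (frechet_derivative F (at z) v) \<le> L * cmod v" "\<And>z w. cmod (F z - F w) \<le> L * cmod (z - w)"
    using C1_compactE[OF F] by metis
  have "integrable lborel (\<lambda>z. frechet_derivative F (at z) v)" for v
    by (rule integrable_bounded_compact_support[where R = R and K = "L * cmod v"])
      (use RL F in \<open>auto simp: C1_compact_def intro: borel_measurable_continuous_onI\<close>)
  then show ?thesis
    by (simp add: d_zbar_def integral_frechet_derivative_eq_0[OF F])
qed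

text \<open>This number is \<open>pi\<close>. It arises as the total mass of the approximate identity
  \<open>s\<^sup>2 / (\<bar>z\<bar>\<^sup>2 + s\<^sup>2)\<^sup>2\<close>, for every \<open>s > 0\<close>.\<close>

definition pompeiu_const :: real where
  "pompeiu_const = (LINT y|lborel. 1 / (1 + (cmod y)\<^sup>2)\<^sup>2)"

lemma pompeiu_const_pos: "pompeiu_const > 0"
proof -
  have "pompeiu_const \<noteq> 0"
  proof
    assume "pompeiu_const = 0"
    then have "AE y::complex in lborel. 1 / (1 + (cmod y)\<^sup>2)\<^sup>2 = 0"
      unfolding pompeiu_const_def by (subst (asm) integral_nonneg_eq_0_iff_AE) (auto simp: integrable_inverse_square)
    then have "AE y::complex in lborel. False"
      by eventually_elim (smt (verit) divide_eq_0_iff zero_le_power2 zero_eq_power2)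
    then show False by (simp add: AE_iff_null null_sets_def)
  qed
  moreover have "pompeiu_const \<ge> 0" unfolding pompeiu_const_def by (rule integral_nonneg_AE) auto
  ultimately show ?thesis by simp
qed

text \<open>The function \<open>cnj w / (\<bar>w\<bar>\<^sup>2 + s\<^sup>2)\<close> is a smooth substitute for \<open>1 / w = cnj w / \<bar>w\<bar>\<^sup>2\<close>. Its
  \<open>d_zbar\<close> derivative, the coefficient of \<open>cnj v\<close>, is an approximate identity.\<close>

lemma regularized_kernel_has_derivative:
  assumes "s > 0"
  shows "((\<lambda>z. cnj (z - \<zeta>) / of_real ((cmod (z - \<zeta>))\<^sup>2 + s\<^sup>2)) has_derivative
    (\<lambda>v. (- (cnj (z - \<zeta>))\<^sup>2 / (of_real ((cmod (z - \<zeta>))\<^sup>2 + s\<^sup>2))\<^sup>2) * v +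
       (of_real (s\<^sup>2) / (of_real ((cmod (z - \<zeta>))\<^sup>2 + s\<^sup>2))\<^sup>2) * cnj v)) (at z)"
proof -
  have D: "complex_of_real ((cmod w)\<^sup>2 + s\<^sup>2) = w * cnj w + of_real (s\<^sup>2)" for w
    by (simp only: of_real_add complex_norm_square)
  have nz: "(z - \<zeta>) * cnj (z - \<zeta>) + of_real (s\<^sup>2) \<noteq> 0"
  proof -
    have "(cmod (z - \<zeta>))\<^sup>2 + s\<^sup>2 \<noteq> 0" using assms by (simp add: add_nonneg_eq_0_iff)
    then show ?thesis unfolding D[symmetric] of_real_eq_0_iff .
  qed
  have cnj: "(cnj has_derivative cnj) F" for F by (rule bounded_linear_imp_has_derivative[OF bounded_linear_cnj])
  have c1: "((\<lambda>z. cnj (z - \<zeta>)) has_derivative cnj) (at z)"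
    by (rule has_derivative_compose[OF _ cnj, where f' = "\<lambda>v. v"]) (auto intro!: derivative_eq_intros)
  have d1: "((\<lambda>z. (z - \<zeta>) * cnj (z - \<zeta>) + of_real (s\<^sup>2)) has_derivative
       (\<lambda>v. (z - \<zeta>) * cnj v + v * cnj (z - \<zeta>))) (at z)"
    by (auto intro!: derivative_eq_intros c1)
  have "((\<lambda>z. cnj (z - \<zeta>) / ((z - \<zeta>) * cnj (z - \<zeta>) + of_real (s\<^sup>2))) has_derivative
       (\<lambda>v. (cnj v * ((z - \<zeta>) * cnj (z - \<zeta>) + of_real (s\<^sup>2)) - cnj (z - \<zeta>) * ((z - \<zeta>) * cnj v + v * cnj (z - \<zeta>))) /
         (((z - \<zeta>) * cnj (z - \<zeta>) + of_real (s\<^sup>2)) * ((z - \<zeta>) * cnj (z - \<zeta>) + of_real (s\<^sup>2))))) (at z)"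
    by (rule has_derivative_divide'[OF c1 d1 nz])
  then show ?thesis
    unfolding D
    by (rule has_derivative_eq_rhs) (simp add: power2_eq_square add_divide_distrib[symmetric] algebra_simps)
qed

text \<open>Integrate the vanishing d-bar derivative of the product of \<open>F\<close> with a regularised Cauchy
  kernel, and let the regularisation shrink: the derivative of the kernel is an approximate identity.\<close>

lemma cauchy_pompeiu:
  assumes F: "C1_compact F"
  shows "(LINT z|lborel. d_zbar F z / (z - \<zeta>)) = - (of_real pompeiu_const * F \<zeta>)"
proof -
  obtain R L where RL: "R > 0" "L \<ge> 0" "\<And>z. cmod z \<ge> R \<Longrightarrow> F z = 0"
    "\<And>z v. cmod z > R \<Longrightarrow> frechet_derivative F (at z) v = 0"
    "\<And>z v. cmod (frechet_derivative F (at z) v) \<le> L * cmod v" "\<And>z w. cmod (F z - F w) \<le> L * cmod (z - w)"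
    using C1_compactE[OF F] by metis
  have [measurable]: "F \<in> borel_measurable borel"
    using C1_compact_continuous[OF F] by (rule borel_measurable_continuous_onI)
  note [measurable] = d_zbar_measurable[OF F]
  have Fdiff: "F differentiable at z" for z using F by (simp add: C1_compact_def)
  have dout: "d_zbar F z = 0" if "cmod z > R" for z using RL(4) that by (simp add: d_zbar_def)
  have dbd: "cmod (d_zbar F z) \<le> L" for z
  proof -
    have "cmod (frechet_derivative F (at z) 1) \<le> L" "cmod (frechet_derivative F (at z) \<i>) \<le> L"
      using RL(5)[of z 1] RL(5)[of z \<i>] by auto
    then show ?thesis
      using norm_triangle_ineq[of "frechet_derivative F (at z) 1" "\<i> * frechet_derivative F (at z) \<i>"]
      by (simp add: d_zbar_def norm_divide norm_mult)
  qed
  have Fbd: "cmod (F z) \<le> L * (2 * R)" for z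
  proof (cases "cmod z \<ge> R")
    case False
    then have "cmod (z - of_real R) \<le> 2 * R" using RL(1) norm_triangle_ineq4[of z "of_real R"] by auto
    then have "L * cmod (z - of_real R) \<le> L * (2 * R)" using RL(2) by (rule mult_left_mono)
    then show ?thesis using RL(6)[of z "of_real R"] RL(3)[of "of_real R"] RL(1) by auto
  qed (use RL in auto)
  define D where "D s z = (cmod (z - \<zeta>))\<^sup>2 + s\<^sup>2" for s z
  define k where "k s z = cnj (z - \<zeta>) / of_real (D s z)" for s z
  have Dpos: "D s z > 0" if "s > 0" for s z using that by (simp add: D_def add_nonneg_pos)
  have kd: "(k s has_derivative (\<lambda>v. (- (cnj (z - \<zeta>))\<^sup>2 / (of_real (D s z))\<^sup>2) * v +
       (of_real (s\<^sup>2) / (of_real (D s z))\<^sup>2) * cnj v)) (at z)" if "s > 0" for s z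
    unfolding k_def[abs_def] D_def by (rule regularized_kernel_has_derivative[OF that])
  have [measurable]: "k s \<in> borel_measurable borel" for s unfolding k_def[abs_def] D_def by measurable
  have Dcont: "continuous_on UNIV (\<lambda>z. complex_of_real (D s z))" for s
    unfolding D_def by (intro continuous_intros)
  have kcont: "continuous_on UNIV (k s)" if "s > 0" for s
    unfolding k_def[abs_def] using Dpos[OF that] by (intro continuous_intros Dcont) (auto simp: less_imp_neq[symmetric])
  have main: "(LINT z|lborel. d_zbar F z * k s z) = - (LINT z|lborel. F z * (of_real (s\<^sup>2) / (of_real (D s z))\<^sup>2))"
    if s: "s > 0" for s
  proof -
    define G where "G z = F z * k s z" for z
    have Gd: "(G has_derivative (\<lambda>v. F z * ((- (cnj (z - \<zeta>))\<^sup>2 / (of_real (D s z))\<^sup>2) * v +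
       (of_real (s\<^sup>2) / (of_real (D s z))\<^sup>2) * cnj v) + frechet_derivative F (at z) v * k s z)) (at z)" for z
      unfolding G_def[abs_def] using Fdiff by (intro has_derivative_mult kd s) (auto simp: frechet_derivative_works)
    have GC: "C1_compact G"
      unfolding C1_compact_def
    proof (intro conjI allI)
      show "G differentiable at z" for z using Gd by (rule differentiableI)
      have "continuous_on UNIV (\<lambda>z. F z * ((- (cnj (z - \<zeta>))\<^sup>2 / (of_real (D s z))\<^sup>2) * v +
       (of_real (s\<^sup>2) / (of_real (D s z))\<^sup>2) * cnj v) + frechet_derivative F (at z) v * k s z)" for v
        using Dpos[OF s] F by (intro continuous_intros C1_compact_continuous[OF F] Dcont kcont s)
           (auto simp: less_imp_neq[symmetric] C1_compact_def)
      then show "continuous_on UNIV (\<lambda>z. frechet_derivative G (at z) v)" for v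
        by (simp only: frechet_derivative_eqI[OF Gd])
      show "\<exists>R. \<forall>z. R \<le> cmod z \<longrightarrow> G z = 0" using RL(3) by (auto simp: G_def)
    qed
    have dG: "d_zbar G z = d_zbar F z * k s z + F z * (of_real (s\<^sup>2) / (of_real (D s z))\<^sup>2)" for z
      by (rule d_zbar_eqI[where a = "F z * (- (cnj (z - \<zeta>))\<^sup>2 / (of_real (D s z))\<^sup>2) + d_z F z * k s z"],
          rule has_derivative_eq_rhs[OF Gd])
        (auto simp: frechet_derivative_wirtinger[OF Fdiff] algebra_simps)
    have kb: "\<exists>B. \<forall>z. cmod z \<le> R \<longrightarrow> cmod (f z) \<le> B" if "continuous_on UNIV f" for f :: "complex \<Rightarrow> complex"
    proof -
      have "compact (f ` cball 0 R)" by (intro compact_continuous_image continuous_on_subset[OF that]) auto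
      from compact_imp_bounded[OF this] obtain a where "\<forall>z\<in>cball 0 R. cmod (f z) \<le> a"
        by (auto simp: bounded_iff)
      then show ?thesis by (intro exI[of _ a]) auto
    qed
    obtain B where B: "\<And>z. cmod z \<le> R \<Longrightarrow> cmod (k s z) \<le> B" using kb[OF kcont[OF s]] by blast
    have "integrable lborel (\<lambda>z. d_zbar F z * k s z)"
    proof (rule integrable_bounded_compact_support[where R = R and K = "L * max B 0"])
      show "cmod (d_zbar F z * k s z) \<le> L * max B 0" for z
        using dbd[of z] B[of z] dout[of z] RL(2)
        by (cases "cmod z \<le> R") (auto simp: norm_mult intro!: mult_mono max.coboundedI1)
    qed (auto simp: dout)
    moreover
    have qc: "continuous_on UNIV (\<lambda>z. of_real (s\<^sup>2) / (complex_of_real (D s z))\<^sup>2)"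
      using Dpos[OF s] by (intro continuous_intros Dcont) (auto simp: less_imp_neq[symmetric])
    obtain B2 where B2: "\<And>z. cmod z \<le> R \<Longrightarrow> cmod (of_real (s\<^sup>2) / (complex_of_real (D s z))\<^sup>2) \<le> B2"
      using kb[OF qc] by blast
    have "integrable lborel (\<lambda>z. F z * (of_real (s\<^sup>2) / (of_real (D s z))\<^sup>2))"
    proof (rule integrable_bounded_compact_support[where R = R and K = "L * (2 * R) * max B2 0"])
      show "(\<lambda>z. F z * (of_real (s\<^sup>2) / (of_real (D s z))\<^sup>2)) \<in> borel_measurable borel"
        unfolding D_def by measurable
      show "cmod (F z * (of_real (s\<^sup>2) / (of_real (D s z))\<^sup>2)) \<le> L * (2 * R) * max B2 0" for z
      proof (cases "cmod z \<le> R")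
        case True
        then show ?thesis unfolding norm_mult
          by (intro mult_mono Fbd max.coboundedI1 B2) (use RL in auto)
      next
        case False
        then have "F z = 0" by (intro RL(3)) simp
        then show ?thesis using RL by simp
      qed
    qed (use RL in auto)
    ultimately have "(LINT z|lborel. d_zbar G z) =
       (LINT z|lborel. d_zbar F z * k s z) + (LINT z|lborel. F z * (of_real (s\<^sup>2) / (of_real (D s z))\<^sup>2))"
      unfolding dG by (rule Bochner_Integration.integral_add)
    then show ?thesis using integral_d_zbar_eq_0[OF GC] by (simp add: eq_neg_iff_add_eq_0)
  qed
  define X where "X n = inverse (real (Suc n))" for n
  have X: "X \<longlonglongrightarrow> 0" "\<And>n. X n > 0"
    using LIMSEQ_inverse_real_of_nat unfolding X_def[abs_def] by (simp_all del: of_nat_Suc)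
  have lim1: "(\<lambda>n. LINT z|lborel. d_zbar F z * k (X n) z) \<longlonglongrightarrow> (LINT z|lborel. d_zbar F z / (z - \<zeta>))"
  proof (rule integral_dominated_convergence[where w = "\<lambda>z. L * (indicator (cball 0 (R + cmod \<zeta>)) (z - \<zeta>) / cmod (z - \<zeta>))"])
    show "integrable lborel (\<lambda>z. L * (indicator (cball 0 (R + cmod \<zeta>)) (z - \<zeta>) / cmod (z - \<zeta>)))"
      by (intro integrable_mult_right integrable_translate[of "\<lambda>z. indicator (cball 0 (R + cmod \<zeta>)) z / cmod z"]
          integrable_inverse_norm_cball)
    show "AE z in lborel. (\<lambda>n. d_zbar F z * k (X n) z) \<longlonglongrightarrow> d_zbar F z / (z - \<zeta>)"
    proof (rule AE_mp[OF AE_lborel_singleton[of \<zeta>]], intro AE_I2 impI)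
      fix z assume z: "z \<noteq> \<zeta>"
      have "(\<lambda>n. d_zbar F z * (cnj (z - \<zeta>) / complex_of_real ((cmod (z - \<zeta>))\<^sup>2 + (X n)\<^sup>2))) \<longlonglongrightarrow>
         d_zbar F z * (cnj (z - \<zeta>) / complex_of_real ((cmod (z - \<zeta>))\<^sup>2 + 0\<^sup>2))"
        using z by (intro tendsto_intros X) auto
      also have "cnj (z - \<zeta>) / complex_of_real ((cmod (z - \<zeta>))\<^sup>2 + 0\<^sup>2) = 1 / (z - \<zeta>)"
        using z by (simp add: complex_norm_square divide_simps del: of_real_power)
      finally show "(\<lambda>n. d_zbar F z * k (X n) z) \<longlonglongrightarrow> d_zbar F z / (z - \<zeta>)"
        by (simp add: k_def D_def)
    qed
    show "AE z in lborel. cmod (d_zbar F z * k (X n) z) \<le> L * (indicator (cball 0 (R + cmod \<zeta>)) (z - \<zeta>) / cmod (z - \<zeta>))" for n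
    proof (intro AE_I2)
      fix z
      show "cmod (d_zbar F z * k (X n) z) \<le> L * (indicator (cball 0 (R + cmod \<zeta>)) (z - \<zeta>) / cmod (z - \<zeta>))"
      proof (cases "cmod z \<le> R \<and> z \<noteq> \<zeta>")
        case True
        then have "cmod (z - \<zeta>) \<le> R + cmod \<zeta>" using norm_triangle_ineq4[of z \<zeta>] by auto
        moreover have "cmod (k (X n) z) \<le> 1 / cmod (z - \<zeta>)"
        proof -
          have "cmod (k (X n) z) = cmod (z - \<zeta>) / D (X n) z"
            using Dpos[OF X(2)] by (simp add: k_def norm_divide less_imp_le del: complex_cnj_diff)
          also have "\<dots> \<le> cmod (z - \<zeta>) / (cmod (z - \<zeta>))\<^sup>2"
            using True by (intro divide_left_mono mult_pos_pos Dpos X) (auto simp: D_def)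
          also have "\<dots> = 1 / cmod (z - \<zeta>)" using True by (simp add: power2_eq_square)
          finally show ?thesis .
        qed
        ultimately have "cmod (d_zbar F z) * cmod (k (X n) z) \<le> L * (1 / cmod (z - \<zeta>))" 
          by (intro mult_mono dbd RL) auto
        then show ?thesis using \<open>cmod (z - \<zeta>) \<le> R + cmod \<zeta>\<close> by (simp add: norm_mult)
      next
        case False
        then have "d_zbar F z * k (X n) z = 0" using dout[of z] by (auto simp: k_def)
        then have "cmod (d_zbar F z * k (X n) z) = 0" by (simp only: norm_zero)
        then show ?thesis using RL(2) by (simp only:) simp
      qed
    qed
  qed measurable
  \<comment> \<open>After the substitution \<open>z = \<zeta> + s y\<close> the approximate identity no longer depends on the
    scale.\<close>
  have lim2: "(\<lambda>n. LINT y|lborel. F (\<zeta> + X n *\<^sub>R y) * of_real (1 / (1 + (cmod y)\<^sup>2)\<^sup>2)) \<longlonglongrightarrow>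
      (LINT y|lborel. F \<zeta> * of_real (1 / (1 + (cmod y)\<^sup>2)\<^sup>2))"
  proof (rule integral_dominated_convergence[where w = "\<lambda>y. (L * (2 * R)) * (1 / (1 + (cmod y)\<^sup>2)\<^sup>2)"])
    show "integrable lborel (\<lambda>y::complex. (L * (2 * R)) * (1 / (1 + (cmod y)\<^sup>2)\<^sup>2))"
      by (intro integrable_mult_right integrable_inverse_square)
    show "AE y in lborel. (\<lambda>n. F (\<zeta> + X n *\<^sub>R y) * of_real (1 / (1 + (cmod y)\<^sup>2)\<^sup>2)) \<longlonglongrightarrow> F \<zeta> * of_real (1 / (1 + (cmod y)\<^sup>2)\<^sup>2)"
    proof (intro AE_I2 tendsto_mult tendsto_const)
      fix y
      have "isCont F \<zeta>" using C1_compact_continuous[OF F] by (simp add: continuous_on_eq_continuous_at)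
      moreover have "(\<lambda>n. \<zeta> + X n *\<^sub>R y) \<longlonglongrightarrow> \<zeta> + 0 *\<^sub>R y" by (intro tendsto_intros X)
      ultimately show "(\<lambda>n. F (\<zeta> + X n *\<^sub>R y)) \<longlonglongrightarrow> F \<zeta>"
        by (intro isCont_tendsto_compose[of \<zeta> F]) auto
    qed
    show "AE y in lborel. norm (F (\<zeta> + X n *\<^sub>R y) * of_real (1 / (1 + (cmod y)\<^sup>2)\<^sup>2)) \<le> (L * (2 * R)) * (1 / (1 + (cmod y)\<^sup>2)\<^sup>2)" for n
      by (intro AE_I2) (simp only: norm_mult norm_of_real, intro mult_mono Fbd, use RL in auto)
  qed measurable
  have eq: "(LINT z|lborel. F z * (of_real ((X n)\<^sup>2) / (of_real (D (X n) z))\<^sup>2)) =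
    (LINT y|lborel. F (\<zeta> + X n *\<^sub>R y) * of_real (1 / (1 + (cmod y)\<^sup>2)\<^sup>2))" for n
  proof -
    have "X n \<noteq> 0" using X(2)[of n] by simp
    have "(X n)\<^sup>2 *\<^sub>R (F (\<zeta> + X n *\<^sub>R y) * (of_real ((X n)\<^sup>2) / (of_real (D (X n) (\<zeta> + X n *\<^sub>R y)))\<^sup>2)) =
       F (\<zeta> + X n *\<^sub>R y) * of_real (1 / (1 + (cmod y)\<^sup>2)\<^sup>2)" for y
    proof -
      have "D (X n) (\<zeta> + X n *\<^sub>R y) = (X n)\<^sup>2 * (1 + (cmod y)\<^sup>2)"
        by (simp add: D_def power_mult_distrib algebra_simps)
      moreover have "(X n)\<^sup>2 * ((X n)\<^sup>2 / ((X n)\<^sup>2 * (1 + (cmod y)\<^sup>2))\<^sup>2) = 1 / (1 + (cmod y)\<^sup>2)\<^sup>2"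
        using \<open>X n \<noteq> 0\<close> by (simp add: power2_eq_square)
      ultimately have "(X n)\<^sup>2 * ((X n)\<^sup>2 / (D (X n) (\<zeta> + X n *\<^sub>R y))\<^sup>2) = 1 / (1 + (cmod y)\<^sup>2)\<^sup>2"
        by (simp only:)
      moreover have "(X n)\<^sup>2 *\<^sub>R (F (\<zeta> + X n *\<^sub>R y) * (of_real ((X n)\<^sup>2) / (of_real (D (X n) (\<zeta> + X n *\<^sub>R y)))\<^sup>2)) =
        F (\<zeta> + X n *\<^sub>R y) * of_real ((X n)\<^sup>2 * ((X n)\<^sup>2 / (D (X n) (\<zeta> + X n *\<^sub>R y))\<^sup>2))"
        by (simp add: scaleR_conv_of_real)
      ultimately show ?thesis by (simp only:)
    qed
    then show ?thesis
      by (subst lborel_integral_affine[OF _ \<open>X n \<noteq> 0\<close>, of _ \<zeta>]) (auto simp: D_def)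
  qed
  have "(LINT y|lborel. F \<zeta> * of_real (1 / (1 + (cmod y)\<^sup>2)\<^sup>2)) = F \<zeta> * of_real pompeiu_const"
    unfolding pompeiu_const_def by (simp only: integral_mult_right_zero integral_complex_of_real)
  then have "(\<lambda>n. LINT z|lborel. d_zbar F z * k (X n) z) \<longlonglongrightarrow> - (F \<zeta> * of_real pompeiu_const)"
    unfolding main[OF X(2)] eq using tendsto_minus[OF lim2] by simp
  from LIMSEQ_unique[OF lim1 this] show ?thesis by (simp add: mult.commute)
qed

section \<open>Bounded measurable functions on the annulus\<close>

definition closed_annulus :: "real \<Rightarrow> complex set" where
  "closed_annulus r0 = {z. r0 \<le> cmod z \<and> cmod z \<le> 1}"

lemma open_annulus: "open (annulus r0)"
proof -
  have "annulus r0 = ball 0 1 - cball 0 r0" by (auto simp: annulus_def)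
  then show ?thesis by auto
qed

lemma compact_closed_annulus: "compact (closed_annulus r0)"
proof -
  have "closed_annulus r0 = cball 0 1 - ball 0 r0" by (auto simp: closed_annulus_def)
  then show ?thesis by (simp add: compact_diff)
qed

lemma annulus_subset_closed: "annulus r0 \<subseteq> closed_annulus r0"
  by (auto simp: annulus_def closed_annulus_def)

lemma annulus_borel [measurable, simp]: "annulus r0 \<in> sets borel"
  using open_annulus by auto

lemma annulus_lebesgue [simp]: "annulus r0 \<in> sets lebesgue"
  by (intro sets_completionI_sets) simp

lemma AE_annulus_iff: "(AE z in lebesgue_on (annulus r0). P z) \<longleftrightarrow> (AE z in lborel. z \<in> annulus r0 \<longrightarrow> P z)"
  by (subst AE_restrict_space_iff) (auto simp: AE_completion_iff)

lemma closed_annulus_subset_closure: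
  assumes "0 < r0" "r0 < 1"
  shows "closed_annulus r0 \<subseteq> closure (annulus r0)"
proof
  fix z assume z: "z \<in> closed_annulus r0"
  define t where "t = (1 + r0) / 2"
  have t: "r0 < t" "t < 1" using assms by (auto simp: t_def)
  have z0: "cmod z > 0" "r0 \<le> cmod z" "cmod z \<le> 1" using z assms by (auto simp: closed_annulus_def)
  \<comment> \<open>Approach \<open>z\<close> along its radius from the side of the middle circle \<open>\<bar>w\<bar> = t\<close>.\<close>
  define X where "X n = z + of_real (inverse (real (Suc n))) * ((of_real t / of_real (cmod z)) * z - z)" for n
  have "X \<longlonglongrightarrow> z + of_real 0 * ((of_real t / of_real (cmod z)) * z - z)"
    unfolding X_def[abs_def] by (intro tendsto_intros LIMSEQ_inverse_real_of_nat)
  then have "X \<longlonglongrightarrow> z" by simp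
  moreover have "X n \<in> annulus r0" for n
  proof -
    define h where "h = inverse (real (Suc n))"
    have h: "0 < h" "h \<le> 1" by (auto simp: h_def field_simps)
    have "X n = of_real ((1 - h) + h * t / cmod z) * z"
      unfolding X_def h_def[symmetric] by (simp add: algebra_simps)
    moreover have "(1 - h) + h * t / cmod z \<ge> 0" using h t z0 assms by (auto intro!: add_nonneg_nonneg)
    ultimately have "cmod (X n) = ((1 - h) + h * t / cmod z) * cmod z" by (simp add: norm_mult del: of_real_add of_real_diff)
    also have "\<dots> = (1 - h) * cmod z + h * t" using z0 by (simp add: field_simps)
    finally have eq: "cmod (X n) = (1 - h) * cmod z + h * t" .
    have "(1 - h) * r0 + h * r0 < (1 - h) * cmod z + h * t"
      using h t z0 by (intro add_le_less_mono mult_left_mono mult_strict_left_mono) auto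
    moreover have "(1 - h) * cmod z + h * t < (1 - h) * 1 + h * 1"
      using h t z0 by (intro add_le_less_mono mult_left_mono mult_strict_left_mono) auto
    ultimately show ?thesis unfolding annulus_def mem_Collect_eq eq by (simp add: algebra_simps)
  qed
  ultimately show "z \<in> closure (annulus r0)" unfolding closure_sequential by blast
qed

text \<open>Data on the annulus are replaced by Borel functions on the whole plane, to which Fubini's
  theorem and translations for the measure \<open>lborel\<close> apply.\<close>

lemma measurable_borel_representative:
  fixes h :: "complex \<Rightarrow> complex"
  assumes "h \<in> borel_measurable (lebesgue_on (annulus r0))"
  obtains g where "g \<in> borel_measurable borel" "\<And>z. z \<notin> annulus r0 \<Longrightarrow> g z = 0"
    "AE z in lebesgue_on (annulus r0). h z = g z"
proof -
  define h1 where "h1 z = (if z \<in> annulus r0 then h z else 0)" for z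
  have h1: "h1 \<in> borel_measurable lebesgue"
    unfolding h1_def[abs_def] using assms by (simp add: borel_measurable_if)
  then have "(\<lambda>z. Re (h1 z)) \<in> borel_measurable (completion lborel)" "(\<lambda>z. Im (h1 z)) \<in> borel_measurable (completion lborel)"
    by (auto intro!: borel_measurable_continuous_on[of _ h1] continuous_intros simp del: measurable_completion)
  from this[THEN completion_ex_borel_measurable_real]
  obtain f1 f2 where [measurable]: "f1 \<in> borel_measurable lborel" "f2 \<in> borel_measurable lborel"
    and ae: "AE z in lborel. Re (h1 z) = f1 z" "AE z in lborel. Im (h1 z) = f2 z" by blast
  define g where "g z = (if z \<in> annulus r0 then of_real (f1 z) + \<i> * of_real (f2 z) else 0)" for z
  have "g \<in> borel_measurable borel" unfolding g_def[abs_def] by measurable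
  moreover have "AE z in lborel. z \<in> annulus r0 \<longrightarrow> h z = g z"
    using ae by eventually_elim (auto simp: g_def h1_def complex_eq_iff)
  ultimately show thesis using that[of g] by (auto simp: g_def AE_annulus_iff)
qed

lemma Linf_borel_representative:
  assumes "h \<in> Linf r0"
  obtains h' M where "h' \<in> borel_measurable borel" "M \<ge> 0" "\<And>z. cmod (h' z) \<le> M"
    "\<And>z. z \<notin> annulus r0 \<Longrightarrow> h' z = 0" "AE z in lebesgue_on (annulus r0). h z = h' z"
proof -
  have hm: "h \<in> borel_measurable (lebesgue_on (annulus r0))"
    and fin: "esssup (lebesgue_on (annulus r0)) (\<lambda>z. ennreal (cmod (h z))) < \<infinity>"
    using assms by (auto simp: Linf_def Linf_norm_def)
  define M where "M = enn2real (esssup (lebesgue_on (annulus r0)) (\<lambda>z. ennreal (cmod (h z))))"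
  have "AE z in lebesgue_on (annulus r0). ennreal (cmod (h z)) \<le> ennreal M"
    using esssup_AE[where M = "lebesgue_on (annulus r0)" and f = "\<lambda>z. ennreal (cmod (h z))"] fin by (simp add: M_def less_top)
  then have bd: "AE z in lborel. z \<in> annulus r0 \<longrightarrow> cmod (h z) \<le> M"
    unfolding AE_annulus_iff by eventually_elim (auto simp: M_def)
  obtain g where g: "g \<in> borel_measurable borel" "\<And>z. z \<notin> annulus r0 \<Longrightarrow> g z = 0"
    "AE z in lebesgue_on (annulus r0). h z = g z"
    by (rule measurable_borel_representative[OF hm]) (rule that)
  note [measurable] = g(1)
  define h' where "h' z = (if cmod (g z) \<le> M then g z else 0)" for z
  have M0: "M \<ge> 0" by (simp add: M_def)
  have "AE z in lborel. z \<in> annulus r0 \<longrightarrow> h z = h' z"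
    using g(3)[unfolded AE_annulus_iff] bd by eventually_elim (auto simp: h'_def)
  moreover have "h' \<in> borel_measurable borel" unfolding h'_def[abs_def] by measurable
  ultimately show thesis using that[of h' M] M0 g(2) by (auto simp: h'_def AE_annulus_iff)
qed

lemma annulus_integral_representative:
  fixes g g' D :: "complex \<Rightarrow> complex"
  assumes g: "g \<in> borel_measurable (lebesgue_on (annulus r0))"
    and g': "g' \<in> borel_measurable borel" "\<And>z. z \<notin> annulus r0 \<Longrightarrow> g' z = 0"
    and ae: "AE z in lebesgue_on (annulus r0). g z = g' z" and D: "D \<in> borel_measurable borel"
  shows "(LINT z|lebesgue_on (annulus r0). g z * D z) = (LINT z|lborel. g' z * D z)"
proof -
  have m: "f \<in> borel_measurable (lebesgue_on (annulus r0))" if "f \<in> borel_measurable borel" for f :: "complex \<Rightarrow> complex"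
    by (intro measurable_restrict_space1 measurable_completion) (use that in simp)
  have "(LINT z|lebesgue_on (annulus r0). g z * D z) = (LINT z|lebesgue_on (annulus r0). g' z * D z)"
    by (rule integral_cong_AE) (use ae g m[OF g'(1)] m[OF D] in auto)
  also have "\<dots> = (LINT z|lebesgue. indicator (annulus r0) z *\<^sub>R (g' z * D z))"
    by (rule integral_restrict_space) simp
  also have "(\<lambda>z. indicator (annulus r0) z *\<^sub>R (g' z * D z)) = (\<lambda>z. g' z * D z)"
    using g'(2) by (auto simp: fun_eq_iff indicator_def)
  also have "(LINT z|lebesgue. g' z * D z) = (LINT z|lborel. g' z * D z)"
    by (rule integral_completion) (use g' D in measurable)
  finally show ?thesis .
qed

section \<open>Lipschitz representatives\<close>

text \<open>A measurable function is an almost everywhere limit of continuous ones. Truncating their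
  values (\<open>cl\<close>) and cutting them off outside a disc (\<open>\<theta>\<close>) makes the convergence dominated.\<close>

lemma L1_approximation_by_continuous:
  fixes g :: "complex \<Rightarrow> complex"
  assumes [measurable]: "g \<in> borel_measurable borel" and K: "\<And>z. cmod (g z) \<le> K"
    and supp: "\<And>z. cmod z > 1 \<Longrightarrow> g z = 0" and "\<eta> > 0"
  obtains c where "continuous_on UNIV c" "\<And>z. cmod z \<ge> 3 \<Longrightarrow> c z = 0"
    "(\<integral>\<^sup>+z. ennreal (cmod (g z - c z)) \<partial>lborel) < ennreal \<eta>"
proof -
  have "g \<in> borel_measurable lebesgue" by (rule measurable_completion) simp
  then have "g measurable_on UNIV" by (rule lebesgue_measurable_imp_measurable_on) simp
  then obtain N a where N: "negligible N" and a: "\<And>n. continuous_on UNIV (a n)"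
    and lim: "\<And>x. x \<notin> N \<Longrightarrow> (\<lambda>n. a n x) \<longlonglongrightarrow> g x"
    unfolding measurable_on_def by auto
  have aeN: "AE x in lborel. x \<notin> N"
    using N unfolding negligible_iff_null_sets by (auto dest!: AE_not_in simp: AE_completion_iff)
  define K' where "K' = max K 1"
  have K': "K' > 0" "\<And>z. cmod (g z) \<le> K'" using K by (auto simp: K'_def intro: max.coboundedI1)
  define cl where "cl w = of_real (K' / max K' (cmod w)) * w" for w :: complex
  have mx: "max K' (cmod w) > 0" for w using K' by auto
  have clc: "continuous_on UNIV cl"
    unfolding cl_def[abs_def] using mx by (intro continuous_intros) (auto simp: less_imp_neq[symmetric])
  have clb: "cmod (cl w) \<le> K'" for w
    using K' mx[of w] by (simp add: cl_def norm_mult norm_divide field_simps)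
  have clg: "cl (g z) = g z" for z using K' by (simp add: cl_def max_absorb1)
  define \<theta> where "\<theta> z = max 0 (min 1 (3 - cmod z))" for z :: complex
  have \<theta>: "0 \<le> \<theta> z" "\<theta> z \<le> 1" "cmod z \<ge> 3 \<Longrightarrow> \<theta> z = 0" "cmod z \<le> 1 \<Longrightarrow> \<theta> z = 1" for z
    by (auto simp: \<theta>_def)
  define c where "c n z = of_real (\<theta> z) * cl (a n z)" for n z
  have cc: "continuous_on UNIV (c n)" for n
    unfolding c_def[abs_def] \<theta>_def
    by (intro continuous_intros continuous_on_compose2[OF clc a]) auto
  have [measurable]: "c n \<in> borel_measurable borel" for n using cc by (rule borel_measurable_continuous_onI)
  have climit: "AE z in lborel. (\<lambda>n. c n z) \<longlonglongrightarrow> g z"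
    using aeN
  proof eventually_elim
    case (elim z)
    have "isCont cl (g z)" using clc by (simp add: continuous_on_eq_continuous_at)
    then have "(\<lambda>n. cl (a n z)) \<longlonglongrightarrow> cl (g z)" using lim[OF elim] by (rule isCont_tendsto_compose)
    then have "(\<lambda>n. of_real (\<theta> z) * cl (a n z)) \<longlonglongrightarrow> of_real (\<theta> z) * g z"
      unfolding clg by (intro tendsto_intros)
    also have "of_real (\<theta> z) * g z = g z" using \<theta>(4)[of z] supp[of z] by (cases "cmod z \<le> 1") auto
    finally show ?case unfolding c_def .
  qed
  have cb: "cmod (c n z) \<le> K'" for n z
  proof -
    have "\<theta> z * cmod (cl (a n z)) \<le> 1 * K'" by (intro mult_mono clb \<theta>) auto
    then show ?thesis using \<theta>(1)[of z] by (simp add: c_def norm_mult)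
  qed
  have "(\<lambda>n. \<integral>\<^sup>+z. ennreal (cmod (g z - c n z)) \<partial>lborel) \<longlonglongrightarrow> 0"
  proof (rule nn_integral_dominated_convergence_norm[where w = "\<lambda>z. K' * indicator (cball 0 3) z"])
    show "AE z in lborel. norm (c n z) \<le> K' * indicator (cball 0 3) z" for n
      using cb[of n] \<theta>(3) by (intro AE_I2) (auto simp: c_def indicator_def)
    have "(\<integral>\<^sup>+z. ennreal (K' * indicator (cball 0 3) (z::complex)) \<partial>lborel) =
      (\<integral>\<^sup>+z. ennreal K' * indicator (cball 0 3) (z::complex) \<partial>lborel)"
      by (intro nn_integral_cong) (auto simp: indicator_def)
    also have "\<dots> = ennreal K' * emeasure lborel (cball (0::complex) 3)"
      by (rule nn_integral_cmult_indicator) simp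
    also have "\<dots> < \<infinity>" using emeasure_lborel_cball_finite[of "0::complex" 3] by (simp add: ennreal_mult_less_top)
    finally show "(\<integral>\<^sup>+z. ennreal (K' * indicator (cball 0 3) (z::complex)) \<partial>lborel) < \<infinity>" .
  qed (use climit in measurable)
  then have "\<forall>\<^sub>F n in sequentially. (\<integral>\<^sup>+z. ennreal (cmod (g z - c n z)) \<partial>lborel) < ennreal \<eta>"
    using \<open>\<eta> > 0\<close> by (intro order_tendstoD(2)[of _ 0]) auto
  then obtain n where "(\<integral>\<^sup>+z. ennreal (cmod (g z - c n z)) \<partial>lborel) < ennreal \<eta>"
    using eventually_happens'[OF sequentially_bot] by blast
  then show thesis using that[of "c n"] cc \<theta>(3) by (auto simp: c_def)
qed

definition mollifier_mass :: "real \<Rightarrow> real" where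
  "mollifier_mass e = (LINT z|lborel. cmod (bump 0 e 0 z))"

definition mollify :: "real \<Rightarrow> (complex \<Rightarrow> complex) \<Rightarrow> complex \<Rightarrow> complex" where
  "mollify e g x = (LINT z|lborel. g z * bump x e 0 z) / of_real (mollifier_mass e)"

lemma bump_translate: "bump x e m z = bump 0 e m (z - x)"
  by (simp add: bump_def)

lemma bump_le_1: "cmod (bump x e 0 z) \<le> 1"
  by (simp add: bump_def flat_def)

lemma bump_borel [measurable]: "bump x e m \<in> borel_measurable borel"
proof -
  have [measurable]: "flat m \<in> borel_measurable borel"
    by (intro borel_measurable_continuous_onI continuous_at_imp_continuous_on ballI DERIV_isCont[OF DERIV_flat])
  show ?thesis unfolding bump_def[abs_def] by measurable
qed

lemma bump_support: "e > 0 \<Longrightarrow> cmod z > cmod x + e \<Longrightarrow> bump x e m z = 0"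
proof (subst bump_eq_0_iff)
  assume "e > 0" "cmod z > cmod x + e"
  then show "e \<le> dist z x" using norm_triangle_ineq2[of z x] by (simp add: dist_norm)
qed

lemma integrable_bump_mult:
  assumes "e > 0" "g \<in> borel_measurable borel" "\<And>z. cmod (g z) \<le> K"
  shows "integrable lborel (\<lambda>z. g z * bump x e 0 z)"
proof (rule integrable_bounded_compact_support[where K = K and R = "cmod x + e"])
  show "(\<lambda>z. g z * bump x e 0 z) \<in> borel_measurable borel" using assms(2) by measurable
  fix z
  have "cmod (g z) * cmod (bump x e 0 z) \<le> K * 1"
    using assms(3)[of z] by (intro mult_mono bump_le_1) (auto intro: order_trans[OF norm_ge_zero])
  then show "cmod (g z * bump x e 0 z) \<le> K" by (simp add: norm_mult)
qed (use assms in \<open>auto simp: bump_support\<close>)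

lemma integrable_norm_bump: "e > 0 \<Longrightarrow> integrable lborel (\<lambda>z. cmod (bump x e 0 z))"
  using integrable_bump_mult[of e "\<lambda>z. 1" 1 x] by simp

lemma integral_norm_bump:
  assumes "e > 0"
  shows "(LINT z|lborel. cmod (bump x e 0 z)) = mollifier_mass e"
proof -
  have "(LINT z|lborel. bump 0 e 0 (- x + z)) = (LINT z|lborel. bump 0 e 0 z)"
    by (rule integral_translate_complex) measurable
  then have "(LINT z|lborel. bump x e 0 z) = (LINT z|lborel. bump 0 e 0 z)"
    by (simp add: bump_translate[of x])
  then have "(LINT z|lborel. of_real (cmod (bump x e 0 z)) :: complex) = (LINT z|lborel. of_real (cmod (bump 0 e 0 z)))"
    by (simp flip: bump_nonneg)
  then show ?thesis by (simp add: mollifier_mass_def)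
qed

lemma integral_bump:
  assumes "e > 0"
  shows "(LINT z|lborel. bump x e 0 z) = of_real (mollifier_mass e)"
  using integral_norm_bump[OF assms, of x] integral_complex_of_real[of lborel "\<lambda>z. cmod (bump x e 0 z)"]
  by (simp flip: bump_nonneg)

lemma mollifier_mass_pos:
  assumes "e > 0"
  shows "mollifier_mass e > 0"
proof -
  have "mollifier_mass e \<noteq> 0"
  proof
    assume "mollifier_mass e = 0"
    then have "AE z in lborel. cmod (bump 0 e 0 z) = 0"
      unfolding mollifier_mass_def
      by (subst (asm) integral_nonneg_eq_0_iff_AE) (auto simp: integrable_norm_bump[OF assms])
    then have "AE z in lborel. z \<notin> ball (0::complex) e"
      by eventually_elim (use assms in \<open>auto simp: bump_eq_0_iff dist_commute\<close>)
    then have "emeasure lborel (ball (0::complex) e) = 0" by (simp add: AE_iff_null null_sets_def ball_def)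
    then show False using assms by (simp add: emeasure_ball unit_ball_vol_2)
  qed
  moreover have "mollifier_mass e \<ge> 0" unfolding mollifier_mass_def by (rule integral_nonneg_AE) auto
  ultimately show ?thesis by simp
qed

lemma mollify_measurable [measurable]:
  assumes [measurable]: "g \<in> borel_measurable borel"
  shows "mollify e g \<in> borel_measurable borel"
proof -
  have "(\<lambda>x. LINT z|lborel. g z * bump 0 e 0 (z - x)) \<in> borel_measurable borel"
    by (rule lborel.borel_measurable_lebesgue_integral) measurable
  moreover have "mollify e g x = (LINT z|lborel. g z * bump 0 e 0 (z - x)) / of_real (mollifier_mass e)" for x
    by (simp only: mollify_def bump_translate[of x])
  then have "mollify e g = (\<lambda>x. (LINT z|lborel. g z * bump 0 e 0 (z - x)) / of_real (mollifier_mass e))" by blast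
  ultimately show ?thesis by simp
qed

text \<open>Split \<open>g = c + (g - c)\<close> with \<open>c\<close> continuous and \<open>g - c\<close> small in \<open>L1\<close>. Mollifying does not
  increase the \<open>L1\<close> norm of \<open>g - c\<close>, and moves \<open>c\<close> by a uniformly small amount.\<close>

lemma mollify_close_in_L1:
  assumes [measurable]: "g \<in> borel_measurable borel" and K: "\<And>z. cmod (g z) \<le> K"
    and supp: "\<And>z. cmod z > 1 \<Longrightarrow> g z = 0" and "\<eta> > 0"
  shows "\<exists>e0>0. \<forall>e. 0 < e \<and> e < e0 \<longrightarrow>
    (\<integral>\<^sup>+x. ennreal (cmod (mollify e g x - g x)) \<partial>lborel) < ennreal \<eta>"
proof -
  obtain c where c: "continuous_on UNIV c" "\<And>z. cmod z \<ge> 3 \<Longrightarrow> c z = 0"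
    "(\<integral>\<^sup>+z. ennreal (cmod (g z - c z)) \<partial>lborel) < ennreal (\<eta> / 4)"
    using L1_approximation_by_continuous[OF assms(1) K supp, of "\<eta> / 4"] \<open>\<eta> > 0\<close> by auto
  have [measurable]: "c \<in> borel_measurable borel" using c(1) by (rule borel_measurable_continuous_onI)
  define V where "V = measure lborel (cball (0::complex) 4)"
  have V: "emeasure lborel (cball (0::complex) 4) = ennreal V"
    unfolding V_def using emeasure_lborel_cball_finite[of "0::complex" 4]
    by (intro emeasure_eq_ennreal_measure) auto
  have V0: "V \<ge> 0" by (simp add: V_def)
  define \<delta>' where "\<delta>' = \<eta> / (4 * (V + 1))"
  have \<delta>': "\<delta>' > 0" using \<open>\<eta> > 0\<close> V0 by (simp add: \<delta>'_def)
  have "uniformly_continuous_on (cball 0 5) c"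
    by (rule compact_uniformly_continuous) (auto intro: continuous_on_subset[OF c(1)])
  then obtain d where d: "d > 0" "\<And>z w. cmod z \<le> 5 \<Longrightarrow> cmod w \<le> 5 \<Longrightarrow> dist z w < d \<Longrightarrow> dist (c z) (c w) < \<delta>'"
    unfolding uniformly_continuous_on_def using \<delta>' by (metis mem_cball_0)
  have compact: "compact (c ` cball 0 3)"
    by (intro compact_continuous_image continuous_on_subset[OF c(1)]) auto
  from compact_imp_bounded[OF this] obtain Kc0 where "\<forall>z\<in>cball 0 3. cmod (c z) \<le> Kc0"
    by (auto simp: bounded_iff)
  then have Kc0: "\<And>z. cmod z \<le> 3 \<Longrightarrow> cmod (c z) \<le> Kc0" by simp
  define Kc where "Kc = max Kc0 0"
  have Kc: "cmod (c z) \<le> Kc" for z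
    using Kc0[of z] c(2)[of z] by (cases "cmod z \<le> 3") (auto simp: Kc_def intro: max.coboundedI1)
  have *: "(\<integral>\<^sup>+x. ennreal (cmod (mollify e g x - g x)) \<partial>lborel) < ennreal \<eta>" if e: "0 < e" "e < min d 1" for e
  proof -
    define k where "k = mollifier_mass e"
    have k: "k > 0" using mollifier_mass_pos[OF e(1)] by (simp add: k_def)
    define b where "b z = cmod (bump 0 e 0 z)" for z
    have [measurable]: "b \<in> borel_measurable borel" unfolding b_def[abs_def] by measurable
    have bx: "cmod (bump x e 0 z) = b (z - x)" for x z by (simp add: b_def bump_translate[of x])
    have bsym: "b (z - x) = b (x - z)" for x z
      by (simp add: b_def bump_def norm_divide norm_minus_commute)
    have bint: "(\<integral>\<^sup>+x. ennreal (b (z - x)) \<partial>lborel) = ennreal k" for z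
    proof -
      have "b (z - x) = cmod (bump z e 0 x)" for x
        using bx[of z x] bsym[of z x] by (simp only:)
      then have "(\<integral>\<^sup>+x. ennreal (b (z - x)) \<partial>lborel) = (\<integral>\<^sup>+x. ennreal (cmod (bump z e 0 x)) \<partial>lborel)"
        by (simp only:)
      also have "\<dots> = ennreal (LINT x|lborel. cmod (bump z e 0 x))"
        by (rule nn_integral_eq_integral[OF integrable_norm_bump[OF e(1)]]) auto
      finally show ?thesis by (simp add: integral_norm_bump[OF e(1)] k_def)
    qed
    define C where "C x = (\<integral>\<^sup>+z. ennreal (cmod (g z - c z)) * ennreal (b (z - x)) \<partial>lborel)" for x
    have pw: "ennreal (cmod (mollify e g x - g x)) \<le>
       ennreal (1 / k) * C x + ennreal \<delta>' * indicator (cball 0 4) x + ennreal (cmod (g x - c x))" for x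
    proof -
      have i1: "integrable lborel (\<lambda>z. g z * bump x e 0 z)" by (rule integrable_bump_mult[OF e(1) _ K]) measurable
      have i2: "integrable lborel (\<lambda>z. c z * bump x e 0 z)" by (rule integrable_bump_mult[OF e(1) _ Kc]) measurable
      have i3: "integrable lborel (\<lambda>z. c x * bump x e 0 z)" by (rule integrable_bump_mult[OF e(1) _ order_refl]) measurable
      have i12: "integrable lborel (\<lambda>z. (g z - c z) * bump x e 0 z)"
        using Bochner_Integration.integrable_diff[OF i1 i2] by (simp add: algebra_simps)
      have i23: "integrable lborel (\<lambda>z. (c z - c x) * bump x e 0 z)"
        using Bochner_Integration.integrable_diff[OF i2 i3] by (simp add: algebra_simps)
      have I3: "(LINT z|lborel. c x * bump x e 0 z) = c x * of_real k"
        by (simp add: integral_bump[OF e(1)] k_def)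
      have "(LINT z|lborel. g z * bump x e 0 z) = (LINT z|lborel. (g z - c z) * bump x e 0 z) +
          (LINT z|lborel. (c z - c x) * bump x e 0 z) + c x * of_real k"
      proof -
        have "(LINT z|lborel. g z * bump x e 0 z) =
          (LINT z|lborel. ((g z - c z) * bump x e 0 z + (c z - c x) * bump x e 0 z) + c x * bump x e 0 z)"
          by (simp add: algebra_simps)
        also have "\<dots> = (LINT z|lborel. (g z - c z) * bump x e 0 z + (c z - c x) * bump x e 0 z) + (LINT z|lborel. c x * bump x e 0 z)"
          by (rule Bochner_Integration.integral_add[OF Bochner_Integration.integrable_add[OF i12 i23] i3])
        also have "(LINT z|lborel. (g z - c z) * bump x e 0 z + (c z - c x) * bump x e 0 z) =
          (LINT z|lborel. (g z - c z) * bump x e 0 z) + (LINT z|lborel. (c z - c x) * bump x e 0 z)"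
          by (rule Bochner_Integration.integral_add[OF i12 i23])
        finally show ?thesis unfolding I3 .
      qed
      then have eq: "mollify e g x - g x = (LINT z|lborel. (g z - c z) * bump x e 0 z) / of_real k +
          (LINT z|lborel. (c z - c x) * bump x e 0 z) / of_real k + (c x - g x)"
        using k by (simp add: mollify_def k_def[symmetric] add_divide_distrib)
      have e1: "ennreal (cmod ((LINT z|lborel. (g z - c z) * bump x e 0 z) / of_real k)) \<le> ennreal (1 / k) * C x"
      proof -
        have "ennreal (cmod (LINT z|lborel. (g z - c z) * bump x e 0 z)) \<le>
          (\<integral>\<^sup>+z. ennreal (cmod ((g z - c z) * bump x e 0 z)) \<partial>lborel)"
          by (rule integral_norm_bound_ennreal[OF i12])
        also have "\<dots> = C x" unfolding C_def norm_mult bx by (simp add: ennreal_mult b_def)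
        finally have "ennreal (1 / k) * ennreal (cmod (LINT z|lborel. (g z - c z) * bump x e 0 z)) \<le> ennreal (1 / k) * C x"
          by (rule mult_left_mono) simp
        then show ?thesis using k by (simp add: norm_divide ennreal_mult[symmetric] field_simps)
      qed
      have e2: "cmod ((LINT z|lborel. (c z - c x) * bump x e 0 z) / of_real k) \<le> \<delta>' * indicator (cball 0 4) x"
      proof -
        have b1: "cmod ((c z - c x) * bump x e 0 z) \<le> (\<delta>' * indicator (cball 0 4) x) * cmod (bump x e 0 z)" for z
        proof (cases "dist z x < e")
          case False
          then show ?thesis using bump_eq_0_iff[OF e(1), of x 0 z] by simp
        next
          case True
          have zx: "cmod z \<le> cmod x + e" "cmod x \<le> cmod z + e"
            using True norm_triangle_ineq2[of z x] norm_triangle_ineq2[of x z] by (auto simp: dist_norm norm_minus_commute)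
          have "cmod (c z - c x) \<le> \<delta>' * indicator (cball 0 4) x"
          proof (cases "cmod x \<le> 4")
            case True2: True
            then have "dist (c z) (c x) < \<delta>'" using zx e True by (intro d) auto
            then show ?thesis using True2 by (simp add: dist_norm)
          next
            case False
            then show ?thesis using zx e by (simp add: c(2))
          qed
          then show ?thesis unfolding norm_mult by (rule mult_right_mono) simp
        qed
        have "cmod (LINT z|lborel. (c z - c x) * bump x e 0 z) \<le> (LINT z|lborel. (\<delta>' * indicator (cball 0 4) x) * cmod (bump x e 0 z))"
          by (rule Bochner_Integration.integral_norm_bound_integral[OF i23])
            (use integrable_norm_bump[OF e(1)] b1 in auto)
        also have "\<dots> = (\<delta>' * indicator (cball 0 4) x) * k" by (simp add: integral_norm_bump[OF e(1)] k_def)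
        finally show ?thesis using k by (simp add: norm_divide pos_divide_le_eq)
      qed
      have "ennreal (cmod (mollify e g x - g x)) \<le>
         ennreal (cmod ((LINT z|lborel. (g z - c z) * bump x e 0 z) / of_real k) +
          cmod ((LINT z|lborel. (c z - c x) * bump x e 0 z) / of_real k) + cmod (c x - g x))"
        unfolding eq by (intro ennreal_leI norm_triangle_le add_mono norm_triangle_ineq order_refl)
      also have "\<dots> = ennreal (cmod ((LINT z|lborel. (g z - c z) * bump x e 0 z) / of_real k)) +
          ennreal (cmod ((LINT z|lborel. (c z - c x) * bump x e 0 z) / of_real k)) + ennreal (cmod (c x - g x))"
        by (simp add: ennreal_plus)
      also have "\<dots> \<le> ennreal (1 / k) * C x + ennreal (\<delta>' * indicator (cball 0 4) x) + ennreal (cmod (g x - c x))"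
        by (intro add_mono e1 ennreal_leI e2) (simp add: norm_minus_commute)
      also have "ennreal (\<delta>' * indicator (cball 0 4) x) = ennreal \<delta>' * indicator (cball 0 4) x"
        by (auto simp: indicator_def)
      finally show ?thesis .
    qed
    have Cm: "C \<in> borel_measurable borel"
      unfolding C_def[abs_def] by (rule lborel.borel_measurable_nn_integral) measurable
    have Ci: "(\<integral>\<^sup>+x. C x \<partial>lborel) = (\<integral>\<^sup>+z. ennreal (cmod (g z - c z)) \<partial>lborel) * ennreal k"
    proof -
      have "(\<integral>\<^sup>+x. C x \<partial>lborel) = (\<integral>\<^sup>+z. (\<integral>\<^sup>+x. ennreal (cmod (g z - c z)) * ennreal (b (z - x)) \<partial>lborel) \<partial>lborel)"
        unfolding C_def by (rule lborel_pair.Fubini') measurable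
      also have "\<dots> = (\<integral>\<^sup>+z. ennreal (cmod (g z - c z)) * ennreal k \<partial>lborel)"
        by (simp add: nn_integral_cmult bint)
      also have "\<dots> = (\<integral>\<^sup>+z. ennreal (cmod (g z - c z)) \<partial>lborel) * ennreal k"
        by (rule nn_integral_multc) measurable
      finally show ?thesis .
    qed
    have "(\<integral>\<^sup>+x. ennreal (cmod (mollify e g x - g x)) \<partial>lborel) \<le>
      (\<integral>\<^sup>+x. ennreal (1 / k) * C x + ennreal \<delta>' * indicator (cball 0 4) x + ennreal (cmod (g x - c x)) \<partial>lborel)"
      by (rule nn_integral_mono) (rule pw)
    also have "\<dots> = ennreal (1 / k) * (\<integral>\<^sup>+x. C x \<partial>lborel) + ennreal \<delta>' * ennreal V + (\<integral>\<^sup>+x. ennreal (cmod (g x - c x)) \<partial>lborel)"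
      using Cm by (simp add: nn_integral_add nn_integral_cmult V)
    also have "ennreal (1 / k) * (\<integral>\<^sup>+x. C x \<partial>lborel) = (\<integral>\<^sup>+z. ennreal (cmod (g z - c z)) \<partial>lborel)"
    proof -
      have "ennreal (1 / k) * ennreal k = 1" using k by (simp flip: ennreal_mult)
      then show ?thesis unfolding Ci by (subst mult.left_commute) simp
    qed
    also have "(\<integral>\<^sup>+z. ennreal (cmod (g z - c z)) \<partial>lborel) + ennreal \<delta>' * ennreal V + (\<integral>\<^sup>+x. ennreal (cmod (g x - c x)) \<partial>lborel) \<le>
       ennreal (\<eta> / 4) + ennreal (\<eta> / 4) + ennreal (\<eta> / 4)"
    proof (intro add_mono less_imp_le[OF c(3)])
      have "\<delta>' * V \<le> \<eta> / 4"
        using \<open>\<eta> > 0\<close> V0 by (simp add: \<delta>'_def field_simps)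
      then show "ennreal \<delta>' * ennreal V \<le> ennreal (\<eta> / 4)"
        using \<delta>' V0 by (simp flip: ennreal_mult add: ennreal_leI)
    qed
    also have "\<dots> < ennreal \<eta>" using \<open>\<eta> > 0\<close> by (simp flip: ennreal_plus add: ennreal_less_iff)
    finally show ?thesis .
  qed
  show ?thesis by (rule exI[of _ "min d 1"]) (use * d in auto)
qed

text \<open>The derivative of a mollification falls on the bump function, and in the sense of
  distributions it can be moved to \<open>g\<close>. Hence the bounds of the weak derivatives give a gradient
  bound that does not depend on the scale \<open>e\<close>.\<close>

lemma mollify_lipschitz:
  assumes [measurable]: "g \<in> borel_measurable borel" "h1 \<in> borel_measurable borel" "h2 \<in> borel_measurable borel"
    and K: "\<And>z. cmod (g z) \<le> K" and M: "\<And>z. cmod (h1 z) \<le> M" "\<And>z. cmod (h2 z) \<le> M"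
    and weak: "\<And>\<psi>. \<psi> \<in> test_functions r0 \<Longrightarrow> (LINT z|lborel. g z * d_z \<psi> z) = - (LINT z|lborel. h1 z * \<psi> z)"
      "\<And>\<psi>. \<psi> \<in> test_functions r0 \<Longrightarrow> (LINT z|lborel. g z * d_zbar \<psi> z) = - (LINT z|lborel. h2 z * \<psi> z)"
    and e: "e > 0" and tube: "\<And>w. w \<in> closed_segment x y \<Longrightarrow> cball w e \<subseteq> annulus r0"
  shows "cmod (mollify e g y - mollify e g x) \<le> 2 * M * cmod (y - x)"
proof -
  define k where "k = mollifier_mass e"
  have k: "k > 0" using mollifier_mass_pos[OF e] by (simp add: k_def)
  define p where "p t = x + t *\<^sub>R (y - x)" for t
  define U where "U t = (LINT z|lborel. g z * bump (p t) e 0 z)" for t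
  have M0: "M \<ge> 0" using M(1)[of 0] norm_ge_zero order_trans by blast
  have pt: "bump (p t) e 0 \<in> test_functions r0" if "t \<in> {0..1}" for t
  proof (rule bump_test_function[OF e tube])
    have "p t = (1 - t) *\<^sub>R x + t *\<^sub>R y" by (simp add: p_def algebra_simps)
    then show "p t \<in> closed_segment x y" using that unfolding closed_segment_def by auto
  qed
  have deriv: "\<exists>D. (U has_vector_derivative D) (at t) \<and> cmod D \<le> 2 * M * cmod (y - x) * k"
    if t: "t \<in> {0..1}" for t
  proof -
    define F where "F = bump (p t) e 0"
    note C1 = test_function_C1_compact[OF pt[OF t], folded F_def]
    have Fd: "F differentiable at z" for z using C1 by (simp add: C1_compact_def)
    have [measurable]: "F \<in> borel_measurable borel" unfolding F_def by measurable
    note [measurable] = d_z_measurable[OF C1] d_zbar_measurable[OF C1]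
    define v where "v = - (y - x)"
    define D where "D = (LINT z|lborel. g z * frechet_derivative F (at z) v)"
    have shift: "bump (p (t + h)) e 0 z = F (z + h *\<^sub>R v)" for h z
      by (simp add: F_def bump_def p_def v_def algebra_simps)
    have intF: "integrable lborel (\<lambda>z. g z * bump (p s) e 0 z)" for s
      by (rule integrable_bump_mult[OF e _ K]) measurable
    have vd: "(U has_vector_derivative D) (at t)"
    proof -
      have "((\<lambda>h. (U (t + h) - U t) /\<^sub>R h) \<longlongrightarrow> D) (at 0)"
        unfolding tendsto_at_iff_sequentially comp_def
      proof (intro allI impI)
        fix X :: "nat \<Rightarrow> real" assume X: "\<forall>i. X i \<in> UNIV - {0}" "X \<longlonglongrightarrow> 0"
        have "(U (t + X n) - U t) /\<^sub>R X n = (LINT z|lborel. g z * ((F (z + X n *\<^sub>R v) - F z) /\<^sub>R X n))" for n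
        proof -
          have "U (t + X n) - U t = (LINT z|lborel. g z * bump (p (t + X n)) e 0 z - g z * bump (p t) e 0 z)"
            unfolding U_def by (rule Bochner_Integration.integral_diff[symmetric]) (rule intF)+
          also have "\<dots> = (LINT z|lborel. g z * (F (z + X n *\<^sub>R v) - F z))"
            unfolding shift F_def[symmetric] by (simp add: algebra_simps)
          finally show ?thesis
            by (simp only: integral_scaleR_right[symmetric] mult_scaleR_right)
        qed
        moreover have "(\<lambda>n. LINT z|lborel. g z * ((F (z + X n *\<^sub>R v) - F z) /\<^sub>R X n)) \<longlonglongrightarrow> D"
          unfolding D_def by (rule integral_difference_quotient[OF C1 _ K]) (use X in auto)
        ultimately show "(\<lambda>n. (U (t + X n) - U t) /\<^sub>R X n) \<longlonglongrightarrow> D" by (simp only:)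
      qed
      then have lim: "((\<lambda>h. (U (t + h) - U t) /\<^sub>R h - D) \<longlongrightarrow> 0) (at 0)" by (rule LIM_zero)
      have "((\<lambda>h. norm (U (t + h) - U t - h *\<^sub>R D) / norm h) \<longlongrightarrow> 0) (at 0)"
      proof (rule Lim_transform_eventually[OF tendsto_norm_zero[OF lim]])
        have "norm ((U (t + h) - U t) /\<^sub>R h - D) = norm (U (t + h) - U t - h *\<^sub>R D) / norm h" if "h \<noteq> 0" for h
        proof -
          have "(U (t + h) - U t) /\<^sub>R h - D = (U (t + h) - U t - h *\<^sub>R D) /\<^sub>R h"
            using that by (simp add: scaleR_diff_right)
          then show ?thesis by (simp add: divide_inverse mult.commute)
        qed
        then show "\<forall>\<^sub>F h in at 0. norm ((U (t + h) - U t) /\<^sub>R h - D) = norm (U (t + h) - U t - h *\<^sub>R D) / norm h"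
          by (auto simp: eventually_at_filter)
      qed
      then show ?thesis
        unfolding has_vector_derivative_def has_derivative_at
        by (auto intro!: bounded_linear_intros)
    qed
    have test: "F \<in> test_functions r0" using pt[OF t] by (simp add: F_def)
    obtain R L where RL: "R > 0" "L \<ge> 0" "\<And>z. cmod z \<ge> R \<Longrightarrow> F z = 0"
      "\<And>z v. cmod z > R \<Longrightarrow> frechet_derivative F (at z) v = 0"
      "\<And>z v. cmod (frechet_derivative F (at z) v) \<le> L * cmod v" "\<And>z w. cmod (F z - F w) \<le> L * cmod (z - w)"
      using C1_compactE[OF C1] by metis
    have dL: "cmod (d_z F z) \<le> L" "cmod (d_zbar F z) \<le> L" for z
    proof -
      have L1: "cmod (frechet_derivative F (at z) 1) \<le> L" "cmod (frechet_derivative F (at z) \<i>) \<le> L"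
        using RL(5)[of z 1] RL(5)[of z \<i>] by auto
      show "cmod (d_z F z) \<le> L"
        using L1 norm_triangle_ineq4[of "frechet_derivative F (at z) 1" "\<i> * frechet_derivative F (at z) \<i>"]
        by (simp add: d_z_def norm_divide norm_mult)
      show "cmod (d_zbar F z) \<le> L"
        using L1 norm_triangle_ineq[of "frechet_derivative F (at z) 1" "\<i> * frechet_derivative F (at z) \<i>"]
        by (simp add: d_zbar_def norm_divide norm_mult)
    qed
    have K0: "K \<ge> 0" using K[of 0] norm_ge_zero order_trans by blast
    have int1: "integrable lborel (\<lambda>z. g z * d_z F z)"
      by (rule integrable_bounded_compact_support[where K = "K * L" and R = R])
        (auto simp: norm_mult intro!: mult_mono K dL K0, auto simp: d_z_def RL(4))
    have int2: "integrable lborel (\<lambda>z. g z * d_zbar F z)"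
      by (rule integrable_bounded_compact_support[where K = "K * L" and R = R])
        (auto simp: norm_mult intro!: mult_mono K dL K0, auto simp: d_zbar_def RL(4))
    have "D = (LINT z|lborel. v * (g z * d_z F z) + cnj v * (g z * d_zbar F z))"
      unfolding D_def by (simp add: frechet_derivative_wirtinger[OF Fd] algebra_simps)
    also have "\<dots> = v * (LINT z|lborel. g z * d_z F z) + cnj v * (LINT z|lborel. g z * d_zbar F z)"
      using int1 int2 by (subst Bochner_Integration.integral_add) auto
    also have "\<dots> = - (v * (LINT z|lborel. h1 z * F z) + cnj v * (LINT z|lborel. h2 z * F z))"
      using weak(1)[OF test] weak(2)[OF test] by simp
    finally have Deq: "D = - (v * (LINT z|lborel. h1 z * F z) + cnj v * (LINT z|lborel. h2 z * F z))" .
    have "cmod D \<le> cmod v * cmod (LINT z|lborel. h1 z * F z) + cmod v * cmod (LINT z|lborel. h2 z * F z)"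
      unfolding Deq norm_minus_cancel by (rule norm_triangle_le) (simp add: norm_mult)
    moreover have hb: "cmod (LINT z|lborel. h z * F z) \<le> M * k"
      if [measurable]: "h \<in> borel_measurable borel" and hM: "\<And>z. cmod (h z) \<le> M" for h
    proof -
      have "cmod (LINT z|lborel. h z * F z) \<le> (LINT z|lborel. M * cmod (F z))"
      proof (rule Bochner_Integration.integral_norm_bound_integral)
        show "integrable lborel (\<lambda>z. h z * F z)" unfolding F_def by (rule integrable_bump_mult[OF e _ hM]) measurable
        show "integrable lborel (\<lambda>z. M * cmod (F z))" unfolding F_def using integrable_norm_bump[OF e] by simp
      qed (auto simp: norm_mult intro!: mult_right_mono hM)
      also have "\<dots> = M * k" by (simp add: F_def integral_norm_bump[OF e] k_def)
      finally show ?thesis .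
    qed
    then have "cmod v * cmod (LINT z|lborel. h1 z * F z) \<le> cmod v * (M * k)"
      "cmod v * cmod (LINT z|lborel. h2 z * F z) \<le> cmod v * (M * k)"
      using M by (intro mult_left_mono; simp)+
    ultimately have "cmod D \<le> cmod v * (M * k) + cmod v * (M * k)" by linarith
    then have "cmod D \<le> 2 * M * cmod (y - x) * k"
      by (simp add: v_def norm_minus_commute algebra_simps)
    with vd show ?thesis by blast
  qed
  then obtain D where D: "\<And>t. t \<in> {0..1} \<Longrightarrow> (U has_vector_derivative D t) (at t)"
    "\<And>t. t \<in> {0..1} \<Longrightarrow> cmod (D t) \<le> 2 * M * cmod (y - x) * k" by metis
  have "cmod (U 1 - U 0) \<le> (2 * M * cmod (y - x) * k) * norm (1 - 0 :: real)"
  proof (rule differentiable_bound[where f' = "\<lambda>t h. h *\<^sub>R D t"])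
    show "(U has_derivative (\<lambda>h. h *\<^sub>R D t)) (at t within {0..1})" if "t \<in> {0..1}" for t
      using D(1)[OF that] unfolding has_vector_derivative_def by (rule has_derivative_at_withinI)
    show "onorm (\<lambda>h. h *\<^sub>R D t) \<le> 2 * M * cmod (y - x) * k" if "t \<in> {0..1}" for t
      by (rule onorm_bound) (use D(2)[OF that] M0 k in \<open>auto simp: mult.commute intro: mult_left_mono\<close>)
  qed auto
  moreover have "mollify e g y - mollify e g x = (U 1 - U 0) / of_real k"
    by (simp add: mollify_def U_def p_def k_def diff_divide_distrib)
  ultimately show ?thesis using k by (simp add: norm_divide pos_divide_le_eq)
qed

text \<open>Nearby points of the annulus are joined by three segments inside it: a chord may cut the hole,
  but not after both ends have been pushed radially outwards.\<close>

lemma annulus_short_path: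
  assumes r0: "0 < r0" "r0 < 1" and x: "x \<in> annulus r0" and y: "y \<in> annulus r0"
    and d: "dist x y < d" "d \<le> (1 - r0) / 5" "d \<le> r0 / 6"
  obtains x' y' where "closed_segment x x' \<subseteq> annulus r0" "closed_segment x' y' \<subseteq> annulus r0"
    "closed_segment y' y \<subseteq> annulus r0" "dist x x' + dist x' y' + dist y' y \<le> 8 * d"
proof -
  have cx: "r0 < cmod x" "cmod x < 1" "r0 < cmod y" "cmod y < 1" using x y by (auto simp: annulus_def)
  have d0: "d > 0" using d(1) by (meson le_less_trans zero_le_dist)
  have ball: "cmod w < 1" if "w \<in> closed_segment a b" "cmod a < 1" "cmod b < 1" for w a b :: complex
    using closed_segment_subset[of a "ball 0 1" b] that by auto
  have away: "cmod w > r0" if "w \<in> closed_segment a b" "cmod a \<ge> r0 + s" "cmod (a - b) < s" for w a b :: complex and s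
  proof -
    have "dist a w \<le> dist a b" using that(1) by (auto simp: dist_commute dest: dist_in_closed_segment)
    then show ?thesis using that norm_triangle_ineq2[of a "a - w"] by (simp add: dist_norm)
  qed
  show thesis
  proof (cases "cmod x \<ge> r0 + d")
    case True
    have "closed_segment x y \<subseteq> annulus r0"
      using ball[of _ x y] away[of _ x y d] cx True d(1) by (auto simp: annulus_def dist_norm)
    then show thesis using that[of x y] x y d(1) d0 by auto
  next
    case False
    \<comment> \<open>The pushed points have modulus at least \<open>r0 + 3 d\<close> and distance at most \<open>2 d\<close>, so their
      chord avoids the hole; they stay in the unit disc because \<open>r0 + 5 d \<le> 1\<close>.\<close>
    define P where "P w = w + of_real (3 * d / cmod w) * w" for w :: complex
    have dxy: "\<bar>cmod x - cmod y\<bar> < d" using d(1) norm_triangle_ineq3[of x y] by (simp add: dist_norm)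
    have Pn: "cmod (P w) = cmod w + 3 * d" if "w \<noteq> 0" for w
    proof -
      have "P w = of_real (1 + 3 * d / cmod w) * w" by (simp add: P_def algebra_simps)
      then have "cmod (P w) = \<bar>1 + 3 * d / cmod w\<bar> * cmod w" by (simp only: norm_mult norm_of_real)
      also have "\<bar>1 + 3 * d / cmod w\<bar> = 1 + 3 * d / cmod w" using d0 by (intro abs_of_nonneg add_nonneg_nonneg) auto
      finally show ?thesis using that by (simp add: distrib_right)
    qed
    have Pd: "dist w (P w) = 3 * d" if "w \<noteq> 0" for w
      using that d0 by (simp add: P_def dist_norm norm_mult norm_divide)
    have nz: "x \<noteq> 0" "y \<noteq> 0" using cx r0 by auto
    have seg: "closed_segment w (P w) \<subseteq> annulus r0" if w: "r0 < cmod w" "cmod w < r0 + 2 * d" for w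
    proof
      fix v assume "v \<in> closed_segment w (P w)"
      then obtain t where t: "0 \<le> t" "t \<le> 1" "v = (1 - t) *\<^sub>R w + t *\<^sub>R P w" unfolding closed_segment_def by auto
      have w0: "cmod w > 0" using w r0 by linarith
      have "v = of_real (1 + t * (3 * d / cmod w)) * w"
        by (simp add: t(3) P_def scaleR_conv_of_real algebra_simps)
      then have "cmod v = \<bar>1 + t * (3 * d / cmod w)\<bar> * cmod w" by (simp only: norm_mult norm_of_real)
      also have "\<bar>1 + t * (3 * d / cmod w)\<bar> = 1 + t * (3 * d / cmod w)"
        using t d0 w0 by (intro abs_of_nonneg add_nonneg_nonneg mult_nonneg_nonneg divide_nonneg_nonneg) auto
      finally have "cmod v = cmod w + t * (3 * d)" using w0 by (simp add: field_simps)
      moreover have "t * (3 * d) \<le> 3 * d" "t * (3 * d) \<ge> 0" using t d0 by (auto intro: mult_left_le_one_le)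
      moreover have "r0 + 5 * d \<le> 1" using d(2) by simp
      ultimately have "r0 < cmod v" "cmod v < 1" using w by linarith+
      then show "v \<in> annulus r0" by (simp add: annulus_def)
    qed
    have yb: "cmod y < r0 + 2 * d" using dxy False by linarith
    have diff: "dist (P x) (P y) \<le> 2 * d"
    proof -
      have "(x + a * x) - (y + b * y) = (x - y) + a * (x - y) + (a - b) * y" for a b :: complex
        by (simp add: algebra_simps)
      then have "P x - P y = (x - y) + of_real (3 * d / cmod x) * (x - y) + of_real (3 * d / cmod x - 3 * d / cmod y) * y"
        unfolding P_def of_real_diff .
      then have "cmod (P x - P y) \<le> cmod (x - y) + cmod (of_real (3 * d / cmod x) * (x - y)) +
          cmod (of_real (3 * d / cmod x - 3 * d / cmod y) * y)"
        by (simp only:) (intro norm_triangle_le add_right_mono norm_triangle_ineq)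
      moreover have "cmod (of_real (3 * d / cmod x) * (x - y)) \<le> (3 * d / r0) * d"
        unfolding norm_mult norm_of_real using cx d0 d(1) r0
        by (intro mult_mono) (auto simp: dist_norm intro!: divide_left_mono mult_pos_pos)
      moreover have "cmod (of_real (3 * d / cmod x - 3 * d / cmod y) * y) \<le> (3 * d / r0) * d"
      proof -
        have "(3 * d / cmod x - 3 * d / cmod y) = (3 * d / cmod x) * ((cmod y - cmod x) / cmod y)"
          using nz by (simp add: field_simps)
        then have "cmod (of_real (3 * d / cmod x - 3 * d / cmod y) * y) = (3 * d / cmod x) * \<bar>cmod y - cmod x\<bar>"
          using nz d0 by (simp only: norm_mult norm_of_real abs_mult abs_divide) simp
        also have "\<dots> \<le> (3 * d / r0) * d"
          using cx d0 r0 dxy by (intro mult_mono) (auto intro!: divide_left_mono mult_pos_pos)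
        finally show ?thesis .
      qed
      moreover have "(3 * d / r0) * d \<le> (1 / 2) * d"
        using d(3) r0 d0 by (intro mult_right_mono) (auto simp: field_simps)
      ultimately show ?thesis using d(1) by (simp add: dist_norm)
    qed
    have "closed_segment (P x) (P y) \<subseteq> annulus r0"
    proof
      fix w assume w: "w \<in> closed_segment (P x) (P y)"
      have "cmod (P x) < 1" "cmod (P y) < 1" using Pn nz False yb d(2) d0 r0 by auto
      moreover have "cmod (P x) \<ge> r0 + 3 * d" using Pn nz cx by auto
      moreover have "cmod (P x - P y) < 3 * d" using diff d0 by (simp add: dist_norm)
      ultimately show "w \<in> annulus r0" using ball[OF w] away[OF w, of "3 * d"] by (simp add: annulus_def)
    qed
    moreover have "closed_segment (P y) y \<subseteq> annulus r0" using seg[OF cx(3) yb] by (simp add: closed_segment_commute)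
    moreover have "closed_segment x (P x) \<subseteq> annulus r0" using seg[OF cx(1)] False d0 by auto
    moreover have "dist x (P x) + dist (P x) (P y) + dist (P y) y \<le> 8 * d"
      using Pd nz diff by (simp add: dist_commute)
    ultimately show thesis using that by blast
  qed
qed

text \<open>A sequence of mollifications converges to \<open>g\<close> almost everywhere. Their common gradient bound
  and the short paths make \<open>g\<close> uniformly continuous on the set \<open>E\<close> of convergence, which is dense,
  so that the restriction to \<open>E\<close> extends continuously to the closed annulus.\<close>

lemma W1inf_continuous_representative:
  assumes r0: "0 < r0" "r0 < 1" and g: "g \<in> W1inf r0"
  obtains b where "continuous_on (closed_annulus r0) b" "AE z in lebesgue_on (annulus r0). g z = b z"
proof -
  obtain h1 h2 where h: "h1 \<in> Linf r0" "h2 \<in> Linf r0" "weak_deriv r0 d_z g h1" "weak_deriv r0 d_zbar g h2"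
    and gL: "g \<in> Linf r0" using g by (auto simp: W1inf_def)
  obtain g' K where g': "g' \<in> borel_measurable borel" "K \<ge> 0" "\<And>z. cmod (g' z) \<le> K"
    "\<And>z. z \<notin> annulus r0 \<Longrightarrow> g' z = 0" "AE z in lebesgue_on (annulus r0). g z = g' z"
    using Linf_borel_representative[OF gL] by blast
  obtain h1' M1 where h1': "h1' \<in> borel_measurable borel" "M1 \<ge> 0" "\<And>z. cmod (h1' z) \<le> M1"
    "\<And>z. z \<notin> annulus r0 \<Longrightarrow> h1' z = 0" "AE z in lebesgue_on (annulus r0). h1 z = h1' z"
    using Linf_borel_representative[OF h(1)] by blast
  obtain h2' M2 where h2': "h2' \<in> borel_measurable borel" "M2 \<ge> 0" "\<And>z. cmod (h2' z) \<le> M2"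
    "\<And>z. z \<notin> annulus r0 \<Longrightarrow> h2' z = 0" "AE z in lebesgue_on (annulus r0). h2 z = h2' z"
    using Linf_borel_representative[OF h(2)] by blast
  define M where "M = max M1 M2"
  have M: "\<And>z. cmod (h1' z) \<le> M" "\<And>z. cmod (h2' z) \<le> M" "M \<ge> 0"
    using h1' h2' by (auto simp: M_def intro: max.coboundedI1 max.coboundedI2)
  have meas: "g \<in> borel_measurable (lebesgue_on (annulus r0))" "h1 \<in> borel_measurable (lebesgue_on (annulus r0))"
    "h2 \<in> borel_measurable (lebesgue_on (annulus r0))" using gL h by (auto simp: Linf_def)
  have weak: "(LINT z|lborel. g' z * d_z \<psi> z) = - (LINT z|lborel. h1' z * \<psi> z)"
    "(LINT z|lborel. g' z * d_zbar \<psi> z) = - (LINT z|lborel. h2' z * \<psi> z)" if t: "\<psi> \<in> test_functions r0" for \<psi>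
  proof -
    note C1 = test_function_C1_compact[OF t]
    have pm: "\<psi> \<in> borel_measurable borel" using C1_compact_continuous[OF C1] by (rule borel_measurable_continuous_onI)
    show "(LINT z|lborel. g' z * d_z \<psi> z) = - (LINT z|lborel. h1' z * \<psi> z)"
      using h(3) t annulus_integral_representative[OF meas(1) g'(1,4,5) d_z_measurable[OF C1]]
        annulus_integral_representative[OF meas(2) h1'(1,4,5) pm] by (simp add: weak_deriv_def)
    show "(LINT z|lborel. g' z * d_zbar \<psi> z) = - (LINT z|lborel. h2' z * \<psi> z)"
      using h(4) t annulus_integral_representative[OF meas(1) g'(1,4,5) d_zbar_measurable[OF C1]]
        annulus_integral_representative[OF meas(3) h2'(1,4,5) pm] by (simp add: weak_deriv_def)
  qed
  have lip: "cmod (mollify e g' y - mollify e g' x) \<le> 2 * M * cmod (y - x)"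
    if "e > 0" "\<And>w. w \<in> closed_segment x y \<Longrightarrow> cball w e \<subseteq> annulus r0" for e x y
    by (rule mollify_lipschitz[OF g'(1) h1'(1) h2'(1) g'(3) M(1) M(2), of r0]) (fact weak that)+
  have supp: "g' z = 0" if "cmod z > 1" for z using that by (intro g'(4)) (auto simp: annulus_def)
  define T where "T e = (\<integral>\<^sup>+x. ennreal (cmod (mollify e g' x - g' x)) \<partial>lborel)" for e
  have "\<exists>e>0. e < inverse (real (Suc n)) \<and> T e < ennreal (inverse (real (Suc n)))" for n
  proof -
    obtain e0 where e0: "e0 > 0" "\<And>e. 0 < e \<Longrightarrow> e < e0 \<Longrightarrow> T e < ennreal (inverse (real (Suc n)))"
      using mollify_close_in_L1[OF g'(1,3) supp, of "inverse (real (Suc n))"] unfolding T_def by auto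
    moreover have "\<exists>e>0. e < min e0 (inverse (real (Suc n)))" using e0(1) by (intro dense) simp
    ultimately show ?thesis by auto
  qed
  then obtain X where X: "\<And>n. X n > 0" "\<And>n. X n < inverse (real (Suc n))" "\<And>n. T (X n) < ennreal (inverse (real (Suc n)))"
    by metis
  have X0: "X \<longlonglongrightarrow> 0"
    by (rule tendsto_sandwich[OF _ _ tendsto_const LIMSEQ_inverse_real_of_nat])
      (use X in \<open>auto intro!: always_eventually less_imp_le simp del: of_nat_Suc\<close>)
  define w where "w n x = mollify (X n) g' x - g' x" for n x
  have wm: "w n \<in> borel_measurable borel" for n unfolding w_def[abs_def] using g'(1) by measurable
  have wi: "integrable lborel (w n)" for n
  proof (rule integrableI_bounded)
    show "(\<integral>\<^sup>+x. ennreal (norm (w n x)) \<partial>lborel) < \<infinity>"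
      using less_trans[OF X(3)[of n] ennreal_less_top] by (simp add: w_def T_def)
  qed (use wm in simp)
  have "(LINT x|lborel. norm (w n x)) \<le> inverse (real (Suc n))" for n
  proof -
    have "ennreal (LINT x|lborel. norm (w n x)) = (\<integral>\<^sup>+x. ennreal (norm (w n x)) \<partial>lborel)"
      by (rule nn_integral_eq_integral[symmetric]) (use wi in auto)
    also have "\<dots> \<le> ennreal (inverse (real (Suc n)))" using X(3)[of n] by (simp add: w_def T_def)
    finally show ?thesis by (subst (asm) ennreal_le_iff) auto
  qed
  then have "(\<lambda>n. LINT x|lborel. norm (w n x)) \<longlonglongrightarrow> 0"
    by (intro tendsto_sandwich[OF _ _ tendsto_const LIMSEQ_inverse_real_of_nat])
      (auto intro!: always_eventually integral_nonneg_AE simp del: of_nat_Suc)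
  with wi obtain r where r: "strict_mono r" "AE x in lborel. (\<lambda>n. w (r n) x) \<longlonglongrightarrow> 0"
    using tendsto_L1_AE_subseq by blast
  define E where "E = {x \<in> annulus r0. (\<lambda>n. w (r n) x) \<longlonglongrightarrow> 0}"
  have Elim: "(\<lambda>n. mollify (X (r n)) g' x) \<longlonglongrightarrow> g' x" if "x \<in> E" for x
    using that LIM_zero_cancel by (auto simp: E_def w_def intro: LIM_zero_cancel)
  have Xr: "(\<lambda>n. X (r n)) \<longlonglongrightarrow> 0" using LIMSEQ_subseq_LIMSEQ[OF X0 r(1)] by (simp add: comp_def)
  have evlip: "\<forall>\<^sub>F n in sequentially. cmod (mollify (X (r n)) g' y - mollify (X (r n)) g' x) \<le> 2 * M * dist x y"
    if seg: "closed_segment x y \<subseteq> annulus r0" for x y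
  proof -
    obtain d where "d > 0" "(\<Union>w\<in>closed_segment x y. ball w d) \<subseteq> annulus r0"
      by (rule compact_subset_open_imp_ball_epsilon_subset[OF _ open_annulus seg]) auto
    then have d: "d > 0" "\<And>w. w \<in> closed_segment x y \<Longrightarrow> ball w d \<subseteq> annulus r0" by auto
    have "\<forall>\<^sub>F n in sequentially. X (r n) < d" using order_tendstoD(2)[OF Xr d(1)] .
    then show ?thesis
    proof eventually_elim
      case (elim n)
      have "cball w (X (r n)) \<subseteq> annulus r0" if "w \<in> closed_segment x y" for w
      proof -
        have "cball w (X (r n)) \<subseteq> ball w d" using elim by auto
        then show ?thesis using d(2)[OF that] by (rule order_trans)
      qed
      from lip[OF X(1) this] show ?case by (simp add: dist_norm norm_minus_commute[of x y])
    qed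
  qed
  define d0 where "d0 = min ((1 - r0) / 5) (r0 / 6)"
  have d0: "d0 > 0" using r0 by (simp add: d0_def)
  have key: "dist (g' x) (g' y) \<le> 16 * M * d" if E: "x \<in> E" "y \<in> E" and d: "dist x y < d" "d \<le> d0" for x y d
  proof -
    obtain x' y' where p: "closed_segment x x' \<subseteq> annulus r0" "closed_segment x' y' \<subseteq> annulus r0"
      "closed_segment y' y \<subseteq> annulus r0" "dist x x' + dist x' y' + dist y' y \<le> 8 * d"
      using annulus_short_path[OF r0, of x y d] E d by (auto simp: E_def d0_def)
    have "\<forall>\<^sub>F n in sequentially. cmod (mollify (X (r n)) g' x - mollify (X (r n)) g' y) \<le> 16 * M * d"
      using evlip[OF p(1)] evlip[OF p(2)] evlip[OF p(3)]
    proof eventually_elim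
      case (elim n)
      let ?m = "mollify (X (r n)) g'"
      have "cmod (?m x - ?m y) \<le> cmod (?m x' - ?m x) + cmod (?m y' - ?m x') + cmod (?m y - ?m y')"
      proof -
        have "?m x - ?m y = - ((?m x' - ?m x) + (?m y' - ?m x') + (?m y - ?m y'))" by simp
        then show ?thesis by (simp only: norm_minus_cancel) (intro norm_triangle_le add_right_mono norm_triangle_ineq)
      qed
      also have "\<dots> \<le> 2 * M * dist x x' + 2 * M * dist x' y' + 2 * M * dist y' y" using elim by linarith
      also have "\<dots> = 2 * M * (dist x x' + dist x' y' + dist y' y)" by (simp add: algebra_simps)
      also have "\<dots> \<le> 2 * M * (8 * d)" using p(4) M(3) by (intro mult_left_mono) auto
      finally show ?case by simp
    qed
    moreover have "(\<lambda>n. cmod (mollify (X (r n)) g' x - mollify (X (r n)) g' y)) \<longlonglongrightarrow> cmod (g' x - g' y)"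
      by (intro tendsto_intros Elim E)
    ultimately show ?thesis unfolding dist_norm by (intro tendsto_upperbound) auto
  qed
  have "uniformly_continuous_on E g'"
    unfolding uniformly_continuous_on_def
  proof (intro allI impI)
    fix \<epsilon> :: real assume \<epsilon>: "\<epsilon> > 0"
    define d where "d = min d0 (\<epsilon> / (16 * M + 1) / 2)"
    have d: "d > 0" "d \<le> d0" using d0 \<epsilon> M(3) by (auto simp: d_def)
    have "16 * M * d \<le> (16 * M + 1) * (\<epsilon> / (16 * M + 1) / 2)" using d M(3) by (intro mult_mono) (auto simp: d_def)
    also have "\<dots> = \<epsilon> / 2"
    proof -
      have "a * (\<epsilon> / a / 2) = \<epsilon> / 2" if "a \<noteq> 0" for a using that by simp
      from this[of "16 * M + 1"] show ?thesis using M(3) by linarith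
    qed
    also have "\<dots> < \<epsilon>" using \<epsilon> by simp
    finally have "16 * M * d < \<epsilon>" .
    then show "\<exists>d>0. \<forall>x\<in>E. \<forall>x'\<in>E. dist x' x < d \<longrightarrow> dist (g' x') (g' x) < \<epsilon>"
      using key d by (intro exI[of _ d]) (auto intro: le_less_trans)
  qed
  then obtain b where b: "uniformly_continuous_on (closure E) b" "\<And>x. x \<in> E \<Longrightarrow> g' x = b x"
    by (rule uniformly_continuous_on_extension_on_closure) blast
  have "annulus r0 \<subseteq> closure E"
  proof
    fix z assume z: "z \<in> annulus r0"
    show "z \<in> closure E"
    proof (rule ccontr)
      assume "z \<notin> closure E"
      then have "z \<in> - closure E \<inter> annulus r0" "open (- closure E \<inter> annulus r0)"
        using z open_annulus by auto
      then obtain e where e: "e > 0" "ball z e \<subseteq> - closure E \<inter> annulus r0" using open_contains_ball by blast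
      have "AE x in lborel. x \<notin> ball z e"
        using r(2)
      proof eventually_elim
        case (elim x)
        show ?case
        proof
          assume "x \<in> ball z e"
          then have "x \<in> annulus r0" "x \<notin> closure E" using e(2) by auto
          moreover then have "x \<in> E" using elim by (simp add: E_def)
          ultimately show False using closure_subset by blast
        qed
      qed
      then have "emeasure lborel (ball z e) = 0" by (simp add: AE_iff_null null_sets_def ball_def)
      then show False using e(1) by (simp add: emeasure_ball unit_ball_vol_2)
    qed
  qed
  then have "closed_annulus r0 \<subseteq> closure E"
    using closed_annulus_subset_closure[OF r0] closure_minimal[of "annulus r0" "closure E"] by auto
  then have "continuous_on (closed_annulus r0) b"
    using uniformly_continuous_imp_continuous[OF b(1)] continuous_on_subset by blast
  moreover have "AE z in lebesgue_on (annulus r0). g z = b z"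
  proof -
    have "AE z in lborel. z \<in> annulus r0 \<longrightarrow> g z = b z"
      using g'(5)[unfolded AE_annulus_iff] r(2) by eventually_elim (use b(2) in \<open>auto simp: E_def\<close>)
    then show ?thesis by (simp add: AE_annulus_iff)
  qed
  ultimately show thesis by (rule that)
qed

section \<open>Holomorphic substitutions in test functions\<close>

lemma Ck_cmult: "Ck k f \<Longrightarrow> Ck k (\<lambda>z. c * f z)"
proof (induction k arbitrary: f)
  case (Suc k)
  have "frechet_derivative (\<lambda>z. c * f z) (at z) v = c * frechet_derivative f (at z) v" for z v
  proof (rule frechet_derivative_eqI)
    show "((\<lambda>z. c * f z) has_derivative (\<lambda>v. c * frechet_derivative f (at z) v)) (at z)"
      using Suc.prems by (intro has_derivative_mult_right) (auto simp: frechet_derivative_works)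
  qed
  then show ?case using Suc by (auto intro!: differentiable_mult)
qed (auto intro: continuous_intros)

lemma Ck_add: "Ck k f \<Longrightarrow> Ck k g \<Longrightarrow> Ck k (\<lambda>z. f z + g z)"
proof (induction k arbitrary: f g)
  case (Suc k)
  then show ?case by (auto simp: frechet_derivative_of_add intro!: differentiable_add)
qed (auto intro: continuous_intros)

lemma test_function_vanishes:
  assumes "\<psi> \<in> test_functions r0" "z \<notin> annulus r0"
  shows "\<psi> z = 0" "frechet_derivative \<psi> (at z) v = 0" "d_z \<psi> z = 0" "d_zbar \<psi> z = 0"
proof -
  have sub: "closure {z. \<psi> z \<noteq> 0} \<subseteq> annulus r0" using assms(1) by (simp add: test_functions_def)
  then show "\<psi> z = 0" using assms(2) closure_subset[of "{z. \<psi> z \<noteq> 0}"] by auto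
  have z: "z \<in> - closure {z. \<psi> z \<noteq> 0}" using sub assms(2) by auto
  have fd: "frechet_derivative \<psi> (at z) v = 0" for v
  proof (rule frechet_derivative_outside_support[OF _ z])
    show "\<psi> w = 0" if "w \<in> - closure {z. \<psi> z \<noteq> 0}" for w
      using that closure_subset[of "{z. \<psi> z \<noteq> 0}"] by auto
  qed auto
  then show "frechet_derivative \<psi> (at z) v = 0" "d_z \<psi> z = 0" "d_zbar \<psi> z = 0" by (simp_all add: d_z_def d_zbar_def)
qed

lemma test_function_differentiable: "\<psi> \<in> test_functions r0 \<Longrightarrow> \<psi> differentiable at z"
  using test_function_C1_compact by (auto simp: C1_compact_def)

lemma test_function_directional_derivatives:
  assumes \<psi>: "\<psi> \<in> test_functions r0"
  shows "(\<lambda>z. a * frechet_derivative \<psi> (at z) v + b * frechet_derivative \<psi> (at z) w) \<in> test_functions r0" (is "?f \<in> _")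
proof -
  have C: "Ck (Suc k) \<psi>" for k using \<psi> by (auto simp: test_functions_def simp del: Ck.simps)
  have "closure {z. \<psi> z \<noteq> 0} \<subseteq> annulus r0" "compact (closure {z. \<psi> z \<noteq> 0})"
    using \<psi> by (auto simp: test_functions_def)
  moreover have "{z. ?f z \<noteq> 0} \<subseteq> closure {z. \<psi> z \<noteq> 0}"
  proof (rule ccontr)
    assume "\<not> ?thesis"
    then obtain z where z: "?f z \<noteq> 0" "z \<in> - closure {z. \<psi> z \<noteq> 0}" by auto
    have "frechet_derivative \<psi> (at z) v = 0" for v
    proof (rule frechet_derivative_outside_support[OF _ z(2)])
      show "\<psi> w = 0" if "w \<in> - closure {z. \<psi> z \<noteq> 0}" for w
        using that closure_subset[of "{z. \<psi> z \<noteq> 0}"] by auto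
    qed auto
    with z(1) show False by simp
  qed
  then have "closure {z. ?f z \<noteq> 0} \<subseteq> closure {z. \<psi> z \<noteq> 0}" by (simp add: closure_minimal)
  moreover have "Ck k ?f" for k using C[of k] by (intro Ck_add Ck_cmult) auto
  ultimately show ?thesis unfolding test_functions_def
    by (auto simp: compact_eq_bounded_closed intro: bounded_subset)
qed

lemma test_function_wirtinger:
  assumes "\<psi> \<in> test_functions r0"
  shows "d_z \<psi> \<in> test_functions r0" "d_zbar \<psi> \<in> test_functions r0"
  using test_function_directional_derivatives[OF assms, of "1/2" 1 "- (\<i>/2)" \<i>]
    test_function_directional_derivatives[OF assms, of "1/2" 1 "\<i>/2" \<i>]
  by (simp_all add: d_z_def[abs_def] d_zbar_def[abs_def] field_simps)

text \<open>A holomorphic change of variables of the punctured plane which preserves the annulus acts on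
  test functions, also after multiplication by holomorphic and antiholomorphic factors.
  These products are closed under directional derivatives, hence smooth.\<close>

locale annulus_substitution =
  fixes r0 :: real and \<eta> \<phi> :: "complex \<Rightarrow> complex"
  assumes r0: "0 < r0" "r0 < 1"
    and \<eta>_hol: "\<eta> holomorphic_on - {0}"
    and \<phi>_cont: "continuous_on (annulus r0) \<phi>"
    and \<phi>_maps: "\<And>z. z \<in> annulus r0 \<Longrightarrow> \<phi> z \<in> annulus r0"
    and \<eta>_inverse: "\<And>w. \<eta> w \<in> annulus r0 \<Longrightarrow> w \<in> annulus r0 \<and> \<phi> (\<eta> w) = w"
begin

lemma has_derivative_product:
  assumes h: "h holomorphic_on - {0}" and k: "k holomorphic_on - {0}" and \<psi>: "\<psi> \<in> test_functions r0"
  shows "((\<lambda>w. h w * cnj (k w) * \<psi> (\<eta> w)) has_derivative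
     (\<lambda>v. (v * deriv h w) * cnj (k w) * \<psi> (\<eta> w) + h w * cnj (v * deriv k w) * \<psi> (\<eta> w) +
       ((v * deriv \<eta> w * h w) * cnj (k w) * d_z \<psi> (\<eta> w) + h w * cnj (v * deriv \<eta> w * k w) * d_zbar \<psi> (\<eta> w)))) (at w)"
proof (cases "w = 0")
  case True
  \<comment> \<open>The factors may be singular at \<open>0\<close>, but the product vanishes near \<open>0\<close>.\<close>
  have zero: "\<eta> v \<notin> annulus r0" if "v \<in> ball 0 r0" for v
    using \<eta>_inverse[of v] that by (auto simp: annulus_def)
  have w: "w \<in> ball 0 r0" using True r0 by simp
  have "((\<lambda>w. 0) has_derivative (\<lambda>v. 0)) (at w)" by simp
  then have "((\<lambda>w. h w * cnj (k w) * \<psi> (\<eta> w)) has_derivative (\<lambda>v. 0)) (at w)"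
    by (rule has_derivative_transform_within_open[OF _ open_ball w])
      (simp add: test_function_vanishes(1)[OF \<psi> zero])
  moreover have "\<psi> (\<eta> w) = 0" "d_z \<psi> (\<eta> w) = 0" "d_zbar \<psi> (\<eta> w) = 0"
    using test_function_vanishes[OF \<psi> zero[OF w]] by auto
  ultimately show ?thesis by simp
next
  case False
  have fd: "(f has_derivative (\<lambda>v. deriv f w * v)) (at w)" if "f holomorphic_on - {0}" for f
    using holomorphic_derivI[OF that _, of w] False by (simp add: has_field_derivative_def open_Compl)
  have cnj: "(cnj has_derivative cnj) F" for F by (rule bounded_linear_imp_has_derivative[OF bounded_linear_cnj])
  have kd: "((\<lambda>w. cnj (k w)) has_derivative (\<lambda>v. cnj (deriv k w * v))) (at w)"
    by (rule has_derivative_compose[OF fd[OF k] cnj])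
  have \<psi>d: "(\<psi> has_derivative (\<lambda>v. v * d_z \<psi> (\<eta> w) + cnj v * d_zbar \<psi> (\<eta> w))) (at (\<eta> w))"
    using test_function_differentiable[OF \<psi>, of "\<eta> w"] unfolding frechet_derivative_works
    by (rule has_derivative_eq_rhs)
      (rule ext, rule frechet_derivative_wirtinger[OF test_function_differentiable[OF \<psi>]])
  have \<psi>\<eta>: "((\<lambda>w. \<psi> (\<eta> w)) has_derivative
     (\<lambda>v. (deriv \<eta> w * v) * d_z \<psi> (\<eta> w) + cnj (deriv \<eta> w * v) * d_zbar \<psi> (\<eta> w))) (at w)"
    by (rule has_derivative_compose[OF fd[OF \<eta>_hol] \<psi>d])
  show ?thesis
    by (rule has_derivative_eq_rhs[OF has_derivative_mult[OF has_derivative_mult[OF fd[OF h] kd] \<psi>\<eta>]])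
      (simp add: algebra_simps)
qed

lemma product_test_function:
  assumes h: "h holomorphic_on - {0}" and \<psi>: "\<psi> \<in> test_functions r0"
  shows "(\<lambda>w. h w * \<psi> (\<eta> w)) \<in> test_functions r0"
proof -
  define G where "G = {(\<lambda>w. h w * cnj (k w) * \<psi> (\<eta> w)) |h k \<psi>.
    h holomorphic_on - {0} \<and> k holomorphic_on - {0} \<and> \<psi> \<in> test_functions r0}"
  have inG: "(\<lambda>w. h w * cnj (k w) * \<psi> (\<eta> w)) \<in> function_algebra G"
    if "h holomorphic_on - {0}" "k holomorphic_on - {0}" "\<psi> \<in> test_functions r0" for h k \<psi>
    using that by (intro function_algebra.base) (auto simp: G_def)
  have op: "open (- {0 :: complex})" by (simp add: open_Compl)
  have "Ck n (\<lambda>w. h w * cnj (1 :: complex) * \<psi> (\<eta> w))" for n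
  proof (rule function_algebra_smooth[of G])
    fix g w assume "g \<in> G"
    then show "g differentiable at w"
      unfolding G_def by (auto intro: differentiableI[OF has_derivative_product])
  next
    fix g v assume "g \<in> G"
    then obtain h k \<psi> where g: "g = (\<lambda>w. h w * cnj (k w) * \<psi> (\<eta> w))"
      "h holomorphic_on - {0}" "k holomorphic_on - {0}" "\<psi> \<in> test_functions r0" unfolding G_def by blast
    show "(\<lambda>z. frechet_derivative g (at z) v) \<in> function_algebra G"
      unfolding g(1) frechet_derivative_eqI[OF has_derivative_product[OF g(2-4)]]
      using g \<eta>_hol op
      by (intro function_algebra.add inG holomorphic_intros holomorphic_deriv test_function_wirtinger) auto
  qed (use inG[OF h _ \<psi>, of "\<lambda>w. 1"] in simp)
  then have smooth: "Ck n (\<lambda>w. h w * \<psi> (\<eta> w))" for n by simp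
  have S: "compact (closure {z. \<psi> z \<noteq> 0})" "closure {z. \<psi> z \<noteq> 0} \<subseteq> annulus r0"
    using \<psi> by (auto simp: test_functions_def)
  define K where "K = \<phi> ` closure {z. \<psi> z \<noteq> 0}"
  have K: "compact K" "K \<subseteq> annulus r0"
    unfolding K_def using S \<phi>_maps by (auto intro!: compact_continuous_image intro: continuous_on_subset[OF \<phi>_cont])
  have "{w. h w * \<psi> (\<eta> w) \<noteq> 0} \<subseteq> K"
  proof
    fix w assume "w \<in> {w. h w * \<psi> (\<eta> w) \<noteq> 0}"
    then have "\<eta> w \<in> closure {z. \<psi> z \<noteq> 0}" using closure_subset by fastforce
    then show "w \<in> K" using S(2) \<eta>_inverse[of w] unfolding K_def by (metis image_eqI subsetD)
  qed
  then have "closure {w. h w * \<psi> (\<eta> w) \<noteq> 0} \<subseteq> K" using K(1) by (simp add: closure_minimal compact_imp_closed)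
  then show ?thesis using K smooth unfolding test_functions_def
    by (auto simp: compact_eq_bounded_closed intro: bounded_subset)
qed

lemma d_zbar_product:
  assumes h: "h holomorphic_on - {0}" and \<psi>: "\<psi> \<in> test_functions r0"
  shows "d_zbar (\<lambda>w. h w * \<psi> (\<eta> w)) w = h w * cnj (deriv \<eta> w) * d_zbar \<psi> (\<eta> w)"
proof -
  have "((\<lambda>w. h w * cnj 1 * \<psi> (\<eta> w)) has_derivative
     (\<lambda>v. (v * deriv h w) * cnj 1 * \<psi> (\<eta> w) + h w * cnj (v * deriv (\<lambda>w. 1) w) * \<psi> (\<eta> w) +
       ((v * deriv \<eta> w * h w) * cnj 1 * d_z \<psi> (\<eta> w) + h w * cnj (v * deriv \<eta> w * 1) * d_zbar \<psi> (\<eta> w)))) (at w)"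
    by (rule has_derivative_product[OF h _ \<psi>, of "\<lambda>w. 1"]) auto
  then have "((\<lambda>w. h w * \<psi> (\<eta> w)) has_derivative
     (\<lambda>v. (deriv h w * \<psi> (\<eta> w) + deriv \<eta> w * h w * d_z \<psi> (\<eta> w)) * v + (h w * cnj (deriv \<eta> w) * d_zbar \<psi> (\<eta> w)) * cnj v)) (at w)"
    by (simp add: algebra_simps)
  then show ?thesis by (rule d_zbar_eqI)
qed

end

section \<open>A weighted Cauchy transform\<close>

definition annulus_density :: "real \<Rightarrow> (complex \<Rightarrow> complex) \<Rightarrow> bool" where
  "annulus_density r0 h \<longleftrightarrow> h \<in> borel_measurable borel \<and> (\<forall>z. z \<notin> annulus r0 \<longrightarrow> h z = 0) \<and> (\<exists>B. \<forall>z. cmod (h z) \<le> B)"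

text \<open>The coordinates \<open>z\<close> and \<open>r0 / z\<close> are the examples; they are unimodular on one boundary
  circle. The lower Lipschitz bound turns Gaussian decay in \<open>\<bar>u z - u \<zeta>\<bar>\<close> into Gaussian decay in
  \<open>\<bar>z - \<zeta>\<bar>\<close>.\<close>

locale weighted_cauchy =
  fixes r0 c :: real and u :: "complex \<Rightarrow> complex"
  assumes r0: "0 < r0" "r0 < 1" and c: "c > 0"
    and u_hol: "u holomorphic_on - {0}"
    and u_borel [measurable]: "u \<in> borel_measurable borel"
    and u_le_1: "\<And>z. z \<in> closed_annulus r0 \<Longrightarrow> cmod (u z) \<le> 1"
    and u_expand: "\<And>z w. z \<in> closed_annulus r0 \<Longrightarrow> w \<in> closed_annulus r0 \<Longrightarrow> c * cmod (z - w) \<le> cmod (u z - u w)"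
begin

definition weight :: "real \<Rightarrow> complex \<Rightarrow> real" where
  "weight N z = exp (N / 2 * (cmod (u z))\<^sup>2)"

text \<open>Holomorphic in \<open>z\<close> and equal to \<open>1\<close> for \<open>z = \<zeta>\<close>, so that \<open>factor N z \<zeta> / (z - \<zeta>)\<close> is again a
  fundamental solution for \<open>d_zbar\<close>. The exponent is chosen such that its real part contains
  \<open>- N / 2 \<bar>u z - u \<zeta>\<bar>\<^sup>2\<close>.\<close>

definition factor :: "real \<Rightarrow> complex \<Rightarrow> complex \<Rightarrow> complex" where
  "factor N z \<zeta> = exp (of_real N * (u z - u \<zeta>) * cnj (u \<zeta>))"

text \<open>Bounds the modulus of the kernel, relative to the weight, by a function of \<open>w = z - \<zeta>\<close>.\<close>

definition gauss :: "real \<Rightarrow> complex \<Rightarrow> real" where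
  "gauss N w = exp (- (N * c\<^sup>2 / 2) * (cmod w)\<^sup>2) / cmod w"

definition cauchy_transform :: "real \<Rightarrow> (complex \<Rightarrow> complex) \<Rightarrow> complex \<Rightarrow> complex" where
  "cauchy_transform N h z = (LINT \<zeta>|lborel. h \<zeta> * (factor N z \<zeta> / (z - \<zeta>))) / of_real pompeiu_const"

definition cauchy_norm :: "real \<Rightarrow> real" where
  "cauchy_norm N = (LINT w|lborel. gauss N w) / pompeiu_const"

lemma factor_borel [measurable]: "factor N z \<in> borel_measurable borel"
proof -
  have [measurable]: "(exp :: complex \<Rightarrow> complex) \<in> borel_measurable borel"
    by (intro borel_measurable_continuous_onI continuous_intros)
  show ?thesis unfolding factor_def[abs_def] by measurable
qed

lemma norm_factor: "cmod (factor N z \<zeta>) = exp (N / 2 * ((cmod (u z))\<^sup>2 - (cmod (u \<zeta>))\<^sup>2 - (cmod (u z - u \<zeta>))\<^sup>2))"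
proof -
  have "2 * Re ((a - b) * cnj b) = (cmod a)\<^sup>2 - (cmod b)\<^sup>2 - (cmod (a - b))\<^sup>2" for a b :: complex
    unfolding cmod_power2 by (simp add: power2_eq_square algebra_simps)
  from this[of "u z" "u \<zeta>"] have "Re (of_real N * (u z - u \<zeta>) * cnj (u \<zeta>)) =
      N / 2 * ((cmod (u z))\<^sup>2 - (cmod (u \<zeta>))\<^sup>2 - (cmod (u z - u \<zeta>))\<^sup>2)"
    by (simp add: mult.assoc)
  then show ?thesis by (simp add: factor_def norm_exp_eq_Re)
qed

lemma norm_factor_le:
  assumes "N \<ge> 0" "z \<in> closed_annulus r0" "\<zeta> \<in> closed_annulus r0"
  shows "cmod (factor N z \<zeta>) \<le> weight N z / weight N \<zeta> * exp (- (N * c\<^sup>2 / 2) * (cmod (z - \<zeta>))\<^sup>2)"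
proof -
  have "(c * cmod (z - \<zeta>))\<^sup>2 \<le> (cmod (u z - u \<zeta>))\<^sup>2" using u_expand[OF assms(2,3)] c by (intro power_mono) auto
  then have "N / 2 * (c\<^sup>2 * (cmod (z - \<zeta>))\<^sup>2) \<le> N / 2 * (cmod (u z - u \<zeta>))\<^sup>2"
    using assms(1) by (intro mult_left_mono) (auto simp: power_mult_distrib)
  then show ?thesis
    by (simp add: norm_factor weight_def algebra_simps flip: exp_diff exp_add)
qed

lemma weight_bounds: "N \<ge> 0 \<Longrightarrow> z \<in> closed_annulus r0 \<Longrightarrow> 1 \<le> weight N z \<and> weight N z \<le> exp (N / 2)"
  using u_le_1[of z] by (auto simp: weight_def mult_le_cancel_left1 power_le_one intro!: mult_left_le)

lemma norm_factor_le_exp: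
  assumes "N \<ge> 0" "z \<in> closed_annulus r0" "\<zeta> \<in> closed_annulus r0"
  shows "cmod (factor N z \<zeta>) \<le> exp (N / 2)"
proof -
  have "(cmod (u z))\<^sup>2 \<le> 1" using u_le_1[OF assms(2)] by (simp add: power_le_one)
  then have "(cmod (u z))\<^sup>2 - (cmod (u \<zeta>))\<^sup>2 - (cmod (u z - u \<zeta>))\<^sup>2 \<le> 1"
    using zero_le_power2[of "cmod (u \<zeta>)"] zero_le_power2[of "cmod (u z - u \<zeta>)"] by linarith
  then have "N / 2 * ((cmod (u z))\<^sup>2 - (cmod (u \<zeta>))\<^sup>2 - (cmod (u z - u \<zeta>))\<^sup>2) \<le> N / 2 * 1"
    using assms(1) by (intro mult_left_mono) auto
  then show ?thesis by (simp add: norm_factor)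
qed

lemma integrable_gauss: "N > 0 \<Longrightarrow> integrable lborel (\<lambda>\<zeta>. gauss N (z - \<zeta>))"
  using integrable_translate[OF integrable_gaussian_kernel[of "N * c\<^sup>2 / 2"], of z] c
  by (simp add: gauss_def norm_minus_commute)

lemma integral_gauss: "(LINT \<zeta>|lborel. gauss N (z - \<zeta>)) = (LINT w|lborel. gauss N w)"
proof -
  have "(LINT w|lborel. gauss N w) = (LINT w|distr lborel borel ((+) (- z)). gauss N w)"
    by (simp only: lborel_distr_plus)
  also have "\<dots> = (LINT w|lborel. gauss N (- z + w))"
    by (rule integral_distr) (auto simp: gauss_def[abs_def])
  also have "\<dots> = (LINT \<zeta>|lborel. gauss N (z - \<zeta>))"
    by (simp add: gauss_def norm_minus_commute)
  finally show ?thesis ..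
qed

lemma kernel_integrand_bound:
  assumes N: "N \<ge> 0" and z: "z \<in> closed_annulus r0" and supp: "\<And>\<zeta>. \<zeta> \<notin> annulus r0 \<Longrightarrow> h \<zeta> = 0"
    and m: "\<And>\<zeta>. \<zeta> \<in> annulus r0 \<Longrightarrow> cmod (h \<zeta>) \<le> m * weight N \<zeta>" and m0: "m \<ge> 0"
  shows "cmod (h \<zeta> * (factor N z \<zeta> / (z - \<zeta>))) \<le> m * weight N z * gauss N (z - \<zeta>)"
proof (cases "\<zeta> \<in> annulus r0")
  case True
  then have \<zeta>: "\<zeta> \<in> closed_annulus r0" using annulus_subset_closed by blast
  have w: "weight N \<zeta> > 0" "weight N z > 0" by (auto simp: weight_def)
  have "cmod (h \<zeta>) * cmod (factor N z \<zeta>) \<le>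
    (m * weight N \<zeta>) * (weight N z / weight N \<zeta> * exp (- (N * c\<^sup>2 / 2) * (cmod (z - \<zeta>))\<^sup>2))"
    using m0 w by (intro mult_mono m True norm_factor_le N z \<zeta>) auto
  also have "\<dots> = m * weight N z * exp (- (N * c\<^sup>2 / 2) * (cmod (z - \<zeta>))\<^sup>2)" using w by simp
  finally have "cmod (h \<zeta>) * cmod (factor N z \<zeta>) / cmod (z - \<zeta>) \<le>
     m * weight N z * exp (- (N * c\<^sup>2 / 2) * (cmod (z - \<zeta>))\<^sup>2) / cmod (z - \<zeta>)"
    by (rule divide_right_mono) simp
  then show ?thesis by (simp add: norm_mult norm_divide gauss_def)
next
  case False
  then show ?thesis using m0 by (simp add: supp gauss_def weight_def)
qed

lemma density_weight_bound:
  assumes "annulus_density r0 h" "N \<ge> 0"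
  obtains B where "B \<ge> 0" "\<And>\<zeta>. cmod (h \<zeta>) \<le> B" "\<And>\<zeta>. \<zeta> \<in> annulus r0 \<Longrightarrow> cmod (h \<zeta>) \<le> B * weight N \<zeta>"
proof -
  obtain B where B: "\<And>\<zeta>. cmod (h \<zeta>) \<le> B" using assms(1) by (auto simp: annulus_density_def)
  then have B0: "B \<ge> 0" using norm_ge_zero order_trans by blast
  show thesis
  proof (rule that[OF B0 B])
    fix \<zeta> assume "\<zeta> \<in> annulus r0"
    then have "\<zeta> \<in> closed_annulus r0" using annulus_subset_closed by (rule subsetD[rotated])
    then have "1 \<le> weight N \<zeta>" using weight_bounds[OF assms(2)] by simp
    then have "B * 1 \<le> B * weight N \<zeta>" using B0 by (intro mult_left_mono)
    then show "cmod (h \<zeta>) \<le> B * weight N \<zeta>" using B[of \<zeta>] by linarith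
  qed
qed

lemma integrable_cauchy_kernel:
  assumes N: "N > 0" and z: "z \<in> closed_annulus r0" and h: "annulus_density r0 h"
  shows "integrable lborel (\<lambda>\<zeta>. h \<zeta> * (factor N z \<zeta> / (z - \<zeta>)))"
proof -
  obtain B where B: "B \<ge> 0" "\<And>\<zeta>. cmod (h \<zeta>) \<le> B" "\<And>\<zeta>. \<zeta> \<in> annulus r0 \<Longrightarrow> cmod (h \<zeta>) \<le> B * weight N \<zeta>"
    by (rule density_weight_bound[OF h less_imp_le[OF N]]) (rule that)
  have [measurable]: "h \<in> borel_measurable borel" using h by (simp add: annulus_density_def)
  show ?thesis
  proof (rule integrable_bounded_support_norm)
    show "integrable lborel (\<lambda>\<zeta>. B * weight N z * gauss N (z - \<zeta>))"
      by (intro integrable_mult_right integrable_gauss N)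
    show "cmod (h \<zeta> * (factor N z \<zeta> / (z - \<zeta>))) \<le> B * weight N z * gauss N (z - \<zeta>)" for \<zeta>
      by (rule kernel_integrand_bound) (use N z h B in \<open>auto simp: annulus_density_def\<close>)
  qed measurable
qed

lemma cauchy_transform_bound:
  assumes N: "N > 0" and z: "z \<in> closed_annulus r0" and h: "annulus_density r0 h"
    and m: "\<And>\<zeta>. \<zeta> \<in> annulus r0 \<Longrightarrow> cmod (h \<zeta>) \<le> m * weight N \<zeta>" and m0: "m \<ge> 0"
  shows "cmod (cauchy_transform N h z) \<le> cauchy_norm N * m * weight N z"
proof -
  have "cmod (LINT \<zeta>|lborel. h \<zeta> * (factor N z \<zeta> / (z - \<zeta>))) \<le> (LINT \<zeta>|lborel. m * weight N z * gauss N (z - \<zeta>))"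
  proof (rule Bochner_Integration.integral_norm_bound_integral)
    show "cmod (h \<zeta> * (factor N z \<zeta> / (z - \<zeta>))) \<le> m * weight N z * gauss N (z - \<zeta>)" for \<zeta>
      by (rule kernel_integrand_bound) (use N z h m m0 in \<open>auto simp: annulus_density_def\<close>)
  qed (intro integrable_cauchy_kernel N z h integrable_mult_right integrable_gauss)+
  also have "\<dots> = m * weight N z * (LINT w|lborel. gauss N w)" by (simp add: integral_gauss)
  finally show ?thesis using pompeiu_const_pos
    by (simp add: cauchy_transform_def cauchy_norm_def norm_divide pos_divide_le_eq mult_ac)
qed

lemma cauchy_transform_diff:
  assumes N: "N > 0" and z: "z \<in> closed_annulus r0" and h: "annulus_density r0 h" "annulus_density r0 k"
  shows "cauchy_transform N (\<lambda>\<zeta>. h \<zeta> - k \<zeta>) z = cauchy_transform N h z - cauchy_transform N k z"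
  using Bochner_Integration.integral_diff[OF integrable_cauchy_kernel[OF N z h(1)] integrable_cauchy_kernel[OF N z h(2)]]
  by (simp add: cauchy_transform_def left_diff_distrib diff_divide_distrib)

lemma cauchy_norm_nonneg: "cauchy_norm N \<ge> 0"
  unfolding cauchy_norm_def using pompeiu_const_pos by (intro divide_nonneg_pos integral_nonneg_AE) (auto simp: gauss_def)

text \<open>For \<open>N\<close> tending to infinity the Gaussian factor in \<open>gauss\<close> decreases to \<open>0\<close> away from the
  origin.\<close>

lemma cauchy_norm_tendsto_0: "(\<lambda>n. cauchy_norm (real n)) \<longlonglongrightarrow> 0"
proof -
  have "(\<lambda>n. LINT w|lborel. gauss (real (Suc n)) w) \<longlonglongrightarrow> (LINT w|(lborel :: complex measure). 0)"
  proof (rule integral_dominated_convergence[where w = "gauss 1"])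
    show "integrable lborel (gauss 1)" using integrable_gauss[of 1 0] by (simp add: gauss_def[abs_def])
    show "AE w in lborel. (\<lambda>n. gauss (real (Suc n)) w) \<longlonglongrightarrow> 0"
    proof (rule AE_mp[OF AE_lborel_singleton[of 0]], intro AE_I2 impI)
      fix w :: complex assume w: "w \<noteq> 0"
      define a where "a = c\<^sup>2 / 2 * (cmod w)\<^sup>2"
      have a: "a > 0" using c w by (simp add: a_def)
      have "(\<lambda>n. exp (- a) ^ Suc n) \<longlonglongrightarrow> 0" using a by (intro LIMSEQ_Suc LIMSEQ_power_zero) auto
      then have "(\<lambda>n. exp (- a) ^ Suc n / cmod w) \<longlonglongrightarrow> 0 / cmod w" by (intro tendsto_divide tendsto_const) (use w in auto)
      moreover have "exp (- a) ^ Suc n / cmod w = gauss (real (Suc n)) w" for n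
        unfolding exp_of_nat_mult[symmetric] by (simp add: gauss_def a_def algebra_simps del: of_nat_Suc)
      ultimately show "(\<lambda>n. gauss (real (Suc n)) w) \<longlonglongrightarrow> 0" by simp
    qed
    show "AE w in lborel. norm (gauss (real (Suc n)) w) \<le> gauss 1 w" for n
    proof (intro AE_I2)
      fix w
      have "1 * (c\<^sup>2 / 2 * (cmod w)\<^sup>2) \<le> real (Suc n) * (c\<^sup>2 / 2 * (cmod w)\<^sup>2)" by (intro mult_right_mono) auto
      then have "gauss (real (Suc n)) w \<le> gauss 1 w"
        unfolding gauss_def by (intro divide_right_mono) (auto simp: algebra_simps)
      then show "norm (gauss (real (Suc n)) w) \<le> gauss 1 w" by (simp add: gauss_def)
    qed
  qed (auto simp: gauss_def[abs_def])
  then have "(\<lambda>n. cauchy_norm (real (Suc n))) \<longlonglongrightarrow> 0 / pompeiu_const"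
    unfolding cauchy_norm_def by (intro tendsto_divide tendsto_const) (use pompeiu_const_pos in auto)
  then have "(\<lambda>n. cauchy_norm (real (Suc n))) \<longlonglongrightarrow> 0" by (simp only: div_0)
  then show ?thesis by (rule LIMSEQ_imp_Suc)
qed

lemma u_continuous: "continuous_on (closed_annulus r0) u"
  by (rule continuous_on_subset[OF holomorphic_on_imp_continuous_on[OF u_hol]])
    (use r0 in \<open>auto simp: closed_annulus_def\<close>)

text \<open>With the Cauchy kernel replaced by the regularised kernels \<open>cnj w / (\<bar>w\<bar>\<^sup>2 + s\<^sup>2)\<close> the
  transform is continuous. The kernels converge in \<open>L1\<close>, hence the transforms converge uniformly.\<close>

lemma cauchy_transform_continuous:
  assumes N: "N > 0" and h: "annulus_density r0 h"
  shows "continuous_on (closed_annulus r0) (cauchy_transform N h)"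
proof -
  obtain B where B: "B \<ge> 0" "\<And>\<zeta>. cmod (h \<zeta>) \<le> B" "\<And>\<zeta>. \<zeta> \<in> annulus r0 \<Longrightarrow> cmod (h \<zeta>) \<le> B * weight N \<zeta>"
    by (rule density_weight_bound[OF h less_imp_le[OF N]]) (rule that)
  have supp: "\<And>\<zeta>. \<zeta> \<notin> annulus r0 \<Longrightarrow> h \<zeta> = 0" and [measurable]: "h \<in> borel_measurable borel"
    using h by (auto simp: annulus_density_def)
  define k where "k s w = cnj w / of_real ((cmod w)\<^sup>2 + s\<^sup>2)" for s :: real and w :: complex
  have [measurable]: "k s \<in> borel_measurable borel" for s unfolding k_def[abs_def] by measurable
  have D0: "(cmod w)\<^sup>2 + s\<^sup>2 > 0" if "s > 0" for s w using that by (simp add: add_nonneg_pos)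
  define T where "T s z = (LINT \<zeta>|lborel. h \<zeta> * (factor N z \<zeta> * k s (z - \<zeta>))) / of_real pompeiu_const" for s z
  define C where "C = B * exp (N / 2)"
  have C0: "C \<ge> 0" using B by (simp add: C_def)
  have hE: "cmod (h \<zeta> * factor N z \<zeta>) \<le> C * indicator (annulus r0) \<zeta>" if "z \<in> closed_annulus r0" for z \<zeta>
  proof (cases "\<zeta> \<in> annulus r0")
    case True
    then have "cmod (h \<zeta>) * cmod (factor N z \<zeta>) \<le> B * exp (N / 2)"
      using that N annulus_subset_closed by (intro mult_mono B norm_factor_le_exp) auto
    then show ?thesis using True by (simp add: norm_mult C_def)
  qed (simp add: supp)
  have dist2: "cmod (z - \<zeta>) \<le> 2" if "z \<in> closed_annulus r0" "\<zeta> \<in> annulus r0" for z \<zeta>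
    using that norm_triangle_ineq4[of z \<zeta>] by (auto simp: closed_annulus_def annulus_def)
  have knorm: "cmod (k s w) = cmod w / ((cmod w)\<^sup>2 + s\<^sup>2)" if "s > 0" for s w
    using D0[OF that, of w] by (simp add: k_def norm_divide del: of_real_add)
  have kb: "cmod (k s w) \<le> 2 / s\<^sup>2" if "s > 0" "cmod w \<le> 2" for s w
    unfolding knorm[OF that(1)] using that by (intro frac_le) auto
  have bd1: "cmod (h \<zeta> * (factor N z \<zeta> * k s (z - \<zeta>))) \<le> C * (2 / s\<^sup>2) * indicator (cball 0 1) \<zeta>"
    if "s > 0" "z \<in> closed_annulus r0" for s z \<zeta>
  proof (cases "\<zeta> \<in> annulus r0")
    case True
    have "cmod (h \<zeta> * factor N z \<zeta>) * cmod (k s (z - \<zeta>)) \<le> C * (2 / s\<^sup>2)"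
      using hE[OF that(2), of \<zeta>] True C0 by (intro mult_mono kb that dist2) auto
    then show ?thesis using True by (simp add: norm_mult mult.assoc annulus_def)
  qed (use C0 in \<open>simp add: supp\<close>)
  have ind: "integrable lborel (\<lambda>\<zeta>::complex. C * (2 / s\<^sup>2) * indicator (cball 0 1) \<zeta>)" for s
    by (intro integrable_mult_right integrable_real_indicator)
      (auto simp: emeasure_lborel_cball_finite[unfolded infinity_ennreal_def])
  have intT: "integrable lborel (\<lambda>\<zeta>. h \<zeta> * (factor N z \<zeta> * k s (z - \<zeta>)))" if "s > 0" "z \<in> closed_annulus r0" for s z
    by (rule integrable_bounded_support_norm[OF ind _ bd1[OF that]]) measurable
  have contT: "continuous_on (closed_annulus r0) (T s)" if s: "s > 0" for s
    unfolding continuous_on_sequentially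
  proof (intro allI ballI impI, elim conjE)
    fix X z assume z: "z \<in> closed_annulus r0" and X: "\<forall>n. X n \<in> closed_annulus r0" "X \<longlonglongrightarrow> z"
    have "(\<lambda>n. LINT \<zeta>|lborel. h \<zeta> * (factor N (X n) \<zeta> * k s (X n - \<zeta>))) \<longlonglongrightarrow>
        (LINT \<zeta>|lborel. h \<zeta> * (factor N z \<zeta> * k s (z - \<zeta>)))"
    proof (rule integral_dominated_convergence[where w = "\<lambda>\<zeta>. C * (2 / s\<^sup>2) * indicator (cball 0 1) \<zeta>"])
      have uX: "(\<lambda>n. u (X n)) \<longlonglongrightarrow> u z"
        using u_continuous X z unfolding continuous_on_sequentially comp_def by blast
      show "AE \<zeta> in lborel. (\<lambda>n. h \<zeta> * (factor N (X n) \<zeta> * k s (X n - \<zeta>))) \<longlonglongrightarrow> h \<zeta> * (factor N z \<zeta> * k s (z - \<zeta>))"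
        unfolding factor_def k_def using D0[OF s] s
        by (intro AE_I2 tendsto_intros uX X) (simp add: less_imp_neq[symmetric] del: of_real_add of_real_power)
    qed (use bd1[OF s] X ind in auto)
    then show "(T s \<circ> X) \<longlonglongrightarrow> T s z" unfolding T_def comp_def
      by (intro tendsto_divide tendsto_const) (use pompeiu_const_pos in auto)
  qed
  define q where "q s w = indicator (cball 0 2) w * (s\<^sup>2 / (cmod w * ((cmod w)\<^sup>2 + s\<^sup>2)))" for s :: real and w :: complex
  have q_le: "0 \<le> q s w" "q s w \<le> indicator (cball 0 2) w / cmod w" if "s > 0" for s w
  proof -
    show "0 \<le> q s w" using D0[OF that, of w] by (simp add: q_def)
    have "s\<^sup>2 / ((cmod w)\<^sup>2 + s\<^sup>2) \<le> 1" using D0[OF that, of w] by simp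
    then have "(s\<^sup>2 / ((cmod w)\<^sup>2 + s\<^sup>2)) / cmod w \<le> 1 / cmod w" by (rule divide_right_mono) simp
    then show "q s w \<le> indicator (cball 0 2) w / cmod w" by (auto simp: q_def indicator_def mult.commute)
  qed
  have [measurable]: "q s \<in> borel_measurable borel" for s unfolding q_def[abs_def] by measurable
  have qint: "integrable lborel (q s)" if "s > 0" for s
    by (rule Bochner_Integration.integrable_bound[OF integrable_inverse_norm_cball[of 2]])
      (use q_le[OF that] in \<open>auto simp: abs_of_nonneg\<close>)
  have qtr: "(LINT \<zeta>|lborel. q s (z - \<zeta>)) = (LINT w|lborel. q s w)" for s z
  proof -
    have "(LINT w|lborel. q s w) = (LINT w|distr lborel borel ((+) (- z)). q s w)" by (simp only: lborel_distr_plus)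
    also have "\<dots> = (LINT w|lborel. q s (- z + w))" by (rule integral_distr) auto
    also have "\<dots> = (LINT \<zeta>|lborel. q s (z - \<zeta>))" by (simp add: q_def norm_minus_commute indicator_def)
    finally show ?thesis ..
  qed
  have qint2: "integrable lborel (\<lambda>\<zeta>. q s (z - \<zeta>))" if "s > 0" for s z
    using integrable_translate[OF qint[OF that], of z] by (simp add: q_def norm_minus_commute indicator_def)
  have close: "cmod (T s z - cauchy_transform N h z) \<le> C / pompeiu_const * (LINT w|lborel. q s w)"
    if s: "s > 0" and z: "z \<in> closed_annulus r0" for s z
  proof -
    have "cmod ((LINT \<zeta>|lborel. h \<zeta> * (factor N z \<zeta> * k s (z - \<zeta>))) - (LINT \<zeta>|lborel. h \<zeta> * (factor N z \<zeta> / (z - \<zeta>))))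
      = cmod (LINT \<zeta>|lborel. h \<zeta> * (factor N z \<zeta> * k s (z - \<zeta>)) - h \<zeta> * (factor N z \<zeta> / (z - \<zeta>)))"
      by (subst Bochner_Integration.integral_diff[OF intT[OF s z] integrable_cauchy_kernel[OF N z h]]) simp
    also have "\<dots> \<le> (LINT \<zeta>|lborel. C * q s (z - \<zeta>))"
    proof (rule Bochner_Integration.integral_norm_bound_integral)
      fix \<zeta>
      have kd: "cmod (k s w - 1 / w) = s\<^sup>2 / (cmod w * ((cmod w)\<^sup>2 + s\<^sup>2))" if "w \<noteq> 0" for w
      proof -
        have nz: "complex_of_real ((cmod w)\<^sup>2 + s\<^sup>2) \<noteq> 0" using D0[OF s, of w] s unfolding of_real_eq_0_iff by simp
        have "k s w - 1 / w = (cnj w * w - of_real ((cmod w)\<^sup>2 + s\<^sup>2)) / (w * of_real ((cmod w)\<^sup>2 + s\<^sup>2))"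
          unfolding k_def using that nz by (simp add: divide_simps del: of_real_add of_real_power)
        also have "cnj w * w - of_real ((cmod w)\<^sup>2 + s\<^sup>2) = - of_real (s\<^sup>2)"
          using complex_norm_square[of w] by (simp add: mult.commute)
        finally have "cmod (k s w - 1 / w) = cmod (- of_real (s\<^sup>2) / (w * of_real ((cmod w)\<^sup>2 + s\<^sup>2)))" by (simp only:)
        then show ?thesis using D0[OF s, of w] by (simp only: norm_divide norm_mult norm_minus_cancel norm_of_real) simp
      qed
      show "cmod (h \<zeta> * (factor N z \<zeta> * k s (z - \<zeta>)) - h \<zeta> * (factor N z \<zeta> / (z - \<zeta>))) \<le> C * q s (z - \<zeta>)"
      proof (cases "\<zeta> \<in> annulus r0 \<and> \<zeta> \<noteq> z")
        case True
        have "h \<zeta> * (factor N z \<zeta> * k s (z - \<zeta>)) - h \<zeta> * (factor N z \<zeta> / (z - \<zeta>)) =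
          (h \<zeta> * factor N z \<zeta>) * (k s (z - \<zeta>) - 1 / (z - \<zeta>))" by (simp add: algebra_simps)
        then have "cmod (h \<zeta> * (factor N z \<zeta> * k s (z - \<zeta>)) - h \<zeta> * (factor N z \<zeta> / (z - \<zeta>))) =
          cmod (h \<zeta> * factor N z \<zeta>) * cmod (k s (z - \<zeta>) - 1 / (z - \<zeta>))" by (simp only: norm_mult)
        also have "\<dots> \<le> C * q s (z - \<zeta>)"
        proof (rule mult_mono)
          show "cmod (h \<zeta> * factor N z \<zeta>) \<le> C" using hE[OF z, of \<zeta>] True by simp
          show "cmod (k s (z - \<zeta>) - 1 / (z - \<zeta>)) \<le> q s (z - \<zeta>)"
            using kd[of "z - \<zeta>"] True dist2[OF z, of \<zeta>] by (auto simp: q_def)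
        qed (use C0 in auto)
        finally show ?thesis .
      next
        case False
        then have "h \<zeta> * (factor N z \<zeta> * k s (z - \<zeta>)) - h \<zeta> * (factor N z \<zeta> / (z - \<zeta>)) = 0"
          by (auto simp: supp k_def)
        then show ?thesis using C0 q_le(1)[OF s, of "z - \<zeta>"] by (simp only: norm_zero) simp
      qed
    qed (intro Bochner_Integration.integrable_diff intT[OF s z] integrable_cauchy_kernel[OF N z h] integrable_mult_right qint2[OF s])+
    also have "\<dots> = C * (LINT w|lborel. q s w)" by (simp add: qtr)
    finally show ?thesis using pompeiu_const_pos
      by (simp add: T_def cauchy_transform_def diff_divide_distrib[symmetric] norm_divide pos_divide_le_eq mult_ac)
  qed
  define X where "X n = inverse (real (Suc n))" for n
  have X: "X \<longlonglongrightarrow> 0" "\<And>n. X n > 0"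
    using LIMSEQ_inverse_real_of_nat unfolding X_def[abs_def] by (simp_all del: of_nat_Suc)
  have "(\<lambda>n. LINT w|lborel. q (X n) w) \<longlonglongrightarrow> (LINT w|(lborel :: complex measure). 0)"
  proof (rule integral_dominated_convergence[OF _ _ integrable_inverse_norm_cball[of 2]])
    show "AE w in lborel. (\<lambda>n. q (X n) w) \<longlonglongrightarrow> 0"
    proof (rule AE_mp[OF AE_lborel_singleton[of 0]], intro AE_I2 impI)
      fix w :: complex assume "w \<noteq> 0"
      then have "(\<lambda>n. q (X n) w) \<longlonglongrightarrow> indicator (cball 0 2) w * (0\<^sup>2 / (cmod w * ((cmod w)\<^sup>2 + 0\<^sup>2)))"
        unfolding q_def by (intro tendsto_intros X) auto
      then show "(\<lambda>n. q (X n) w) \<longlonglongrightarrow> 0" by simp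
    qed
    show "AE w in lborel. norm (q (X n) w) \<le> indicator (cball 0 2) w / cmod w" for n
      using q_le[OF X(2)[of n]] by (intro AE_I2) (simp add: abs_of_nonneg)
  qed auto
  then have "(\<lambda>n. C / pompeiu_const * (LINT w|lborel. q (X n) w)) \<longlonglongrightarrow> C / pompeiu_const * 0"
    by (intro tendsto_mult tendsto_const) simp
  then have lim: "(\<lambda>n. C / pompeiu_const * (LINT w|lborel. q (X n) w)) \<longlonglongrightarrow> 0" by simp
  have "uniform_limit (closed_annulus r0) (\<lambda>n. T (X n)) (cauchy_transform N h) sequentially"
  proof (rule uniform_limitI)
    fix e :: real assume "e > 0"
    from order_tendstoD(2)[OF lim this]
    show "\<forall>\<^sub>F n in sequentially. \<forall>z\<in>closed_annulus r0. dist (T (X n) z) (cauchy_transform N h z) < e"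
      by eventually_elim (use close[OF X(2)] in \<open>auto simp: dist_norm intro: le_less_trans\<close>)
  qed
  then show ?thesis
    by (rule uniform_limit_theorem[rotated]) (use contT[OF X(2)] in auto)
qed

lemma identity_substitution: "annulus_substitution r0 (\<lambda>z. z) (\<lambda>z. z)"
  by unfold_locales (use r0 in \<open>auto intro: holomorphic_intros continuous_intros\<close>)

lemma factor_holomorphic: "(\<lambda>z. factor N z \<zeta>) holomorphic_on - {0}"
  unfolding factor_def by (intro holomorphic_intros u_hol)

text \<open>This is the Cauchy-Pompeiu formula for \<open>factor \<psi>\<close>, as \<open>d_zbar\<close> does not see the holomorphic
  factor.\<close>

lemma cauchy_kernel_reproduces:
  assumes \<psi>: "\<psi> \<in> test_functions r0"
  shows "(LINT z|lborel. factor N z \<zeta> / (z - \<zeta>) * d_zbar \<psi> z) = - (of_real pompeiu_const * \<psi> \<zeta>)"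
proof -
  interpret annulus_substitution r0 "\<lambda>z. z" "\<lambda>z. z" by (rule identity_substitution)
  define F where "F z = factor N z \<zeta> * \<psi> z" for z
  have "F \<in> test_functions r0" unfolding F_def[abs_def]
    using product_test_function[OF factor_holomorphic \<psi>] .
  then have C1: "C1_compact F" by (rule test_function_C1_compact)
  have "d_zbar F z = factor N z \<zeta> * d_zbar \<psi> z" for z
    using d_zbar_product[OF factor_holomorphic \<psi>, of N \<zeta> z] unfolding F_def[abs_def] by simp
  then have "(LINT z|lborel. factor N z \<zeta> / (z - \<zeta>) * d_zbar \<psi> z) = (LINT z|lborel. d_zbar F z / (z - \<zeta>))"
    by simp
  also have "\<dots> = - (of_real pompeiu_const * F \<zeta>)" by (rule cauchy_pompeiu[OF C1])
  finally show ?thesis by (simp add: F_def factor_def)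
qed

text \<open>By Fubini's theorem the integration in \<open>z\<close> comes first; there the kernel reproduces the test
  function.\<close>

lemma cauchy_transform_weak_solution:
  assumes N: "N > 0" and h: "annulus_density r0 h" and \<psi>: "\<psi> \<in> test_functions r0"
  shows "(LINT z|lborel. (indicator (annulus r0) z *\<^sub>R cauchy_transform N h z) * d_zbar \<psi> z) =
     - (LINT \<zeta>|lborel. h \<zeta> * \<psi> \<zeta>)"
proof -
  obtain B where B: "B \<ge> 0" "\<And>\<zeta>. cmod (h \<zeta>) \<le> B" "\<And>\<zeta>. \<zeta> \<in> annulus r0 \<Longrightarrow> cmod (h \<zeta>) \<le> B * weight N \<zeta>"
    by (rule density_weight_bound[OF h less_imp_le[OF N]]) (rule that)
  have supp: "\<And>\<zeta>. \<zeta> \<notin> annulus r0 \<Longrightarrow> h \<zeta> = 0" and [measurable]: "h \<in> borel_measurable borel"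
    using h by (auto simp: annulus_density_def)
  note C1 = test_function_C1_compact[OF \<psi>]
  note [measurable] = d_zbar_measurable[OF C1]
  obtain R L where RL: "R > 0" "L \<ge> 0" "\<And>z. cmod z \<ge> R \<Longrightarrow> \<psi> z = 0"
    "\<And>z v. cmod z > R \<Longrightarrow> frechet_derivative \<psi> (at z) v = 0"
    "\<And>z v. cmod (frechet_derivative \<psi> (at z) v) \<le> L * cmod v" "\<And>z w. cmod (\<psi> z - \<psi> w) \<le> L * cmod (z - w)"
    by (rule C1_compactE[OF C1]) (rule that)
  have dbd: "cmod (d_zbar \<psi> z) \<le> L" for z
  proof -
    have "cmod (frechet_derivative \<psi> (at z) 1) \<le> L" "cmod (frechet_derivative \<psi> (at z) \<i>) \<le> L"
      using RL(5)[of z 1] RL(5)[of z \<i>] by auto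
    then show ?thesis
      using norm_triangle_ineq[of "frechet_derivative \<psi> (at z) 1" "\<i> * frechet_derivative \<psi> (at z) \<i>"]
      by (simp add: d_zbar_def norm_divide norm_mult)
  qed
  have dout: "d_zbar \<psi> z = 0" if "z \<notin> annulus r0" for z using test_function_vanishes(4)[OF \<psi> that] .
  define f where "f z \<zeta> = h \<zeta> * (factor N z \<zeta> / (z - \<zeta>)) * d_zbar \<psi> z" for z \<zeta>
  have [measurable]: "(exp :: complex \<Rightarrow> complex) \<in> borel_measurable borel"
    by (intro borel_measurable_continuous_onI continuous_intros)
  have fm: "case_prod f \<in> borel_measurable (lborel \<Otimes>\<^sub>M lborel)"
    unfolding f_def factor_def by measurable
  define C where "C = B * exp (N / 2) * L"
  have C0: "C \<ge> 0" using B RL by (simp add: C_def)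
  have fb: "cmod (f z \<zeta>) \<le> C * (indicator (cball 0 2) (z - \<zeta>) / cmod (z - \<zeta>)) * indicator (annulus r0) z" for z \<zeta>
  proof (cases "z \<in> annulus r0 \<and> \<zeta> \<in> annulus r0")
    case True
    then have cl: "z \<in> closed_annulus r0" "\<zeta> \<in> closed_annulus r0" using annulus_subset_closed by auto
    have "cmod (h \<zeta>) * cmod (factor N z \<zeta>) * cmod (d_zbar \<psi> z) \<le> B * exp (N / 2) * L"
      using B RL N by (intro mult_mono B dbd norm_factor_le_exp cl) auto
    then have "cmod (h \<zeta>) * cmod (factor N z \<zeta>) * cmod (d_zbar \<psi> z) / cmod (z - \<zeta>) \<le> C / cmod (z - \<zeta>)"
      unfolding C_def by (rule divide_right_mono) simp
    moreover have "cmod (z - \<zeta>) \<le> 2"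
      using True norm_triangle_ineq4[of z \<zeta>] by (auto simp: annulus_def)
    ultimately show ?thesis using True by (simp add: f_def norm_mult norm_divide)
  next
    case False
    then have "f z \<zeta> = 0" using supp dout by (auto simp: f_def)
    then show ?thesis using C0 by simp
  qed
  define J where "J = (LINT w|lborel. indicator (cball 0 2) w / cmod w)"
  have Jint: "integrable lborel (\<lambda>\<zeta>. indicator (cball 0 2) (z - \<zeta>) / cmod (z - \<zeta>))" for z :: complex
    using integrable_translate[OF integrable_inverse_norm_cball[of 2], of z] by (simp add: norm_minus_commute indicator_def)
  have J: "(LINT \<zeta>|lborel. indicator (cball 0 2) (z - \<zeta>) / cmod (z - \<zeta>)) = J" for z :: complex
  proof -
    have "J = (LINT w|distr lborel borel ((+) (- z)). indicator (cball 0 2) w / cmod w)"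
      unfolding J_def by (simp only: lborel_distr_plus)
    also have "\<dots> = (LINT w|lborel. indicator (cball 0 2) (- z + w) / cmod (- z + w))" by (rule integral_distr) auto
    also have "\<dots> = (LINT \<zeta>|lborel. indicator (cball 0 2) (z - \<zeta>) / cmod (z - \<zeta>))" by (simp add: norm_minus_commute indicator_def)
    finally show ?thesis ..
  qed
  have fbint: "integrable lborel (\<lambda>\<zeta>. C * (indicator (cball 0 2) (z - \<zeta>) / cmod (z - \<zeta>)) * indicator (annulus r0) z)" for z
    by (intro integrable_mult_left integrable_mult_right Jint)
  have fmz: "f z \<in> borel_measurable borel" for z unfolding f_def[abs_def] by measurable
  have fint: "integrable lborel (f z)" for z
    by (rule integrable_bounded_support_norm[OF fbint fmz fb])
  have fI: "integrable (lborel \<Otimes>\<^sub>M lborel) (case_prod f)"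
  proof (rule lborel_pair.Fubini_integrable[OF fm])
    show "AE z in lborel. integrable lborel (\<lambda>\<zeta>. case (z, \<zeta>) of (z, \<zeta>) \<Rightarrow> f z \<zeta>)" using fint by simp
    have nb: "(LINT \<zeta>|lborel. cmod (f z \<zeta>)) \<le> C * J * indicator (annulus r0) z" for z
    proof -
      have "(LINT \<zeta>|lborel. cmod (f z \<zeta>)) \<le> (LINT \<zeta>|lborel. C * (indicator (cball 0 2) (z - \<zeta>) / cmod (z - \<zeta>)) * indicator (annulus r0) z)"
        by (rule integral_mono[OF integrable_norm[OF fint] fbint fb])
      also have "\<dots> = C * J * indicator (annulus r0) z"
        by (simp only: integral_mult_left_zero integral_mult_right_zero J)
      finally show ?thesis .
    qed
    have "integrable lborel (\<lambda>z. LINT \<zeta>|lborel. cmod (f z \<zeta>))"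
    proof (rule integrable_bounded_compact_support[where K = "C * J" and R = 1])
      show "(\<lambda>z. LINT \<zeta>|lborel. cmod (f z \<zeta>)) \<in> borel_measurable borel"
      proof -
        have "(\<lambda>(z, \<zeta>). cmod (f z \<zeta>)) \<in> borel_measurable (lborel \<Otimes>\<^sub>M lborel)"
          using measurable_compose[OF fm borel_measurable_norm] by (simp add: case_prod_beta')
        then have "(\<lambda>z. LINT \<zeta>|lborel. cmod (f z \<zeta>)) \<in> borel_measurable lborel"
          by (rule lborel.borel_measurable_lebesgue_integral)
        then show ?thesis by simp
      qed
      have nn: "(LINT \<zeta>|lborel. cmod (f z \<zeta>)) \<ge> 0" for z by (rule integral_nonneg_AE) auto
      have CJ: "C * J \<ge> 0" using C0 unfolding J_def by (intro mult_nonneg_nonneg integral_nonneg_AE) auto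
      show "norm (LINT \<zeta>|lborel. cmod (f z \<zeta>)) \<le> C * J" for z
        using nb[of z] nn[of z] CJ by (cases "z \<in> annulus r0") auto
      show "(LINT \<zeta>|lborel. cmod (f z \<zeta>)) = 0" if "cmod z > 1" for z
        using nb[of z] nn[of z] that by (auto simp: annulus_def)
    qed
    then show "integrable lborel (\<lambda>z. LINT \<zeta>|lborel. norm (case (z, \<zeta>) of (z, \<zeta>) \<Rightarrow> f z \<zeta>))" by simp
  qed
  have "(LINT z|lborel. (indicator (annulus r0) z *\<^sub>R cauchy_transform N h z) * d_zbar \<psi> z) =
     (LINT z|lborel. (LINT \<zeta>|lborel. f z \<zeta>) / of_real pompeiu_const)"
  proof (rule Bochner_Integration.integral_cong[OF refl])
    fix z
    show "(indicator (annulus r0) z *\<^sub>R cauchy_transform N h z) * d_zbar \<psi> z = (LINT \<zeta>|lborel. f z \<zeta>) / of_real pompeiu_const"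
    proof (cases "z \<in> annulus r0")
      case True
      have "(LINT \<zeta>|lborel. f z \<zeta>) = (LINT \<zeta>|lborel. h \<zeta> * (factor N z \<zeta> / (z - \<zeta>))) * d_zbar \<psi> z"
        unfolding f_def by (rule integral_mult_left_zero)
      then show ?thesis using True by (simp only: cauchy_transform_def indicator_simps scaleR_one times_divide_eq_left)
    qed (use dout[of z] in \<open>simp add: f_def\<close>)
  qed
  also have "\<dots> = (LINT z|lborel. (LINT \<zeta>|lborel. f z \<zeta>)) / of_real pompeiu_const" by simp
  also have "(LINT z|lborel. (LINT \<zeta>|lborel. f z \<zeta>)) = (LINT \<zeta>|lborel. (LINT z|lborel. f z \<zeta>))"
    by (rule lborel_pair.Fubini_integral[OF fI, symmetric])
  also have "(\<lambda>\<zeta>. LINT z|lborel. f z \<zeta>) = (\<lambda>\<zeta>. (- of_real pompeiu_const) * (h \<zeta> * \<psi> \<zeta>))"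
  proof
    fix \<zeta>
    have "(LINT z|lborel. f z \<zeta>) = (LINT z|lborel. h \<zeta> * (factor N z \<zeta> / (z - \<zeta>) * d_zbar \<psi> z))"
      by (simp add: f_def mult.assoc)
    also have "\<dots> = h \<zeta> * (LINT z|lborel. factor N z \<zeta> / (z - \<zeta>) * d_zbar \<psi> z)"
      by (rule integral_mult_right_zero)
    finally show "(LINT z|lborel. f z \<zeta>) = (- of_real pompeiu_const) * (h \<zeta> * \<psi> \<zeta>)"
      by (simp only: cauchy_kernel_reproduces[OF \<psi>]) simp
  qed
  also have "(LINT \<zeta>|lborel. (- of_real pompeiu_const) * (h \<zeta> * \<psi> \<zeta>)) / of_real pompeiu_const = - (LINT \<zeta>|lborel. h \<zeta> * \<psi> \<zeta>)"
    using pompeiu_const_pos by (simp only: integral_mult_right_zero) simp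
  finally show ?thesis .
qed

text \<open>As the transform inverts \<open>d_zbar\<close>, a fixed point of
  \<open>G \<mapsto> F + cauchy_transform N (a G + b cnj G)\<close> solves \<open>d_zbar G = a G + b cnj G\<close> for holomorphic
  \<open>F\<close>. The assumption on \<open>cauchy_norm N\<close> makes this map a contraction in the weighted norm.\<close>

lemma perturbed_equation_solution:
  assumes N: "N > 0"
    and a: "annulus_density r0 a" "\<And>z. cmod (a z) \<le> M" and b: "annulus_density r0 b" "\<And>z. cmod (b z) \<le> M"
    and q: "2 * M * cauchy_norm N \<le> 1 / 2"
    and F: "F holomorphic_on - {0}" and m: "\<And>z. z \<in> closed_annulus r0 \<Longrightarrow> cmod (F z) \<le> m * weight N z" and m0: "m \<ge> 0"
  obtains G where "continuous_on (closed_annulus r0) G"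
    "\<And>z. z \<in> closed_annulus r0 \<Longrightarrow> cmod (G z - F z) \<le> 4 * M * cauchy_norm N * m * weight N z"
    "\<And>\<psi>. \<psi> \<in> test_functions r0 \<Longrightarrow> (LINT z|lborel. (indicator (annulus r0) z *\<^sub>R G z) * d_zbar \<psi> z) =
       - (LINT z|lborel. (a z * G z + b z * cnj (G z)) * \<psi> z)"
proof -
  let ?A = "closed_annulus r0"
  define H where "H g \<zeta> = a \<zeta> * g \<zeta> + b \<zeta> * cnj (g \<zeta>)" for g \<zeta>
  define Q where "Q = 2 * M * cauchy_norm N"
  have M0: "M \<ge> 0" using a(2)[of 0] norm_ge_zero order_trans by blast
  have Q: "0 \<le> Q" "Q \<le> 1 / 2" using q M0 cauchy_norm_nonneg[of N] by (auto simp: Q_def)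
  have Fc: "continuous_on ?A F"
    by (rule continuous_on_subset[OF holomorphic_on_imp_continuous_on[OF F]])
      (use r0 in \<open>auto simp: closed_annulus_def\<close>)
  have clb: "?A \<in> sets borel" using compact_closed_annulus[of r0] by (simp add: compact_imp_closed)
  have Hd: "annulus_density r0 (H g)" if g: "continuous_on ?A g" for g
  proof -
    have [measurable]: "(\<lambda>z. indicator ?A z *\<^sub>R g z) \<in> borel_measurable borel"
      by (rule borel_measurable_continuous_on_indicator[OF clb g])
    have [measurable]: "a \<in> borel_measurable borel" "b \<in> borel_measurable borel"
      using a b by (auto simp: annulus_density_def)
    have off: "a z = 0 \<and> b z = 0" if "z \<notin> annulus r0" for z
      using a b that by (auto simp: annulus_density_def)
    have "H g = (\<lambda>z. a z * (indicator ?A z *\<^sub>R g z) + b z * cnj (indicator ?A z *\<^sub>R g z))"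
    proof
      fix z show "H g z = a z * (indicator ?A z *\<^sub>R g z) + b z * cnj (indicator ?A z *\<^sub>R g z)"
        using off[of z] annulus_subset_closed[of r0] by (cases "z \<in> annulus r0") (auto simp: H_def)
    qed
    moreover have "(\<lambda>z. a z * (indicator ?A z *\<^sub>R g z) + b z * cnj (indicator ?A z *\<^sub>R g z)) \<in> borel_measurable borel"
      by measurable
    ultimately have 1: "H g \<in> borel_measurable borel" by simp
    obtain K where K: "K \<ge> 0" "\<And>z. z \<in> ?A \<Longrightarrow> norm (g z) \<le> K"
      using continuous_on_compact_bound[OF compact_closed_annulus g] by metis
    have "cmod (H g z) \<le> M * K + M * K" for z
    proof (cases "z \<in> annulus r0")
      case True
      then have "z \<in> ?A" using annulus_subset_closed by auto
      then have "cmod (a z) * cmod (g z) + cmod (b z) * cmod (g z) \<le> M * K + M * K"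
        using K M0 by (intro add_mono mult_mono a b) auto
      then show ?thesis unfolding H_def by (intro norm_triangle_le) (simp add: norm_mult)
    qed (use off K M0 in \<open>auto simp: H_def\<close>)
    then show ?thesis using 1 off by (auto simp: annulus_density_def H_def)
  qed
  have Hdiff: "cmod (H g z - H k z) \<le> 2 * M * e" if "cmod (g z - k z) \<le> e" for g k z e
  proof -
    have "H g z - H k z = a z * (g z - k z) + b z * cnj (g z - k z)" by (simp add: H_def algebra_simps)
    then have "cmod (H g z - H k z) \<le> cmod (a z) * cmod (g z - k z) + cmod (b z) * cmod (g z - k z)"
      by (simp only:) (intro norm_triangle_le, simp add: norm_mult flip: complex_cnj_diff)
    also have "\<dots> \<le> M * e + M * e"
      using that M0 by (intro add_mono mult_mono a b) auto
    finally show ?thesis by simp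
  qed
  have Sdiff: "cmod (cauchy_transform N (H g) z - cauchy_transform N (H k) z) \<le> Q * e * weight N z"
    if z: "z \<in> ?A" and g: "continuous_on ?A g" "continuous_on ?A k"
      and e: "e \<ge> 0" "\<And>z. z \<in> ?A \<Longrightarrow> cmod (g z - k z) \<le> e * weight N z" for g k z e
  proof -
    have d: "annulus_density r0 (\<lambda>\<zeta>. H g \<zeta> - H k \<zeta>)"
    proof -
      have [measurable]: "H g \<in> borel_measurable borel" "H k \<in> borel_measurable borel"
        using Hd[OF g(1)] Hd[OF g(2)] by (auto simp: annulus_density_def)
      obtain B1 B2 where "\<And>z. cmod (H g z) \<le> B1" "\<And>z. cmod (H k z) \<le> B2"
        using Hd[OF g(1)] Hd[OF g(2)] by (auto simp: annulus_density_def)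
      then have "cmod (H g z - H k z) \<le> B1 + B2" for z
        by (intro order_trans[OF norm_triangle_ineq4] add_mono)
      then show ?thesis using Hd[OF g(1)] Hd[OF g(2)] by (auto simp: annulus_density_def)
    qed
    have "cmod (cauchy_transform N (\<lambda>\<zeta>. H g \<zeta> - H k \<zeta>) z) \<le> cauchy_norm N * (2 * M * e) * weight N z"
    proof (rule cauchy_transform_bound[OF N z d])
      show "cmod (H g \<zeta> - H k \<zeta>) \<le> 2 * M * e * weight N \<zeta>" if "\<zeta> \<in> annulus r0" for \<zeta>
        using Hdiff[of g \<zeta> k "e * weight N \<zeta>", OF e(2)] that annulus_subset_closed[of r0]
        by (auto simp: mult.assoc)
    qed (use M0 e in auto)
    then show ?thesis by (simp add: cauchy_transform_diff[OF N z Hd[OF g(1)] Hd[OF g(2)]] Q_def mult_ac)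
  qed
  \<comment> \<open>Successive approximations for \<open>G = F + cauchy_transform N (a G + b cnj G)\<close>, with contraction
    constant \<open>Q\<close> in the weighted norm.\<close>
  define G where "G n = ((\<lambda>g z. F z + cauchy_transform N (H g) z) ^^ n) F" for n
  have G0: "G 0 = F" and GS: "G (Suc n) = (\<lambda>z. F z + cauchy_transform N (H (G n)) z)" for n
    by (simp_all add: G_def)
  have Gc: "continuous_on ?A (G n)" for n
    by (induction n) (auto simp: G0 GS intro!: continuous_intros Fc cauchy_transform_continuous N Hd)
  have Gd: "cmod (G (Suc n) z - G n z) \<le> Q ^ Suc n * m * weight N z" if "z \<in> ?A" for n z
    using that
  proof (induction n arbitrary: z)
    case 0
    have zero: "cauchy_transform N (H (\<lambda>z. 0)) z = 0" by (simp add: cauchy_transform_def H_def)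
    have "cmod (cauchy_transform N (H F) z - cauchy_transform N (H (\<lambda>z. 0)) z) \<le> Q * m * weight N z"
      using m m0 by (intro Sdiff 0 Fc) auto
    then show ?case by (simp add: G0 GS zero)
  next
    case (Suc n)
    have "cmod (cauchy_transform N (H (G (Suc n))) z - cauchy_transform N (H (G n)) z) \<le> Q * (Q ^ Suc n * m) * weight N z"
      using Q m0 Suc by (intro Sdiff Gc) auto
    then show ?case unfolding GS[of "Suc n"] GS[of n] by (simp add: mult_ac)
  qed
  have Wpos: "weight N z > 0" for z by (simp add: weight_def)
  have Qpow: "Q ^ Suc n \<le> Q * (1 / 2) ^ n" for n
    using Q by (auto intro!: mult_left_mono power_mono)
  have Gd2: "cmod (G (Suc n) z - G n z) \<le> (Q * m * weight N z) * (1 / 2) ^ n" if "z \<in> ?A" for n z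
  proof -
    have "Q ^ Suc n * (m * weight N z) \<le> (Q * (1 / 2) ^ n) * (m * weight N z)"
      using m0 Wpos[of z] by (intro mult_right_mono Qpow) auto
    then show ?thesis using Gd[OF that, of n] by (simp add: mult_ac)
  qed
  have sum_geo: "(\<Sum>i<n. (1 / 2 :: real) ^ i) \<le> 2" for n
    using sum_le_suminf[of "\<lambda>i. (1 / 2 :: real) ^ i" "{..<n}"] suminf_geometric[of "1 / 2 :: real"] by simp
  have tele: "G n z - F z = (\<Sum>i<n. G (Suc i) z - G i z)" for n z
    using sum_lessThan_telescope[of "\<lambda>i. G i z" n] by (simp add: G0)
  have near: "cmod (G n z - F z) \<le> 2 * (Q * m * weight N z)" if "z \<in> ?A" for n z
  proof -
    have "cmod (G n z - F z) \<le> (\<Sum>i<n. (Q * m * weight N z) * (1 / 2) ^ i)"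
      unfolding tele by (rule order_trans[OF norm_sum sum_mono[OF Gd2[OF that]]])
    also have "\<dots> = (Q * m * weight N z) * (\<Sum>i<n. (1 / 2) ^ i)" by (simp add: sum_distrib_left)
    also have "\<dots> \<le> (Q * m * weight N z) * 2" using Q m0 Wpos[of z] by (intro mult_left_mono sum_geo) auto
    finally show ?thesis by simp
  qed
  define L where "L z = F z + (\<Sum>i. G (Suc i) z - G i z)" for z
  have "uniform_limit ?A (\<lambda>n z. \<Sum>i<n. G (Suc i) z - G i z) (\<lambda>z. \<Sum>i. G (Suc i) z - G i z) sequentially"
  proof (rule Weierstrass_m_test)
    show "norm (G (Suc n) z - G n z) \<le> (Q * m * exp (N / 2)) * (1 / 2) ^ n" if "z \<in> ?A" for n z
    proof -
      have "Q * m * weight N z * (1 / 2) ^ n \<le> Q * m * exp (N / 2) * (1 / 2) ^ n"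
        using Q m0 weight_bounds[OF less_imp_le[OF N] that] by (intro mult_right_mono mult_left_mono) auto
      then show ?thesis using Gd2[OF that, of n] by linarith
    qed
    show "summable (\<lambda>n. (Q * m * exp (N / 2)) * (1 / 2 :: real) ^ n)"
      by (intro summable_mult summable_geometric) simp
  qed
  then have ul: "uniform_limit ?A G L sequentially"
    unfolding L_def tele[symmetric] uniform_limit_iff by (simp add: dist_norm algebra_simps)
  have Lc: "continuous_on ?A L"
    by (rule uniform_limit_theorem[OF _ ul]) (use Gc in auto)
  have Glim: "(\<lambda>n. G n z) \<longlonglongrightarrow> L z" if "z \<in> ?A" for z using tendsto_uniform_limitI[OF ul that] .
  have Lnear: "cmod (L z - F z) \<le> 2 * (Q * m * weight N z)" if "z \<in> ?A" for z
    by (rule tendsto_upperbound[OF tendsto_norm[OF tendsto_diff[OF Glim[OF that] tendsto_const]]])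
      (use near[OF that] in auto)
  have fix_point: "L z = F z + cauchy_transform N (H L) z" if z: "z \<in> ?A" for z
  proof -
    have "(\<lambda>n. cauchy_transform N (H (G n)) z) \<longlonglongrightarrow> cauchy_transform N (H L) z"
      unfolding tendsto_iff
    proof (intro allI impI)
      fix e :: real assume e: "e > 0"
      define d where "d = e / (Q * weight N z + 1)"
      have d: "d > 0" using e Q Wpos[of z] by (auto simp: d_def intro!: divide_pos_pos add_nonneg_pos)
      have "\<forall>\<^sub>F n in sequentially. \<forall>z\<in>?A. dist (G n z) (L z) < d"
        using ul d by (simp add: uniform_limit_iff)
      then show "\<forall>\<^sub>F n in sequentially. dist (cauchy_transform N (H (G n)) z) (cauchy_transform N (H L) z) < e"
      proof eventually_elim
        case (elim n)
        have "cmod (G n w - L w) \<le> d * weight N w" if w: "w \<in> ?A" for w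
        proof -
          have "d * 1 \<le> d * weight N w" using weight_bounds[OF less_imp_le[OF N] w] d by (intro mult_left_mono) auto
          then show ?thesis using elim w by (auto simp: dist_norm)
        qed
        then have "cmod (cauchy_transform N (H (G n)) z - cauchy_transform N (H L) z) \<le> Q * d * weight N z"
          using d by (intro Sdiff z Gc Lc) auto
        also have "\<dots> = (Q * weight N z) * d" by simp
        also have "\<dots> < (Q * weight N z + 1) * d" using d by (simp add: algebra_simps)
        also have "\<dots> = e"
        proof -
          have "Q * weight N z + 1 \<noteq> 0" using mult_nonneg_nonneg[OF Q(1) less_imp_le[OF Wpos[of z]]] by linarith
          then show ?thesis by (simp add: d_def)
        qed
        finally show ?case by (simp add: dist_norm)
      qed
    qed
    then have "(\<lambda>n. G (Suc n) z) \<longlonglongrightarrow> F z + cauchy_transform N (H L) z"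
      unfolding GS by (intro tendsto_intros)
    moreover have "(\<lambda>n. G (Suc n) z) \<longlonglongrightarrow> L z" using Glim[OF z] by (rule LIMSEQ_Suc)
    ultimately show ?thesis using LIMSEQ_unique by blast
  qed
  show thesis
  proof (rule that[OF Lc])
    show "cmod (L z - F z) \<le> 4 * M * cauchy_norm N * m * weight N z" if "z \<in> ?A" for z
      using Lnear[OF that] by (simp add: Q_def mult_ac)
    fix \<psi> assume \<psi>: "\<psi> \<in> test_functions r0"
    interpret annulus_substitution r0 "\<lambda>z. z" "\<lambda>z. z" by (rule identity_substitution)
    have Ft: "(\<lambda>z. F z * \<psi> z) \<in> test_functions r0" using product_test_function[OF F \<psi>] .
    have dF: "d_zbar (\<lambda>z. F z * \<psi> z) z = F z * d_zbar \<psi> z" for z using d_zbar_product[OF F \<psi>, of z] by simp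
    have F0: "(LINT z|lborel. F z * d_zbar \<psi> z) = 0"
      using integral_d_zbar_eq_0[OF test_function_C1_compact[OF Ft]] by (simp add: dF)
    have dout: "d_zbar \<psi> z = 0" if "z \<notin> annulus r0" for z using test_function_vanishes(4)[OF \<psi> that] .
    have [measurable]: "d_zbar \<psi> \<in> borel_measurable borel" by (rule d_zbar_measurable[OF test_function_C1_compact[OF \<psi>]])
    have intg: "integrable lborel (\<lambda>z. (indicator (annulus r0) z *\<^sub>R g z) * d_zbar \<psi> z)" if g: "continuous_on ?A g" for g
    proof -
      obtain K where K: "K \<ge> 0" "\<And>z. z \<in> ?A \<Longrightarrow> norm (g z) \<le> K"
        using continuous_on_compact_bound[OF compact_closed_annulus g] by metis
      have "d_zbar \<psi> \<in> test_functions r0" by (rule test_function_wirtinger[OF \<psi>])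
      then have "continuous_on (cball 0 1) (d_zbar \<psi>)"
        using C1_compact_continuous[OF test_function_C1_compact] continuous_on_subset by blast
      then obtain K2 where K2: "K2 \<ge> 0" "\<And>z. z \<in> cball 0 1 \<Longrightarrow> norm (d_zbar \<psi> z) \<le> K2"
        using continuous_on_compact_bound[OF compact_cball] by metis
      have [measurable]: "(\<lambda>z. indicator (annulus r0) z *\<^sub>R g z) \<in> borel_measurable borel"
        by (rule borel_measurable_continuous_on_indicator) (use continuous_on_subset[OF g annulus_subset_closed] in auto)
      show ?thesis
      proof (rule integrable_bounded_compact_support[where K = "K * K2" and R = 1])
        show "cmod ((indicator (annulus r0) z *\<^sub>R g z) * d_zbar \<psi> z) \<le> K * K2" for z
        proof (cases "z \<in> annulus r0")
          case True
          then have "z \<in> ?A" "z \<in> cball 0 1" using annulus_subset_closed by (auto simp: annulus_def)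
          then have "cmod (g z) * cmod (d_zbar \<psi> z) \<le> K * K2" using K K2 by (intro mult_mono) auto
          then show ?thesis using True by (simp add: norm_mult)
        qed (use K K2 in simp)
        show "(\<lambda>z. (indicator (annulus r0) z *\<^sub>R g z) * d_zbar \<psi> z) \<in> borel_measurable borel" by measurable
      qed (auto simp: annulus_def)
    qed
    have Sc: "continuous_on ?A (cauchy_transform N (H L))" by (rule cauchy_transform_continuous[OF N Hd[OF Lc]])
    have "(LINT z|lborel. (indicator (annulus r0) z *\<^sub>R L z) * d_zbar \<psi> z) =
      (LINT z|lborel. (indicator (annulus r0) z *\<^sub>R F z) * d_zbar \<psi> z + (indicator (annulus r0) z *\<^sub>R cauchy_transform N (H L) z) * d_zbar \<psi> z)"
    proof (rule Bochner_Integration.integral_cong[OF refl])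
      fix z
      show "(indicator (annulus r0) z *\<^sub>R L z) * d_zbar \<psi> z = (indicator (annulus r0) z *\<^sub>R F z) * d_zbar \<psi> z +
          (indicator (annulus r0) z *\<^sub>R cauchy_transform N (H L) z) * d_zbar \<psi> z"
      proof (cases "z \<in> annulus r0")
        case True
        then have "L z = F z + cauchy_transform N (H L) z" using annulus_subset_closed by (intro fix_point) auto
        then show ?thesis using True by (simp only: indicator_simps scaleR_one distrib_right)
      qed simp
    qed
    also have "\<dots> = (LINT z|lborel. (indicator (annulus r0) z *\<^sub>R F z) * d_zbar \<psi> z) +
      (LINT z|lborel. (indicator (annulus r0) z *\<^sub>R cauchy_transform N (H L) z) * d_zbar \<psi> z)"
      by (rule Bochner_Integration.integral_add[OF intg[OF Fc] intg[OF Sc]])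
    also have "(\<lambda>z. (indicator (annulus r0) z *\<^sub>R F z) * d_zbar \<psi> z) = (\<lambda>z. F z * d_zbar \<psi> z)"
      using dout by (auto simp: indicator_def fun_eq_iff)
    also have "(LINT z|lborel. (indicator (annulus r0) z *\<^sub>R cauchy_transform N (H L) z) * d_zbar \<psi> z) = - (LINT z|lborel. H L z * \<psi> z)"
      by (rule cauchy_transform_weak_solution[OF N Hd[OF Lc] \<psi>])
    finally show "(LINT z|lborel. (indicator (annulus r0) z *\<^sub>R L z) * d_zbar \<psi> z) = - (LINT z|lborel. (a z * L z + b z * cnj (L z)) * \<psi> z)"
      by (simp add: F0 H_def)
  qed
qed

text \<open>This is \<open>x \<le> exp (x - 1)\<close> for \<open>x = \<bar>u\<bar>\<^sup>2\<close>, with equality exactly on the circle \<open>\<bar>u\<bar> = 1\<close>.\<close>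

lemma u_power_le: "cmod (u z) ^ n \<le> exp (- real n / 2) * weight (real n) z"
proof -
  have "(cmod (u z))\<^sup>2 \<le> exp ((cmod (u z))\<^sup>2 - 1)" using exp_ge_add_one_self[of "(cmod (u z))\<^sup>2 - 1"] by simp
  also have "\<dots> = (exp (((cmod (u z))\<^sup>2 - 1) / 2))\<^sup>2" by (simp add: power2_eq_square flip: exp_add)
  finally have "cmod (u z) \<le> exp (((cmod (u z))\<^sup>2 - 1) / 2)" by (rule power2_le_imp_le) simp
  then have "cmod (u z) ^ n \<le> exp (((cmod (u z))\<^sup>2 - 1) / 2) ^ n" by (intro power_mono) auto
  also have "\<dots> = exp (- real n / 2) * weight (real n) z"
    by (simp add: weight_def algebra_simps diff_divide_distrib flip: exp_of_nat_mult exp_add)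
  finally show ?thesis .
qed

text \<open>For \<open>N = n\<close> the ratio of \<open>u ^ n P(u)\<close> and the weight is at most \<open>K exp (- n / 2)\<close>, where \<open>K\<close>
  bounds \<open>P\<close>, while the weight itself is at most \<open>exp (n / 2)\<close>. So the error of the solution is at
  most \<open>K\<close> times a multiple of \<open>cauchy_norm n\<close>, uniformly on the closed annulus.\<close>

lemma peak_solutions:
  assumes a: "annulus_density r0 a" and b: "annulus_density r0 b" and e: "e > 0"
  shows "\<forall>\<^sub>F n in sequentially. \<forall>\<tau>. cmod \<tau> = 1 \<longrightarrow> (\<exists>G. continuous_on (closed_annulus r0) G \<and>
    (\<forall>z\<in>closed_annulus r0. cmod (G z - \<tau> * u z ^ n * poly P (u z)) \<le> e) \<and>
    (\<forall>\<psi>\<in>test_functions r0. (LINT z|lborel. (indicator (annulus r0) z *\<^sub>R G z) * d_zbar \<psi> z) =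
       - (LINT z|lborel. (a z * G z + b z * cnj (G z)) * \<psi> z)))"
proof -
  obtain M1 M2 where M12: "\<And>z. cmod (a z) \<le> M1" "\<And>z. cmod (b z) \<le> M2" using a b by (auto simp: annulus_density_def)
  define M where "M = max M1 M2"
  have M: "\<And>z. cmod (a z) \<le> M" "\<And>z. cmod (b z) \<le> M" using M12 by (auto simp: M_def intro: max.coboundedI1 max.coboundedI2)
  have M0: "M \<ge> 0" using M(1)[of 0] norm_ge_zero order_trans by blast
  have "continuous_on (cball 0 1) (poly P)" by (intro continuous_intros)
  then obtain K where K: "K \<ge> 0" "\<And>z. z \<in> cball 0 1 \<Longrightarrow> norm (poly P z) \<le> K"
    using continuous_on_compact_bound[OF compact_cball] by metis
  have l1: "(\<lambda>n. 2 * M * cauchy_norm (real n)) \<longlonglongrightarrow> 2 * M * 0" "(\<lambda>n. 4 * M * K * cauchy_norm (real n)) \<longlonglongrightarrow> 4 * M * K * 0"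
    by (intro tendsto_intros cauchy_norm_tendsto_0)+
  have "\<forall>\<^sub>F n in sequentially. 2 * M * cauchy_norm (real n) < 1 / 2"
    by (rule order_tendstoD(2)[OF l1(1)]) simp
  moreover have "\<forall>\<^sub>F n in sequentially. 4 * M * K * cauchy_norm (real n) < e"
    by (rule order_tendstoD(2)[OF l1(2)]) (use e in simp)
  ultimately show ?thesis using eventually_gt_at_top[of 0]
  proof eventually_elim
    case (elim n)
    show ?case
    proof (intro allI impI)
      fix \<tau> :: complex assume \<tau>: "cmod \<tau> = 1"
      define F where "F z = \<tau> * u z ^ n * poly P (u z)" for z
      have Fh: "F holomorphic_on - {0}" unfolding F_def poly_altdef by (intro holomorphic_intros u_hol)
      have Fb: "cmod (F z) \<le> (K * exp (- real n / 2)) * weight (real n) z" if "z \<in> closed_annulus r0" for z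
      proof -
        have "cmod (u z) ^ n * cmod (poly P (u z)) \<le> (exp (- real n / 2) * weight (real n) z) * K"
          using u_le_1[OF that] K by (intro mult_mono u_power_le) (auto simp: weight_def)
        then show ?thesis by (simp add: F_def norm_mult norm_power \<tau> mult_ac)
      qed
      obtain G where G: "continuous_on (closed_annulus r0) G"
        "\<And>z. z \<in> closed_annulus r0 \<Longrightarrow> cmod (G z - F z) \<le> 4 * M * cauchy_norm (real n) * (K * exp (- real n / 2)) * weight (real n) z"
        "\<And>\<psi>. \<psi> \<in> test_functions r0 \<Longrightarrow> (LINT z|lborel. (indicator (annulus r0) z *\<^sub>R G z) * d_zbar \<psi> z) =
          - (LINT z|lborel. (a z * G z + b z * cnj (G z)) * \<psi> z)"
        by (rule perturbed_equation_solution[OF _ a M(1) b M(2) _ Fh Fb]) (use elim K in \<open>auto intro: that\<close>)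
      have "cmod (G z - F z) \<le> e" if z: "z \<in> closed_annulus r0" for z
      proof -
        have "exp (- real n / 2) * weight (real n) z \<le> exp (- real n / 2) * exp (real n / 2)"
          using weight_bounds[OF _ z, of "real n"] by (intro mult_left_mono) auto
        also have "\<dots> = 1" by (simp flip: exp_add)
        finally have "(4 * M * K * cauchy_norm (real n)) * (exp (- real n / 2) * weight (real n) z) \<le> (4 * M * K * cauchy_norm (real n)) * 1"
          using M0 K cauchy_norm_nonneg[of "real n"] by (intro mult_left_mono) auto
        then show ?thesis using G(2)[OF z] elim(2) by (simp add: mult_ac)
      qed
      then show "\<exists>G. continuous_on (closed_annulus r0) G \<and>
          (\<forall>z\<in>closed_annulus r0. cmod (G z - \<tau> * u z ^ n * poly P (u z)) \<le> e) \<and>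
          (\<forall>\<psi>\<in>test_functions r0. (LINT z|lborel. (indicator (annulus r0) z *\<^sub>R G z) * d_zbar \<psi> z) =
             - (LINT z|lborel. (a z * G z + b z * cnj (G z)) * \<psi> z))"
        using G unfolding F_def by blast
    qed
  qed
qed

end

lemma weighted_cauchy_identity:
  assumes "0 < r0" "r0 < 1"
  shows "weighted_cauchy r0 1 (\<lambda>z. z)"
  by unfold_locales (use assms in \<open>auto simp: closed_annulus_def intro: holomorphic_intros\<close>)

lemma weighted_cauchy_inversion:
  assumes "0 < r0" "r0 < 1"
  shows "weighted_cauchy r0 r0 (\<lambda>z. of_real r0 / z)"
proof unfold_locales
  show "(\<lambda>z. complex_of_real r0 / z) holomorphic_on - {0}" by (intro holomorphic_intros) auto
  show "(\<lambda>z. complex_of_real r0 / z) \<in> borel_measurable borel" by measurable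
  show "cmod (of_real r0 / z) \<le> 1" if "z \<in> closed_annulus r0" for z
    using that assms by (auto simp: closed_annulus_def norm_divide divide_le_eq)
  fix z w assume zw: "z \<in> closed_annulus r0" "w \<in> closed_annulus r0"
  then have c: "0 < cmod z" "cmod z \<le> 1" "0 < cmod w" "cmod w \<le> 1" using assms by (auto simp: closed_annulus_def)
  then have nz: "z \<noteq> 0" "w \<noteq> 0" by auto
  have "of_real r0 / z - of_real r0 / w = of_real r0 * (w - z) / (z * w)" using nz by (simp add: field_simps)
  then have "cmod (of_real r0 / z - of_real r0 / w) = r0 * cmod (z - w) / (cmod z * cmod w)"
    using assms by (simp add: norm_mult norm_divide norm_minus_commute)
  moreover have "r0 * cmod (z - w) / 1 \<le> r0 * cmod (z - w) / (cmod z * cmod w)"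
    using c assms by (intro divide_left_mono mult_nonneg_nonneg) (auto intro: mult_le_one mult_pos_pos)
  ultimately show "r0 * cmod (z - w) \<le> cmod (of_real r0 / z - of_real r0 / w)" by simp
qed (use assms in auto)

section \<open>Hardy bounds and boundary traces of continuous functions\<close>

lemma annulus_imp_circle: "0 < r0 \<Longrightarrow> r0 < r \<Longrightarrow> r < 1 \<Longrightarrow> of_real r * cis t \<in> annulus r0"
  by (simp add: annulus_def norm_mult)

lemma continuous_annulus_measurable:
  "continuous_on (annulus r0) f \<Longrightarrow> f \<in> borel_measurable (lebesgue_on (annulus r0))"
  by (rule continuous_imp_measurable_on_sets_lebesgue) auto

lemma continuous_on_norm_powr:
  assumes "continuous_on S f" "p > (0::real)"
  shows "continuous_on S (\<lambda>x. norm (f x) powr p)"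
  using assms by (intro continuous_on_powr' continuous_intros) auto

definition circle_mean :: "real \<Rightarrow> (complex \<Rightarrow> complex) \<Rightarrow> real \<Rightarrow> real" where
  "circle_mean p f r = integral {0..2 * pi} (\<lambda>t. cmod (f (of_real r * cis t)) powr p)"

lemma circle_mean_continuous:
  assumes "0 < r0" "p > 0" "continuous_on (annulus r0) f"
  shows "continuous_on {r0<..<1} (circle_mean p f)"
proof -
  have "continuous_on ({r0<..<1} \<times> cbox 0 (2 * pi)) (\<lambda>(r, t). cmod (f (of_real r * cis t)) powr p)"
    unfolding case_prod_beta
    by (intro continuous_on_norm_powr continuous_on_compose2[OF assms(3)] continuous_intros)
      (use assms in \<open>auto intro: annulus_imp_circle\<close>)
  then have "continuous_on {r0<..<1} (\<lambda>r. integral (cbox 0 (2 * pi)) (\<lambda>t. cmod (f (of_real r * cis t)) powr p))"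
    by (rule integral_continuous_on_param)
  then show ?thesis by (simp add: circle_mean_def[abs_def])
qed

lemma circle_mean_nn_integral:
  assumes "0 < r0" "p > 0" "continuous_on (annulus r0) f" "r0 < r" "r < 1"
  shows "ennreal (1 / (2 * pi)) * (\<integral>\<^sup>+t. ennreal (cmod (f (of_real r * cis t)) powr p) \<partial>lebesgue_on {0..2 * pi}) =
    ennreal (circle_mean p f r / (2 * pi))"
proof -
  have "continuous_on {0..2 * pi} (\<lambda>t. cmod (f (of_real r * cis t)) powr p)"
    by (intro continuous_on_norm_powr continuous_on_compose2[OF assms(3)] continuous_intros)
      (use assms in \<open>auto intro: annulus_imp_circle\<close>)
  then have i: "integrable (lebesgue_on {0..2 * pi}) (\<lambda>t. cmod (f (of_real r * cis t)) powr p)"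
    by (rule continuous_imp_integrable_real)
  have "(\<integral>\<^sup>+t. ennreal (cmod (f (of_real r * cis t)) powr p) \<partial>lebesgue_on {0..2 * pi}) =
     ennreal (LINT t|lebesgue_on {0..2 * pi}. cmod (f (of_real r * cis t)) powr p)"
    by (rule nn_integral_eq_integral[OF i]) auto
  also have "(LINT t|lebesgue_on {0..2 * pi}. cmod (f (of_real r * cis t)) powr p) = circle_mean p f r"
    unfolding circle_mean_def by (rule lebesgue_integral_eq_integral[OF i]) auto
  finally show ?thesis by (simp flip: ennreal_mult')
qed

text \<open>The means over circles depend continuously on the radius, so their essential supremum is a
  supremum.\<close>

lemma hardy_bounded_iff:
  assumes r0: "0 < r0" "r0 < 1" and p: "p > 0" and f: "continuous_on (annulus r0) f"
  shows "hardy_bounded r0 p f \<longleftrightarrow> (\<exists>C. \<forall>r. r0 < r \<and> r < 1 \<longrightarrow> circle_mean p f r \<le> C)"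
proof -
  let ?M = "lebesgue_on {r0<..<1}"
  define g where "g r = ennreal (1 / (2 * pi)) *
    (\<integral>\<^sup>+t. ennreal (cmod (f (of_real r * cis t)) powr p) \<partial>lebesgue_on {0..2 * pi})" for r
  have eq: "g r = ennreal (circle_mean p f r / (2 * pi))" if "r0 < r" "r < 1" for r
    unfolding g_def by (rule circle_mean_nn_integral[OF r0(1) p f that])
  have "circle_mean p f \<in> borel_measurable ?M"
    by (rule continuous_imp_measurable_on_sets_lebesgue[OF circle_mean_continuous[OF r0(1) p f]]) auto
  then have "(\<lambda>r. ennreal (circle_mean p f r / (2 * pi))) \<in> borel_measurable ?M" by measurable
  moreover have "g \<in> borel_measurable ?M \<longleftrightarrow> (\<lambda>r. ennreal (circle_mean p f r / (2 * pi))) \<in> borel_measurable ?M"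
    by (rule measurable_cong) (use eq in auto)
  ultimately have gm: "g \<in> borel_measurable ?M" by simp
  have hb: "hardy_bounded r0 p f \<longleftrightarrow> esssup ?M g < \<infinity>" by (simp add: hardy_bounded_def g_def[abs_def])
  show ?thesis
  proof
    assume "hardy_bounded r0 p f"
    then have fin: "esssup ?M g < \<infinity>" by (simp add: hb)
    define C where "C = enn2real (esssup ?M g)"
    have "AE r in ?M. g r \<le> ennreal C"
      using esssup_AE[where M = ?M and f = g] fin by (simp add: C_def less_top)
    then have ae: "AE r in lborel. r \<in> {r0<..<1} \<longrightarrow> g r \<le> ennreal C"
      by (subst (asm) AE_restrict_space_iff) (auto simp: AE_completion_iff)
    have "circle_mean p f r1 \<le> 2 * pi * C" if r1: "r0 < r1" "r1 < 1" for r1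
    proof (rule ccontr)
      assume "\<not> circle_mean p f r1 \<le> 2 * pi * C"
      then have big: "circle_mean p f r1 > 2 * pi * C" by simp
      have "open ({r0<..<1} \<inter> circle_mean p f -` {2 * pi * C<..})"
        by (rule continuous_open_preimage[OF circle_mean_continuous[OF r0(1) p f]]) auto
      moreover have "r1 \<in> {r0<..<1} \<inter> circle_mean p f -` {2 * pi * C<..}" using r1 big by auto
      ultimately obtain e where e: "e > 0" "ball r1 e \<subseteq> {r0<..<1} \<inter> circle_mean p f -` {2 * pi * C<..}"
        using open_contains_ball by blast
      have "AE r in lborel. r \<notin> ball r1 e"
        using ae
      proof eventually_elim
        case (elim r)
        show ?case
        proof
          assume "r \<in> ball r1 e"
          then have r: "r0 < r" "r < 1" "2 * pi * C < circle_mean p f r" using e(2) by auto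
          then have "ennreal (circle_mean p f r / (2 * pi)) \<le> ennreal C" using elim eq by auto
          then have "circle_mean p f r / (2 * pi) \<le> C" by (subst (asm) ennreal_le_iff) (auto simp: C_def)
          then show False using r(3) by (simp add: field_simps)
        qed
      qed
      then have "emeasure lborel (ball r1 e) = 0" by (simp add: AE_iff_null null_sets_def ball_def)
      moreover have "ball r1 e = {r1 - e<..<r1 + e}" by (auto simp: ball_def dist_real_def)
      ultimately show False using e(1) by simp
    qed
    then show "\<exists>C. \<forall>r. r0 < r \<and> r < 1 \<longrightarrow> circle_mean p f r \<le> C" by blast
  next
    assume "\<exists>C. \<forall>r. r0 < r \<and> r < 1 \<longrightarrow> circle_mean p f r \<le> C"
    then obtain C where C: "\<And>r. r0 < r \<Longrightarrow> r < 1 \<Longrightarrow> circle_mean p f r \<le> C" by blast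
    have "esssup ?M g \<le> ennreal (C / (2 * pi))"
      by (rule esssup_I[OF gm]) (use eq C in \<open>auto intro!: AE_I2 ennreal_leI divide_right_mono\<close>)
    then show "hardy_bounded r0 p f" unfolding hb by (rule le_less_trans) simp
  qed
qed

lemma bounded_imp_hardy_bounded:
  assumes r0: "0 < r0" "r0 < 1" and p: "p > 0" and f: "continuous_on (closed_annulus r0) f"
  shows "hardy_bounded r0 p f"
proof -
  have fa: "continuous_on (annulus r0) f" using continuous_on_subset[OF f annulus_subset_closed] .
  obtain K where K: "K \<ge> 0" "\<And>z. z \<in> closed_annulus r0 \<Longrightarrow> norm (f z) \<le> K"
    using continuous_on_compact_bound[OF compact_closed_annulus f] by metis
  have "circle_mean p f r \<le> integral {0..2 * pi} (\<lambda>t. K powr p)" if "r0 < r" "r < 1" for r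
    unfolding circle_mean_def
  proof (rule integral_le)
    show "(\<lambda>t. cmod (f (of_real r * cis t)) powr p) integrable_on {0..2 * pi}"
      by (intro integrable_continuous_real continuous_on_norm_powr continuous_on_compose2[OF fa] continuous_intros p)
        (use that r0 in \<open>auto intro: annulus_imp_circle\<close>)
    show "cmod (f (of_real r * cis t)) powr p \<le> K powr p" if "t \<in> {0..2 * pi}" for t
      using K(2)[OF subsetD[OF annulus_subset_closed annulus_imp_circle[OF r0(1) \<open>r0 < r\<close> \<open>r < 1\<close>]]] p
      by (intro powr_mono2) auto
  qed auto
  then show ?thesis unfolding hardy_bounded_iff[OF r0 p fa] by blast
qed

definition boundary :: "real \<Rightarrow> complex set" where
  "boundary r0 = sphere 0 1 \<union> sphere 0 r0"

lemma boundary_subset_closed: "0 < r0 \<Longrightarrow> r0 < 1 \<Longrightarrow> boundary r0 \<subseteq> closed_annulus r0"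
  by (auto simp: boundary_def closed_annulus_def)

text \<open>Every boundary point is the end of a radial segment, which stays in each approach region.\<close>

lemma nontangential_region_accumulates:
  assumes r0: "0 < r0" "r0 < 1" and \<zeta>: "\<zeta> \<in> boundary r0"
  shows "\<zeta> islimpt {z \<in> annulus r0. dist z \<zeta> < 2 * infdist z (sphere 0 1 \<union> sphere 0 r0)}"
  unfolding islimpt_approachable
proof (intro allI impI)
  fix e :: real assume e: "e > 0"
  define s where "s = min (e / 2) ((1 - r0) / 3)"
  have s: "s > 0" "s < e" "3 * s \<le> 1 - r0" using e r0 by (auto simp: s_def min_def field_simps)
  define t where "t = (if cmod \<zeta> = 1 then 1 - s else r0 + s)"
  have c: "cmod \<zeta> = 1 \<or> cmod \<zeta> = r0" using \<zeta> by (auto simp: boundary_def)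
  then have c0: "cmod \<zeta> > 0" using r0 by auto
  have ts: "\<bar>t - cmod \<zeta>\<bar> = s" using c s r0 by (auto simp: t_def)
  have tb: "r0 + s \<le> t" "t \<le> 1 - s" using s r0 by (auto simp: t_def)
  define z where "z = of_real (t / cmod \<zeta>) * \<zeta>"
  have "t > 0" using tb s r0 by linarith
  then have nz: "cmod z = t" unfolding z_def norm_mult norm_of_real using c0 by simp
  have "z - \<zeta> = of_real ((t - cmod \<zeta>) / cmod \<zeta>) * \<zeta>"
    using c0 by (auto simp: z_def field_simps)
  then have dz: "dist z \<zeta> = s" unfolding dist_norm
    by (simp only: norm_mult norm_of_real abs_divide ts) (use c0 in simp)
  have "s \<le> infdist z (sphere 0 1 \<union> sphere 0 r0)"
  proof -
    have ne: "sphere 0 1 \<union> sphere 0 r0 \<noteq> ({} :: complex set)" using r0 by auto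
    have "s \<le> dist z y" if "y \<in> sphere 0 1 \<union> sphere 0 r0" for y
      using norm_triangle_ineq3[of z y] that nz tb by (auto simp: dist_norm)
    then show ?thesis unfolding infdist_notempty[OF ne] by (intro cINF_greatest ne)
  qed
  then show "\<exists>z\<in>{z \<in> annulus r0. dist z \<zeta> < 2 * infdist z (sphere 0 1 \<union> sphere 0 r0)}. z \<noteq> \<zeta> \<and> dist z \<zeta> < e"
    using dz s nz tb by (intro bexI[of _ z]) (auto simp: annulus_def)
qed

text \<open>Uniqueness of the nontangential limit, which \<open>THE\<close> requires, holds because \<open>\<zeta>\<close> is a limit
  point of the approach region.\<close>

lemma trace_continuous:
  assumes r0: "0 < r0" "r0 < 1" and f: "continuous_on (closed_annulus r0) f"
    and g: "\<And>z. z \<in> annulus r0 \<Longrightarrow> g z = f z" and \<zeta>: "\<zeta> \<in> boundary r0"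
  shows "trace r0 g \<zeta> = f \<zeta>"
  unfolding trace_def
proof (rule the_equality)
  let ?R = "\<lambda>b. {z \<in> annulus r0. dist z \<zeta> < b * infdist z (sphere 0 1 \<union> sphere 0 r0)}"
  have lim: "(g \<longlongrightarrow> f \<zeta>) (at \<zeta> within ?R b)" for b
  proof (rule Lim_transform_eventually)
    have "(f \<longlongrightarrow> f \<zeta>) (at \<zeta> within closed_annulus r0)"
      using f \<zeta> boundary_subset_closed[OF r0] by (auto simp: continuous_on_def)
    then show "(f \<longlongrightarrow> f \<zeta>) (at \<zeta> within ?R b)"
      by (rule tendsto_within_subset) (use annulus_subset_closed in auto)
    show "\<forall>\<^sub>F z in at \<zeta> within ?R b. f z = g z" using g by (auto simp: eventually_at_filter)
  qed
  then show "nontangential_limit r0 g \<zeta> (f \<zeta>)" by (simp add: nontangential_limit_def)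
  fix L assume "nontangential_limit r0 g \<zeta> L"
  then have "(g \<longlongrightarrow> L) (at \<zeta> within ?R 2)" by (simp add: nontangential_limit_def)
  moreover have "at \<zeta> within ?R 2 \<noteq> bot"
    using nontangential_region_accumulates[OF r0 \<zeta>] by (simp add: trivial_limit_within)
  ultimately show "L = f \<zeta>" using lim[of 2] tendsto_unique by blast
qed

definition boundary_integral :: "real \<Rightarrow> (complex \<Rightarrow> real) \<Rightarrow> real" where
  "boundary_integral r0 h = (LINT t|lebesgue_on {0..2 * pi}. h (cis t)) +
     (LINT t|lebesgue_on {0..2 * pi}. h (of_real r0 * cis t))"

lemma circles_in_boundary [simp]: "0 < r0 \<Longrightarrow> cis t \<in> boundary r0" "0 < r0 \<Longrightarrow> of_real r0 * cis t \<in> boundary r0"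
  by (auto simp: boundary_def norm_mult)

lemma boundary_integral_cong:
  assumes "0 < r0" "\<And>z. z \<in> boundary r0 \<Longrightarrow> f z = g z"
  shows "boundary_integral r0 f = boundary_integral r0 g"
  using assms by (simp add: boundary_integral_def)

lemma hardy_norm_continuous:
  assumes r0: "0 < r0" "r0 < 1" and f: "continuous_on (closed_annulus r0) f"
    and g: "\<And>z. z \<in> annulus r0 \<Longrightarrow> g z = f z"
  shows "hardy_norm r0 p g = (boundary_integral r0 (\<lambda>z. cmod (f z) powr p) / (2 * pi)) powr (1 / p)"
  using trace_continuous[OF r0 f g] r0
  by (simp add: hardy_norm_def boundary_Lp_norm_def boundary_integral_def add_divide_distrib)

section \<open>Peak functions in the Hardy spaces\<close>

text \<open>The solution \<open>f\<close> of \<open>f - \<beta> cnj f = w\<close> for \<open>\<bar>\<beta>\<bar> < 1\<close>. This real-linear change of unknown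
  removes the derivative from the right-hand side of \<open>d_zbar f = \<beta> cnj (d_z f)\<close>.\<close>

definition conj_unmix :: "real \<Rightarrow> complex \<Rightarrow> complex" where
  "conj_unmix \<beta> w = (w + of_real \<beta> * cnj w) / of_real (1 - \<beta>\<^sup>2)"

lemma conj_unmix_diff: "conj_unmix \<beta> v - conj_unmix \<beta> w = conj_unmix \<beta> (v - w)"
  by (simp add: conj_unmix_def diff_divide_distrib[symmetric] algebra_simps)

lemma conj_unmix_bound:
  assumes "\<bar>\<beta>\<bar> \<le> \<kappa>" "\<kappa> < 1"
  shows "cmod (conj_unmix \<beta> w) \<le> cmod w / (1 - \<kappa>)"
proof -
  have "\<beta>\<^sup>2 < 1" using assms by (simp add: abs_square_less_1)
  have "cmod (w + of_real \<beta> * cnj w) \<le> cmod w + \<bar>\<beta>\<bar> * cmod w"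
    by (rule norm_triangle_le) (simp add: norm_mult)
  then have "cmod (conj_unmix \<beta> w) \<le> ((1 + \<bar>\<beta>\<bar>) * cmod w) / (1 - \<beta>\<^sup>2)"
    using \<open>\<beta>\<^sup>2 < 1\<close> unfolding conj_unmix_def norm_divide norm_of_real
    by (simp add: algebra_simps divide_right_mono)
  also have "1 - \<beta>\<^sup>2 = (1 + \<bar>\<beta>\<bar>) * (1 - \<bar>\<beta>\<bar>)" by (simp add: algebra_simps power2_eq_square)
  also have "((1 + \<bar>\<beta>\<bar>) * cmod w) / ((1 + \<bar>\<beta>\<bar>) * (1 - \<bar>\<beta>\<bar>)) = cmod w / (1 - \<bar>\<beta>\<bar>)" by simp
  also have "\<dots> \<le> cmod w / (1 - \<kappa>)" using assms by (intro divide_left_mono) auto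
  finally show ?thesis .
qed

lemma conj_unmix_lower:
  assumes "\<bar>\<beta>\<bar> < 1"
  shows "cmod w / 2 \<le> cmod (conj_unmix \<beta> w)"
proof -
  have b: "0 < 1 - \<beta>\<^sup>2" using assms by (simp add: abs_square_less_1)
  have "cmod w - \<bar>\<beta>\<bar> * cmod w \<le> cmod (w + of_real \<beta> * cnj w)"
    using norm_diff_ineq[of w "of_real \<beta> * cnj w"] by (simp add: norm_mult)
  then have "((1 - \<bar>\<beta>\<bar>) * cmod w) / (1 - \<beta>\<^sup>2) \<le> cmod (conj_unmix \<beta> w)"
    using b unfolding conj_unmix_def norm_divide norm_of_real
    by (simp add: algebra_simps divide_right_mono)
  moreover have "((1 - \<bar>\<beta>\<bar>) * cmod w) / (1 - \<beta>\<^sup>2) = cmod w / (1 + \<bar>\<beta>\<bar>)"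
  proof -
    have "1 - \<beta>\<^sup>2 = (1 - \<bar>\<beta>\<bar>) * (1 + \<bar>\<beta>\<bar>)" by (simp add: algebra_simps power2_eq_square)
    moreover have "1 - \<bar>\<beta>\<bar> \<noteq> 0" using assms by simp
    ultimately show ?thesis by (simp only: mult_divide_mult_cancel_left_if if_False)
  qed
  moreover have "cmod w / 2 \<le> cmod w / (1 + \<bar>\<beta>\<bar>)" using assms by (intro divide_left_mono) auto
  ultimately show ?thesis by linarith
qed

lemma conj_unmix_continuous:
  assumes "continuous_on S b" "continuous_on S f" "\<And>z. z \<in> S \<Longrightarrow> \<bar>b z\<bar> \<le> \<kappa>" "\<kappa> < 1"
  shows "continuous_on S (\<lambda>z. conj_unmix (b z) (f z))"
proof -
  have "1 - (b z)\<^sup>2 \<noteq> 0" if "z \<in> S" for z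
  proof -
    have "(b z)\<^sup>2 < 1" using assms(3)[OF that] assms(4) by (simp add: abs_square_less_1)
    then show ?thesis by simp
  qed
  then show ?thesis unfolding conj_unmix_def
    by (intro continuous_intros assms) (simp del: of_real_diff)
qed

text \<open>For \<open>b = 0\<close> the map \<open>conj_unmix\<close> is the identity. The threshold for \<open>n\<close> does not depend on
  the phase \<open>\<tau>\<close>, so that norm identities for these functions can be averaged over \<open>\<tau>\<close>.\<close>

definition has_peaks :: "real \<Rightarrow> (complex \<Rightarrow> complex) set \<Rightarrow> (complex \<Rightarrow> real) \<Rightarrow> (complex \<Rightarrow> complex) \<Rightarrow> bool" where
  "has_peaks r0 X b u \<longleftrightarrow> (\<forall>P e. e > 0 \<longrightarrow> (\<forall>\<^sub>F n in sequentially. \<forall>\<tau>. cmod \<tau> = 1 \<longrightarrow>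
     (\<exists>f. f \<in> X \<and> continuous_on (closed_annulus r0) f \<and>
        (\<forall>z\<in>closed_annulus r0. cmod (f z - conj_unmix (b z) (\<tau> * u z ^ n * poly P (u z))) \<le> e))))"

context weighted_cauchy
begin

lemma Hp_has_peaks:
  assumes "p > 0"
  shows "has_peaks r0 (Hp r0 p) (\<lambda>z. 0) u"
  unfolding has_peaks_def
proof (intro allI impI always_eventually)
  fix P :: "complex poly" and e :: real and n :: nat and \<tau> :: complex assume e: "e > 0"
  let ?f = "\<lambda>z. \<tau> * u z ^ n * poly P (u z)"
  have hol: "?f holomorphic_on - {0}" unfolding poly_altdef by (intro holomorphic_intros u_hol)
  have sub: "closed_annulus r0 \<subseteq> - {0}" using r0 by (auto simp: closed_annulus_def)
  have c: "continuous_on (closed_annulus r0) ?f"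
    using holomorphic_on_imp_continuous_on[OF hol] sub by (rule continuous_on_subset)
  have "?f holomorphic_on annulus r0"
    using hol sub annulus_subset_closed by (meson holomorphic_on_subset order_trans)
  then have "?f \<in> Hp r0 p" using bounded_imp_hardy_bounded[OF r0 assms c] by (simp add: Hp_def)
  then show "\<exists>f. f \<in> Hp r0 p \<and> continuous_on (closed_annulus r0) f \<and>
    (\<forall>z\<in>closed_annulus r0. cmod (f z - conj_unmix 0 (\<tau> * u z ^ n * poly P (u z))) \<le> e)"
    using c e by (intro exI[of _ ?f]) (simp add: conj_unmix_def)
qed

lemma Gp_has_peaks:
  assumes p: "p > 0" and \<alpha>: "\<alpha> \<in> Linf r0"
  shows "has_peaks r0 (Gp r0 p \<alpha>) (\<lambda>z. 0) u"
  unfolding has_peaks_def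
proof (intro allI impI)
  fix P :: "complex poly" and e :: real assume e: "e > 0"
  obtain \<alpha>' M where \<alpha>': "\<alpha>' \<in> borel_measurable borel" "M \<ge> 0" "\<And>z. cmod (\<alpha>' z) \<le> M"
    "\<And>z. z \<notin> annulus r0 \<Longrightarrow> \<alpha>' z = 0" "AE z in lebesgue_on (annulus r0). \<alpha> z = \<alpha>' z"
    by (rule Linf_borel_representative[OF \<alpha>]) (rule that)
  have d: "annulus_density r0 (\<lambda>z. 0)" "annulus_density r0 \<alpha>'" using \<alpha>' by (auto simp: annulus_density_def)
  from peak_solutions[OF d e, of P]
  show "\<forall>\<^sub>F n in sequentially. \<forall>\<tau>. cmod \<tau> = 1 \<longrightarrow> (\<exists>f. f \<in> Gp r0 p \<alpha> \<and> continuous_on (closed_annulus r0) f \<and>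
        (\<forall>z\<in>closed_annulus r0. cmod (f z - conj_unmix 0 (\<tau> * u z ^ n * poly P (u z))) \<le> e))"
  proof eventually_elim
    case (elim n)
    show ?case
    proof (intro allI impI)
      fix \<tau> :: complex assume "cmod \<tau> = 1"
      with elim obtain G where G: "continuous_on (closed_annulus r0) G"
        "\<And>z. z \<in> closed_annulus r0 \<Longrightarrow> cmod (G z - \<tau> * u z ^ n * poly P (u z)) \<le> e"
        "\<And>\<psi>. \<psi> \<in> test_functions r0 \<Longrightarrow> (LINT z|lborel. (indicator (annulus r0) z *\<^sub>R G z) * d_zbar \<psi> z) =
             - (LINT z|lborel. (0 * G z + \<alpha>' z * cnj (G z)) * \<psi> z)" by blast
      have Ga: "continuous_on (annulus r0) G" using continuous_on_subset[OF G(1) annulus_subset_closed] .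
      have Gm: "G \<in> borel_measurable (lebesgue_on (annulus r0))" by (rule continuous_annulus_measurable[OF Ga])
      have Gb: "(\<lambda>z. indicator (annulus r0) z *\<^sub>R G z) \<in> borel_measurable borel"
        by (rule borel_measurable_continuous_on_indicator[OF _ Ga]) simp
      have am: "\<alpha> \<in> borel_measurable (lebesgue_on (annulus r0))" using \<alpha> by (simp add: Linf_def)
      have "weak_deriv r0 d_zbar G (\<lambda>z. \<alpha> z * cnj (G z))"
        unfolding weak_deriv_def
      proof
        fix \<psi> assume \<psi>: "\<psi> \<in> test_functions r0"
        note C1 = test_function_C1_compact[OF \<psi>]
        have pm: "\<psi> \<in> borel_measurable borel" using C1_compact_continuous[OF C1] by (rule borel_measurable_continuous_onI)
        have "(LINT z|lebesgue_on (annulus r0). G z * d_zbar \<psi> z) = (LINT z|lborel. (indicator (annulus r0) z *\<^sub>R G z) * d_zbar \<psi> z)"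
          by (rule annulus_integral_representative[OF Gm Gb _ _ d_zbar_measurable[OF C1]]) (auto intro!: AE_I2)
        also have "\<dots> = - (LINT z|lborel. (\<alpha>' z * cnj (indicator (annulus r0) z *\<^sub>R G z)) * \<psi> z)"
        proof -
          have "(0 * G z + \<alpha>' z * cnj (G z)) * \<psi> z = (\<alpha>' z * cnj (indicator (annulus r0) z *\<^sub>R G z)) * \<psi> z" for z
            using \<alpha>'(4)[of z] by (cases "z \<in> annulus r0") auto
          then show ?thesis using G(3)[OF \<psi>] by (simp only:)
        qed
        also have "(LINT z|lborel. (\<alpha>' z * cnj (indicator (annulus r0) z *\<^sub>R G z)) * \<psi> z) =
          (LINT z|lebesgue_on (annulus r0). (\<alpha> z * cnj (G z)) * \<psi> z)"
        proof (rule annulus_integral_representative[symmetric])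
          show "(\<lambda>z. \<alpha> z * cnj (G z)) \<in> borel_measurable (lebesgue_on (annulus r0))"
            using am measurable_compose[OF Gm cnj_borel] by (intro borel_measurable_times)
          show "(\<lambda>z. \<alpha>' z * cnj (indicator (annulus r0) z *\<^sub>R G z)) \<in> borel_measurable borel"
            using \<alpha>'(1) measurable_compose[OF Gb cnj_borel] by (intro borel_measurable_times)
          show "AE z in lebesgue_on (annulus r0). \<alpha> z * cnj (G z) = \<alpha>' z * cnj (indicator (annulus r0) z *\<^sub>R G z)"
            using \<alpha>'(5) unfolding AE_annulus_iff by eventually_elim auto
        qed (use \<alpha>'(4) pm in auto)
        finally show "(LINT z|lebesgue_on (annulus r0). G z * d_zbar \<psi> z) = - (LINT z|lebesgue_on (annulus r0). (\<alpha> z * cnj (G z)) * \<psi> z)" .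
      qed
      then have "G \<in> Gp r0 p \<alpha>" using Gm bounded_imp_hardy_bounded[OF r0 p G(1)] by (simp add: Gp_def)
      then show "\<exists>f. f \<in> Gp r0 p \<alpha> \<and> continuous_on (closed_annulus r0) f \<and>
        (\<forall>z\<in>closed_annulus r0. cmod (f z - conj_unmix 0 (\<tau> * u z ^ n * poly P (u z))) \<le> e)"
        using G by (intro exI[of _ G]) (simp add: conj_unmix_def)
    qed
  qed
qed

end

lemma emeasure_annulus_finite: "emeasure (lebesgue_on (annulus r0)) (annulus r0) < \<infinity>"
proof -
  have "emeasure (lebesgue_on (annulus r0)) (annulus r0) = emeasure lborel (annulus r0)"
    by (subst emeasure_restrict_space) auto
  also have "\<dots> \<le> emeasure lborel (ball (0 :: complex) 1)"
    by (rule emeasure_mono) (auto simp: annulus_def)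
  also have "\<dots> < \<infinity>" by (rule emeasure_lborel_ball_finite)
  finally show ?thesis .
qed

lemma integrable_on_annulus:
  fixes f :: "complex \<Rightarrow> complex"
  assumes "f \<in> borel_measurable (lebesgue_on (annulus r0))" "AE z in lebesgue_on (annulus r0). cmod (f z) \<le> B"
  shows "integrable (lebesgue_on (annulus r0)) f"
proof (rule integrableI_bounded_set[where A = "annulus r0" and B = B])
  show "AE z in lebesgue_on (annulus r0). z \<in> annulus r0 \<longrightarrow> norm (f z) \<le> B"
    using assms(2) by eventually_elim simp
qed (use assms(1) emeasure_annulus_finite in auto)

text \<open>Nonempty open sets have positive measure, and the closed annulus is the closure of the open
  one.\<close>

lemma AE_bound_closed_annulus:
  fixes b :: "complex \<Rightarrow> real"
  assumes r0: "0 < r0" "r0 < 1" and b: "continuous_on (closed_annulus r0) b"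
    and ae: "AE z in lebesgue_on (annulus r0). b z \<le> C" and z: "z \<in> closed_annulus r0"
  shows "b z \<le> C"
proof -
  have ann: "b w \<le> C" if w: "w \<in> annulus r0" for w
  proof (rule ccontr)
    assume "\<not> b w \<le> C"
    have "open (annulus r0 \<inter> b -` {C<..})"
      by (rule continuous_open_preimage[OF continuous_on_subset[OF b annulus_subset_closed] open_annulus]) auto
    moreover have "w \<in> annulus r0 \<inter> b -` {C<..}" using w \<open>\<not> b w \<le> C\<close> by auto
    ultimately obtain e where e: "e > 0" "ball w e \<subseteq> annulus r0 \<inter> b -` {C<..}"
      using open_contains_ball by blast
    have "AE v in lborel. v \<notin> ball w e"
      using ae[unfolded AE_annulus_iff] by eventually_elim (use e(2) in force)
    then have "emeasure lborel (ball w e) = 0" by (simp add: AE_iff_null null_sets_def ball_def)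
    then show False using e(1) by (simp add: emeasure_ball unit_ball_vol_2)
  qed
  have "z \<in> closure (annulus r0)" using z closed_annulus_subset_closure[OF r0] by auto
  then obtain X where X: "\<And>n. X n \<in> annulus r0" "X \<longlonglongrightarrow> z" unfolding closure_sequential by blast
  have "(\<lambda>n. b (X n)) \<longlonglongrightarrow> b z"
    using b X z annulus_subset_closed[of r0] unfolding continuous_on_sequentially comp_def by blast
  then show ?thesis by (rule tendsto_upperbound) (use ann X in auto)
qed

lemma real_W1inf_continuous_representative:
  assumes r0: "0 < r0" "r0 < 1" and \<nu>: "(\<lambda>z. complex_of_real (\<nu> z)) \<in> W1inf r0"
    and \<kappa>: "0 < \<kappa>" "\<kappa> < 1" "Linf_norm r0 (\<lambda>z. complex_of_real (\<nu> z)) \<le> ennreal \<kappa>"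
  obtains b where "continuous_on (closed_annulus r0) b" "AE z in lebesgue_on (annulus r0). \<nu> z = b z"
    "\<And>z. z \<in> closed_annulus r0 \<Longrightarrow> \<bar>b z\<bar> \<le> \<kappa>"
proof -
  obtain g where g: "continuous_on (closed_annulus r0) g" "AE z in lebesgue_on (annulus r0). complex_of_real (\<nu> z) = g z"
    by (rule W1inf_continuous_representative[OF r0 \<nu>]) (rule that)
  define b where "b z = Re (g z)" for z
  have bc: "continuous_on (closed_annulus r0) b" unfolding b_def by (intro continuous_intros g)
  have ae: "AE z in lebesgue_on (annulus r0). \<nu> z = b z"
    using g(2) by eventually_elim (metis Re_complex_of_real b_def)
  have "AE z in lebesgue_on (annulus r0). ennreal (cmod (complex_of_real (\<nu> z))) \<le> ennreal \<kappa>"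
    using esssup_AE[where M = "lebesgue_on (annulus r0)" and f = "\<lambda>z. ennreal (cmod (complex_of_real (\<nu> z)))"]
    by eventually_elim (use \<kappa>(3) in \<open>auto simp: Linf_norm_def intro: order_trans\<close>)
  then have ae2: "AE z in lebesgue_on (annulus r0). \<bar>b z\<bar> \<le> \<kappa>"
    using ae by eventually_elim (use \<kappa> in \<open>auto simp: ennreal_le_iff\<close>)
  have "\<bar>b z\<bar> \<le> \<kappa>" if "z \<in> closed_annulus r0" for z
    by (rule AE_bound_closed_annulus[OF r0 _ ae2 that]) (intro continuous_intros bc)
  then show thesis using that bc ae by blast
qed

text \<open>For \<open>G\<close> with \<open>d_zbar G = - n cnj f\<close>, where \<open>f = conj_unmix b G\<close>, one has \<open>f - b cnj f = G\<close>,
  and the equation for \<open>G\<close> is the conjugate Beltrami equation for \<open>f\<close>.\<close>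

lemma (in weighted_cauchy) Hp_nu_has_peaks:
  assumes p: "p > 0" and \<nu>: "(\<lambda>z. complex_of_real (\<nu> z)) \<in> W1inf r0" and \<kappa>: "0 < \<kappa>" "\<kappa> < 1"
    and b: "continuous_on (closed_annulus r0) b" and \<nu>b: "AE z in lebesgue_on (annulus r0). \<nu> z = b z"
    and b\<kappa>: "\<And>z. z \<in> closed_annulus r0 \<Longrightarrow> \<bar>b z\<bar> \<le> \<kappa>"
  shows "has_peaks r0 (Hp_nu r0 p \<nu>) b u"
  unfolding has_peaks_def
proof (intro allI impI)
  fix P :: "complex poly" and e :: real assume e: "e > 0"
  let ?A = "closed_annulus r0" and ?L = "lebesgue_on (annulus r0)"
  obtain n where n: "n \<in> Linf r0" "weak_deriv r0 d_zbar (\<lambda>z. complex_of_real (\<nu> z)) n"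
    using \<nu> by (auto simp: W1inf_def)
  obtain n' M where n': "n' \<in> borel_measurable borel" "M \<ge> 0" "\<And>z. cmod (n' z) \<le> M"
    "\<And>z. z \<notin> annulus r0 \<Longrightarrow> n' z = 0" "AE z in ?L. n z = n' z"
    by (rule Linf_borel_representative[OF n(1)]) (rule that)
  define ib where "ib z = indicator ?A z *\<^sub>R b z" for z
  have clb: "?A \<in> sets borel" using compact_closed_annulus[of r0] by (simp add: compact_imp_closed)
  have [measurable]: "ib \<in> borel_measurable borel" unfolding ib_def[abs_def]
    by (rule borel_measurable_continuous_on_indicator[OF clb b])
  have ib: "\<bar>ib z\<bar> \<le> \<kappa>" for z using b\<kappa>[of z] \<kappa> by (cases "z \<in> ?A") (auto simp: ib_def)
  have sq: "1 - \<kappa>\<^sup>2 > 0" using \<kappa> by (simp add: abs_square_less_1)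
  have ib2: "1 - \<kappa>\<^sup>2 \<le> 1 - (ib z)\<^sup>2" for z using ib[of z] abs_le_square_iff[of "ib z" \<kappa>] \<kappa> by simp
  define Bf where "Bf z = - n' z / of_real (1 - (ib z)\<^sup>2)" for z
  define Af where "Af z = Bf z * of_real (ib z)" for z
  note [measurable] = n'(1)
  have Bb: "cmod (Bf z) \<le> M / (1 - \<kappa>\<^sup>2)" for z
  proof -
    have "cmod (Bf z) = cmod (n' z) / (1 - (ib z)\<^sup>2)"
      using ib2[of z] sq by (simp add: Bf_def norm_divide del: of_real_diff)
    also have "\<dots> \<le> M / (1 - \<kappa>\<^sup>2)" using n' ib2[of z] sq by (intro frac_le) auto
    finally show ?thesis .
  qed
  have M2: "M / (1 - \<kappa>\<^sup>2) \<ge> 0" using n' sq by simp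
  have Ab: "cmod (Af z) \<le> M / (1 - \<kappa>\<^sup>2) * 1" for z
    unfolding Af_def norm_mult norm_of_real using ib[of z] \<kappa> M2 by (intro mult_mono Bb) auto
  have "Bf \<in> borel_measurable borel" unfolding Bf_def[abs_def] by measurable
  moreover then have "Af \<in> borel_measurable borel" unfolding Af_def[abs_def] by measurable
  ultimately have d: "annulus_density r0 Af" "annulus_density r0 Bf"
    using Ab Bb n'(4) unfolding annulus_density_def by (auto simp: Af_def Bf_def)
  have e': "e * (1 - \<kappa>) > 0" using e \<kappa> by simp
  from peak_solutions[OF d e', of P]
  show "\<forall>\<^sub>F n in sequentially. \<forall>\<tau>. cmod \<tau> = 1 \<longrightarrow> (\<exists>f. f \<in> Hp_nu r0 p \<nu> \<and> continuous_on ?A f \<and>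
        (\<forall>z\<in>?A. cmod (f z - conj_unmix (b z) (\<tau> * u z ^ n * poly P (u z))) \<le> e))"
  proof eventually_elim
    case (elim k)
    show ?case
    proof (intro allI impI)
      fix \<tau> :: complex assume "cmod \<tau> = 1"
      with elim obtain G where G: "continuous_on ?A G"
        "\<And>z. z \<in> ?A \<Longrightarrow> cmod (G z - \<tau> * u z ^ k * poly P (u z)) \<le> e * (1 - \<kappa>)"
        "\<And>\<psi>. \<psi> \<in> test_functions r0 \<Longrightarrow> (LINT z|lborel. (indicator (annulus r0) z *\<^sub>R G z) * d_zbar \<psi> z) =
             - (LINT z|lborel. (Af z * G z + Bf z * cnj (G z)) * \<psi> z)" by blast
      define f where "f z = conj_unmix (b z) (G z)" for z
      have fc: "continuous_on ?A f" unfolding f_def using conj_unmix_continuous[OF b G(1) b\<kappa> \<kappa>(2)] .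
      have Ga: "continuous_on (annulus r0) G" using continuous_on_subset[OF G(1) annulus_subset_closed] .
      have fa: "continuous_on (annulus r0) f" using continuous_on_subset[OF fc annulus_subset_closed] .
      have Gm: "G \<in> borel_measurable ?L" by (rule continuous_annulus_measurable[OF Ga])
      have fm: "f \<in> borel_measurable ?L" by (rule continuous_annulus_measurable[OF fa])
      have Gb: "(\<lambda>z. indicator (annulus r0) z *\<^sub>R G z) \<in> borel_measurable borel"
        by (rule borel_measurable_continuous_on_indicator[OF _ Ga]) simp
      have fb: "(\<lambda>z. indicator (annulus r0) z *\<^sub>R f z) \<in> borel_measurable borel"
        by (rule borel_measurable_continuous_on_indicator[OF _ fa]) simp
      have nm: "n \<in> borel_measurable ?L" "(\<lambda>z. complex_of_real (\<nu> z)) \<in> borel_measurable ?L"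
        using n(1) \<nu> by (auto simp: Linf_def W1inf_def)
      have nz: "complex_of_real (1 - (b z)\<^sup>2) \<noteq> 0" if "z \<in> annulus r0" for z
      proof -
        have "ib z = b z" using subsetD[OF annulus_subset_closed that] by (simp add: ib_def)
        then show ?thesis unfolding of_real_eq_0_iff using ib2[of z] sq by auto
      qed
      have unmix: "f z - of_real (b z) * cnj (f z) = G z" if "z \<in> annulus r0" for z
      proof -
        have "f z - of_real (b z) * cnj (f z) = ((G z + of_real (b z) * cnj (G z)) - of_real (b z) * (cnj (G z) + of_real (b z) * G z)) / of_real (1 - (b z)\<^sup>2)"
          by (simp add: f_def conj_unmix_def diff_divide_distrib)
        also have "(G z + of_real (b z) * cnj (G z)) - of_real (b z) * (cnj (G z) + of_real (b z) * G z) = G z * of_real (1 - (b z)\<^sup>2)"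
          by (simp add: algebra_simps power2_eq_square)
        finally show ?thesis using nz[OF that] by simp
      qed
      have rhs: "Af z * G z + Bf z * cnj (G z) = - n' z * cnj (f z)" if "z \<in> annulus r0" for z
      proof -
        have "ib z = b z" using subsetD[OF annulus_subset_closed that] by (simp add: ib_def)
        then show ?thesis
          by (simp add: Af_def Bf_def f_def conj_unmix_def add_divide_distrib diff_divide_distrib algebra_simps)
      qed
      obtain K where K: "K \<ge> 0" "\<And>z. z \<in> ?A \<Longrightarrow> norm (f z) \<le> K"
        using continuous_on_compact_bound[OF compact_closed_annulus fc] by metis
      have "weak_conj_beltrami r0 \<nu> f"
        unfolding weak_conj_beltrami_def
      proof (rule bexI[OF _ n(1)], intro conjI n(2) ballI)
        fix \<psi> assume \<psi>: "\<psi> \<in> test_functions r0"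
        note C1 = test_function_C1_compact[OF \<psi>]
        have pm: "\<psi> \<in> borel_measurable borel" using C1_compact_continuous[OF C1] by (rule borel_measurable_continuous_onI)
        have cont: "continuous_on UNIV \<psi>" "continuous_on UNIV (d_zbar \<psi>)"
          using C1_compact_continuous[OF C1] C1_compact_continuous[OF test_function_C1_compact[OF test_function_wirtinger(2)[OF \<psi>]]] by auto
        have meas: "\<psi> \<in> borel_measurable ?L" "d_zbar \<psi> \<in> borel_measurable ?L"
          using cont by (auto intro: continuous_annulus_measurable continuous_on_subset)
        obtain K1 K2 where K12: "K1 \<ge> 0" "\<And>z. z \<in> ?A \<Longrightarrow> norm (\<psi> z) \<le> K1" "K2 \<ge> 0" "\<And>z. z \<in> ?A \<Longrightarrow> norm (d_zbar \<psi> z) \<le> K2"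
          using continuous_on_compact_bound[OF compact_closed_annulus continuous_on_subset[OF cont(1)]]
            continuous_on_compact_bound[OF compact_closed_annulus continuous_on_subset[OF cont(2)]] by (metis subset_UNIV)
        have fcm: "(\<lambda>z. cnj (f z)) \<in> borel_measurable ?L" using measurable_compose[OF fm cnj_borel] .
        have i1: "integrable ?L (\<lambda>z. f z * d_zbar \<psi> z)"
        proof (rule integrable_on_annulus[where B = "K * K2"])
          show "AE z in ?L. cmod (f z * d_zbar \<psi> z) \<le> K * K2"
            unfolding norm_mult using K K12 annulus_subset_closed[of r0] by (intro AE_I2 mult_mono) auto
        qed (intro borel_measurable_times fm meas)
        have i2: "integrable ?L (\<lambda>z. cnj (f z) * (complex_of_real (\<nu> z) * d_zbar \<psi> z))"
        proof (rule integrable_on_annulus[where B = "K * (\<kappa> * K2)"])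
          have "AE z in ?L. z \<in> annulus r0" by (rule AE_I2) simp
          then show "AE z in ?L. cmod (cnj (f z) * (complex_of_real (\<nu> z) * d_zbar \<psi> z)) \<le> K * (\<kappa> * K2)"
            using \<nu>b
          proof eventually_elim
            case (elim z)
            then have "z \<in> ?A" using annulus_subset_closed by auto
            then show ?case unfolding norm_mult using elim K K12 \<kappa> b\<kappa>[of z] by (intro mult_mono) auto
          qed
        qed (intro borel_measurable_times fcm nm meas)
        have i3: "integrable ?L (\<lambda>z. cnj (f z) * (n z * \<psi> z))"
        proof (rule integrable_on_annulus[where B = "K * (M * K1)"])
          have "AE z in ?L. z \<in> annulus r0" by (rule AE_I2) simp
          then show "AE z in ?L. cmod (cnj (f z) * (n z * \<psi> z)) \<le> K * (M * K1)"
            using n'(5)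
          proof eventually_elim
            case (elim z)
            then have "z \<in> ?A" using annulus_subset_closed by auto
            then show ?case unfolding norm_mult using elim K K12 n'(2,3) by (intro mult_mono) auto
          qed
        qed (intro borel_measurable_times fcm nm meas)
        have "(LINT z|?L. f z * d_zbar \<psi> z) - (LINT z|?L. cnj (f z) * (complex_of_real (\<nu> z) * d_zbar \<psi> z)) =
          (LINT z|?L. f z * d_zbar \<psi> z - cnj (f z) * (complex_of_real (\<nu> z) * d_zbar \<psi> z))"
          by (rule Bochner_Integration.integral_diff[OF i1 i2, symmetric])
        also have "\<dots> = (LINT z|?L. G z * d_zbar \<psi> z)"
        proof (rule integral_cong_AE)
          have "AE z in ?L. z \<in> annulus r0" by (rule AE_I2) simp
          then show "AE z in ?L. f z * d_zbar \<psi> z - cnj (f z) * (complex_of_real (\<nu> z) * d_zbar \<psi> z) = G z * d_zbar \<psi> z"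
            using \<nu>b by eventually_elim (simp add: unmix[symmetric] algebra_simps)
        qed (intro borel_measurable_times borel_measurable_diff fcm fm nm meas Gm)+
        also have "\<dots> = (LINT z|lborel. (indicator (annulus r0) z *\<^sub>R G z) * d_zbar \<psi> z)"
          by (rule annulus_integral_representative[OF Gm Gb _ _ d_zbar_measurable[OF C1]]) (auto intro!: AE_I2)
        also have "\<dots> = (LINT z|lborel. (n' z * cnj (indicator (annulus r0) z *\<^sub>R f z)) * \<psi> z)"
        proof -
          have "(Af z * G z + Bf z * cnj (G z)) * \<psi> z = - ((n' z * cnj (indicator (annulus r0) z *\<^sub>R f z)) * \<psi> z)" for z
            using rhs[of z] test_function_vanishes(1)[OF \<psi>, of z] by (cases "z \<in> annulus r0") auto
          then show ?thesis using G(3)[OF \<psi>] by (simp only: Bochner_Integration.integral_minus minus_minus)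
        qed
        also have "\<dots> = (LINT z|?L. (n z * cnj (f z)) * \<psi> z)"
        proof (rule annulus_integral_representative[symmetric])
          show "(\<lambda>z. n z * cnj (f z)) \<in> borel_measurable ?L" by (intro borel_measurable_times nm fcm)
          show "(\<lambda>z. n' z * cnj (indicator (annulus r0) z *\<^sub>R f z)) \<in> borel_measurable borel"
            using n'(1) measurable_compose[OF fb cnj_borel] by (intro borel_measurable_times)
          show "AE z in ?L. n z * cnj (f z) = n' z * cnj (indicator (annulus r0) z *\<^sub>R f z)"
            using n'(5) unfolding AE_annulus_iff by eventually_elim auto
        qed (use n'(4) pm in auto)
        also have "\<dots> = (LINT z|?L. cnj (f z) * (n z * \<psi> z))" by (simp add: mult_ac)
        finally have "(LINT z|?L. f z * d_zbar \<psi> z) =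
          (LINT z|?L. cnj (f z) * (complex_of_real (\<nu> z) * d_zbar \<psi> z)) + (LINT z|?L. cnj (f z) * (n z * \<psi> z))"
          by (simp add: algebra_simps)
        also have "\<dots> = (LINT z|?L. cnj (f z) * (complex_of_real (\<nu> z) * d_zbar \<psi> z) + cnj (f z) * (n z * \<psi> z))"
          by (rule Bochner_Integration.integral_add[OF i2 i3, symmetric])
        finally show "- (LINT z|?L. f z * d_zbar \<psi> z) =
           - (LINT z|?L. cnj (f z) * (complex_of_real (\<nu> z) * d_zbar \<psi> z + n z * \<psi> z))"
          by (simp add: distrib_left)
      qed
      then have "f \<in> Hp_nu r0 p \<nu>" using fm bounded_imp_hardy_bounded[OF r0 p fc] by (simp add: Hp_nu_def)
      moreover have "cmod (f z - conj_unmix (b z) (\<tau> * u z ^ k * poly P (u z))) \<le> e" if "z \<in> ?A" for z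
      proof -
        have "cmod (f z - conj_unmix (b z) (\<tau> * u z ^ k * poly P (u z))) \<le> cmod (G z - \<tau> * u z ^ k * poly P (u z)) / (1 - \<kappa>)"
          unfolding f_def conj_unmix_diff by (rule conj_unmix_bound[OF b\<kappa>[OF that] \<kappa>(2)])
        also have "\<dots> \<le> (e * (1 - \<kappa>)) / (1 - \<kappa>)" using G(2)[OF that] \<kappa> by (intro divide_right_mono) auto
        finally show ?thesis using \<kappa> by simp
      qed
      ultimately show "\<exists>f. f \<in> Hp_nu r0 p \<nu> \<and> continuous_on ?A f \<and>
        (\<forall>z\<in>?A. cmod (f z - conj_unmix (b z) (\<tau> * u z ^ k * poly P (u z))) \<le> e)"
        using fc by blast
    qed
  qed
qed

section \<open>Integrals over the boundary circles\<close>

lemma lebesgue_on_integral: "(LINT t|lebesgue_on {0..2 * pi}. g t) = (LINT t|lebesgue. indicator {0..2 * pi} t *\<^sub>R (g t :: real))"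
  by (rule integral_restrict_space) simp

lemma integrable_lebesgue_on_iff:
  fixes a b :: real and g :: "real \<Rightarrow> real"
  shows
  "integrable (lebesgue_on {a..b}) g \<longleftrightarrow> integrable lebesgue (\<lambda>t. indicator {a..b} t *\<^sub>R g t)"
  by (rule integrable_restrict_space) simp

lemma lebesgue_shift_integrable:
  fixes g :: "real \<Rightarrow> real"
  assumes "integrable lebesgue g"
  shows "integrable lebesgue (\<lambda>t. g (c + t))"
  using lebesgue_integrable_real_affine[OF assms, of 1 c] by simp

lemma lebesgue_shift_integral:
  fixes g :: "real \<Rightarrow> real"
  shows "(LINT t|lebesgue. g (c + t)) = (LINT t|lebesgue. g t)"
  using lebesgue_integral_real_affine[of 1 g c] by simp

lemma cis_2pi_shift: "cis (t + 2 * pi) = cis t"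
  by (simp add: cis_mult[symmetric])

text \<open>Cut the period at \<open>2 pi - a\<close> and move the second piece by one period. Integrability is part of
  the statement since the integral of a function which is not integrable is \<open>0\<close>.\<close>

lemma circle_rotation_aux:
  fixes h :: "complex \<Rightarrow> real"
  assumes a: "0 \<le> a" "a \<le> 2 * pi" and i: "integrable (lebesgue_on {0..2 * pi}) (\<lambda>t. h (cis t))"
  shows "integrable (lebesgue_on {0..2 * pi}) (\<lambda>t. h (cis (t + a)))"
    "(LINT t|lebesgue_on {0..2 * pi}. h (cis (t + a))) = (LINT t|lebesgue_on {0..2 * pi}. h (cis t))"
proof -
  define F where "F t = indicator {0..2 * pi} t * h (cis t)" for t
  have F: "integrable lebesgue F" using i unfolding integrable_lebesgue_on_iff F_def by simp
  define F1 where "F1 t = indicator {a..2 * pi} t * F t" for t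
  define F2 where "F2 t = indicator {0<..a} t * F t" for t
  have F1: "integrable lebesgue F1" and F2: "integrable lebesgue F2"
    unfolding F1_def F2_def using integrable_mult_indicator[OF _ F] by auto
  have F12: "(LINT t|lebesgue. F1 t + F2 t) = (LINT t|lebesgue. F t)"
  proof (rule integral_cong_AE)
    have "AE t in lborel. t \<noteq> a \<and> t \<noteq> 0"
      using AE_lborel_singleton[of a] AE_lborel_singleton[of "0::real"] by eventually_elim simp
    then have "AE t in lebesgue. t \<noteq> a \<and> t \<noteq> 0" by (rule AE_completion)
    then show "AE t in lebesgue. F1 t + F2 t = F t"
      by eventually_elim (use a in \<open>auto simp: F1_def F2_def F_def indicator_def\<close>)
  qed (use F F1 F2 in \<open>auto intro: borel_measurable_integrable\<close>)
  define S where "S t = F1 (a + t) + F2 ((a - 2 * pi) + t)" for t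
  have S: "integrable lebesgue S"
    unfolding S_def by (intro Bochner_Integration.integrable_add lebesgue_shift_integrable F1 F2)
  have SI: "(LINT t|lebesgue. S t) = (LINT t|lebesgue. F t)"
  proof -
    have "(LINT t|lebesgue. S t) = (LINT t|lebesgue. F1 (a + t)) + (LINT t|lebesgue. F2 ((a - 2 * pi) + t))"
      unfolding S_def by (intro Bochner_Integration.integral_add lebesgue_shift_integrable F1 F2)
    also have "\<dots> = (LINT t|lebesgue. F1 t) + (LINT t|lebesgue. F2 t)" by (simp only: lebesgue_shift_integral)
    also have "\<dots> = (LINT t|lebesgue. F t)" unfolding F12[symmetric] by (rule Bochner_Integration.integral_add[OF F1 F2, symmetric])
    finally show ?thesis .
  qed
  have Seq: "S t = indicator {0..2 * pi} t *\<^sub>R h (cis (t + a))" for t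
  proof -
    have c: "cis (a + t - 2 * pi) = cis (t + a)" using cis_2pi_shift[of "a + t - 2 * pi"] by (simp add: add.commute)
    consider "t < 0" | "0 \<le> t" "t \<le> 2 * pi - a" | "2 * pi - a < t" "t \<le> 2 * pi" | "t > 2 * pi" by linarith
    then show ?thesis
    proof cases
      case 3
      then have "F1 (a + t) = 0" by (simp add: F1_def)
      moreover have "F2 ((a - 2 * pi) + t) = h (cis (t + a))"
        using 3 a c by (simp add: F2_def F_def algebra_simps)
      ultimately show ?thesis using 3 a by (simp add: S_def)
    qed (use a in \<open>auto simp: S_def F1_def F2_def F_def add.commute indicator_def\<close>)
  qed
  show "integrable (lebesgue_on {0..2 * pi}) (\<lambda>t. h (cis (t + a)))"
    unfolding integrable_lebesgue_on_iff using S unfolding Seq[abs_def] .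
  show "(LINT t|lebesgue_on {0..2 * pi}. h (cis (t + a))) = (LINT t|lebesgue_on {0..2 * pi}. h (cis t))"
    using SI unfolding lebesgue_on_integral Seq F_def by simp
qed

lemma circle_rotation:
  fixes h :: "complex \<Rightarrow> real"
  assumes c: "cmod c = 1"
  shows "(LINT t|lebesgue_on {0..2 * pi}. h (c * cis t)) = (LINT t|lebesgue_on {0..2 * pi}. h (cis t))"
proof -
  have rot: "integrable (lebesgue_on {0..2 * pi}) (\<lambda>t. k (d * cis t))"
    "(LINT t|lebesgue_on {0..2 * pi}. k (d * cis t)) = (LINT t|lebesgue_on {0..2 * pi}. k (cis t))"
    if d: "cmod d = 1" and i: "integrable (lebesgue_on {0..2 * pi}) (\<lambda>t. k (cis t))" for d and k :: "complex \<Rightarrow> real"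
  proof -
    have "d = cis (Arg2pi d)" using Arg2pi_eq[of d] d by (simp add: cis_conv_exp)
    then have e: "d * cis t = cis (t + Arg2pi d)" for t by (metis cis_mult add.commute)
    have a: "0 \<le> Arg2pi d" "Arg2pi d \<le> 2 * pi" using Arg2pi_ge_0[of d] Arg2pi_lt_2pi[of d] by auto
    show "integrable (lebesgue_on {0..2 * pi}) (\<lambda>t. k (d * cis t))"
      "(LINT t|lebesgue_on {0..2 * pi}. k (d * cis t)) = (LINT t|lebesgue_on {0..2 * pi}. k (cis t))"
      unfolding e by (fact circle_rotation_aux[OF a i])+
  qed
  show ?thesis
  proof (cases "integrable (lebesgue_on {0..2 * pi}) (\<lambda>t. h (cis t))")
    case True
    then show ?thesis by (rule rot(2)[OF c])
  next
    case False
    have "\<not> integrable (lebesgue_on {0..2 * pi}) (\<lambda>t. h (c * cis t))"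
    proof
      assume "integrable (lebesgue_on {0..2 * pi}) (\<lambda>t. h (c * cis t))"
      then have "integrable (lebesgue_on {0..2 * pi}) (\<lambda>t. h (c * (cnj c * cis t)))"
        by (rule rot(1)[of "cnj c" "\<lambda>z. h (c * z)", rotated]) (simp add: c)
      moreover have "c * (cnj c * cis t) = cis t" for t using complex_norm_square[of c] c by (simp flip: mult.assoc)
      ultimately show False using False by simp
    qed
    then show ?thesis using False by (simp add: not_integrable_integral_eq)
  qed
qed

lemma circle_reflection:
  fixes h :: "complex \<Rightarrow> real"
  shows "(LINT t|lebesgue_on {0..2 * pi}. h (cis (- t))) = (LINT t|lebesgue_on {0..2 * pi}. h (cis t))"
proof -
  have "(LINT t|lebesgue. indicator {0..2 * pi} t * h (cis t)) =
    (LINT t|lebesgue. indicator {0..2 * pi} (2 * pi + (-1) * t) * h (cis (2 * pi + (-1) * t)))"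
    using lebesgue_integral_real_affine[of "-1" "\<lambda>t. indicator {0..2 * pi} t * h (cis t)" "2 * pi"] by simp
  also have "(\<lambda>t. indicator {0..2 * pi} (2 * pi + (-1) * t) * h (cis (2 * pi + (-1) * t))) =
    (\<lambda>t. indicator {0..2 * pi} t * h (cis (- t)))"
  proof -
    have "cis (2 * pi + (-1) * t) = cis (- t)" for t using cis_2pi_shift[of "- t"] by (simp add: add.commute)
    then show ?thesis by (simp only:) (auto simp: indicator_def fun_eq_iff)
  qed
  finally show ?thesis unfolding lebesgue_on_integral by simp
qed

lemma circle_const: "(LINT t|lebesgue_on {0..2 * pi}. c) = 2 * pi * (c :: real)"
  by (subst lebesgue_integral_eq_integral) auto

lemma boundary_continuous_circles:
  assumes "0 < r0" "continuous_on (boundary r0) h"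
  shows "continuous_on {0..2 * pi} (\<lambda>t. h (cis t))" "continuous_on {0..2 * pi} (\<lambda>t. h (of_real r0 * cis t))"
  using assms by (auto intro!: continuous_on_compose2[OF assms(2)] continuous_intros)

definition boundary_integrable :: "real \<Rightarrow> (complex \<Rightarrow> real) \<Rightarrow> bool" where
  "boundary_integrable r0 h \<longleftrightarrow> integrable (lebesgue_on {0..2 * pi}) (\<lambda>t. h (cis t)) \<and>
     integrable (lebesgue_on {0..2 * pi}) (\<lambda>t. h (of_real r0 * cis t))"

lemma continuous_boundary_integrable:
  "0 < r0 \<Longrightarrow> continuous_on (boundary r0) h \<Longrightarrow> boundary_integrable r0 h"
  unfolding boundary_integrable_def
  by (auto intro!: continuous_imp_integrable_real boundary_continuous_circles)

lemma boundary_integral_mono: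
  assumes "0 < r0" "boundary_integrable r0 h" "boundary_integrable r0 k" "\<And>z. z \<in> boundary r0 \<Longrightarrow> h z \<le> k z"
  shows "boundary_integral r0 h \<le> boundary_integral r0 k"
  using assms unfolding boundary_integral_def boundary_integrable_def
  by (intro add_mono integral_mono) auto

lemma boundary_integral_add:
  assumes "boundary_integrable r0 h" "boundary_integrable r0 k"
  shows "boundary_integral r0 (\<lambda>z. h z + k z) = boundary_integral r0 h + boundary_integral r0 k"
    "boundary_integrable r0 (\<lambda>z. h z + k z)"
  using assms by (simp_all add: boundary_integral_def boundary_integrable_def)

lemma boundary_integral_diff:
  assumes "boundary_integrable r0 h" "boundary_integrable r0 k"
  shows "boundary_integral r0 (\<lambda>z. h z - k z) = boundary_integral r0 h - boundary_integral r0 k"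
    "boundary_integrable r0 (\<lambda>z. h z - k z)"
  using assms by (simp_all add: boundary_integral_def boundary_integrable_def)

lemma boundary_integral_const: "boundary_integral r0 (\<lambda>z. c) = 4 * pi * c" "boundary_integrable r0 (\<lambda>z. c)"
proof -
  show "boundary_integral r0 (\<lambda>z. c) = 4 * pi * c" by (simp only: boundary_integral_def circle_const)
  have "integrable (lebesgue_on {0..2 * pi}) (\<lambda>t. c)" by (rule continuous_imp_integrable_real) simp
  then show "boundary_integrable r0 (\<lambda>z. c)" by (simp add: boundary_integrable_def)
qed

lemma boundary_integral_close:
  assumes "0 < r0" "boundary_integrable r0 h" "boundary_integrable r0 k" "\<And>z. z \<in> boundary r0 \<Longrightarrow> \<bar>h z - k z\<bar> \<le> e"
  shows "\<bar>boundary_integral r0 h - boundary_integral r0 k\<bar> \<le> 4 * pi * e"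
proof -
  have le: "boundary_integral r0 h \<le> boundary_integral r0 k + 4 * pi * e"
    if "boundary_integrable r0 h" "boundary_integrable r0 k" "\<And>z. z \<in> boundary r0 \<Longrightarrow> \<bar>h z - k z\<bar> \<le> e" for h k
  proof -
    note a = boundary_integral_add[OF that(2) boundary_integral_const(2)[of r0 e]]
    have "boundary_integral r0 h \<le> boundary_integral r0 (\<lambda>z. k z + e)"
      by (rule boundary_integral_mono[OF assms(1) that(1) a(2)]) (use that(3) in fastforce)
    then show ?thesis by (simp add: a(1) boundary_integral_const)
  qed
  from le[OF assms(2,3,4)] le[OF assms(3,2)] assms(4) show ?thesis by (simp add: abs_le_iff abs_minus_commute)
qed

lemma boundary_integral_dominated_convergence:
  assumes r0: "0 < r0" and c: "\<And>n. continuous_on (boundary r0) (h n)"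
    and bd: "\<And>n z. z \<in> boundary r0 \<Longrightarrow> \<bar>h n z\<bar> \<le> K"
    and lim: "\<And>z. z \<in> boundary r0 \<Longrightarrow> (\<lambda>n. h n z) \<longlonglongrightarrow> l z"
  shows "boundary_integrable r0 l" "(\<lambda>n. boundary_integral r0 (h n)) \<longlonglongrightarrow> boundary_integral r0 l"
proof -
  let ?M = "lebesgue_on {0..2 * pi}"
  have key: "integrable ?M (\<lambda>t. l (g t)) \<and> (\<lambda>n. LINT t|?M. h n (g t)) \<longlonglongrightarrow> (LINT t|?M. l (g t))"
    if g: "\<And>t. g t \<in> boundary r0" and cg: "\<And>n. continuous_on {0..2 * pi} (\<lambda>t. h n (g t))" for g
  proof -
    have m: "(\<lambda>t. h n (g t)) \<in> borel_measurable ?M" for n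
      by (rule continuous_imp_measurable_on_sets_lebesgue[OF cg]) simp
    have ml: "(\<lambda>t. l (g t)) \<in> borel_measurable ?M"
      by (rule borel_measurable_LIMSEQ_real[where u = "\<lambda>n t. h n (g t)", OF _ m]) (use lim g in auto)
    have K: "integrable ?M (\<lambda>t. K)" by (rule continuous_imp_integrable_real) simp
    have L: "AE t in ?M. (\<lambda>n. h n (g t)) \<longlonglongrightarrow> l (g t)" using lim g by (intro AE_I2) auto
    have B: "AE t in ?M. norm (h n (g t)) \<le> K" for n using bd g by (intro AE_I2) auto
    show ?thesis
      using integrable_dominated_convergence[OF ml m K L B] integral_dominated_convergence[OF ml m K L B] by blast
  qed
  have 1: "integrable ?M (\<lambda>t. l (cis t)) \<and> (\<lambda>n. LINT t|?M. h n (cis t)) \<longlonglongrightarrow> (LINT t|?M. l (cis t))"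
    by (rule key) (use boundary_continuous_circles(1)[OF r0 c] r0 in auto)
  have 2: "integrable ?M (\<lambda>t. l (of_real r0 * cis t)) \<and> (\<lambda>n. LINT t|?M. h n (of_real r0 * cis t)) \<longlonglongrightarrow> (LINT t|?M. l (of_real r0 * cis t))"
    by (rule key) (use boundary_continuous_circles(2)[OF r0 c] r0 in auto)
  show "boundary_integrable r0 l" using 1 2 by (simp add: boundary_integrable_def)
  show "(\<lambda>n. boundary_integral r0 (h n)) \<longlonglongrightarrow> boundary_integral r0 l"
    unfolding boundary_integral_def using 1 2 by (intro tendsto_add) auto
qed

lemma boundary_integral_swap:
  assumes r0: "0 < r0" and H: "continuous_on ({0..2 * pi} \<times> boundary r0) (\<lambda>(\<theta>, z). H \<theta> z)"
  shows "integral {0..2 * pi} (\<lambda>\<theta>. boundary_integral r0 (H \<theta>)) =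
      boundary_integral r0 (\<lambda>z. integral {0..2 * pi} (\<lambda>\<theta>. H \<theta> z))"
    "continuous_on {0..2 * pi} (\<lambda>\<theta>. boundary_integral r0 (H \<theta>))"
    "continuous_on (boundary r0) (\<lambda>z. integral {0..2 * pi} (\<lambda>\<theta>. H \<theta> z))"
proof -
  let ?I = "{0..2 * pi}"
  have cH: "continuous_on (boundary r0) (H \<theta>)" if "\<theta> \<in> ?I" for \<theta>
  proof -
    have "continuous_on (boundary r0) (\<lambda>z. case (\<theta>, z) of (\<theta>, z) \<Rightarrow> H \<theta> z)"
      by (rule continuous_on_compose2[OF H continuous_on_Pair[OF continuous_on_const continuous_on_id]]) (use that in auto)
    then show ?thesis by simp
  qed
  have swap: "continuous_on (boundary r0) (\<lambda>z. integral (cbox 0 (2 * pi)) (\<lambda>\<theta>. H \<theta> z))"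
  proof (rule integral_continuous_on_param)
    have "continuous_on (boundary r0 \<times> cbox 0 (2 * pi)) (\<lambda>x. case (snd x, fst x) of (\<theta>, z) \<Rightarrow> H \<theta> z)"
      by (rule continuous_on_compose2[OF H]) (auto intro!: continuous_intros)
    then show "continuous_on (boundary r0 \<times> cbox 0 (2 * pi)) (\<lambda>(z, \<theta>). H \<theta> z)" by (simp add: case_prod_beta)
  qed
  then show swap': "continuous_on (boundary r0) (\<lambda>z. integral ?I (\<lambda>\<theta>. H \<theta> z))" by simp
  have key: "integral ?I (\<lambda>\<theta>. LINT t|lebesgue_on ?I. H \<theta> (g t)) = (LINT t|lebesgue_on ?I. integral ?I (\<lambda>\<theta>. H \<theta> (g t)))
      \<and> continuous_on ?I (\<lambda>\<theta>. LINT t|lebesgue_on ?I. H \<theta> (g t))"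
    if g: "\<And>t. g t \<in> boundary r0" "continuous_on UNIV g" for g
  proof -
    have c2: "continuous_on (cbox (0, 0) (2 * pi, 2 * pi)) (\<lambda>(\<theta>, t). H \<theta> (g t))"
    proof -
      have "continuous_on (cbox (0, 0) (2 * pi, 2 * pi)) (\<lambda>x. case (fst x, g (snd x)) of (\<theta>, z) \<Rightarrow> H \<theta> z)"
        by (rule continuous_on_compose2[OF H])
          (auto intro!: continuous_intros continuous_on_compose2[OF g(2)] g(1))
      then show ?thesis by (simp add: case_prod_beta)
    qed
    have c1: "continuous_on ?I (\<lambda>t. H \<theta> (g t))" if "\<theta> \<in> ?I" for \<theta>
      by (rule continuous_on_compose2[OF cH[OF that] continuous_on_subset[OF g(2)]]) (use g in auto)
    have e1: "(LINT t|lebesgue_on ?I. H \<theta> (g t)) = integral ?I (\<lambda>t. H \<theta> (g t))" if "\<theta> \<in> ?I" for \<theta>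
      by (rule lebesgue_integral_eq_integral[OF continuous_imp_integrable_real[OF c1[OF that]]]) simp
    have ci: "continuous_on ?I (\<lambda>t. integral ?I (\<lambda>\<theta>. H \<theta> (g t)))"
      by (rule continuous_on_compose2[OF swap' continuous_on_subset[OF g(2)]]) (use g in auto)
    have e2: "(LINT t|lebesgue_on ?I. integral ?I (\<lambda>\<theta>. H \<theta> (g t))) = integral ?I (\<lambda>t. integral ?I (\<lambda>\<theta>. H \<theta> (g t)))"
      by (rule lebesgue_integral_eq_integral[OF continuous_imp_integrable_real[OF ci]]) simp
    have "integral ?I (\<lambda>\<theta>. LINT t|lebesgue_on ?I. H \<theta> (g t)) = integral ?I (\<lambda>\<theta>. integral ?I (\<lambda>t. H \<theta> (g t)))"
      by (rule Henstock_Kurzweil_Integration.integral_cong) (rule e1)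
    also have "\<dots> = integral ?I (\<lambda>t. integral ?I (\<lambda>\<theta>. H \<theta> (g t)))"
      using integral_swap_continuous[OF c2] by simp
    finally have a: "integral ?I (\<lambda>\<theta>. LINT t|lebesgue_on ?I. H \<theta> (g t)) = (LINT t|lebesgue_on ?I. integral ?I (\<lambda>\<theta>. H \<theta> (g t)))"
      unfolding e2 .
    have "continuous_on ?I (\<lambda>\<theta>. integral (cbox 0 (2 * pi)) (\<lambda>t. H \<theta> (g t)))"
    proof (rule integral_continuous_on_param)
      show "continuous_on (?I \<times> cbox 0 (2 * pi)) (\<lambda>(\<theta>, t). H \<theta> (g t))" using c2 by (simp add: cbox_Pair_eq)
    qed
    then have "continuous_on ?I (\<lambda>\<theta>. LINT t|lebesgue_on ?I. H \<theta> (g t))"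
      by (rule continuous_on_eq) (simp add: e1)
    with a show ?thesis by blast
  qed
  have 1: "integral ?I (\<lambda>\<theta>. LINT t|lebesgue_on ?I. H \<theta> (cis t)) = (LINT t|lebesgue_on ?I. integral ?I (\<lambda>\<theta>. H \<theta> (cis t)))
      \<and> continuous_on ?I (\<lambda>\<theta>. LINT t|lebesgue_on ?I. H \<theta> (cis t))"
    by (rule key) (use r0 in \<open>auto intro!: continuous_intros\<close>)
  have 2: "integral ?I (\<lambda>\<theta>. LINT t|lebesgue_on ?I. H \<theta> (of_real r0 * cis t)) = (LINT t|lebesgue_on ?I. integral ?I (\<lambda>\<theta>. H \<theta> (of_real r0 * cis t)))
      \<and> continuous_on ?I (\<lambda>\<theta>. LINT t|lebesgue_on ?I. H \<theta> (of_real r0 * cis t))"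
    by (rule key) (use r0 in \<open>auto intro!: continuous_intros\<close>)
  show "continuous_on ?I (\<lambda>\<theta>. boundary_integral r0 (H \<theta>))"
    unfolding boundary_integral_def using 1 2 by (intro continuous_on_add) auto
  have "integral ?I (\<lambda>\<theta>. boundary_integral r0 (H \<theta>)) = integral ?I (\<lambda>\<theta>. LINT t|lebesgue_on ?I. H \<theta> (cis t)) +
      integral ?I (\<lambda>\<theta>. LINT t|lebesgue_on ?I. H \<theta> (of_real r0 * cis t))"
    unfolding boundary_integral_def using 1 2
    by (intro Henstock_Kurzweil_Integration.integral_add integrable_continuous_real) auto
  then show "integral ?I (\<lambda>\<theta>. boundary_integral r0 (H \<theta>)) = boundary_integral r0 (\<lambda>z. integral ?I (\<lambda>\<theta>. H \<theta> z))"
    using 1 2 by (simp add: boundary_integral_def)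
qed

section \<open>What an isometry does to the boundary\<close>

lemma powr_uniform_modulus:
  assumes p: "p > (0::real)" and e: "e > 0"
  obtains d where "d > 0" "\<And>x y. 0 \<le> x \<Longrightarrow> x \<le> K \<Longrightarrow> 0 \<le> y \<Longrightarrow> y \<le> K \<Longrightarrow> \<bar>x - y\<bar> \<le> d \<Longrightarrow> \<bar>x powr p - y powr p\<bar> \<le> e"
proof -
  have "continuous_on {0..K} (\<lambda>x. x powr p)" by (rule continuous_on_powr') (use p in \<open>auto intro: continuous_intros\<close>)
  then have "uniformly_continuous_on {0..K} (\<lambda>x. x powr p)" by (rule compact_uniformly_continuous) simp
  then obtain d where d: "d > 0" "\<And>x y. x \<in> {0..K} \<Longrightarrow> y \<in> {0..K} \<Longrightarrow> dist y x < d \<Longrightarrow> dist (y powr p) (x powr p) < e"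
    unfolding uniformly_continuous_on_def using e by blast
  show thesis
  proof (rule that[of "d / 2"])
    fix x y assume "0 \<le> x" "x \<le> K" "0 \<le> y" "y \<le> K" "\<bar>x - y\<bar> \<le> d / 2"
    then show "\<bar>x powr p - y powr p\<bar> \<le> e" using d(2)[of y x] d(1) by (auto simp: dist_real_def)
  qed (use d in simp)
qed

definition phase_mean :: "real \<Rightarrow> real \<Rightarrow> real" where
  "phase_mean p \<beta> = integral {0..2 * pi} (\<lambda>\<theta>. cmod (conj_unmix \<beta> (cis \<theta>)) powr p)"

lemma conj_unmix_of_real: "conj_unmix \<beta> (of_real r * w) = of_real r * conj_unmix \<beta> w"
  by (simp add: conj_unmix_def algebra_simps)

lemma conj_unmix_circle_continuous: "continuous_on S (\<lambda>\<theta>. conj_unmix \<beta> (cis \<theta> * w))"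
  unfolding conj_unmix_def divide_inverse by (intro continuous_intros)

text \<open>Averaging over the phase removes the dependence on the argument of \<open>w\<close>.\<close>

lemma phase_mean_eq:
  assumes p: "p > 0"
  shows "integral {0..2 * pi} (\<lambda>\<theta>. cmod (conj_unmix \<beta> (cis \<theta> * w)) powr p) = cmod w powr p * phase_mean p \<beta>"
proof -
  define c where "c = (if w = 0 then 1 else w / of_real (cmod w))"
  have c: "cmod c = 1" "w = of_real (cmod w) * c" by (auto simp: c_def norm_divide)
  define h where "h z = cmod (conj_unmix \<beta> z) powr p" for z
  have i: "integrable (lebesgue_on {0..2 * pi}) (\<lambda>\<theta>. h (cis \<theta> * v))" for v
    unfolding h_def by (intro continuous_imp_integrable_real continuous_on_norm_powr conj_unmix_circle_continuous p)
  have e: "(LINT \<theta>|lebesgue_on {0..2 * pi}. h (cis \<theta> * v)) = integral {0..2 * pi} (\<lambda>\<theta>. h (cis \<theta> * v))" for v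
    by (rule lebesgue_integral_eq_integral[OF i]) simp
  have "h (cis \<theta> * w) = cmod w powr p * h (cis \<theta> * c)" for \<theta>
  proof -
    have "cis \<theta> * w = of_real (cmod w) * (cis \<theta> * c)" by (subst c(2)) simp
    then have "h (cis \<theta> * w) = (cmod w * cmod (conj_unmix \<beta> (cis \<theta> * c))) powr p"
      by (simp only: h_def conj_unmix_of_real norm_mult norm_of_real abs_norm_cancel)
    then show ?thesis by (simp add: powr_mult h_def)
  qed
  then have "integral {0..2 * pi} (\<lambda>\<theta>. h (cis \<theta> * w)) = cmod w powr p * integral {0..2 * pi} (\<lambda>\<theta>. h (cis \<theta> * c))"
    by simp
  also have "integral {0..2 * pi} (\<lambda>\<theta>. h (cis \<theta> * c)) = (LINT \<theta>|lebesgue_on {0..2 * pi}. h (c * cis \<theta>))"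
    using e[of c] by (simp add: mult.commute)
  also have "\<dots> = (LINT \<theta>|lebesgue_on {0..2 * pi}. h (cis \<theta>))" by (rule circle_rotation[OF c(1)])
  also have "\<dots> = phase_mean p \<beta>" using e[of 1] by (simp add: phase_mean_def h_def)
  finally show ?thesis by (simp add: h_def)
qed

lemma phase_mean_pos:
  assumes "p > 0" "\<bar>\<beta>\<bar> < 1"
  shows "phase_mean p \<beta> \<ge> 2 * pi * (1 / 2) powr p"
proof -
  have "integral {0..2 * pi} (\<lambda>\<theta>. (1 / 2) powr p) \<le> phase_mean p \<beta>"
    unfolding phase_mean_def
  proof (rule integral_le)
    show "(\<lambda>\<theta>. cmod (conj_unmix \<beta> (cis \<theta>)) powr p) integrable_on {0..2 * pi}"
      using conj_unmix_circle_continuous[of "{0..2 * pi}" \<beta> 1] assms(1)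
      by (intro integrable_continuous_real continuous_on_norm_powr) auto
    show "(1 / 2) powr p \<le> cmod (conj_unmix \<beta> (cis \<theta>)) powr p" for \<theta>
      using conj_unmix_lower[OF assms(2), of "cis \<theta>"] assms(1) by (intro powr_mono2) auto
  qed auto
  then show ?thesis by simp
qed

lemma phase_mean_continuous:
  assumes p: "p > 0" and "\<kappa> < 1" "continuous_on S b" "\<And>z. z \<in> S \<Longrightarrow> \<bar>b z\<bar> \<le> \<kappa>"
  shows "continuous_on S (\<lambda>z. phase_mean p (b z))"
proof -
  have "continuous_on (S \<times> cbox 0 (2 * pi)) (\<lambda>x. cmod (conj_unmix (b (fst x)) (cis (snd x))) powr p)"
    by (intro continuous_on_norm_powr p conj_unmix_continuous[where \<kappa> = \<kappa>] continuous_on_compose2[OF assms(3)] continuous_intros)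
      (use assms in auto)
  then have "continuous_on S (\<lambda>z. integral (cbox 0 (2 * pi)) (\<lambda>\<theta>. cmod (conj_unmix (b z) (cis \<theta>)) powr p))"
    by (intro integral_continuous_on_param) (simp add: case_prod_beta)
  then show ?thesis by (simp add: phase_mean_def)
qed

text \<open>On the unit circle \<open>cnj z = 1 / z\<close>, so \<open>Re z\<close> and \<open>Im z\<close> are Laurent polynomials in \<open>z\<close>; a
  power of \<open>z\<close> clears the denominator.\<close>

lemma real_polynomial_on_circle:
  fixes q :: "complex \<Rightarrow> real"
  assumes "real_polynomial_function q"
  shows "\<exists>d P. \<forall>z. cmod z = 1 \<longrightarrow> of_real (q z) * z ^ d = poly P z"
  using assms
proof induction
  case (linear f)
  interpret bounded_linear f by (rule linear)
  have "of_real (f z) * z ^ 1 = poly [:of_real (f 1) / 2 - of_real (f \<i>) / (2 * \<i>), 0, of_real (f 1) / 2 + of_real (f \<i>) / (2 * \<i>):] z"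
    if "cmod z = 1" for z
  proof -
    have zz: "cnj z * z = 1" using complex_norm_square[of z] that by (simp add: mult.commute)
    have "f z = f (Re z *\<^sub>R 1 + Im z *\<^sub>R \<i>)" by (rule arg_cong[where f = f]) (simp add: complex_eq_iff)
    also have "\<dots> = Re z * f 1 + Im z * f \<i>" by (simp only: add scaleR real_scaleR_def)
    moreover have "(z + cnj z) / 2 = of_real (Re z)" "(z - cnj z) / (2 * \<i>) = of_real (Im z)"
      by (simp add: complex_add_cnj, subst nonzero_divide_eq_eq, auto simp: complex_eq_iff)
    ultimately have "complex_of_real (f z) = (z + cnj z) / 2 * of_real (f 1) + (z - cnj z) / (2 * \<i>) * of_real (f \<i>)"
      by simp
    then have "of_real (f z) * z = ((z + cnj z) / 2 * of_real (f 1) + (z - cnj z) / (2 * \<i>) * of_real (f \<i>)) * z"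
      by (simp only:)
    also have "\<dots> = (z * z + cnj z * z) / 2 * of_real (f 1) + (z * z - cnj z * z) / (2 * \<i>) * of_real (f \<i>)"
      by (simp add: algebra_simps add_divide_distrib diff_divide_distrib)
    finally show ?thesis unfolding zz by (simp add: algebra_simps add_divide_distrib diff_divide_distrib)
  qed
  then show ?case by blast
next
  case (const c)
  then show ?case by (intro exI[of _ 0] exI[of _ "[:of_real c:]"]) simp
next
  case (add f g)
  then obtain d1 P1 d2 P2 where P: "\<And>z. cmod z = 1 \<Longrightarrow> of_real (f z) * z ^ d1 = poly P1 z"
    "\<And>z. cmod z = 1 \<Longrightarrow> of_real (g z) * z ^ d2 = poly P2 z" by blast
  have "of_real (f z + g z) * z ^ (d1 + d2) = poly (P1 * monom 1 d2 + P2 * monom 1 d1) z" if "cmod z = 1" for z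
  proof -
    have "of_real (f z + g z) * z ^ (d1 + d2) = (of_real (f z) * z ^ d1) * z ^ d2 + (of_real (g z) * z ^ d2) * z ^ d1"
      by (simp add: power_add algebra_simps)
    then show ?thesis by (simp add: P[OF that] poly_monom)
  qed
  then show ?case by blast
next
  case (mult f g)
  then obtain d1 P1 d2 P2 where P: "\<And>z. cmod z = 1 \<Longrightarrow> of_real (f z) * z ^ d1 = poly P1 z"
    "\<And>z. cmod z = 1 \<Longrightarrow> of_real (g z) * z ^ d2 = poly P2 z" by blast
  have "of_real (f z * g z) * z ^ (d1 + d2) = poly (P1 * P2) z" if "cmod z = 1" for z
  proof -
    have "of_real (f z * g z) * z ^ (d1 + d2) = (of_real (f z) * z ^ d1) * (of_real (g z) * z ^ d2)"
      by (simp add: power_add algebra_simps)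
    then show ?thesis by (simp add: P[OF that])
  qed
  then show ?case by blast
qed

text \<open>Stone-Weierstrass gives a real polynomial in \<open>Re z\<close> and \<open>Im z\<close>, and the power of \<open>z\<close> that
  makes it a complex polynomial does not change the modulus on the circle.\<close>

lemma polynomial_modulus_approximation:
  assumes h: "continuous_on (sphere 0 1) (h :: complex \<Rightarrow> real)" and e: "e > 0"
  obtains P where "\<And>z. cmod z = 1 \<Longrightarrow> \<bar>cmod (poly P z) - \<bar>h z\<bar>\<bar> \<le> e"
proof -
  obtain q where q: "real_polynomial_function q" "\<And>z. z \<in> sphere 0 1 \<Longrightarrow> \<bar>h z - q z\<bar> < e"
    using Stone_Weierstrass_real_polynomial_function[OF compact_sphere h e] by blast
  obtain d P where P: "\<And>z. cmod z = 1 \<Longrightarrow> of_real (q z) * z ^ d = poly P z"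
    using real_polynomial_on_circle[OF q(1)] by blast
  have "\<bar>cmod (poly P z) - \<bar>h z\<bar>\<bar> \<le> e" if "cmod z = 1" for z
  proof -
    have "cmod (poly P z) = \<bar>q z\<bar>" using that by (simp flip: P add: norm_mult norm_power)
    moreover have "\<bar>h z - q z\<bar> < e" using q(2) that by simp
    ultimately show ?thesis by linarith
  qed
  then show thesis by (rule that)
qed

text \<open>Average the norm identity for the peak functions over the phase and let \<open>n\<close> tend to infinity:
  only the points with \<open>\<bar>u\<bar> = 1\<close> survive. A polynomial \<open>P\<close> with \<open>\<bar>P\<bar>\<^sup>p phase_mean = 1\<close> approximately
  turns the surviving weights into angular measure; since \<open>u\<close> is its own inverse between the circle
  \<open>\<bar>u\<bar> = 1\<close> and the unit circle, the modulus of \<open>P(u)\<close> can be prescribed on the former.\<close>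

lemma isometry_preserves_peak_mass:
  assumes r0: "0 < r0" "r0 < 1" and p: "p > 0"
    and \<Phi>: "continuous_on (closed_annulus r0) \<Phi>" "\<And>z. z \<in> closed_annulus r0 \<Longrightarrow> \<Phi> z \<in> closed_annulus r0"
    and b: "continuous_on (closed_annulus r0) b" "\<And>z. z \<in> closed_annulus r0 \<Longrightarrow> \<bar>b z\<bar> \<le> \<kappa>" "\<kappa> < 1"
    and u: "continuous_on (closed_annulus r0) u" "\<And>z. z \<in> closed_annulus r0 \<Longrightarrow> cmod (u z) \<le> 1"
      "\<And>z. z \<in> closed_annulus r0 \<Longrightarrow> u z \<noteq> 0"
      "\<And>z. z \<in> closed_annulus r0 \<Longrightarrow> cmod (u z) = 1 \<Longrightarrow> u (u z) = z"
      "\<And>w. cmod w = 1 \<Longrightarrow> u w \<in> closed_annulus r0"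
    and peaks: "has_peaks r0 X b u"
    and iso: "\<And>f. f \<in> X \<Longrightarrow> continuous_on (closed_annulus r0) f \<Longrightarrow>
      boundary_integral r0 (\<lambda>z. cmod (f z) powr p) = boundary_integral r0 (\<lambda>z. cmod (f (\<Phi> z)) powr p)"
  shows "boundary_integrable r0 (\<lambda>z. of_bool (cmod (u z) = 1))"
    "boundary_integrable r0 (\<lambda>z. of_bool (cmod (u (\<Phi> z)) = 1))"
    "boundary_integral r0 (\<lambda>z. of_bool (cmod (u (\<Phi> z)) = 1)) = boundary_integral r0 (\<lambda>z. of_bool (cmod (u z) = 1))"
proof -
  let ?A = "closed_annulus r0" and ?I = "{0..2 * pi}"
  have bA: "z \<in> ?A" "\<Phi> z \<in> ?A" if "z \<in> boundary r0" for z
    using that boundary_subset_closed[OF r0] \<Phi>(2) by auto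
  have \<Phi>b: "continuous_on (boundary r0) \<Phi>" using continuous_on_subset[OF \<Phi>(1) boundary_subset_closed[OF r0]] .
  have bc: "continuous_on (boundary r0) g" "continuous_on (boundary r0) (\<lambda>z. g (\<Phi> z))" if "continuous_on ?A g" for g :: "complex \<Rightarrow> real"
    using continuous_on_subset[OF that boundary_subset_closed[OF r0]] continuous_on_compose2[OF that \<Phi>b] bA by auto
  define Q where "Q P z = cmod (poly P (u z)) powr p * phase_mean p (b z)" for P z
  have Qc: "continuous_on ?A (Q P)" for P
    unfolding Q_def
    by (intro continuous_on_mult continuous_on_norm_powr phase_mean_continuous[OF p b(3,1,2)] p
      continuous_on_compose2[OF _ u(1), of UNIV "poly P"]) (auto intro: continuous_intros)
  define J where "J n P z = (cmod (u z) ^ n) powr p * Q P z" for n P z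
  have Jc: "continuous_on ?A (J n P)" for n P
  proof -
    have "continuous_on ?A (\<lambda>z. norm (u z ^ n) powr p)" by (intro continuous_on_norm_powr continuous_intros u(1) p)
    then show ?thesis unfolding J_def by (intro continuous_on_mult Qc) (simp add: norm_power)
  qed
  define H where "H n P \<theta> z = cmod (conj_unmix (b z) (cis \<theta> * u z ^ n * poly P (u z))) powr p" for n P \<theta> z
  have Hc: "continuous_on (?I \<times> ?A) (\<lambda>x. H n P (fst x) (snd x))" for n P
    unfolding H_def
    by (intro continuous_on_norm_powr p conj_unmix_continuous[where \<kappa> = \<kappa>] continuous_intros b(3)
       continuous_on_compose2[OF b(1)] continuous_on_compose2[OF u(1)]
       continuous_on_compose2[OF _ continuous_on_compose2[OF u(1)], of UNIV "poly P"]) (use b(2) in auto)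
  have Hmean: "integral ?I (\<lambda>\<theta>. H n P \<theta> z) = J n P z" for n P z
    using phase_mean_eq[OF p, of "b z" "u z ^ n * poly P (u z)"]
    by (simp add: H_def J_def Q_def mult.assoc norm_mult norm_power powr_mult)
  have Hb1: "continuous_on (?I \<times> boundary r0) (\<lambda>(\<theta>, z). H n P \<theta> z)" for n P
    using continuous_on_subset[OF Hc[of n P], of "?I \<times> boundary r0"] boundary_subset_closed[OF r0]
    by (auto simp: case_prod_beta)
  have Hb2: "continuous_on (?I \<times> boundary r0) (\<lambda>(\<theta>, z). H n P \<theta> (\<Phi> z))" for n P
  proof -
    have "continuous_on (?I \<times> boundary r0) (\<lambda>x. (\<lambda>x. H n P (fst x) (snd x)) (fst x, \<Phi> (snd x)))"
      by (rule continuous_on_compose2[OF Hc]) (auto intro!: continuous_intros continuous_on_compose2[OF \<Phi>b] bA)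
    then show ?thesis by (simp add: case_prod_beta)
  qed
  have Hb: "continuous_on (boundary r0) (H n P \<theta>)" "continuous_on (boundary r0) (\<lambda>z. H n P \<theta> (\<Phi> z))" if "\<theta> \<in> ?I" for n P \<theta>
  proof -
    have "continuous_on (boundary r0) (\<lambda>z. case (\<theta>, z) of (\<theta>, z) \<Rightarrow> H n P \<theta> z)"
      by (rule continuous_on_compose2[OF Hb1 continuous_on_Pair[OF continuous_on_const continuous_on_id]]) (use that in auto)
    then show "continuous_on (boundary r0) (H n P \<theta>)" by simp
    have "continuous_on (boundary r0) (\<lambda>z. case (\<theta>, z) of (\<theta>, z) \<Rightarrow> H n P \<theta> (\<Phi> z))"
      by (rule continuous_on_compose2[OF Hb2 continuous_on_Pair[OF continuous_on_const continuous_on_id]]) (use that in auto)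
    then show "continuous_on (boundary r0) (\<lambda>z. H n P \<theta> (\<Phi> z))" by simp
  qed
  have near: "\<forall>\<^sub>F n in sequentially. \<bar>boundary_integral r0 (J n P) - boundary_integral r0 (\<lambda>z. J n P (\<Phi> z))\<bar> \<le> \<epsilon>"
    if \<epsilon>: "\<epsilon> > 0" for P \<epsilon>
  proof -
    have "continuous_on (cball 0 1) (poly P)" by (intro continuous_intros)
    then obtain KP where KP: "KP \<ge> 0" "\<And>z. z \<in> cball 0 1 \<Longrightarrow> norm (poly P z) \<le> KP"
      using continuous_on_compact_bound[OF compact_cball] by metis
    define K0 where "K0 = KP / (1 - \<kappa>)"
    define \<epsilon>' where "\<epsilon>' = \<epsilon> / (16 * pi * pi)"
    have \<epsilon>': "\<epsilon>' > 0" using \<epsilon> by (simp add: \<epsilon>'_def)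
    obtain d where d: "d > 0" "\<And>x y. 0 \<le> x \<Longrightarrow> x \<le> K0 + 1 \<Longrightarrow> 0 \<le> y \<Longrightarrow> y \<le> K0 + 1 \<Longrightarrow> \<bar>x - y\<bar> \<le> d \<Longrightarrow> \<bar>x powr p - y powr p\<bar> \<le> \<epsilon>'"
      by (rule powr_uniform_modulus[OF p \<epsilon>', of "K0 + 1"]) (rule that)
    define e' where "e' = min d 1"
    have e': "e' > 0" "e' \<le> d" "e' \<le> 1" using d by (auto simp: e'_def)
    have "\<forall>\<^sub>F n in sequentially. \<forall>\<tau>. cmod \<tau> = 1 \<longrightarrow> (\<exists>f. f \<in> X \<and> continuous_on ?A f \<and>
        (\<forall>z\<in>?A. cmod (f z - conj_unmix (b z) (\<tau> * u z ^ n * poly P (u z))) \<le> e'))"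
      using peaks e'(1) unfolding has_peaks_def by blast
    then show ?thesis
    proof eventually_elim
      case (elim n)
      have each: "\<bar>boundary_integral r0 (H n P \<theta>) - boundary_integral r0 (\<lambda>z. H n P \<theta> (\<Phi> z))\<bar> \<le> 8 * pi * \<epsilon>'" if \<theta>: "\<theta> \<in> ?I" for \<theta>
      proof -
        obtain f where f: "f \<in> X" "continuous_on ?A f"
          "\<And>z. z \<in> ?A \<Longrightarrow> cmod (f z - conj_unmix (b z) (cis \<theta> * u z ^ n * poly P (u z))) \<le> e'"
          using elim[rule_format, of "cis \<theta>"] by auto
        have pt: "\<bar>cmod (f z) powr p - H n P \<theta> z\<bar> \<le> \<epsilon>'" if z: "z \<in> ?A" for z
        proof -
          let ?w = "cis \<theta> * u z ^ n * poly P (u z)"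
          have "cmod ?w \<le> 1 * KP"
            unfolding norm_mult norm_power norm_cis using u(2)[OF z] KP by (intro mult_mono) (auto simp: power_le_one)
          then have w: "cmod (conj_unmix (b z) ?w) \<le> K0"
            using order_trans[OF conj_unmix_bound[OF b(2)[OF z] b(3), of ?w]] b(3)
            by (simp add: K0_def divide_right_mono)
          have a: "\<bar>cmod (f z) - cmod (conj_unmix (b z) ?w)\<bar> \<le> e'"
            using f(3)[OF z] norm_triangle_ineq3[of "f z" "conj_unmix (b z) ?w"] by linarith
          show ?thesis unfolding H_def
          proof (rule d(2))
            show "cmod (f z) \<le> K0 + 1" "cmod (conj_unmix (b z) ?w) \<le> K0 + 1" "\<bar>cmod (f z) - cmod (conj_unmix (b z) ?w)\<bar> \<le> d"
              using a w e' by linarith+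
          qed auto
        qed
        have fc: "continuous_on ?A (\<lambda>z. cmod (f z) powr p)" by (intro continuous_on_norm_powr f p)
        have "\<bar>boundary_integral r0 (\<lambda>z. cmod (f z) powr p) - boundary_integral r0 (H n P \<theta>)\<bar> \<le> 4 * pi * \<epsilon>'"
          by (intro boundary_integral_close r0 continuous_boundary_integrable bc(1)[OF fc] Hb(1)[OF \<theta>] pt bA)
        moreover have "\<bar>boundary_integral r0 (\<lambda>z. cmod (f (\<Phi> z)) powr p) - boundary_integral r0 (\<lambda>z. H n P \<theta> (\<Phi> z))\<bar> \<le> 4 * pi * \<epsilon>'"
          by (intro boundary_integral_close r0 continuous_boundary_integrable bc(2)[OF fc] Hb(2)[OF \<theta>] pt bA)
        ultimately show ?thesis using iso[OF f(1,2)] by linarith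
      qed
      have "boundary_integral r0 (J n P) - boundary_integral r0 (\<lambda>z. J n P (\<Phi> z)) =
        integral ?I (\<lambda>\<theta>. boundary_integral r0 (H n P \<theta>)) - integral ?I (\<lambda>\<theta>. boundary_integral r0 (\<lambda>z. H n P \<theta> (\<Phi> z)))"
        using boundary_integral_swap(1)[OF r0(1) Hb1[of n P]] boundary_integral_swap(1)[OF r0(1) Hb2[of n P]]
        by (simp add: Hmean)
      also have "\<dots> = integral ?I (\<lambda>\<theta>. boundary_integral r0 (H n P \<theta>) - boundary_integral r0 (\<lambda>z. H n P \<theta> (\<Phi> z)))"
        by (intro Henstock_Kurzweil_Integration.integral_diff[symmetric] integrable_continuous_real
          boundary_integral_swap(2)[OF r0(1) Hb1] boundary_integral_swap(2)[OF r0(1) Hb2])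
      finally have "norm (boundary_integral r0 (J n P) - boundary_integral r0 (\<lambda>z. J n P (\<Phi> z))) \<le> integral ?I (\<lambda>\<theta>. 8 * pi * \<epsilon>')"
        using each by (simp only:) (intro integral_norm_bound_integral integrable_diff integrable_continuous_real
          boundary_integral_swap(2)[OF r0(1) Hb1] boundary_integral_swap(2)[OF r0(1) Hb2], auto)
      also have "\<dots> = 2 * pi * (8 * pi * \<epsilon>')" by simp
      also have "\<dots> = \<epsilon>" by (simp add: \<epsilon>'_def)
      finally show ?case by simp
    qed
  qed
  define L where "L P z = of_bool (cmod (u z) = 1) * Q P z" for P z
  have Jlim: "(\<lambda>n. J n P z) \<longlonglongrightarrow> L P z" if z: "z \<in> ?A" for P z
  proof -
    define x where "x = cmod (u z) powr p"
    have x: "0 < x" using u(3)[OF z] by (simp add: x_def)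
    have "(cmod (u z) ^ n) powr p = x ^ n" for n
      using u(3)[OF z] by (simp add: x_def powr_powr mult.commute flip: powr_realpow)
    moreover have "(\<lambda>n. x ^ n) \<longlonglongrightarrow> of_bool (cmod (u z) = 1)"
    proof (cases "cmod (u z) = 1")
      case False
      then have "cmod (u z) < 1" using u(2)[OF z] by simp
      then have "x < 1" using p u(3)[OF z] powr_less_mono2[of p "cmod (u z)" 1] by (simp add: x_def)
      then show ?thesis using False x by (simp add: LIMSEQ_power_zero)
    qed (simp add: x_def)
    ultimately show ?thesis unfolding J_def L_def by (simp only:) (intro tendsto_mult tendsto_const)
  qed
  have lims: "boundary_integrable r0 (L P)" "boundary_integrable r0 (\<lambda>z. L P (\<Phi> z))"
    "boundary_integral r0 (L P) = boundary_integral r0 (\<lambda>z. L P (\<Phi> z))" for P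
  proof -
    obtain K where K: "K \<ge> 0" "\<And>z. z \<in> ?A \<Longrightarrow> norm (Q P z) \<le> K"
      using continuous_on_compact_bound[OF compact_closed_annulus Qc[of P]] by metis
    have Jb: "\<bar>J n P z\<bar> \<le> K" if z: "z \<in> ?A" for n z
    proof -
      have "(cmod (u z) ^ n) powr p \<le> 1" using u(2)[OF z] p by (intro powr_le1) (auto simp: power_le_one)
      then have "(cmod (u z) ^ n) powr p * \<bar>Q P z\<bar> \<le> 1 * K" using K(2)[OF z] by (intro mult_mono) auto
      then show ?thesis by (simp add: J_def abs_mult)
    qed
    note d1 = boundary_integral_dominated_convergence[OF r0(1) bc(1)[OF Jc[of _ P]] Jb[OF bA(1)] Jlim[OF bA(1)]]
    note d2 = boundary_integral_dominated_convergence[OF r0(1) bc(2)[OF Jc[of _ P]] Jb[OF bA(2)] Jlim[OF bA(2)]]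
    show "boundary_integrable r0 (L P)" by (rule d1(1))
    show "boundary_integrable r0 (\<lambda>z. L P (\<Phi> z))" by (rule d2(1))
    have "(\<lambda>n. boundary_integral r0 (J n P) - boundary_integral r0 (\<lambda>z. J n P (\<Phi> z))) \<longlonglongrightarrow> 0"
      unfolding tendsto_iff dist_real_def diff_0_right
    proof (intro allI impI)
      fix e :: real assume "e > 0"
      then have "e / 2 > 0" by simp
      from near[OF this, of P] show "\<forall>\<^sub>F n in sequentially. \<bar>boundary_integral r0 (J n P) - boundary_integral r0 (\<lambda>z. J n P (\<Phi> z))\<bar> < e"
        by eventually_elim (use \<open>e > 0\<close> in linarith)
    qed
    moreover have "(\<lambda>n. boundary_integral r0 (J n P) - boundary_integral r0 (\<lambda>z. J n P (\<Phi> z))) \<longlonglongrightarrow>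
      boundary_integral r0 (L P) - boundary_integral r0 (\<lambda>z. L P (\<Phi> z))"
      by (intro tendsto_diff d1(2) d2(2))
    ultimately show "boundary_integral r0 (L P) = boundary_integral r0 (\<lambda>z. L P (\<Phi> z))"
      using LIMSEQ_unique by fastforce
  qed
  have one: "boundary_integrable r0 (\<lambda>z. of_bool (cmod (u z) = 1))" "boundary_integrable r0 (\<lambda>z. of_bool (cmod (u (\<Phi> z)) = 1))"
  proof -
    have pl: "(\<lambda>n. cmod (u z) ^ n) \<longlonglongrightarrow> of_bool (cmod (u z) = 1)" if "z \<in> ?A" for z
      using u(2)[OF that] by (cases "cmod (u z) = 1") (auto intro: LIMSEQ_power_zero)
    have pc: "continuous_on ?A (\<lambda>z. cmod (u z) ^ n)" for n by (intro continuous_intros u(1))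
    have pb: "\<bar>cmod (u z) ^ n\<bar> \<le> 1" if "z \<in> ?A" for n z using u(2)[OF that] by (simp add: power_le_one)
    show "boundary_integrable r0 (\<lambda>z. of_bool (cmod (u z) = 1))"
      by (rule boundary_integral_dominated_convergence(1)[OF r0(1) bc(1)[OF pc] pb[OF bA(1)] pl[OF bA(1)]])
    show "boundary_integrable r0 (\<lambda>z. of_bool (cmod (u (\<Phi> z)) = 1))"
      by (rule boundary_integral_dominated_convergence(1)[OF r0(1) bc(2)[OF pc] pb[OF bA(2)] pl[OF bA(2)]])
  qed
  show "boundary_integrable r0 (\<lambda>z. of_bool (cmod (u z) = 1))" "boundary_integrable r0 (\<lambda>z. of_bool (cmod (u (\<Phi> z)) = 1))"
    by (fact one)+
  have small: "\<bar>boundary_integral r0 (\<lambda>z. of_bool (cmod (u (\<Phi> z)) = 1)) - boundary_integral r0 (\<lambda>z. of_bool (cmod (u z) = 1))\<bar> \<le> 8 * pi * \<eta>"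
    if \<eta>: "\<eta> > 0" for \<eta>
  proof -
    have PM: "phase_mean p (b z) > 0" if "z \<in> ?A" for z
    proof -
      have "\<bar>b z\<bar> < 1" using b(2)[OF that] b(3) by linarith
      then have "2 * pi * (1 / 2) powr p \<le> phase_mean p (b z)" by (rule phase_mean_pos[OF p])
      moreover have "2 * pi * (1 / 2) powr p > 0" by simp
      ultimately show ?thesis by linarith
    qed
    have mc: "continuous_on ?A (\<lambda>z. phase_mean p (b z))" by (rule phase_mean_continuous[OF p b(3,1,2)])
    obtain Km where Km: "Km \<ge> 0" "\<And>z. z \<in> ?A \<Longrightarrow> norm (phase_mean p (b z)) \<le> Km"
      using continuous_on_compact_bound[OF compact_closed_annulus mc] by metis
    define h where "h w = phase_mean p (b (u w)) powr (- 1 / p)" for w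
    have uA: "u ` sphere 0 1 \<subseteq> ?A" "sphere 0 1 \<subseteq> ?A" using u(5) r0 by (auto simp: closed_annulus_def)
    have hc: "continuous_on (sphere 0 1) h"
      unfolding h_def
      using PM uA by (intro continuous_on_powr continuous_on_const continuous_on_compose2[OF mc continuous_on_subset[OF u(1)]])
        (auto simp: less_imp_neq[symmetric])
    have h0: "h w > 0" if "cmod w = 1" for w using PM[OF u(5)[OF that]] by (simp add: h_def)
    obtain Kh where Kh: "Kh \<ge> 0" "\<And>w. w \<in> sphere 0 1 \<Longrightarrow> norm (h w) \<le> Kh"
      using continuous_on_compact_bound[OF compact_sphere hc] by metis
    define \<eta>' where "\<eta>' = \<eta> / (Km + 1)"
    have \<eta>': "\<eta>' > 0" using \<eta> Km by (simp add: \<eta>'_def)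
    obtain d where d: "d > 0" "\<And>x y. 0 \<le> x \<Longrightarrow> x \<le> Kh + 1 \<Longrightarrow> 0 \<le> y \<Longrightarrow> y \<le> Kh + 1 \<Longrightarrow> \<bar>x - y\<bar> \<le> d \<Longrightarrow> \<bar>x powr p - y powr p\<bar> \<le> \<eta>'"
      by (rule powr_uniform_modulus[OF p \<eta>', of "Kh + 1"]) (rule that)
    have "min d 1 > 0" using d by simp
    from polynomial_modulus_approximation[OF hc this] obtain P where
      P: "\<And>z. cmod z = 1 \<Longrightarrow> \<bar>cmod (poly P z) - \<bar>h z\<bar>\<bar> \<le> min d 1" by metis
    have Q1: "\<bar>Q P z - 1\<bar> \<le> \<eta>" if z: "z \<in> ?A" "cmod (u z) = 1" for z
    proof -
      let ?w = "u z" and ?m = "phase_mean p (b z)"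
      have uu: "u ?w = z" using u(4)[OF z] .
      have hp: "h ?w powr p = 1 / ?m"
      proof -
        have "h ?w powr p = ?m powr (- 1 / p * p)" by (simp only: h_def uu powr_powr)
        also have "- 1 / p * p = - 1" using p by simp
        finally show ?thesis using PM[OF z(1)] by (simp add: powr_minus_divide)
      qed
      have a: "\<bar>cmod (poly P ?w) - h ?w\<bar> \<le> min d 1" using P[OF z(2)] h0[OF z(2)] by simp
      have hK: "h ?w \<le> Kh" using Kh(2)[of ?w] z(2) h0[OF z(2)] by simp
      have "\<bar>cmod (poly P ?w) powr p - h ?w powr p\<bar> \<le> \<eta>'"
      proof (rule d(2))
        have a': "\<bar>cmod (poly P ?w) - h ?w\<bar> \<le> d" "\<bar>cmod (poly P ?w) - h ?w\<bar> \<le> 1" using a by auto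
        then show "\<bar>cmod (poly P ?w) - h ?w\<bar> \<le> d" "cmod (poly P ?w) \<le> Kh + 1" using hK by linarith+
        show "0 \<le> h ?w" "h ?w \<le> Kh + 1" using hK h0[OF z(2)] by linarith+
      qed simp
      then have "\<bar>cmod (poly P ?w) powr p - 1 / ?m\<bar> * ?m \<le> \<eta>' * Km"
        unfolding hp using Km(2)[OF z(1)] PM[OF z(1)] \<eta>' by (intro mult_mono) auto
      also have "\<dots> \<le> \<eta>" using \<eta> Km by (simp add: \<eta>'_def field_simps)
      also have "\<bar>cmod (poly P ?w) powr p - 1 / ?m\<bar> * ?m = \<bar>(cmod (poly P ?w) powr p - 1 / ?m) * ?m\<bar>"
        using PM[OF z(1)] by (simp add: abs_mult)
      also have "(cmod (poly P ?w) powr p - 1 / ?m) * ?m = Q P z - 1"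
        using PM[OF z(1)] by (simp add: Q_def left_diff_distrib)
      finally show ?thesis .
    qed
    have L1: "\<bar>L P z - of_bool (cmod (u z) = 1)\<bar> \<le> \<eta>" if "z \<in> ?A" for z
      using Q1[OF that] \<eta> by (cases "cmod (u z) = 1") (auto simp: L_def)
    have "\<bar>boundary_integral r0 (L P) - boundary_integral r0 (\<lambda>z. of_bool (cmod (u z) = 1))\<bar> \<le> 4 * pi * \<eta>"
      by (intro boundary_integral_close r0 lims one L1 bA)
    moreover have "\<bar>boundary_integral r0 (\<lambda>z. L P (\<Phi> z)) - boundary_integral r0 (\<lambda>z. of_bool (cmod (u (\<Phi> z)) = 1))\<bar> \<le> 4 * pi * \<eta>"
      by (intro boundary_integral_close r0 lims one L1 bA)
    ultimately show ?thesis using lims(3)[of P] by linarith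
  qed
  show "boundary_integral r0 (\<lambda>z. of_bool (cmod (u (\<Phi> z)) = 1)) = boundary_integral r0 (\<lambda>z. of_bool (cmod (u z) = 1))"
  proof (rule ccontr)
    assume ne: "\<not> ?thesis"
    define d where "d = \<bar>boundary_integral r0 (\<lambda>z. of_bool (cmod (u (\<Phi> z)) = 1)) - boundary_integral r0 (\<lambda>z. of_bool (cmod (u z) = 1))\<bar>"
    have d: "d > 0" using ne by (simp add: d_def)
    then have "d / (16 * pi) > 0" by simp
    from small[OF this] have "d \<le> d / 2" unfolding d_def[symmetric] by simp
    with d show False by linarith
  qed
qed

section \<open>Rigidity\<close>

text \<open>By the maximum modulus principle for \<open>F\<close> and for \<open>1 / F\<close>, the modulus is \<open>1\<close> everywhere,
  which forces \<open>F\<close> to be constant.\<close>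

lemma unimodular_boundary_constant:
  assumes r0: "0 < r0" "r0 < 1" and c: "continuous_on (closed_annulus r0) F" and hol: "F holomorphic_on annulus r0"
    and nz: "\<And>z. z \<in> annulus r0 \<Longrightarrow> F z \<noteq> 0" and one: "\<And>z. z \<in> boundary r0 \<Longrightarrow> cmod (F z) = 1"
  obtains l where "cmod l = 1" "\<And>z. z \<in> annulus r0 \<Longrightarrow> F z = l"
proof -
  have int: "interior (annulus r0) = annulus r0" using open_annulus by (simp add: interior_open)
  have cl: "closure (annulus r0) \<subseteq> closed_annulus r0"
    by (rule closure_minimal[OF annulus_subset_closed compact_imp_closed[OF compact_closed_annulus]])
  have bd: "bounded (annulus r0)" using compact_imp_bounded[OF compact_closed_annulus] annulus_subset_closed by (rule bounded_subset)
  have fr: "z \<in> boundary r0" if "z \<in> frontier (annulus r0)" for z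
  proof -
    have "z \<in> closed_annulus r0" "z \<notin> annulus r0" using that cl by (auto simp: frontier_def int)
    then show ?thesis by (auto simp: boundary_def closed_annulus_def annulus_def)
  qed
  have nz': "F z \<noteq> 0" if "z \<in> closed_annulus r0" for z
    using that nz[of z] one[of z] by (cases "z \<in> annulus r0") (auto simp: closed_annulus_def annulus_def boundary_def)
  have n1: "cmod (F z) \<le> 1" if "z \<in> annulus r0" for z
    by (rule maximum_modulus_frontier[of F "annulus r0"])
      (use hol continuous_on_subset[OF c cl] bd one fr that in \<open>auto simp: int\<close>)
  have n2: "cmod (1 / F z) \<le> 1" if "z \<in> annulus r0" for z
  proof (rule maximum_modulus_frontier[of "\<lambda>z. 1 / F z" "annulus r0"])
    show "(\<lambda>z. 1 / F z) holomorphic_on interior (annulus r0)" unfolding int using nz by (intro holomorphic_intros hol) auto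
    show "continuous_on (closure (annulus r0)) (\<lambda>z. 1 / F z)"
      using nz' cl by (intro continuous_intros continuous_on_subset[OF c cl]) auto
    show "cmod (1 / F z) \<le> 1" if "z \<in> frontier (annulus r0)" for z
      using one[OF fr[OF that]] by (simp add: norm_divide)
  qed (use bd that in auto)
  have n: "cmod (F z) = 1" if "z \<in> annulus r0" for z
  proof -
    have "1 \<le> cmod (F z)" using n2[OF that] nz[OF that] by (simp add: norm_divide divide_le_eq)
    then show ?thesis using n1[OF that] by linarith
  qed
  define z0 where "z0 = complex_of_real ((1 + r0) / 2)"
  have "cmod z0 = (1 + r0) / 2" unfolding z0_def norm_of_real using r0 by simp
  then have z0: "z0 \<in> annulus r0" using r0 by (simp add: annulus_def)
  have "connected (annulus r0)"
    using connected_annulus(1)[where a = "0 :: complex"] by (simp add: annulus_def)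
  then have "F constant_on annulus r0"
    using n z0 by (intro maximum_modulus_principle[OF hol open_annulus _ open_annulus order_refl z0]) auto
  then obtain l where "\<And>z. z \<in> annulus r0 \<Longrightarrow> F z = l" by (auto simp: constant_on_def)
  then show thesis using that[of l] n[OF z0] z0 by auto
qed

text \<open>The two level sets exhaust the boundary, hence by continuity each circle is mapped into one
  circle; the sizes of the level sets exclude that both go to the same circle.\<close>

lemma boundary_masses_imp_automorphism:
  assumes r0: "0 < r0" "r0 < 1" and \<phi>: "\<phi> holomorphic_on annulus r0" "\<And>z. z \<in> annulus r0 \<Longrightarrow> \<phi> z \<in> annulus r0"
    and \<Phi>: "continuous_on (closed_annulus r0) \<Phi>" "\<And>z. z \<in> closed_annulus r0 \<Longrightarrow> \<Phi> z \<in> closed_annulus r0"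
      "\<And>z. z \<in> annulus r0 \<Longrightarrow> \<Phi> z = \<phi> z"
    and int: "boundary_integrable r0 (\<lambda>z. of_bool (cmod (\<Phi> z) = 1))" "boundary_integrable r0 (\<lambda>z. of_bool (cmod (\<Phi> z) = r0))"
    and mass: "boundary_integral r0 (\<lambda>z. of_bool (cmod (\<Phi> z) = 1)) = 2 * pi"
      "boundary_integral r0 (\<lambda>z. of_bool (cmod (\<Phi> z) = r0)) = 2 * pi"
  shows "(\<exists>l. cmod l = 1 \<and> (\<forall>z\<in>annulus r0. \<phi> z = l * z)) \<or>
         (\<exists>\<mu>. cmod \<mu> = 1 \<and> (\<forall>z\<in>annulus r0. \<phi> z = \<mu> * (of_real r0 / z)))"
proof -
  let ?I = "{0..2 * pi}" and ?A = "closed_annulus r0"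
  have bA: "z \<in> ?A" "\<Phi> z \<in> ?A" if "z \<in> boundary r0" for z
    using that boundary_subset_closed[OF r0] \<Phi>(2) by auto
  have \<Phi>b: "continuous_on (boundary r0) \<Phi>" using continuous_on_subset[OF \<Phi>(1) boundary_subset_closed[OF r0]] .
  \<comment> \<open>A continuous function that vanishes exactly where \<open>\<Phi>\<close> takes boundary values and is at most
    \<open>1\<close> elsewhere. The two masses add up to the total \<open>4 pi\<close>, so its integral is zero.\<close>
  define D where "D z = (1 - cmod (\<Phi> z)) * (cmod (\<Phi> z) - r0)" for z
  have Dc: "continuous_on (boundary r0) D" unfolding D_def by (intro continuous_intros \<Phi>b)
  have D0: "D z \<ge> 0" if "z \<in> boundary r0" for z
    using bA(2)[OF that] by (simp add: D_def closed_annulus_def)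
  have Dle: "D z \<le> 1 - (of_bool (cmod (\<Phi> z) = 1) + of_bool (cmod (\<Phi> z) = r0))" if "z \<in> boundary r0" for z
  proof -
    have "cmod (\<Phi> z) \<le> 1" "r0 \<le> cmod (\<Phi> z)" using bA(2)[OF that] by (auto simp: closed_annulus_def)
    then have "D z \<le> 1 * 1" unfolding D_def using r0 by (intro mult_mono) auto
    then show ?thesis using r0 by (auto simp: D_def)
  qed
  note s = boundary_integral_add[OF int]
  note d = boundary_integral_diff[OF boundary_integral_const(2)[of r0 1] s(2)]
  have "boundary_integral r0 D \<le> boundary_integral r0 (\<lambda>z. 1 - (of_bool (cmod (\<Phi> z) = 1) + of_bool (cmod (\<Phi> z) = r0)))"
    by (rule boundary_integral_mono[OF r0(1) continuous_boundary_integrable[OF r0(1) Dc] d(2) Dle])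
  also have "\<dots> = 0" by (simp add: d(1) s(1) mass boundary_integral_const)
  finally have "boundary_integral r0 D \<le> 0" .
  moreover have D12: "(LINT t|lebesgue_on ?I. D (cis t)) \<ge> 0" "(LINT t|lebesgue_on ?I. D (of_real r0 * cis t)) \<ge> 0"
    using D0 r0 by (auto intro!: integral_nonneg_AE AE_I2)
  ultimately have z: "(LINT t|lebesgue_on ?I. D (cis t)) = 0" "(LINT t|lebesgue_on ?I. D (of_real r0 * cis t)) = 0"
    by (simp_all add: boundary_integral_def)
  have Dz: "\<forall>t\<in>?I. D (cis t) = 0" "\<forall>t\<in>?I. D (of_real r0 * cis t) = 0"
    using z integralL_eq_0_iff[OF boundary_continuous_circles(1)[OF r0(1) Dc]] integralL_eq_0_iff[OF boundary_continuous_circles(2)[OF r0(1) Dc]]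
      D0 r0 by auto
  have const: "(\<forall>t\<in>?I. cmod (\<Phi> (g t)) = 1) \<or> (\<forall>t\<in>?I. cmod (\<Phi> (g t)) = r0)"
    if g: "\<And>t. g t \<in> boundary r0" "continuous_on ?I g" and Dg: "\<forall>t\<in>?I. D (g t) = 0" for g
  proof -
    have "continuous_on ?I (\<lambda>t. cmod (\<Phi> (g t)))"
      by (intro continuous_intros continuous_on_compose2[OF \<Phi>b g(2)]) (use g in auto)
    then have "connected ((\<lambda>t. cmod (\<Phi> (g t))) ` ?I)" by (rule connected_continuous_image) simp
    moreover have sub: "(\<lambda>t. cmod (\<Phi> (g t))) ` ?I \<subseteq> {1, r0}" using Dg by (auto simp: D_def)
    then have "finite ((\<lambda>t. cmod (\<Phi> (g t))) ` ?I)" by (rule finite_subset) simp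
    ultimately obtain a where "(\<lambda>t. cmod (\<Phi> (g t))) ` ?I = {a}"
      using connected_finite_iff_sing by fastforce
    then have a: "\<And>t. t \<in> ?I \<Longrightarrow> cmod (\<Phi> (g t)) = a" by auto
    moreover have "0 \<in> ?I" by simp
    then have "a \<in> {1, r0}" using sub a by blast
    ultimately show ?thesis by auto
  qed
  have circ: "\<exists>t\<in>?I. z = of_real s * cis t" if "cmod z = s" "s > 0" for z s
  proof -
    have "z = of_real s * cis (Arg2pi z)" using Arg2pi_eq[of z] that by (simp add: cis_conv_exp)
    then show ?thesis using Arg2pi_ge_0[of z] Arg2pi_lt_2pi[of z] by (intro bexI[of _ "Arg2pi z"]) auto
  qed
  have whole: "\<forall>z. cmod z = s \<longrightarrow> cmod (\<Phi> z) = a"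
    if sp: "s > 0" and sa: "\<forall>t\<in>?I. cmod (\<Phi> (of_real s * cis t)) = a" for s a
  proof (intro allI impI)
    fix z assume "cmod z = s"
    then obtain t where "t \<in> ?I" "z = of_real s * cis t" using circ[OF _ sp] by blast
    then show "cmod (\<Phi> z) = a" using sa by simp
  qed
  have "(\<forall>t\<in>?I. cmod (\<Phi> (of_real 1 * cis t)) = 1) \<or> (\<forall>t\<in>?I. cmod (\<Phi> (of_real 1 * cis t)) = r0)"
    by (rule const) (use Dz(1) r0 in \<open>auto intro!: continuous_intros\<close>)
  then have c1: "(\<forall>z. cmod z = 1 \<longrightarrow> cmod (\<Phi> z) = 1) \<or> (\<forall>z. cmod z = 1 \<longrightarrow> cmod (\<Phi> z) = r0)"
    using whole[OF zero_less_one, of 1] whole[OF zero_less_one, of r0] by blast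
  have "(\<forall>t\<in>?I. cmod (\<Phi> (of_real r0 * cis t)) = 1) \<or> (\<forall>t\<in>?I. cmod (\<Phi> (of_real r0 * cis t)) = r0)"
    by (rule const) (use Dz(2) r0 in \<open>auto intro!: continuous_intros\<close>)
  then have c2: "(\<forall>z. cmod z = r0 \<longrightarrow> cmod (\<Phi> z) = 1) \<or> (\<forall>z. cmod z = r0 \<longrightarrow> cmod (\<Phi> z) = r0)"
    using whole[OF r0(1), of 1] whole[OF r0(1), of r0] by blast
  have not_both: "\<not> (\<forall>z\<in>boundary r0. cmod (\<Phi> z) = 1)" "\<not> (\<forall>z\<in>boundary r0. cmod (\<Phi> z) = r0)"
  proof -
    show "\<not> (\<forall>z\<in>boundary r0. cmod (\<Phi> z) = 1)"
    proof
      assume "\<forall>z\<in>boundary r0. cmod (\<Phi> z) = 1"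
      then have "boundary_integral r0 (\<lambda>z. of_bool (cmod (\<Phi> z) = 1)) = boundary_integral r0 (\<lambda>z. 1)"
        by (intro boundary_integral_cong r0) auto
      then show False using mass by (simp add: boundary_integral_const)
    qed
    show "\<not> (\<forall>z\<in>boundary r0. cmod (\<Phi> z) = r0)"
    proof
      assume "\<forall>z\<in>boundary r0. cmod (\<Phi> z) = r0"
      then have "boundary_integral r0 (\<lambda>z. of_bool (cmod (\<Phi> z) = r0)) = boundary_integral r0 (\<lambda>z. 1)"
        by (intro boundary_integral_cong r0) auto
      then show False using mass by (simp add: boundary_integral_const)
    qed
  qed
  have bcases: "cmod z = 1 \<or> cmod z = r0" if "z \<in> boundary r0" for z using that by (auto simp: boundary_def)
  have nz: "z \<noteq> 0" if "z \<in> ?A" for z using that r0 by (auto simp: closed_annulus_def)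
  have nza: "z \<noteq> 0" if "z \<in> annulus r0" for z using that r0 by (auto simp: annulus_def)
  show ?thesis
  proof (cases "\<forall>z. cmod z = 1 \<longrightarrow> cmod (\<Phi> z) = 1")
    case True
    then have T2: "\<forall>z. cmod z = r0 \<longrightarrow> cmod (\<Phi> z) = r0" using c2 not_both(1) bcases by blast
    obtain l where l: "cmod l = 1" "\<And>z. z \<in> annulus r0 \<Longrightarrow> \<Phi> z / z = l"
    proof (rule unimodular_boundary_constant[OF r0, of "\<lambda>z. \<Phi> z / z"])
      show "continuous_on ?A (\<lambda>z. \<Phi> z / z)" using nz by (intro continuous_intros \<Phi>(1)) auto
      have "(\<lambda>z. \<phi> z / z) holomorphic_on annulus r0" using nza by (intro holomorphic_intros \<phi>(1)) auto
      then show "(\<lambda>z. \<Phi> z / z) holomorphic_on annulus r0" by (rule holomorphic_transform) (simp add: \<Phi>(3))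
      show "\<Phi> z / z \<noteq> 0" if "z \<in> annulus r0" for z using nza[OF that] nza[OF \<phi>(2)[OF that]] \<Phi>(3)[OF that] by simp
      show "cmod (\<Phi> z / z) = 1" if "z \<in> boundary r0" for z
        using bcases[OF that] True T2 r0 by (auto simp: norm_divide)
    qed (rule that)
    have "\<phi> z = l * z" if "z \<in> annulus r0" for z using l(2)[OF that] nza[OF that] \<Phi>(3)[OF that] by (simp add: field_simps)
    then show ?thesis using l(1) by blast
  next
    case False
    then have T1: "\<forall>z. cmod z = 1 \<longrightarrow> cmod (\<Phi> z) = r0" using c1 by blast
    then have T2: "\<forall>z. cmod z = r0 \<longrightarrow> cmod (\<Phi> z) = 1" using c2 not_both(2) bcases by blast
    obtain l where l: "cmod l = 1" "\<And>z. z \<in> annulus r0 \<Longrightarrow> \<Phi> z * z / of_real r0 = l"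
    proof (rule unimodular_boundary_constant[OF r0, of "\<lambda>z. \<Phi> z * z / of_real r0"])
      show "continuous_on ?A (\<lambda>z. \<Phi> z * z / of_real r0)" using r0 by (intro continuous_intros \<Phi>(1)) auto
      have "(\<lambda>z. \<phi> z * z / of_real r0) holomorphic_on annulus r0" using r0 by (intro holomorphic_intros \<phi>(1)) auto
      then show "(\<lambda>z. \<Phi> z * z / of_real r0) holomorphic_on annulus r0" by (rule holomorphic_transform) (simp add: \<Phi>(3))
      show "\<Phi> z * z / of_real r0 \<noteq> 0" if "z \<in> annulus r0" for z
        using nza[OF that] nza[OF \<phi>(2)[OF that]] \<Phi>(3)[OF that] r0 by simp
      show "cmod (\<Phi> z * z / of_real r0) = 1" if "z \<in> boundary r0" for z
        using bcases[OF that] T1 T2 r0 by (auto simp: norm_divide norm_mult)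
    qed (rule that)
    have "\<phi> z = l * (of_real r0 / z)" if "z \<in> annulus r0" for z
      using l(2)[OF that] nza[OF that] \<Phi>(3)[OF that] r0 by (simp add: field_simps)
    then show ?thesis using l(1) by blast
  qed
qed

section \<open>Holomorphic change of variables\<close>

text \<open>Complex numbers as vectors, whose linear maps have a matrix and a Jacobian determinant.\<close>

definition to_plane :: "complex \<Rightarrow> real^2" where
  "to_plane z = vector [Re z, Im z]"

definition of_plane :: "real^2 \<Rightarrow> complex" where
  "of_plane x = Complex (x $ 1) (x $ 2)"

lemma plane_inverse [simp]: "of_plane (to_plane z) = z" "to_plane (of_plane x) = x"
  by (simp_all add: of_plane_def to_plane_def complex_eq_iff vec_eq_iff forall_2)

lemma to_plane_linear: "bounded_linear to_plane"
proof (rule linear_conv_bounded_linear[THEN iffD1], rule linearI)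
qed (simp_all add: to_plane_def vec_eq_iff forall_2)

lemma of_plane_linear: "bounded_linear of_plane"
proof (rule linear_conv_bounded_linear[THEN iffD1], rule linearI)
qed (simp_all add: of_plane_def complex_eq_iff)

lemma plane_borel [measurable]: "to_plane \<in> borel_measurable borel" "of_plane \<in> borel_measurable borel"
  using to_plane_linear of_plane_linear by (auto intro: borel_measurable_continuous_onI linear_continuous_on)

lemma lborel_to_plane: "distr lborel borel to_plane = lborel"
proof (rule lborel_eqI[symmetric])
  fix l u :: "real^2" assume le: "\<And>b. b \<in> Basis \<Longrightarrow> l \<bullet> b \<le> u \<bullet> b"
  have le2: "l $ 1 \<le> u $ 1" "l $ 2 \<le> u $ 2"
    using le[of "axis 1 1"] le[of "axis 2 1"] by (auto simp: inner_axis)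
  have "to_plane -` box l u = box (of_plane l) (of_plane u)"
    by (auto simp: box_def to_plane_def of_plane_def Basis_complex_def Basis_vec_def inner_axis forall_2)
  then have "emeasure (distr lborel borel to_plane) (box l u) = emeasure lborel (box (of_plane l) (of_plane u))"
    by (subst emeasure_distr) auto
  also have "\<dots> = ennreal (\<Prod>b\<in>Basis. (of_plane u - of_plane l) \<bullet> b)"
    by (rule emeasure_lborel_box) (use le2 in \<open>auto simp: Basis_complex_def of_plane_def\<close>)
  also have "(\<Prod>b\<in>Basis. (of_plane u - of_plane l) \<bullet> b) = (u $ 1 - l $ 1) * (u $ 2 - l $ 2)"
    by (simp add: Basis_complex_def of_plane_def)
  also have "\<dots> = (\<Prod>b\<in>Basis. (u - l) \<bullet> b)"
  proof -
    have B: "(Basis :: (real^2) set) = {axis 1 1, axis 2 1}"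
      by (auto simp: Basis_vec_def) (metis exhaust_2)
    have "axis 1 1 \<noteq> (axis 2 1 :: real^2)" by (simp add: axis_eq_axis)
    then have "(\<Prod>b\<in>{axis 1 1, axis 2 1}. (u - l) \<bullet> b) = ((u - l) \<bullet> axis 1 1) * ((u - l) \<bullet> axis 2 1)" by simp
    then show ?thesis unfolding B by (simp add: inner_axis)
  qed
  finally show "emeasure (distr lborel borel to_plane) (box l u) = ennreal (\<Prod>b\<in>Basis. (u - l) \<bullet> b)" .
qed simp

lemma plane_integral:
  fixes K :: "complex \<Rightarrow> complex"
  assumes K[measurable]: "K \<in> borel_measurable borel" and A: "A \<in> sets borel" and off: "\<And>z. z \<notin> A \<Longrightarrow> K z = 0"
  shows "(\<lambda>x. to_plane (K (of_plane x))) absolutely_integrable_on (to_plane ` A) \<longleftrightarrow> integrable lborel K"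
    "integrable lborel K \<Longrightarrow> integral (to_plane ` A) (\<lambda>x. to_plane (K (of_plane x))) = to_plane (LINT z|lborel. K z)"
proof -
  let ?f = "\<lambda>x. to_plane (K (of_plane x))"
  have im: "to_plane ` A = of_plane -` A"
  proof
    show "of_plane -` A \<subseteq> to_plane ` A"
    proof
      fix x assume "x \<in> of_plane -` A"
      then show "x \<in> to_plane ` A" by (intro image_eqI[of _ _ "of_plane x"]) auto
    qed
  qed auto
  have Ap: "to_plane ` A \<in> sets borel" unfolding im using measurable_sets[OF plane_borel(2) A] by simp
  have [measurable]: "?f \<in> borel_measurable borel" by measurable
  have zero: "to_plane 0 = 0" by (simp add: linear_0 bounded_linear.linear to_plane_linear)
  have ind: "(\<lambda>x. indicator (to_plane ` A) x *\<^sub>R ?f x) = ?f"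
    unfolding im by (auto simp: fun_eq_iff indicator_def off zero)
  have i1: "integrable lborel ?f \<longleftrightarrow> integrable lborel (\<lambda>z. to_plane (K z))"
    using integrable_distr_eq[of to_plane lborel borel ?f] by (simp add: lborel_to_plane)
  have i2: "integrable lborel (\<lambda>z. to_plane (K z)) \<longleftrightarrow> integrable lborel K"
    using integrable_bounded_linear[OF to_plane_linear, of lborel K]
      integrable_bounded_linear[OF of_plane_linear, of lborel "\<lambda>z. to_plane (K z)"] by auto
  have ab: "?f absolutely_integrable_on (to_plane ` A) \<longleftrightarrow> integrable lborel ?f"
    unfolding set_integrable_def ind by (rule integrable_completion) simp
  show "?f absolutely_integrable_on (to_plane ` A) \<longleftrightarrow> integrable lborel K" using ab i1 i2 by simp
  assume iK: "integrable lborel K"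
  then have ai: "?f absolutely_integrable_on (to_plane ` A)" using ab i1 i2 by simp
  have "integral (to_plane ` A) ?f = (LINT x : to_plane ` A | lebesgue. ?f x)"
    by (rule set_lebesgue_integral_eq_integral(2)[OF ai, symmetric])
  also have "\<dots> = (LINT x|lebesgue. ?f x)" unfolding set_lebesgue_integral_def ind ..
  also have "\<dots> = (LINT x|lborel. ?f x)" by (rule integral_completion) simp
  also have "\<dots> = (LINT x|distr lborel borel to_plane. ?f x)" by (simp only: lborel_to_plane)
  also have "\<dots> = (LINT z|lborel. to_plane (K z))" by (subst integral_distr) auto
  also have "\<dots> = to_plane (LINT z|lborel. K z)" by (rule integral_bounded_linear[OF to_plane_linear iK])
  finally show "integral (to_plane ` A) ?f = to_plane (LINT z|lborel. K z)" .
qed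

lemma det_complex_multiplication:
  "det (matrix (\<lambda>v. to_plane (a * of_plane v))) = (cmod a)\<^sup>2"
proof -
  have m: "matrix (\<lambda>v. to_plane (a * of_plane v)) $ i $ j = to_plane (a * of_plane (axis j 1)) $ i" for i j
    by (simp add: matrix_def)
  show ?thesis unfolding det_2 m cmod_power2
    by (simp add: to_plane_def of_plane_def axis_def power2_eq_square)
qed

text \<open>As a real-linear map, multiplication by \<open>\<phi>'\<close> has determinant \<open>\<bar>\<phi>'\<bar>\<^sup>2\<close>.\<close>

lemma holomorphic_change_of_variables:
  fixes K :: "complex \<Rightarrow> complex"
  assumes A: "open A" and \<phi>: "\<phi> holomorphic_on A" "inj_on \<phi> A" "\<phi> ` A = A"
    and K[measurable]: "K \<in> borel_measurable borel" and off: "\<And>z. z \<notin> A \<Longrightarrow> K z = 0"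
  shows "(LINT w|lborel. K w) = (LINT z|lborel. indicator A z *\<^sub>R ((cmod (deriv \<phi> z))\<^sup>2 *\<^sub>R K (\<phi> z)))"
proof -
  let ?P = "to_plane ` A"
  define g where "g x = to_plane (\<phi> (of_plane x))" for x
  define g' where "g' x v = to_plane (deriv \<phi> (of_plane x) * of_plane v)" for x v
  define K2 where "K2 z = indicator A z *\<^sub>R ((cmod (deriv \<phi> z))\<^sup>2 *\<^sub>R K (\<phi> z))" for z
  have Ab: "A \<in> sets borel" using A by simp
  have \<phi>m: "(\<lambda>z. indicator A z *\<^sub>R \<phi> z) \<in> borel_measurable borel" "(\<lambda>z. indicator A z *\<^sub>R deriv \<phi> z) \<in> borel_measurable borel"
    using holomorphic_on_imp_continuous_on[OF \<phi>(1)] holomorphic_on_imp_continuous_on[OF holomorphic_deriv[OF \<phi>(1) A]]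
    by (auto intro!: borel_measurable_continuous_on_indicator[OF Ab])
  have K2eq: "K2 = (\<lambda>z. indicator A z *\<^sub>R ((cmod (indicator A z *\<^sub>R deriv \<phi> z))\<^sup>2 *\<^sub>R K (indicator A z *\<^sub>R \<phi> z)))"
    by (auto simp: K2_def indicator_def fun_eq_iff)
  have K2m: "K2 \<in> borel_measurable borel" unfolding K2eq using \<phi>m Ab by measurable
  have K2off: "K2 z = 0" if "z \<notin> A" for z using that by (simp add: K2_def)
  have "g ` ?P = to_plane ` (\<phi> ` A)" by (simp add: g_def image_image)
  then have gP: "g ` ?P = ?P" by (simp only: \<phi>(3))
  have ginj: "inj_on g ?P"
    unfolding g_def using \<phi>(2) by (auto simp: inj_on_def) (metis plane_inverse(1))
  have gd: "(g has_derivative g' x) (at x within ?P)" if "x \<in> ?P" for x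
  proof -
    have zA: "of_plane x \<in> A" using that by auto
    have d1: "(\<phi> has_derivative (\<lambda>v. deriv \<phi> (of_plane x) * v)) (at (of_plane x))"
      using holomorphic_derivI[OF \<phi>(1) A zA] by (simp add: has_field_derivative_def)
    have d2: "((\<lambda>x. \<phi> (of_plane x)) has_derivative (\<lambda>v. deriv \<phi> (of_plane x) * of_plane v)) (at x)"
      by (rule has_derivative_compose[OF bounded_linear_imp_has_derivative[OF of_plane_linear] d1])
    have "(g has_derivative (\<lambda>v. to_plane (deriv \<phi> (of_plane x) * of_plane v))) (at x)"
      unfolding g_def[abs_def]
      by (rule has_derivative_compose[OF d2 bounded_linear_imp_has_derivative[OF to_plane_linear]])
    then show ?thesis unfolding g'_def[abs_def] by (rule has_derivative_at_withinI)
  qed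
  have Pl: "?P \<in> sets lebesgue"
  proof -
    have "?P = of_plane -` A"
    proof
      show "of_plane -` A \<subseteq> ?P"
      proof
        fix x assume "x \<in> of_plane -` A"
        then show "x \<in> ?P" by (intro image_eqI[of _ _ "of_plane x"]) auto
      qed
    qed auto
    then have "?P \<in> sets borel" using measurable_sets[OF plane_borel(2) Ab] by simp
    then show ?thesis by simp
  qed
  let ?f = "\<lambda>x. to_plane (K (of_plane x))" and ?f2 = "\<lambda>x. to_plane (K2 (of_plane x))"
  have scal: "to_plane (r *\<^sub>R w) = r *\<^sub>R to_plane w" for r w
    by (simp add: linear_cmul bounded_linear.linear to_plane_linear)
  have f2: "\<bar>det (matrix (g' x))\<bar> *\<^sub>R ?f (g x) = ?f2 x" if "x \<in> ?P" for x
  proof -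
    have "\<bar>det (matrix (g' x))\<bar> = (cmod (deriv \<phi> (of_plane x)))\<^sup>2"
      unfolding g'_def[abs_def] det_complex_multiplication by simp
    moreover have "of_plane x \<in> A" using that by auto
    ultimately show ?thesis by (simp add: g_def K2_def scal)
  qed
  have cv: "((\<lambda>x. \<bar>det (matrix (g' x))\<bar> *\<^sub>R ?f (g x)) absolutely_integrable_on ?P \<and>
       integral ?P (\<lambda>x. \<bar>det (matrix (g' x))\<bar> *\<^sub>R ?f (g x)) = b) \<longleftrightarrow>
     (?f absolutely_integrable_on (g ` ?P) \<and> integral (g ` ?P) ?f = b)" for b
    by (rule has_absolute_integral_change_of_variables[OF Pl gd ginj])
  have e1: "(\<lambda>x. \<bar>det (matrix (g' x))\<bar> *\<^sub>R ?f (g x)) absolutely_integrable_on ?P \<longleftrightarrow> ?f2 absolutely_integrable_on ?P"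
    unfolding set_integrable_def by (intro arg_cong[where f = "integrable lebesgue"] ext) (auto simp: indicator_def f2)
  have e2: "integral ?P (\<lambda>x. \<bar>det (matrix (g' x))\<bar> *\<^sub>R ?f (g x)) = integral ?P ?f2"
    by (rule Henstock_Kurzweil_Integration.integral_cong) (rule f2)
  note c = cv[unfolded e1 e2 gP]
  have p1: "?f2 absolutely_integrable_on ?P \<longleftrightarrow> integrable lborel K2" by (rule plane_integral(1)[OF K2m Ab K2off])
  have p2: "?f absolutely_integrable_on ?P \<longleftrightarrow> integrable lborel K" by (rule plane_integral(1)[OF K Ab off])
  show ?thesis
  proof (cases "integrable lborel K")
    case True
    have "integral ?P ?f = to_plane (LINT z|lborel. K z)" by (rule plane_integral(2)[OF K Ab off True])
    with True have "?f absolutely_integrable_on ?P \<and> integral ?P ?f = to_plane (LINT z|lborel. K z)" using p2 by blast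
    then have f2i: "?f2 absolutely_integrable_on ?P \<and> integral ?P ?f2 = to_plane (LINT z|lborel. K z)" using c by blast
    then have i2: "integrable lborel K2" using p1 by blast
    then have "to_plane (LINT z|lborel. K2 z) = to_plane (LINT z|lborel. K z)"
    proof -
      have "integral ?P ?f2 = to_plane (LINT z|lborel. K2 z)" by (rule plane_integral(2)[OF K2m Ab K2off i2])
      then show ?thesis using f2i by simp
    qed
    then have "(LINT z|lborel. K2 z) = (LINT z|lborel. K z)" by (metis plane_inverse(1))
    then show ?thesis by (simp add: K2_def)
  next
    case False
    then have "\<not> integrable lborel K2" using c p1 p2 by blast
    then have "(LINT z|lborel. K2 z) = 0" by (rule not_integrable_integral_eq)
    moreover have "(LINT z|lborel. K z) = 0" using False by (rule not_integrable_integral_eq)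
    ultimately show ?thesis unfolding K2_def[symmetric] by simp
  qed
qed

section \<open>Automorphisms of the annulus act isometrically\<close>

lemma AE_equal_measurable:
  fixes f g :: "complex \<Rightarrow> complex"
  assumes f: "f \<in> borel_measurable (lebesgue_on (annulus r0))"
    and ae: "AE z in lebesgue_on (annulus r0). g z = f z"
  shows "g \<in> borel_measurable (lebesgue_on (annulus r0))"
proof -
  have "\<exists>N\<in>null_sets lborel. {z \<in> space lborel. \<not> (z \<in> annulus r0 \<longrightarrow> g z = f z)} \<subseteq> N"
    by (rule ae[unfolded AE_annulus_iff, unfolded eventually_ae_filter])
  then obtain N where N: "N \<in> null_sets lborel" "{z \<in> space lborel. \<not> (z \<in> annulus r0 \<longrightarrow> g z = f z)} \<subseteq> N"
    by (rule bexE)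
  have neg: "negligible N" using null_sets_completionI[OF N(1)] by (simp add: negligible_iff_null_sets)
  have "f measurable_on annulus r0" using f by (simp add: measurable_on_iff_borel_measurable)
  then have "g measurable_on annulus r0" by (rule measurable_on_spike[OF _ neg]) (use N(2) in auto)
  then show ?thesis by (simp add: measurable_on_iff_borel_measurable)
qed

text \<open>Here \<open>\<phi>\<close> and \<open>\<eta>\<close> are inverse to each other on the annulus. Composition with \<open>\<phi>\<close> acts on
  solutions, composition with \<open>\<eta>\<close> on test functions.\<close>

locale annulus_automorphism = annulus_substitution +
  fixes B :: real
  assumes \<phi>_hol: "\<phi> holomorphic_on annulus r0"
    and \<eta>_maps: "\<And>w. w \<in> annulus r0 \<Longrightarrow> \<eta> w \<in> annulus r0"
    and \<phi>_inverse: "\<And>z. z \<in> annulus r0 \<Longrightarrow> \<eta> (\<phi> z) = z"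
    and deriv_bound: "\<And>z. z \<in> annulus r0 \<Longrightarrow> cmod (deriv \<phi> z) \<le> B"
begin

lemma \<phi>_inj: "inj_on \<phi> (annulus r0)"
  using \<phi>_inverse by (metis inj_onI)

lemma \<phi>_onto: "\<phi> ` annulus r0 = annulus r0"
proof
  show "annulus r0 \<subseteq> \<phi> ` annulus r0"
  proof
    fix w assume "w \<in> annulus r0"
    then have e: "\<eta> w \<in> annulus r0" by (rule \<eta>_maps)
    have "w = \<phi> (\<eta> w)" using conjunct2[OF \<eta>_inverse[OF e]] by (rule sym)
    with e show "w \<in> \<phi> ` annulus r0" by (intro image_eqI[of _ _ "\<eta> w"])
  qed
qed (use \<phi>_maps in auto)

lemma nonzero: "z \<in> annulus r0 \<Longrightarrow> z \<noteq> 0"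
  using r0 by (auto simp: annulus_def)

lemma deriv_inverse:
  assumes z: "z \<in> annulus r0"
  shows "deriv \<eta> (\<phi> z) * deriv \<phi> z = 1"
proof -
  have "(\<eta> has_field_derivative deriv \<eta> (\<phi> z)) (at (\<phi> z))"
    by (rule holomorphic_derivI[OF \<eta>_hol]) (use nonzero[OF \<phi>_maps[OF z]] in \<open>auto simp: open_Compl\<close>)
  from DERIV_chain[OF this holomorphic_derivI[OF \<phi>_hol open_annulus z]]
  have 1: "((\<eta> \<circ> \<phi>) has_field_derivative deriv \<eta> (\<phi> z) * deriv \<phi> z) (at z)" .
  have "((\<lambda>z. z) has_field_derivative 1) (at z)" by simp
  then have "((\<eta> \<circ> \<phi>) has_field_derivative 1) (at z)"
    by (rule has_field_derivative_transform_within_open[OF _ open_annulus z]) (simp add: \<phi>_inverse)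
  with 1 show ?thesis by (rule DERIV_unique)
qed

lemma AE_compose:
  assumes "AE z in lebesgue_on (annulus r0). P z"
  shows "AE z in lebesgue_on (annulus r0). P (\<phi> z)"
proof -
  have "\<exists>N\<in>null_sets lborel. {z \<in> space lborel. \<not> (z \<in> annulus r0 \<longrightarrow> P z)} \<subseteq> N"
    by (rule assms[unfolded AE_annulus_iff, unfolded eventually_ae_filter])
  then obtain N where N: "N \<in> null_sets lborel" "{z \<in> space lborel. \<not> (z \<in> annulus r0 \<longrightarrow> P z)} \<subseteq> N"
    by (rule bexE)
  have neg: "negligible N" using null_sets_completionI[OF N(1)] by (simp add: negligible_iff_null_sets)
  have "negligible (\<eta> ` (N \<inter> annulus r0))"
  proof (rule negligible_differentiable_image_negligible)
    show "negligible (N \<inter> annulus r0)" using neg by (rule negligible_subset) auto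
    have "\<eta> holomorphic_on annulus r0" by (rule holomorphic_on_subset[OF \<eta>_hol]) (use nonzero in auto)
    then have "\<eta> differentiable_on annulus r0" by (rule holomorphic_on_imp_differentiable_on)
    then show "\<eta> differentiable_on N \<inter> annulus r0" by (rule differentiable_on_subset) auto
  qed auto
  then have "\<eta> ` (N \<inter> annulus r0) \<in> null_sets lebesgue" by (simp add: negligible_iff_null_sets)
  then have "AE z in lebesgue. z \<in> annulus r0 \<longrightarrow> P (\<phi> z)"
  proof (rule AE_I')
    show "{z \<in> space lebesgue. \<not> (z \<in> annulus r0 \<longrightarrow> P (\<phi> z))} \<subseteq> \<eta> ` (N \<inter> annulus r0)"
    proof
      fix z assume "z \<in> {z \<in> space lebesgue. \<not> (z \<in> annulus r0 \<longrightarrow> P (\<phi> z))}"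
      then have z: "z \<in> annulus r0" "\<not> P (\<phi> z)" by auto
      then have "\<phi> z \<in> N \<inter> annulus r0" using N(2) \<phi>_maps by auto
      then show "z \<in> \<eta> ` (N \<inter> annulus r0)" using \<phi>_inverse[OF z(1)] by (metis image_eqI)
    qed
  qed
  then show ?thesis by (simp add: AE_restrict_space_iff)
qed

lemma \<phi>_indicator_borel: "(\<lambda>z. indicator (annulus r0) z *\<^sub>R \<phi> z) \<in> borel_measurable borel"
  by (rule borel_measurable_continuous_on_indicator[OF _ \<phi>_cont]) simp

lemma deriv_\<phi>_continuous: "continuous_on (annulus r0) (deriv \<phi>)"
  by (intro holomorphic_on_imp_continuous_on holomorphic_deriv[OF \<phi>_hol open_annulus])

lemma deriv_\<phi>_measurable: "deriv \<phi> \<in> borel_measurable (lebesgue_on (annulus r0))"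
  by (rule continuous_annulus_measurable[OF deriv_\<phi>_continuous])

lemma measurable_compose_\<phi>:
  fixes K :: "complex \<Rightarrow> complex"
  assumes "K \<in> borel_measurable (lebesgue_on (annulus r0))"
  shows "(\<lambda>z. K (\<phi> z)) \<in> borel_measurable (lebesgue_on (annulus r0))"
proof -
  obtain g where g: "g \<in> borel_measurable borel" "\<And>z. z \<notin> annulus r0 \<Longrightarrow> g z = 0"
    "AE z in lebesgue_on (annulus r0). K z = g z"
    by (rule measurable_borel_representative[OF assms]) (rule that)
  have "(\<lambda>z. g (indicator (annulus r0) z *\<^sub>R \<phi> z)) \<in> borel_measurable borel"
    using measurable_compose[OF \<phi>_indicator_borel g(1)] .
  then have "(\<lambda>z. g (indicator (annulus r0) z *\<^sub>R \<phi> z)) \<in> borel_measurable (lebesgue_on (annulus r0))"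
    by (intro measurable_restrict_space1 measurable_completion) simp
  moreover have "AE z in lebesgue_on (annulus r0). K (\<phi> z) = g (indicator (annulus r0) z *\<^sub>R \<phi> z)"
    using AE_compose[OF g(3)] unfolding AE_annulus_iff by eventually_elim simp
  ultimately show ?thesis by (rule AE_equal_measurable)
qed

lemma change_of_variables:
  fixes K :: "complex \<Rightarrow> complex"
  assumes K: "K \<in> borel_measurable (lebesgue_on (annulus r0))"
  shows "(LINT w|lebesgue_on (annulus r0). K w) =
    (LINT z|lebesgue_on (annulus r0). of_real ((cmod (deriv \<phi> z))\<^sup>2) * K (\<phi> z))"
proof -
  let ?L = "lebesgue_on (annulus r0)"
  obtain g where g: "g \<in> borel_measurable borel" "\<And>z. z \<notin> annulus r0 \<Longrightarrow> g z = 0" "AE z in ?L. K z = g z"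
    by (rule measurable_borel_representative[OF K]) (rule that)
  define g2 where "g2 z = indicator (annulus r0) z *\<^sub>R ((cmod (deriv \<phi> z))\<^sup>2 *\<^sub>R g (\<phi> z))" for z
  have g2_eq: "g2 = (\<lambda>z. indicator (annulus r0) z *\<^sub>R ((cmod (indicator (annulus r0) z *\<^sub>R deriv \<phi> z))\<^sup>2 *\<^sub>R
      g (indicator (annulus r0) z *\<^sub>R \<phi> z)))"
    by (auto simp: g2_def indicator_def fun_eq_iff)
  have [measurable]: "(\<lambda>z. indicator (annulus r0) z *\<^sub>R deriv \<phi> z) \<in> borel_measurable borel"
    by (rule borel_measurable_continuous_on_indicator[OF _ deriv_\<phi>_continuous]) simp
  note [measurable] = \<phi>_indicator_borel g(1)
  have [measurable]: "annulus r0 \<in> sets borel" by simp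
  have g2m: "g2 \<in> borel_measurable borel" unfolding g2_eq by measurable
  have one: "(\<lambda>z. 1 :: complex) \<in> borel_measurable borel" by simp
  have "(LINT w|?L. K w * 1) = (LINT w|lborel. g w * 1)"
    by (rule annulus_integral_representative[OF K g one])
  also have "(LINT w|lborel. g w * 1) = (LINT z|lborel. g2 z * 1)"
    using holomorphic_change_of_variables[OF open_annulus \<phi>_hol \<phi>_inj \<phi>_onto g(1,2)] by (simp add: g2_def)
  also have "\<dots> = (LINT z|?L. (of_real ((cmod (deriv \<phi> z))\<^sup>2) * K (\<phi> z)) * 1)"
  proof (rule annulus_integral_representative[symmetric, OF _ g2m _ _ one])
    have "(\<lambda>z. complex_of_real ((cmod (deriv \<phi> z))\<^sup>2)) \<in> borel_measurable ?L"
      by (intro continuous_annulus_measurable continuous_intros deriv_\<phi>_continuous)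
    then show "(\<lambda>z. of_real ((cmod (deriv \<phi> z))\<^sup>2) * K (\<phi> z)) \<in> borel_measurable ?L"
      by (intro borel_measurable_times measurable_compose_\<phi> K)
    show "AE z in ?L. of_real ((cmod (deriv \<phi> z))\<^sup>2) * K (\<phi> z) = g2 z"
      using AE_compose[OF g(3)] unfolding AE_annulus_iff
      by eventually_elim (auto simp: g2_def scaleR_conv_of_real)
  qed (simp add: g2_def)
  finally show ?thesis by simp
qed

text \<open>The test function that corresponds to \<open>\<psi>\<close> carries the factor \<open>\<eta>'\<close>; together with the Jacobian
  it turns \<open>d_zbar\<close> into \<open>d_zbar\<close>, and a zero-order term picks up the factor \<open>cnj \<phi>'\<close>.\<close>

definition pullback :: "(complex \<Rightarrow> complex) \<Rightarrow> complex \<Rightarrow> complex" where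
  "pullback \<psi> w = deriv \<eta> w * \<psi> (\<eta> w)"

lemma deriv_\<eta>_holomorphic: "deriv \<eta> holomorphic_on - {0}"
  by (rule holomorphic_deriv[OF \<eta>_hol]) (simp add: open_Compl)

lemma pullback_test_function: "\<psi> \<in> test_functions r0 \<Longrightarrow> pullback \<psi> \<in> test_functions r0"
  unfolding pullback_def[abs_def] by (rule product_test_function[OF deriv_\<eta>_holomorphic])

lemma pullback_transforms:
  assumes \<psi>: "\<psi> \<in> test_functions r0" and z: "z \<in> annulus r0"
  shows "of_real ((cmod (deriv \<phi> z))\<^sup>2) * d_zbar (pullback \<psi>) (\<phi> z) = d_zbar \<psi> z"
    "of_real ((cmod (deriv \<phi> z))\<^sup>2) * pullback \<psi> (\<phi> z) = cnj (deriv \<phi> z) * \<psi> z"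
proof -
  have sq: "complex_of_real ((cmod (deriv \<phi> z))\<^sup>2) = deriv \<phi> z * cnj (deriv \<phi> z)" by (rule complex_norm_square)
  have i: "deriv \<eta> (\<phi> z) * deriv \<phi> z = 1" by (rule deriv_inverse[OF z])
  then have ic: "cnj (deriv \<eta> (\<phi> z)) * cnj (deriv \<phi> z) = 1" by (metis complex_cnj_mult complex_cnj_one)
  have "of_real ((cmod (deriv \<phi> z))\<^sup>2) * d_zbar (pullback \<psi>) (\<phi> z) =
    (deriv \<phi> z * cnj (deriv \<phi> z)) * (deriv \<eta> (\<phi> z) * cnj (deriv \<eta> (\<phi> z)) * d_zbar \<psi> z)"
    unfolding sq pullback_def[abs_def] d_zbar_product[OF deriv_\<eta>_holomorphic \<psi>] \<phi>_inverse[OF z] ..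
  also have "\<dots> = (deriv \<eta> (\<phi> z) * deriv \<phi> z) * (cnj (deriv \<eta> (\<phi> z)) * cnj (deriv \<phi> z)) * d_zbar \<psi> z"
    by (simp only: mult_ac)
  finally show "of_real ((cmod (deriv \<phi> z))\<^sup>2) * d_zbar (pullback \<psi>) (\<phi> z) = d_zbar \<psi> z"
    by (simp only: i ic mult_1)
  have "of_real ((cmod (deriv \<phi> z))\<^sup>2) * pullback \<psi> (\<phi> z) = (deriv \<phi> z * cnj (deriv \<phi> z)) * (deriv \<eta> (\<phi> z) * \<psi> z)"
    unfolding sq pullback_def \<phi>_inverse[OF z] ..
  also have "\<dots> = (deriv \<eta> (\<phi> z) * deriv \<phi> z) * (cnj (deriv \<phi> z) * \<psi> z)" by (simp only: mult_ac)
  finally show "of_real ((cmod (deriv \<phi> z))\<^sup>2) * pullback \<psi> (\<phi> z) = cnj (deriv \<phi> z) * \<psi> z"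
    by (simp only: i mult_1)
qed

lemma pullback_integral:
  assumes \<psi>: "\<psi> \<in> test_functions r0"
    and f: "f \<in> borel_measurable (lebesgue_on (annulus r0))" and h: "h \<in> borel_measurable (lebesgue_on (annulus r0))"
  shows "(LINT w|lebesgue_on (annulus r0). f w * d_zbar (pullback \<psi>) w + h w * pullback \<psi> w) =
    (LINT z|lebesgue_on (annulus r0). f (\<phi> z) * d_zbar \<psi> z + (h (\<phi> z) * cnj (deriv \<phi> z)) * \<psi> z)"
proof -
  let ?L = "lebesgue_on (annulus r0)"
  note t = pullback_test_function[OF \<psi>]
  have tm: "\<psi>' \<in> borel_measurable ?L" if "\<psi>' \<in> test_functions r0" for \<psi>'
    using C1_compact_continuous[OF test_function_C1_compact[OF that]]
    by (intro continuous_annulus_measurable) (rule continuous_on_subset, auto)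
  have m: "(\<lambda>w. f w * d_zbar (pullback \<psi>) w + h w * pullback \<psi> w) \<in> borel_measurable ?L"
    by (intro borel_measurable_add borel_measurable_times f h tm t test_function_wirtinger(2)[OF t])
  show ?thesis
    unfolding change_of_variables[OF m]
  proof (rule Bochner_Integration.integral_cong[OF refl])
    fix z assume "z \<in> space ?L"
    then have z: "z \<in> annulus r0" by simp
    have "of_real ((cmod (deriv \<phi> z))\<^sup>2) * (f (\<phi> z) * d_zbar (pullback \<psi>) (\<phi> z) + h (\<phi> z) * pullback \<psi> (\<phi> z)) =
      f (\<phi> z) * (of_real ((cmod (deriv \<phi> z))\<^sup>2) * d_zbar (pullback \<psi>) (\<phi> z)) + h (\<phi> z) * (of_real ((cmod (deriv \<phi> z))\<^sup>2) * pullback \<psi> (\<phi> z))"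
      by (simp only: distrib_left mult_ac)
    then show "of_real ((cmod (deriv \<phi> z))\<^sup>2) * (f (\<phi> z) * d_zbar (pullback \<psi>) (\<phi> z) + h (\<phi> z) * pullback \<psi> (\<phi> z)) =
      f (\<phi> z) * d_zbar \<psi> z + (h (\<phi> z) * cnj (deriv \<phi> z)) * \<psi> z"
      unfolding pullback_transforms[OF \<psi> z] by (simp only: mult.assoc)
  qed
qed

lemma weak_deriv_compose:
  assumes w: "weak_deriv r0 d_zbar f h"
    and f: "f \<in> borel_measurable (lebesgue_on (annulus r0))" and h: "h \<in> borel_measurable (lebesgue_on (annulus r0))"
  shows "weak_deriv r0 d_zbar (f \<circ> \<phi>) (\<lambda>z. h (\<phi> z) * cnj (deriv \<phi> z))"
  unfolding weak_deriv_def
proof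
  fix \<psi> assume \<psi>: "\<psi> \<in> test_functions r0"
  have z: "(\<lambda>z. 0 :: complex) \<in> borel_measurable (lebesgue_on (annulus r0))" by simp
  have "(LINT z|lebesgue_on (annulus r0). (f \<circ> \<phi>) z * d_zbar \<psi> z) = (LINT w|lebesgue_on (annulus r0). f w * d_zbar (pullback \<psi>) w)"
    using pullback_integral[OF \<psi> f z] by simp
  also have "\<dots> = - (LINT w|lebesgue_on (annulus r0). h w * pullback \<psi> w)"
    using w pullback_test_function[OF \<psi>] by (simp add: weak_deriv_def)
  also have "(LINT w|lebesgue_on (annulus r0). h w * pullback \<psi> w) = (LINT z|lebesgue_on (annulus r0). (h (\<phi> z) * cnj (deriv \<phi> z)) * \<psi> z)"
    using pullback_integral[OF \<psi> z h] by simp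
  finally show "(LINT z|lebesgue_on (annulus r0). (f \<circ> \<phi>) z * d_zbar \<psi> z) =
     - (LINT z|lebesgue_on (annulus r0). (h (\<phi> z) * cnj (deriv \<phi> z)) * \<psi> z)" .
qed

lemma Linf_compose:
  assumes "n \<in> Linf r0"
  shows "(\<lambda>z. n (\<phi> z) * cnj (deriv \<phi> z)) \<in> Linf r0"
proof -
  let ?L = "lebesgue_on (annulus r0)"
  obtain n' M where n': "n' \<in> borel_measurable borel" "M \<ge> 0" "\<And>z. cmod (n' z) \<le> M"
    "\<And>z. z \<notin> annulus r0 \<Longrightarrow> n' z = 0" "AE z in ?L. n z = n' z"
    by (rule Linf_borel_representative[OF assms]) (rule that)
  have m: "(\<lambda>z. n (\<phi> z) * cnj (deriv \<phi> z)) \<in> borel_measurable ?L"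
    using assms measurable_compose[OF deriv_\<phi>_measurable cnj_borel]
    by (intro borel_measurable_times measurable_compose_\<phi>) (auto simp: Linf_def)
  have "AE z in ?L. ennreal (cmod (n (\<phi> z) * cnj (deriv \<phi> z))) \<le> ennreal (M * B)"
    using AE_compose[OF n'(5)] unfolding AE_annulus_iff
  proof eventually_elim
    case (elim z)
    show ?case
    proof
      assume z: "z \<in> annulus r0"
      have "cmod (n (\<phi> z)) * cmod (deriv \<phi> z) \<le> M * B"
        using elim z n'(2,3) deriv_bound[OF z] by (intro mult_mono) auto
      then show "ennreal (cmod (n (\<phi> z) * cnj (deriv \<phi> z))) \<le> ennreal (M * B)" by (simp add: norm_mult ennreal_leI)
    qed
  qed
  then have "Linf_norm r0 (\<lambda>z. n (\<phi> z) * cnj (deriv \<phi> z)) \<le> ennreal (M * B)"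
    unfolding Linf_norm_def using m by (intro esssup_I) auto
  then show ?thesis using m by (auto simp: Linf_def intro: le_less_trans)
qed

lemma conj_beltrami_compose:
  assumes w: "weak_conj_beltrami r0 \<nu> f" and f: "f \<in> borel_measurable (lebesgue_on (annulus r0))"
    and \<nu>: "(\<lambda>z. complex_of_real (\<nu> z)) \<in> borel_measurable (lebesgue_on (annulus r0))"
  shows "weak_conj_beltrami r0 (\<nu> \<circ> \<phi>) (f \<circ> \<phi>)"
proof -
  let ?L = "lebesgue_on (annulus r0)"
  obtain n where n: "n \<in> Linf r0" "weak_deriv r0 d_zbar (\<lambda>z. complex_of_real (\<nu> z)) n"
    and eq: "\<And>\<psi>. \<psi> \<in> test_functions r0 \<Longrightarrow> - (LINT z|?L. f z * d_zbar \<psi> z) =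
       - (LINT z|?L. cnj (f z) * (complex_of_real (\<nu> z) * d_zbar \<psi> z + n z * \<psi> z))"
    using w by (auto simp: weak_conj_beltrami_def)
  have nm: "n \<in> borel_measurable ?L" using n(1) by (simp add: Linf_def)
  have fc: "(\<lambda>z. cnj (f z)) \<in> borel_measurable ?L" using measurable_compose[OF f cnj_borel] .
  show ?thesis
    unfolding weak_conj_beltrami_def
  proof (rule bexI[OF _ Linf_compose[OF n(1)]], intro conjI ballI)
    show "weak_deriv r0 d_zbar (\<lambda>z. complex_of_real ((\<nu> \<circ> \<phi>) z)) (\<lambda>z. n (\<phi> z) * cnj (deriv \<phi> z))"
      using weak_deriv_compose[OF n(2) \<nu> nm] by (simp add: comp_def)
    fix \<psi> assume \<psi>: "\<psi> \<in> test_functions r0"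
    have z: "(\<lambda>z. 0 :: complex) \<in> borel_measurable ?L" by simp
    have "- (LINT z|?L. (f \<circ> \<phi>) z * d_zbar \<psi> z) = - (LINT w|?L. f w * d_zbar (pullback \<psi>) w)"
      using pullback_integral[OF \<psi> f z] by simp
    also have "\<dots> = - (LINT w|?L. (cnj (f w) * complex_of_real (\<nu> w)) * d_zbar (pullback \<psi>) w + (cnj (f w) * n w) * pullback \<psi> w)"
      unfolding eq[OF pullback_test_function[OF \<psi>]] by (simp add: distrib_left mult.assoc)
    also have "(LINT w|?L. (cnj (f w) * complex_of_real (\<nu> w)) * d_zbar (pullback \<psi>) w + (cnj (f w) * n w) * pullback \<psi> w) =
      (LINT z|?L. (cnj (f (\<phi> z)) * complex_of_real (\<nu> (\<phi> z))) * d_zbar \<psi> z + ((cnj (f (\<phi> z)) * n (\<phi> z)) * cnj (deriv \<phi> z)) * \<psi> z)"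
      by (rule pullback_integral[OF \<psi>]) (intro borel_measurable_times fc \<nu> nm)+
    finally show "- (LINT z|?L. (f \<circ> \<phi>) z * d_zbar \<psi> z) =
       - (LINT z|?L. cnj ((f \<circ> \<phi>) z) * (complex_of_real ((\<nu> \<circ> \<phi>) z) * d_zbar \<psi> z + (n (\<phi> z) * cnj (deriv \<phi> z)) * \<psi> z))"
      by (simp add: distrib_left mult.assoc)
  qed
qed

lemma alpha_tilde_eq: "alpha_tilde r0 \<phi> \<alpha> = (\<lambda>z. \<alpha> (\<phi> z) * cnj (deriv \<phi> z))"
proof -
  have "\<not> \<phi> constant_on annulus r0"
  proof
    assume "\<phi> constant_on annulus r0"
    then obtain k where k: "\<And>z. z \<in> annulus r0 \<Longrightarrow> \<phi> z = k" by (auto simp: constant_on_def)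
    define t where "t = (1 + r0) / 2"
    have t: "r0 < t" "t < 1" "t > 0" using r0 by (auto simp: t_def)
    have "of_real t \<in> annulus r0" "- of_real t \<in> annulus r0" using t by (auto simp: annulus_def)
    then have "complex_of_real t = - of_real t" using k \<phi>_inj by (metis inj_onD)
    then show False using t by (simp add: eq_neg_iff_add_eq_0)
  qed
  then show ?thesis by (simp add: alpha_tilde_def)
qed

text \<open>The change of variables takes care of the three equations. What a concrete automorphism has
  to contribute is that it preserves the Hardy bound and the norm.\<close>

lemma composition_isometries:
  assumes \<alpha>: "\<alpha> \<in> Linf r0" and \<nu>: "(\<lambda>z. complex_of_real (\<nu> z)) \<in> W1inf r0"
    and hb: "\<And>f. continuous_on (annulus r0) f \<Longrightarrow> hardy_bounded r0 p f \<Longrightarrow> hardy_bounded r0 p (f \<circ> \<phi>)"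
    and norm: "\<And>f. hardy_norm r0 p (f \<circ> \<phi>) = hardy_norm r0 p f"
  shows "comp_isometry r0 p \<phi> (Hp r0 p) (Hp r0 p)"
    "comp_isometry r0 p \<phi> (Gp r0 p \<alpha>) (Gp r0 p (alpha_tilde r0 \<phi> \<alpha>))"
    "comp_isometry r0 p \<phi> (Hp_nu r0 p \<nu>) (Hp_nu r0 p (\<nu> \<circ> \<phi>))"
proof -
  have cc: "continuous_on (annulus r0) (f \<circ> \<phi>)" if "continuous_on (annulus r0) f" for f
    using continuous_on_compose[OF \<phi>_cont, of f] that by (simp add: \<phi>_onto)
  have isoI: "comp_isometry r0 p \<phi> X Y"
    if "\<And>f. f \<in> X \<Longrightarrow> continuous_on (annulus r0) f \<Longrightarrow> f \<circ> \<phi> \<in> Y" for X Y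
    using that cc norm unfolding comp_isometry_def real_linear_isometry_def continuous_reps_def
    by (auto simp: comp_def)
  show "comp_isometry r0 p \<phi> (Hp r0 p) (Hp r0 p)"
  proof (rule isoI)
    fix f assume f: "f \<in> Hp r0 p" "continuous_on (annulus r0) f"
    then have "f holomorphic_on \<phi> ` annulus r0" by (simp add: Hp_def \<phi>_onto)
    then have "f \<circ> \<phi> holomorphic_on annulus r0" by (rule holomorphic_on_compose[OF \<phi>_hol])
    then show "f \<circ> \<phi> \<in> Hp r0 p" using f hb by (simp add: Hp_def)
  qed
  show "comp_isometry r0 p \<phi> (Gp r0 p \<alpha>) (Gp r0 p (alpha_tilde r0 \<phi> \<alpha>))"
  proof (rule isoI)
    fix f assume f: "f \<in> Gp r0 p \<alpha>" "continuous_on (annulus r0) f"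
    then have fm: "f \<in> borel_measurable (lebesgue_on (annulus r0))"
      and w: "weak_deriv r0 d_zbar f (\<lambda>z. \<alpha> z * cnj (f z))" by (auto simp: Gp_def)
    have hm: "(\<lambda>z. \<alpha> z * cnj (f z)) \<in> borel_measurable (lebesgue_on (annulus r0))"
      using \<alpha> measurable_compose[OF fm cnj_borel] by (intro borel_measurable_times) (auto simp: Linf_def)
    have "weak_deriv r0 d_zbar (f \<circ> \<phi>) (\<lambda>z. alpha_tilde r0 \<phi> \<alpha> z * cnj ((f \<circ> \<phi>) z))"
      using weak_deriv_compose[OF w fm hm] unfolding alpha_tilde_eq by (simp add: mult_ac)
    then show "f \<circ> \<phi> \<in> Gp r0 p (alpha_tilde r0 \<phi> \<alpha>)"
      using f hb[OF f(2)] continuous_annulus_measurable[OF cc[OF f(2)]] by (simp add: Gp_def)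
  qed
  show "comp_isometry r0 p \<phi> (Hp_nu r0 p \<nu>) (Hp_nu r0 p (\<nu> \<circ> \<phi>))"
  proof (rule isoI)
    fix f assume f: "f \<in> Hp_nu r0 p \<nu>" "continuous_on (annulus r0) f"
    then have fm: "f \<in> borel_measurable (lebesgue_on (annulus r0))" and w: "weak_conj_beltrami r0 \<nu> f" by (auto simp: Hp_nu_def)
    have "(\<lambda>z. complex_of_real (\<nu> z)) \<in> borel_measurable (lebesgue_on (annulus r0))" using \<nu> by (simp add: W1inf_def Linf_def)
    from conj_beltrami_compose[OF w fm this] show "f \<circ> \<phi> \<in> Hp_nu r0 p (\<nu> \<circ> \<phi>)"
      using f hb[OF f(2)] continuous_annulus_measurable[OF cc[OF f(2)]] by (simp add: Hp_nu_def)
  qed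
qed

end

lemma infdist_image_lower:
  assumes c: "c > 0" and S: "S \<noteq> {}" and surj: "S \<subseteq> \<Phi> ` S" and lower: "\<And>y. y \<in> S \<Longrightarrow> c * dist z y \<le> dist (\<Phi> z) (\<Phi> y)"
  shows "c * infdist z S \<le> infdist (\<Phi> z) S"
  unfolding infdist_notempty[OF S]
proof (rule cINF_greatest[OF S])
  fix w assume "w \<in> S"
  then obtain y where y: "y \<in> S" "w = \<Phi> y" using surj by auto
  have "c * (INF a\<in>S. dist z a) \<le> c * dist z y"
    using c y by (intro mult_left_mono cINF_lower bdd_belowI[of _ 0]) auto
  also have "\<dots> \<le> dist (\<Phi> z) w" using lower[OF y(1)] y by simp
  finally show "c * (INF a\<in>S. dist z a) \<le> dist (\<Phi> z) w" .
qed

text \<open>A bi-Lipschitz map that preserves the boundary changes the distance to a boundary point and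
  the distance to the boundary by bounded factors only, hence it changes apertures by a bounded
  factor.\<close>

lemma nontangential_limit_compose:
  assumes r0: "0 < r0" "r0 < 1" and c: "0 < c" "c \<le> C"
    and lip: "\<And>z w. z \<in> closed_annulus r0 \<Longrightarrow> w \<in> closed_annulus r0 \<Longrightarrow> c * dist z w \<le> dist (\<Phi> z) (\<Phi> w) \<and> dist (\<Phi> z) (\<Phi> w) \<le> C * dist z w"
    and maps: "\<And>z. z \<in> annulus r0 \<Longrightarrow> \<Phi> z \<in> annulus r0" and surj: "boundary r0 \<subseteq> \<Phi> ` boundary r0"
    and g: "\<And>z. z \<in> annulus r0 \<Longrightarrow> g z = f (\<Phi> z)"
    and \<zeta>: "\<zeta> \<in> boundary r0" and L: "nontangential_limit r0 f (\<Phi> \<zeta>) L"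
  shows "nontangential_limit r0 g \<zeta> L"
  unfolding nontangential_limit_def
proof (intro allI impI)
  fix b :: real assume b: "b > 1"
  let ?R = "\<lambda>b \<zeta>. {z \<in> annulus r0. dist z \<zeta> < b * infdist z (sphere 0 1 \<union> sphere 0 r0)}"
  define b' where "b' = C / c * b"
  have "C / c \<ge> 1" using c by simp
  then have "1 * b \<le> C / c * b" using b by (intro mult_right_mono) auto
  then have b': "b' > 1" using b by (simp add: b'_def)
  have C0: "C > 0" using c by linarith
  have \<zeta>A: "\<zeta> \<in> closed_annulus r0" using \<zeta> boundary_subset_closed[OF r0] by auto
  have bnd: "boundary r0 = sphere 0 1 \<union> sphere 0 r0" by (simp add: boundary_def)
  have ne: "sphere 0 1 \<union> sphere 0 r0 \<noteq> ({} :: complex set)" using \<zeta> by (auto simp: boundary_def)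
  have region: "\<Phi> z \<in> ?R b' (\<Phi> \<zeta>) \<and> \<Phi> z \<noteq> \<Phi> \<zeta>" if z: "z \<in> ?R b \<zeta>" "z \<noteq> \<zeta>" for z
  proof -
    have zA: "z \<in> closed_annulus r0" using z annulus_subset_closed by auto
    have "c * infdist z (boundary r0) \<le> infdist (\<Phi> z) (boundary r0)"
      using lip[OF zA] boundary_subset_closed[OF r0] ne surj by (intro infdist_image_lower c(1)) (auto simp: bnd)
    then have inf: "c * infdist z (sphere 0 1 \<union> sphere 0 r0) \<le> infdist (\<Phi> z) (sphere 0 1 \<union> sphere 0 r0)" by (simp only: bnd)
    have "dist (\<Phi> z) (\<Phi> \<zeta>) \<le> C * dist z \<zeta>" using lip[OF zA \<zeta>A] by simp
    also have "\<dots> < C * (b * infdist z (sphere 0 1 \<union> sphere 0 r0))" using z C0 by simp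
    also have "\<dots> = b' * (c * infdist z (sphere 0 1 \<union> sphere 0 r0))" using c by (simp add: b'_def)
    also have "\<dots> \<le> b' * infdist (\<Phi> z) (sphere 0 1 \<union> sphere 0 r0)" using inf b' by (intro mult_left_mono) auto
    finally have "dist (\<Phi> z) (\<Phi> \<zeta>) < b' * infdist (\<Phi> z) (sphere 0 1 \<union> sphere 0 r0)" .
    moreover have "0 < c * dist z \<zeta>" using c z by simp
    then have "\<Phi> z \<noteq> \<Phi> \<zeta>" using lip[OF zA \<zeta>A] by auto
    ultimately show ?thesis using maps z by auto
  qed
  have "(f \<longlongrightarrow> L) (at (\<Phi> \<zeta>) within ?R b' (\<Phi> \<zeta>))" using L b' by (simp add: nontangential_limit_def)
  moreover have "filterlim \<Phi> (at (\<Phi> \<zeta>) within ?R b' (\<Phi> \<zeta>)) (at \<zeta> within ?R b \<zeta>)"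
    unfolding filterlim_at
  proof
    show "\<forall>\<^sub>F z in at \<zeta> within ?R b \<zeta>. \<Phi> z \<in> ?R b' (\<Phi> \<zeta>) \<and> \<Phi> z \<noteq> \<Phi> \<zeta>"
      using region by (auto simp: eventually_at_filter intro!: always_eventually)
    have "((\<lambda>z. C * dist z \<zeta>) \<longlongrightarrow> C * dist \<zeta> \<zeta>) (at \<zeta> within ?R b \<zeta>)" by (intro tendsto_intros)
    then have lim0: "((\<lambda>z. C * dist z \<zeta>) \<longlongrightarrow> 0) (at \<zeta> within ?R b \<zeta>)" by simp
    have "((\<lambda>z. dist (\<Phi> z) (\<Phi> \<zeta>)) \<longlongrightarrow> 0) (at \<zeta> within ?R b \<zeta>)"
    proof (rule tendsto_sandwich[OF _ _ tendsto_const lim0])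
      show "\<forall>\<^sub>F z in at \<zeta> within ?R b \<zeta>. dist (\<Phi> z) (\<Phi> \<zeta>) \<le> C * dist z \<zeta>"
        using lip[OF _ \<zeta>A] annulus_subset_closed[of r0] by (auto simp: eventually_at_filter intro!: always_eventually)
    qed simp
    then show "(\<Phi> \<longlongrightarrow> \<Phi> \<zeta>) (at \<zeta> within ?R b \<zeta>)" by (rule iffD2[OF tendsto_dist_iff])
  qed
  ultimately have "((\<lambda>z. f (\<Phi> z)) \<longlongrightarrow> L) (at \<zeta> within ?R b \<zeta>)" by (rule filterlim_compose)
  then show "(g \<longlongrightarrow> L) (at \<zeta> within ?R b \<zeta>)"
    by (rule Lim_transform_eventually) (use g in \<open>auto simp: eventually_at_filter\<close>)
qed

lemma circle_mean_lebesgue: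
  assumes "0 < r0" "p > 0" "continuous_on (annulus r0) f" "r0 < r" "r < 1"
  shows "circle_mean p f r = (LINT t|lebesgue_on {0..2 * pi}. cmod (f (of_real r * cis t)) powr p)"
proof -
  have "continuous_on {0..2 * pi} (\<lambda>t. cmod (f (of_real r * cis t)) powr p)"
    by (intro continuous_on_norm_powr continuous_on_compose2[OF assms(3)] continuous_intros)
      (use assms in \<open>auto intro: annulus_imp_circle\<close>)
  then show ?thesis unfolding circle_mean_def
    by (intro lebesgue_integral_eq_integral[symmetric] continuous_imp_integrable_real) auto
qed

lemma rotation_isometries:
  assumes r0: "0 < r0" "r0 < 1" and p: "p > 0" and \<alpha>: "\<alpha> \<in> Linf r0" and \<nu>: "(\<lambda>z. complex_of_real (\<nu> z)) \<in> W1inf r0"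
    and l: "cmod l = 1" and \<phi>: "\<And>z. z \<in> annulus r0 \<Longrightarrow> \<phi> z = l * z"
  shows "comp_isometry r0 p \<phi> (Hp r0 p) (Hp r0 p)"
    "comp_isometry r0 p \<phi> (Gp r0 p \<alpha>) (Gp r0 p (alpha_tilde r0 \<phi> \<alpha>))"
    "comp_isometry r0 p \<phi> (Hp_nu r0 p \<nu>) (Hp_nu r0 p (\<nu> \<circ> \<phi>))"
proof -
  have ll: "l * cnj l = 1" using complex_norm_square[of l] l by simp
  then have ll1: "l * (cnj l * z) = z" "cnj l * (l * z) = z" for z
    by (simp_all flip: mult.assoc) (simp_all add: mult.commute)
  have hol: "\<phi> holomorphic_on annulus r0"
    by (rule holomorphic_transform[of "\<lambda>z. l * z"]) (auto intro: holomorphic_intros simp: \<phi>)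
  have maps: "\<phi> z \<in> annulus r0" if "z \<in> annulus r0" for z using that l by (simp add: \<phi> annulus_def norm_mult)
  have ldist: "dist (k * z) (k * w) = dist z w" if "cmod k = 1" for k z w :: complex
    using that by (simp add: dist_norm norm_mult flip: right_diff_distrib)
  have lA: "k * z \<in> annulus r0" if "cmod k = 1" "z \<in> annulus r0" for k z
    using that by (simp add: annulus_def norm_mult)
  have lA': "z \<in> annulus r0" if "cmod k = 1" "k * z \<in> annulus r0" for k z
    using that by (simp add: annulus_def norm_mult)
  have lb: "k * z \<in> boundary r0" if "cmod k = 1" "z \<in> boundary r0" for k z
    using that by (simp add: boundary_def norm_mult)
  have cl: "cmod (cnj l) = 1" using l by simp
  interpret annulus_automorphism r0 "\<lambda>w. cnj l * w" \<phi> 1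
  proof
    show "0 < r0" "r0 < 1" by (rule r0)+
    show "(\<lambda>w. cnj l * w) holomorphic_on - {0}" by (intro holomorphic_intros)
    show "continuous_on (annulus r0) \<phi>" by (rule holomorphic_on_imp_continuous_on[OF hol])
    show "\<phi> z \<in> annulus r0" if "z \<in> annulus r0" for z by (rule maps[OF that])
    show "w \<in> annulus r0 \<and> \<phi> (cnj l * w) = w" if "cnj l * w \<in> annulus r0" for w
      using lA'[OF cl that] \<phi>[OF that] ll1(1) by simp
    show "\<phi> holomorphic_on annulus r0" by (rule hol)
    show "cnj l * w \<in> annulus r0" if "w \<in> annulus r0" for w by (rule lA[OF cl that])
    show "cnj l * \<phi> z = z" if "z \<in> annulus r0" for z unfolding \<phi>[OF that] by (rule ll1)
    show "cmod (deriv \<phi> z) \<le> 1" if z: "z \<in> annulus r0" for z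
    proof -
      have "((\<lambda>z. l * z) has_field_derivative l) (at z)" by (auto intro!: derivative_eq_intros)
      then have "(\<phi> has_field_derivative l) (at z)"
        by (rule has_field_derivative_transform_within_open[OF _ open_annulus z]) (simp add: \<phi>)
      then show ?thesis using l by (simp add: DERIV_imp_deriv)
    qed
  qed
  have rot_lim: "nontangential_limit r0 g \<zeta> L"
    if k: "cmod k = 1" "\<And>z. k * (cnj k * z) = z" and g: "\<And>z. z \<in> annulus r0 \<Longrightarrow> g z = f (k * z)"
      and \<zeta>: "\<zeta> \<in> boundary r0" and L: "nontangential_limit r0 f (k * \<zeta>) L" for k f g \<zeta> L
  proof (rule nontangential_limit_compose[OF r0, of 1 1 "\<lambda>z. k * z"])
    show "boundary r0 \<subseteq> (\<lambda>z. k * z) ` boundary r0"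
    proof
      fix z assume "z \<in> boundary r0"
      then have "cnj k * z \<in> boundary r0" using lb[of "cnj k"] k(1) by simp
      then show "z \<in> (\<lambda>z. k * z) ` boundary r0" by (rule rev_image_eqI) (rule k(2)[symmetric])
    qed
  qed (use k(1) g \<zeta> L ldist lA in auto)
  have tr: "trace r0 (f \<circ> \<phi>) \<zeta> = trace r0 f (l * \<zeta>)" if \<zeta>: "\<zeta> \<in> boundary r0" for f \<zeta>
  proof -
    have "nontangential_limit r0 (f \<circ> \<phi>) \<zeta> L" if "nontangential_limit r0 f (l * \<zeta>) L" for L
      by (rule rot_lim[OF l ll1(1) _ \<zeta> that]) (simp add: \<phi>)
    moreover have "nontangential_limit r0 f (l * \<zeta>) L" if L: "nontangential_limit r0 (f \<circ> \<phi>) \<zeta> L" for L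
    proof (rule rot_lim[OF cl])
      show "cnj l * (cnj (cnj l) * z) = z" for z using ll1(2) by simp
      show "f z = (f \<circ> \<phi>) (cnj l * z)" if "z \<in> annulus r0" for z using \<phi>[OF lA[OF cl that]] ll1(1) by simp
      show "l * \<zeta> \<in> boundary r0" by (rule lb[OF l \<zeta>])
      show "nontangential_limit r0 (f \<circ> \<phi>) (cnj l * (l * \<zeta>)) L" using L by (simp only: ll1)
    qed
    ultimately have "nontangential_limit r0 (f \<circ> \<phi>) \<zeta> = nontangential_limit r0 f (l * \<zeta>)" by blast
    then show ?thesis by (simp add: trace_def)
  qed
  have norm: "hardy_norm r0 p (f \<circ> \<phi>) = hardy_norm r0 p f" for f
  proof -
    have "(LINT t|lebesgue_on {0..2 * pi}. cmod (trace r0 f (l * cis t)) powr p) = (LINT t|lebesgue_on {0..2 * pi}. cmod (trace r0 f (cis t)) powr p)"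
      by (rule circle_rotation[OF l, of "\<lambda>z. cmod (trace r0 f z) powr p"])
    moreover have "(LINT t|lebesgue_on {0..2 * pi}. cmod (trace r0 f (l * (of_real r0 * cis t))) powr p) = (LINT t|lebesgue_on {0..2 * pi}. cmod (trace r0 f (of_real r0 * cis t)) powr p)"
      using circle_rotation[OF l, of "\<lambda>z. cmod (trace r0 f (of_real r0 * z)) powr p"] by (simp add: mult.left_commute)
    ultimately show ?thesis using r0 by (simp add: hardy_norm_def boundary_Lp_norm_def tr)
  qed
  have hb: "hardy_bounded r0 p (f \<circ> \<phi>)" if f: "continuous_on (annulus r0) f" "hardy_bounded r0 p f" for f
  proof -
    have cc: "continuous_on (annulus r0) (f \<circ> \<phi>)" using continuous_on_compose[OF \<phi>_cont, of f] f(1) by (simp add: \<phi>_onto)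
    have "circle_mean p (f \<circ> \<phi>) r = circle_mean p f r" if r: "r0 < r" "r < 1" for r
    proof -
      have "(LINT t|lebesgue_on {0..2 * pi}. cmod ((f \<circ> \<phi>) (of_real r * cis t)) powr p) =
        (LINT t|lebesgue_on {0..2 * pi}. cmod (f (of_real r * (l * cis t))) powr p)"
        using annulus_imp_circle[OF r0(1) r] by (simp add: \<phi> mult.left_commute)
      also have "\<dots> = (LINT t|lebesgue_on {0..2 * pi}. cmod (f (of_real r * cis t)) powr p)"
        by (rule circle_rotation[OF l, of "\<lambda>z. cmod (f (of_real r * z)) powr p"])
      finally show ?thesis by (simp only: circle_mean_lebesgue[OF r0(1) p cc r] circle_mean_lebesgue[OF r0(1) p f(1) r])
    qed
    then show ?thesis using f(2) unfolding hardy_bounded_iff[OF r0 p f(1)] hardy_bounded_iff[OF r0 p cc] by auto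
  qed
  from composition_isometries[OF \<alpha> \<nu> hb norm]
  show "comp_isometry r0 p \<phi> (Hp r0 p) (Hp r0 p)"
    "comp_isometry r0 p \<phi> (Gp r0 p \<alpha>) (Gp r0 p (alpha_tilde r0 \<phi> \<alpha>))"
    "comp_isometry r0 p \<phi> (Hp_nu r0 p \<nu>) (Hp_nu r0 p (\<nu> \<circ> \<phi>))" by blast+
qed

lemma inversion_isometries:
  assumes r0: "0 < r0" "r0 < 1" and p: "p > 0" and \<alpha>: "\<alpha> \<in> Linf r0" and \<nu>: "(\<lambda>z. complex_of_real (\<nu> z)) \<in> W1inf r0"
    and \<mu>: "cmod \<mu> = 1" and \<phi>: "\<And>z. z \<in> annulus r0 \<Longrightarrow> \<phi> z = \<mu> * (of_real r0 / z)"
  shows "comp_isometry r0 p \<phi> (Hp r0 p) (Hp r0 p)"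
    "comp_isometry r0 p \<phi> (Gp r0 p \<alpha>) (Gp r0 p (alpha_tilde r0 \<phi> \<alpha>))"
    "comp_isometry r0 p \<phi> (Hp_nu r0 p \<nu>) (Hp_nu r0 p (\<nu> \<circ> \<phi>))"
proof -
  define \<eta> where "\<eta> w = \<mu> * (of_real r0 / w)" for w
  have \<mu>0: "\<mu> \<noteq> 0" using \<mu> by auto
  have \<eta>\<eta>: "\<eta> (\<eta> w) = w" for w using \<mu>0 r0 by (simp add: \<eta>_def)
  have \<eta>n: "cmod (\<eta> w) = r0 / cmod w" for w using \<mu> r0 by (simp add: \<eta>_def norm_mult norm_divide)
  have \<eta>_iff: "\<eta> w \<in> annulus r0 \<longleftrightarrow> w \<in> annulus r0" for w
    using r0 by (cases "w = 0") (auto simp: annulus_def \<eta>n divide_simps)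
  have \<phi>\<eta>: "\<phi> z = \<eta> z" if "z \<in> annulus r0" for z using \<phi>[OF that] by (simp add: \<eta>_def)
  have nz: "z \<noteq> 0" if "z \<in> annulus r0" for z using that r0 by (auto simp: annulus_def)
  have \<eta>hol: "\<eta> holomorphic_on - {0}" unfolding \<eta>_def by (intro holomorphic_intros) auto
  have hol: "\<phi> holomorphic_on annulus r0"
    by (rule holomorphic_transform[OF holomorphic_on_subset[OF \<eta>hol]]) (use nz \<phi>\<eta> in auto)
  interpret annulus_automorphism r0 \<eta> \<phi> "1 / r0"
  proof
    show "0 < r0" "r0 < 1" by (rule r0)+
    show "\<eta> holomorphic_on - {0}" by (rule \<eta>hol)
    show "continuous_on (annulus r0) \<phi>" by (rule holomorphic_on_imp_continuous_on[OF hol])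
    show "\<phi> z \<in> annulus r0" if "z \<in> annulus r0" for z using that by (simp add: \<phi>\<eta> \<eta>_iff)
    show "w \<in> annulus r0 \<and> \<phi> (\<eta> w) = w" if "\<eta> w \<in> annulus r0" for w
      using that \<eta>_iff[of w] \<phi>\<eta>[OF that] by (simp add: \<eta>\<eta>)
    show "\<phi> holomorphic_on annulus r0" by (rule hol)
    show "\<eta> w \<in> annulus r0" if "w \<in> annulus r0" for w using that by (simp add: \<eta>_iff)
    show "\<eta> (\<phi> z) = z" if "z \<in> annulus r0" for z using that by (simp add: \<phi>\<eta> \<eta>\<eta>)
    show "cmod (deriv \<phi> z) \<le> 1 / r0" if z: "z \<in> annulus r0" for z
    proof -
      have "(\<eta> has_field_derivative (\<mu> * (- of_real r0 / z\<^sup>2))) (at z)"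
        unfolding \<eta>_def using nz[OF z] by (auto intro!: derivative_eq_intros simp: power2_eq_square)
      then have "(\<phi> has_field_derivative (\<mu> * (- of_real r0 / z\<^sup>2))) (at z)"
        by (rule has_field_derivative_transform_within_open[OF _ open_annulus z]) (simp add: \<phi>\<eta>)
      then have "deriv \<phi> z = \<mu> * (- of_real r0 / z\<^sup>2)" by (rule DERIV_imp_deriv)
      then have "cmod (deriv \<phi> z) = r0 / (cmod z)\<^sup>2" using \<mu> r0 by (simp add: norm_mult norm_divide norm_power)
      also have "\<dots> \<le> r0 / r0\<^sup>2" using z r0 by (intro divide_left_mono power_mono mult_pos_pos zero_less_power) (auto simp: annulus_def)
      finally show ?thesis using r0 by (simp add: power2_eq_square)
    qed
  qed
  have lip: "r0 * dist z w \<le> dist (\<eta> z) (\<eta> w) \<and> dist (\<eta> z) (\<eta> w) \<le> 1 / r0 * dist z w"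
    if "z \<in> closed_annulus r0" "w \<in> closed_annulus r0" for z w
  proof -
    have c: "r0 \<le> cmod z" "cmod z \<le> 1" "r0 \<le> cmod w" "cmod w \<le> 1" using that by (auto simp: closed_annulus_def)
    have z0: "z \<noteq> 0" "w \<noteq> 0" using c r0 by auto
    have "\<eta> z - \<eta> w = \<mu> * of_real r0 * (w - z) / (z * w)" using z0 by (simp add: \<eta>_def field_simps)
    then have d: "dist (\<eta> z) (\<eta> w) = r0 * dist z w / (cmod z * cmod w)"
      using \<mu> r0 by (simp add: dist_norm norm_mult norm_divide norm_minus_commute)
    have "r0 * r0 \<le> cmod z * cmod w" using c r0 by (intro mult_mono) auto
    then have "r0 * dist z w / (cmod z * cmod w) \<le> r0 * dist z w / (r0 * r0)"
      using r0 c z0 by (intro divide_left_mono mult_nonneg_nonneg mult_pos_pos) auto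
    moreover have "r0 * dist z w / 1 \<le> r0 * dist z w / (cmod z * cmod w)"
      using r0 c z0 by (intro divide_left_mono mult_nonneg_nonneg) (auto intro: mult_le_one)
    ultimately show ?thesis unfolding d using r0 by simp
  qed
  have \<eta>b: "\<eta> z \<in> boundary r0" if "z \<in> boundary r0" for z using that r0 by (auto simp: boundary_def \<eta>n)
  have surj: "boundary r0 \<subseteq> \<eta> ` boundary r0"
  proof
    fix z assume "z \<in> boundary r0"
    from \<eta>b[OF this] show "z \<in> \<eta> ` boundary r0" by (rule rev_image_eqI) (rule \<eta>\<eta>[symmetric])
  qed
  have rC: "r0 \<le> 1 / r0" using r0 mult_le_one[of r0 r0] by (simp add: field_simps)
  have maps: "\<eta> z \<in> annulus r0" if "z \<in> annulus r0" for z using that \<eta>_iff by simp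
  have tr: "trace r0 (f \<circ> \<phi>) \<zeta> = trace r0 f (\<eta> \<zeta>)" if \<zeta>: "\<zeta> \<in> boundary r0" for f \<zeta>
  proof -
    have "nontangential_limit r0 (f \<circ> \<phi>) \<zeta> L" if L: "nontangential_limit r0 f (\<eta> \<zeta>) L" for L
      by (rule nontangential_limit_compose[OF r0 r0(1) rC lip maps surj _ \<zeta> L]) (simp_all add: \<phi>\<eta>)
    moreover have "nontangential_limit r0 f (\<eta> \<zeta>) L" if "nontangential_limit r0 (f \<circ> \<phi>) \<zeta> L" for L
    proof -
      have L: "nontangential_limit r0 (f \<circ> \<phi>) (\<eta> (\<eta> \<zeta>)) L" using that by (simp add: \<eta>\<eta>)
      show ?thesis
        by (rule nontangential_limit_compose[OF r0 r0(1) rC lip maps surj _ \<eta>b[OF \<zeta>] L]) (simp_all add: \<phi>\<eta> maps \<eta>\<eta>)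
    qed
    ultimately have "nontangential_limit r0 (f \<circ> \<phi>) \<zeta> = nontangential_limit r0 f (\<eta> \<zeta>)" by blast
    then show ?thesis by (simp add: trace_def)
  qed
  have flip: "(LINT t|lebesgue_on {0..2 * pi}. h (\<mu> * cis (- t))) = (LINT t|lebesgue_on {0..2 * pi}. h (cis t))" for h :: "complex \<Rightarrow> real"
  proof -
    have "(LINT t|lebesgue_on {0..2 * pi}. h (\<mu> * cis (- t))) = (LINT t|lebesgue_on {0..2 * pi}. h (\<mu> * cis t))"
      by (rule circle_reflection[of "\<lambda>z. h (\<mu> * z)"])
    also have "\<dots> = (LINT t|lebesgue_on {0..2 * pi}. h (cis t))" by (rule circle_rotation[OF \<mu>])
    finally show ?thesis .
  qed
  have \<eta>cis: "\<eta> (of_real r * cis t) = of_real (r0 / r) * (\<mu> * cis (- t))" for r t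
    by (simp add: \<eta>_def divide_inverse mult_ac)
  have norm: "hardy_norm r0 p (f \<circ> \<phi>) = hardy_norm r0 p f" for f
  proof -
    have "(LINT t|lebesgue_on {0..2 * pi}. cmod (trace r0 f (\<eta> (cis t))) powr p) = (LINT t|lebesgue_on {0..2 * pi}. cmod (trace r0 f (of_real r0 * cis t)) powr p)"
      using flip[of "\<lambda>z. cmod (trace r0 f (of_real r0 * z)) powr p"] \<eta>cis[of 1] by simp
    moreover have "(LINT t|lebesgue_on {0..2 * pi}. cmod (trace r0 f (\<eta> (of_real r0 * cis t))) powr p) = (LINT t|lebesgue_on {0..2 * pi}. cmod (trace r0 f (cis t)) powr p)"
      using flip[of "\<lambda>z. cmod (trace r0 f z) powr p"] \<eta>cis[of r0] r0 by simp
    ultimately show ?thesis using r0 by (simp add: hardy_norm_def boundary_Lp_norm_def tr add.commute)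
  qed
  have hb: "hardy_bounded r0 p (f \<circ> \<phi>)" if f: "continuous_on (annulus r0) f" "hardy_bounded r0 p f" for f
  proof -
    have cc: "continuous_on (annulus r0) (f \<circ> \<phi>)" using continuous_on_compose[OF \<phi>_cont, of f] f(1) by (simp add: \<phi>_onto)
    have "circle_mean p (f \<circ> \<phi>) r = circle_mean p f (r0 / r)" if r: "r0 < r" "r < 1" for r
    proof -
      have r': "r0 < r0 / r" "r0 / r < 1" using r r0 by (auto simp: field_simps)
      have "(LINT t|lebesgue_on {0..2 * pi}. cmod ((f \<circ> \<phi>) (of_real r * cis t)) powr p) =
        (LINT t|lebesgue_on {0..2 * pi}. cmod (f (of_real (r0 / r) * (\<mu> * cis (- t)))) powr p)"
        using annulus_imp_circle[OF r0(1) r] by (simp only: comp_def \<phi>\<eta> \<eta>cis)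
      also have "\<dots> = (LINT t|lebesgue_on {0..2 * pi}. cmod (f (of_real (r0 / r) * cis t)) powr p)"
        by (rule flip[of "\<lambda>z. cmod (f (of_real (r0 / r) * z)) powr p"])
      finally show ?thesis by (simp only: circle_mean_lebesgue[OF r0(1) p cc r] circle_mean_lebesgue[OF r0(1) p f(1) r'])
    qed
    moreover obtain C where "\<And>r. r0 < r \<Longrightarrow> r < 1 \<Longrightarrow> circle_mean p f r \<le> C"
      using f(2) unfolding hardy_bounded_iff[OF r0 p f(1)] by blast
    moreover have "r0 < r0 / r \<and> r0 / r < 1" if "r0 < r" "r < 1" for r using that r0 by (auto simp: field_simps)
    ultimately have "\<forall>r. r0 < r \<and> r < 1 \<longrightarrow> circle_mean p (f \<circ> \<phi>) r \<le> C" by auto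
    then show ?thesis unfolding hardy_bounded_iff[OF r0 p cc] by blast
  qed
  from composition_isometries[OF \<alpha> \<nu> hb norm]
  show "comp_isometry r0 p \<phi> (Hp r0 p) (Hp r0 p)"
    "comp_isometry r0 p \<phi> (Gp r0 p \<alpha>) (Gp r0 p (alpha_tilde r0 \<phi> \<alpha>))"
    "comp_isometry r0 p \<phi> (Hp_nu r0 p \<nu>) (Hp_nu r0 p (\<nu> \<circ> \<phi>))" by blast+
qed

section \<open>The four conditions\<close>

text \<open>The continuous representative agrees with \<open>\<phi>\<close> almost everywhere, hence everywhere, as both
  functions are continuous and nonempty open sets are not null sets.\<close>

lemma bounded_derivative_extension:
  assumes r0: "0 < r0" "r0 < 1" and \<phi>: "\<phi> holomorphic_on annulus r0" "\<phi> ` annulus r0 \<subseteq> annulus r0" "\<phi> \<in> W1inf r0"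
  obtains \<Phi> where "continuous_on (closed_annulus r0) \<Phi>" "\<And>z. z \<in> annulus r0 \<Longrightarrow> \<Phi> z = \<phi> z"
    "\<And>z. z \<in> closed_annulus r0 \<Longrightarrow> \<Phi> z \<in> closed_annulus r0"
proof -
  obtain \<Phi> where \<Phi>: "continuous_on (closed_annulus r0) \<Phi>" "AE z in lebesgue_on (annulus r0). \<phi> z = \<Phi> z"
    by (rule W1inf_continuous_representative[OF r0 \<phi>(3)]) (rule that)
  have \<Phi>a: "continuous_on (annulus r0) \<Phi>" using continuous_on_subset[OF \<Phi>(1) annulus_subset_closed] .
  have eq: "\<Phi> z = \<phi> z" if z: "z \<in> annulus r0" for z
  proof (rule ccontr)
    assume ne: "\<Phi> z \<noteq> \<phi> z"
    have "continuous_on (annulus r0) (\<lambda>z. \<Phi> z - \<phi> z)"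
      by (intro continuous_intros \<Phi>a holomorphic_on_imp_continuous_on \<phi>(1))
    then have "open (annulus r0 \<inter> (\<lambda>z. \<Phi> z - \<phi> z) -` (- {0}))"
      by (rule continuous_open_preimage[OF _ open_annulus]) (simp add: open_Compl)
    moreover have "z \<in> annulus r0 \<inter> (\<lambda>z. \<Phi> z - \<phi> z) -` (- {0})" using z ne by simp
    ultimately obtain e where e: "e > 0" "ball z e \<subseteq> annulus r0 \<inter> (\<lambda>z. \<Phi> z - \<phi> z) -` (- {0})"
      using open_contains_ball by blast
    have "AE v in lborel. v \<notin> ball z e"
      using \<Phi>(2)[unfolded AE_annulus_iff] by eventually_elim (use e(2) in auto)
    then have "emeasure lborel (ball z e) = 0" by (simp add: AE_iff_null null_sets_def ball_def)
    then show False using e(1) by (simp add: emeasure_ball unit_ball_vol_2)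
  qed
  have "\<Phi> z \<in> closed_annulus r0" if z: "z \<in> closed_annulus r0" for z
  proof -
    have "z \<in> closure (annulus r0)" using z closed_annulus_subset_closure[OF r0] by auto
    then obtain X where X: "\<And>n. X n \<in> annulus r0" "X \<longlonglongrightarrow> z" unfolding closure_sequential by blast
    have lim: "(\<lambda>n. \<Phi> (X n)) \<longlonglongrightarrow> \<Phi> z"
      using \<Phi>(1) X z annulus_subset_closed[of r0] unfolding continuous_on_sequentially comp_def by blast
    have mem: "\<Phi> (X n) \<in> closed_annulus r0" for n
      using X(1)[of n] \<phi>(2) annulus_subset_closed[of r0] by (auto simp: eq)
    show ?thesis by (rule closed_sequentially[OF compact_imp_closed[OF compact_closed_annulus] mem lim])
  qed
  then show thesis using that \<Phi>(1) eq by blast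
qed

text \<open>The peak functions for \<open>u = z\<close> determine how much of the boundary \<open>\<Phi>\<close> sends to the outer
  circle, those for \<open>u = r0 / z\<close> how much it sends to the inner circle.\<close>

lemma isometry_imp_automorphism:
  assumes r0: "0 < r0" "r0 < 1" and p: "p > 0"
    and \<phi>: "\<phi> holomorphic_on annulus r0" "\<phi> ` annulus r0 \<subseteq> annulus r0" "\<phi> \<in> W1inf r0"
    and b: "continuous_on (closed_annulus r0) b" "\<And>z. z \<in> closed_annulus r0 \<Longrightarrow> \<bar>b z\<bar> \<le> \<kappa>" "\<kappa> < 1"
    and peaks: "has_peaks r0 X b (\<lambda>z. z)" "has_peaks r0 X b (\<lambda>z. of_real r0 / z)"
    and iso: "comp_isometry r0 p \<phi> X Y"
  shows "(\<exists>l. cmod l = 1 \<and> (\<forall>z\<in>annulus r0. \<phi> z = l * z)) \<or>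
         (\<exists>\<mu>. cmod \<mu> = 1 \<and> (\<forall>z\<in>annulus r0. \<phi> z = \<mu> * (of_real r0 / z)))"
proof -
  let ?A = "closed_annulus r0"
  obtain \<Phi> where \<Phi>: "continuous_on ?A \<Phi>" "\<And>z. z \<in> annulus r0 \<Longrightarrow> \<Phi> z = \<phi> z" "\<And>z. z \<in> ?A \<Longrightarrow> \<Phi> z \<in> ?A"
    by (rule bounded_derivative_extension[OF r0 \<phi>]) (rule that)
  have norm_eq: "boundary_integral r0 (\<lambda>z. cmod (f z) powr p) = boundary_integral r0 (\<lambda>z. cmod (f (\<Phi> z)) powr p)"
    if f: "f \<in> X" "continuous_on ?A f" for f
  proof -
    have "f \<in> continuous_reps r0 X" using f continuous_on_subset[OF f(2) annulus_subset_closed] by (simp add: continuous_reps_def)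
    then have e: "hardy_norm r0 p (f \<circ> \<phi>) = hardy_norm r0 p f"
      using iso by (simp add: comp_isometry_def real_linear_isometry_def)
    have fc: "continuous_on ?A (\<lambda>z. f (\<Phi> z))" by (rule continuous_on_compose2[OF f(2) \<Phi>(1)]) (use \<Phi>(3) in auto)
    have n1: "hardy_norm r0 p f = (boundary_integral r0 (\<lambda>z. cmod (f z) powr p) / (2 * pi)) powr (1 / p)"
      by (rule hardy_norm_continuous[OF r0 f(2)]) simp
    have n2: "hardy_norm r0 p (f \<circ> \<phi>) = (boundary_integral r0 (\<lambda>z. cmod (f (\<Phi> z)) powr p) / (2 * pi)) powr (1 / p)"
      by (rule hardy_norm_continuous[OF r0 fc]) (simp add: \<Phi>(2))
    have nn: "boundary_integral r0 (\<lambda>z. cmod (g z) powr p) / (2 * pi) \<ge> 0" for g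
      by (auto simp: boundary_integral_def intro!: divide_nonneg_pos add_nonneg_nonneg integral_nonneg_AE AE_I2)
    have root: "(x powr (1 / p)) powr p = x" if "x \<ge> 0" for x :: real using p that by (simp add: powr_powr)
    have "boundary_integral r0 (\<lambda>z. cmod (f z) powr p) / (2 * pi) = boundary_integral r0 (\<lambda>z. cmod (f (\<Phi> z)) powr p) / (2 * pi)"
      using root[OF nn[of f]] root[OF nn[of "\<lambda>z. f (\<Phi> z)"]] e unfolding n1 n2 by simp
    then show ?thesis by simp
  qed
  have A1: "cmod z = 1 \<or> cmod z = r0" if "z \<in> boundary r0" for z using that by (auto simp: boundary_def)
  have m1: "boundary_integral r0 (\<lambda>z. of_bool (cmod z = 1)) = 2 * pi" "boundary_integral r0 (\<lambda>z. of_bool (cmod z = r0)) = 2 * pi"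
    using r0 circle_const[of 1] by (simp_all add: boundary_integral_def norm_mult)
  have rz: "r0 / cmod z = 1 \<longleftrightarrow> cmod z = r0" for z :: complex using r0 by (cases "z = 0") (auto simp: field_simps)
  have un: "cmod (of_real r0 / z) = r0 / cmod z" for z using r0 by (simp add: norm_divide)
  have cA: "r0 \<le> cmod z" "cmod z \<le> 1" "z \<noteq> 0" if "z \<in> ?A" for z
    using that r0 by (auto simp: closed_annulus_def)
  have u1: "cmod z \<le> 1" "z \<noteq> 0" "z = z" if "z \<in> ?A" for z using cA[OF that] by auto
  have u1': "w \<in> ?A" if "cmod w = 1" for w using that r0 by (simp add: closed_annulus_def)
  have one: "boundary_integrable r0 (\<lambda>z. of_bool (cmod (\<Phi> z) = 1))"
    "boundary_integral r0 (\<lambda>z. of_bool (cmod (\<Phi> z) = 1)) = boundary_integral r0 (\<lambda>z. of_bool (cmod z = 1))"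
    by (rule isometry_preserves_peak_mass[OF r0 p \<Phi>(1,3) b continuous_on_id u1 u1' peaks(1) norm_eq]; assumption)+
  have uc: "continuous_on ?A (\<lambda>z. complex_of_real r0 / z)"
    using r0 by (intro continuous_intros) (auto simp: closed_annulus_def)
  have u2: "cmod (complex_of_real r0 / z) \<le> 1" "complex_of_real r0 / z \<noteq> 0"
    "complex_of_real r0 / (complex_of_real r0 / z) = z" if "z \<in> ?A" for z
    using cA[OF that] r0 by (simp_all add: un divide_le_eq)
  have u2': "complex_of_real r0 / w \<in> ?A" if "cmod w = 1" for w
    using that r0 by (simp add: closed_annulus_def un)
  have two: "boundary_integrable r0 (\<lambda>z. of_bool (cmod (complex_of_real r0 / \<Phi> z) = 1))"
    "boundary_integral r0 (\<lambda>z. of_bool (cmod (complex_of_real r0 / \<Phi> z) = 1)) = boundary_integral r0 (\<lambda>z. of_bool (cmod (complex_of_real r0 / z) = 1))"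
    by (rule isometry_preserves_peak_mass[OF r0 p \<Phi>(1,3) b uc u2 u2' peaks(2) norm_eq]; assumption)+
  note two' = two[unfolded un rz]
  show ?thesis
  proof (rule boundary_masses_imp_automorphism[OF r0 \<phi>(1) _ \<Phi>(1,3,2) one(1) two'(1)])
    show "boundary_integral r0 (\<lambda>z. of_bool (cmod (\<Phi> z) = 1)) = 2 * pi" using one(2) m1(1) by simp
    show "boundary_integral r0 (\<lambda>z. of_bool (cmod (\<Phi> z) = r0)) = 2 * pi" using two'(2) m1(2) by simp
  qed (use \<phi>(2) in auto)
qed

theorem theorem3:
  fixes p r0 \<kappa> :: real and \<phi> \<alpha> :: "complex \<Rightarrow> complex" and \<nu> :: "complex \<Rightarrow> real"
  assumes "1 < p"
    and "0 < r0" "r0 < 1"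
    and "\<phi> holomorphic_on annulus r0"
    and "\<phi> ` annulus r0 \<subseteq> annulus r0"
    and "\<phi> \<in> W1inf r0"
    and "\<alpha> \<in> Linf r0"
    and "(\<lambda>z. complex_of_real (\<nu> z)) \<in> W1inf r0"
    and "0 < \<kappa>" "\<kappa> < 1"
    and "Linf_norm r0 (\<lambda>z. complex_of_real (\<nu> z)) \<le> ennreal \<kappa>"
  shows
    "(comp_isometry r0 p \<phi> (Hp r0 p) (Hp r0 p)
        \<longleftrightarrow> comp_isometry r0 p \<phi> (Gp r0 p \<alpha>) (Gp r0 p (alpha_tilde r0 \<phi> \<alpha>))) \<and>
     (comp_isometry r0 p \<phi> (Gp r0 p \<alpha>) (Gp r0 p (alpha_tilde r0 \<phi> \<alpha>))
        \<longleftrightarrow> comp_isometry r0 p \<phi> (Hp_nu r0 p \<nu>) (Hp_nu r0 p (\<nu> \<circ> \<phi>))) \<and>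
     (comp_isometry r0 p \<phi> (Hp_nu r0 p \<nu>) (Hp_nu r0 p (\<nu> \<circ> \<phi>))
        \<longleftrightarrow> (\<exists>l::complex. cmod l = 1 \<and> (\<forall>z\<in>annulus r0. \<phi> z = l * z)) \<or>
            (\<exists>\<mu>::complex. cmod \<mu> = 1 \<and> (\<forall>z\<in>annulus r0. \<phi> z = \<mu> * (complex_of_real r0 / z))))"
proof -
  let ?aut = "(\<exists>l::complex. cmod l = 1 \<and> (\<forall>z\<in>annulus r0. \<phi> z = l * z)) \<or>
            (\<exists>\<mu>::complex. cmod \<mu> = 1 \<and> (\<forall>z\<in>annulus r0. \<phi> z = \<mu> * (complex_of_real r0 / z)))"
  have p: "p > 0" using assms(1) by simp
  note r0 = assms(2,3)
  interpret id: weighted_cauchy r0 1 "\<lambda>z. z" by (rule weighted_cauchy_identity[OF r0])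
  interpret inv: weighted_cauchy r0 r0 "\<lambda>z. of_real r0 / z" by (rule weighted_cauchy_inversion[OF r0])
  obtain b where b: "continuous_on (closed_annulus r0) b" "AE z in lebesgue_on (annulus r0). \<nu> z = b z"
    "\<And>z. z \<in> closed_annulus r0 \<Longrightarrow> \<bar>b z\<bar> \<le> \<kappa>"
    by (rule real_W1inf_continuous_representative[OF r0 assms(8-11)]) (rule that)
  have zero: "continuous_on (closed_annulus r0) (\<lambda>z. 0 :: real)" "\<And>z. z \<in> closed_annulus r0 \<Longrightarrow> \<bar>0 :: real\<bar> \<le> 0" "(0 :: real) < 1"
    by auto
  have backward: "comp_isometry r0 p \<phi> (Hp r0 p) (Hp r0 p)"
    "comp_isometry r0 p \<phi> (Gp r0 p \<alpha>) (Gp r0 p (alpha_tilde r0 \<phi> \<alpha>))"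
    "comp_isometry r0 p \<phi> (Hp_nu r0 p \<nu>) (Hp_nu r0 p (\<nu> \<circ> \<phi>))" if "?aut"
  proof -
    have "(comp_isometry r0 p \<phi> (Hp r0 p) (Hp r0 p) \<and>
      comp_isometry r0 p \<phi> (Gp r0 p \<alpha>) (Gp r0 p (alpha_tilde r0 \<phi> \<alpha>))) \<and>
      comp_isometry r0 p \<phi> (Hp_nu r0 p \<nu>) (Hp_nu r0 p (\<nu> \<circ> \<phi>))"
      using that
    proof (elim disjE exE conjE)
      fix l assume l: "cmod l = 1" "\<forall>z\<in>annulus r0. \<phi> z = l * z"
      show ?thesis by (intro conjI rotation_isometries[OF r0 p assms(7,8) l(1) bspec[OF l(2)]])
    next
      fix \<mu> assume \<mu>: "cmod \<mu> = 1" "\<forall>z\<in>annulus r0. \<phi> z = \<mu> * (complex_of_real r0 / z)"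
      show ?thesis by (intro conjI inversion_isometries[OF r0 p assms(7,8) \<mu>(1) bspec[OF \<mu>(2)]])
    qed
    then show "comp_isometry r0 p \<phi> (Hp r0 p) (Hp r0 p)"
      "comp_isometry r0 p \<phi> (Gp r0 p \<alpha>) (Gp r0 p (alpha_tilde r0 \<phi> \<alpha>))"
      "comp_isometry r0 p \<phi> (Hp_nu r0 p \<nu>) (Hp_nu r0 p (\<nu> \<circ> \<phi>))" by simp_all
  qed
  note forward = isometry_imp_automorphism[OF r0 p assms(4-6)]
  have "?aut" if "comp_isometry r0 p \<phi> (Hp r0 p) (Hp r0 p)"
    by (rule forward[OF zero id.Hp_has_peaks[OF p] inv.Hp_has_peaks[OF p] that])
  moreover have "?aut" if "comp_isometry r0 p \<phi> (Gp r0 p \<alpha>) (Gp r0 p (alpha_tilde r0 \<phi> \<alpha>))"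
    by (rule forward[OF zero id.Gp_has_peaks[OF p assms(7)] inv.Gp_has_peaks[OF p assms(7)] that])
  moreover have "?aut" if "comp_isometry r0 p \<phi> (Hp_nu r0 p \<nu>) (Hp_nu r0 p (\<nu> \<circ> \<phi>))"
    by (rule forward[OF b(1,3) assms(10) id.Hp_nu_has_peaks[OF p assms(8-10) b] inv.Hp_nu_has_peaks[OF p assms(8-10) b] that])
  ultimately show ?thesis using backward by blast
qed

end
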